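(* The irreducible isometric triples are, up to isomorphism, exactly those of the following types, and these types are pairwise non-isomorphic: (1) $\mathrm{Tr}(\lambda,1,n,\varepsilon)$ with $\lambda\in\{\pm1\}$; (2) $\mathrm{Tr}(\lambda,2,n,m,1)$ with $\lambda\in\{\pm1\}$ and $m\equiv n \bmod 2$; (3) $\mathrm{Tr}(\lambda,2,n,m,\varepsilon)$ with $\lambda\in S^1$, $\mathrm{Im}\,\lambda>0$; (4) $\mathrm{Tr}(\lambda,2,n,m)$ with $\lambda\in\mathbb{R}_{>1}\cup\mathbb{R}_{<-1}$; (5) $\mathrm{Tr}(\lambda,4,n,m)$ with $\lambda\in\mathbb{C}$, $|\lambda|>1$, $\mathrm{Im}\,\lambda>0$. Here $n\in\mathbb{Z}_{\ge1}$, $\varepsilon\in\{\pm1\}$, $m\in\{0,1\}$.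
   Context: An isometric triple $(H_{\mathbb R},M,S)$ consists of a finite dimensional real vector space $H_{\mathbb R}$, an automorphism $M$, and a nondegenerate bilinear form $S:H_{\mathbb R}\times H_{\mathbb R}\to\mathbb{R}$ which is $(-1)^m$-symmetric for some $m\in\{0,1\}$ and for which $M$ is an isometry. It is irreducible if it is nonzero and $H_{\mathbb R}$ does not split into two nonzero $S$-orthogonal $M$-invariant subspaces. Isomorphisms respect $M$ and $S$. $H_{\mathbb C}=H_{\mathbb R}\otimes\mathbb{C}$; $M=M_sM_u=M_uM_s$ (semisimple and unipotent part), $N=\log M_u$. Matrices: $J_n=(\delta_{j,k+1})_{j,k=1,\dots,n}$ and $E_n^{per}=((-1)^{j-1}\delta_{j,n+1-k})_{j,k=1,\dots,n}$. For a row $\underline a=(a_1,\dots,a_n)$, $N\underline a=\underline a J_n$ means $Na_k=a_{k+1}$ for $k<n$ and $Na_n=0$; $S(\underline a^t,\underline b)=(S(a_j,b_k))_{j,k}$. Types: $\mathrm{Tr}(\lambda,1,n,\varepsilon)$, $\lambda\in\{\pm1\}$: $\dim H_{\mathbb R}=n$ with basis $\underline a$, $M_s=\lambda\,\mathrm{id}$, $N\underline a=\underline aJ_n$, $S(\underline a^t,\underline a)=\varepsilon E_n^{per}$ (so $S$ is $(-1)^{n-1}$-symmetric). $\mathrm{Tr}(\lambda,2,n,m,\varepsilon)$, $\lambda\in S^1$: $\dim H_{\mathbb R}=2n$, $H_{\mathbb C}=H^{(1)}\oplus\overline{H^{(1)}}$, $\underline a$ a basis of $H^{(1)}$, $\overline{\underline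 a}$ the conjugate basis of $\overline{H^{(1)}}$, $M_s=\lambda$ on $H^{(1)}$ and $\overline\lambda$ on $\overline{H^{(1)}}$, $N\underline a=\underline aJ_n$, $N\overline{\underline a}=\overline{\underline a}J_n$, and $S$ is $(-1)^m$-symmetric with $S(\underline a^t,\underline a)=0=S(\overline{\underline a}^t,\overline{\underline a})$, $S(\underline a^t,\overline{\underline a})=i^{n+m+1}\varepsilon E_n^{per}$, $S(\overline{\underline a}^t,\underline a)=i^{n+m+1}\varepsilon(-1)^{n+m+1}E_n^{per}$. $\mathrm{Tr}(\lambda,2,n,m)$, $\lambda\in\mathbb{R}_{>1}\cup\mathbb{R}_{<-1}$: $H_{\mathbb R}=H^{(1)}\oplus H^{(2)}$ with bases $\underline a$, $\underline b$ of length $n$, $M_s=\lambda$ on $H^{(1)}$ and $\lambda^{-1}$ on $H^{(2)}$, $N\underline a=\underline aJ_n$, $N\underline b=\underline bJ_n$, $S(\underline a^t,\underline a)=0=S(\underline b^t,\underline b)$, $S(\underline a^t,\underline b)=E_n^{per}$, $S(\underline b^t,\underline a)=(-1)^{n+m+1}E_n^{per}$ (so $S$ is $(-1)^m$-symmetric). $\mathrm{Tr}(\lambda,4,n,m)$, $|\lambda|>1$, $\mathrm{Im}\,\lambda>0$: $\dim H_{\mathbb R}=4n$, $H_{\mathbb C}=H^{(1)}\oplus H^{(2)}\oplus\overline{H^{(1)}}\oplus\overline{H^{(2)}}$ with bases $\underline a,\underline b,\overline{\underline a},\overline{\underline b}$ of length $n$; $M_s$ is $\lambda,\lambda^{-1},\overline\lambda,\overline\lambda^{-1}$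 on these summands respectively; $N$ acts by $J_n$ on each of the four bases; $S(\underline a^t,\underline b)=E_n^{per}=S(\overline{\underline a}^t,\overline{\underline b})$, $S(\underline b^t,\underline a)=(-1)^{n+m+1}E_n^{per}=S(\overline{\underline b}^t,\overline{\underline a})$, all other blocks of $S$ are zero. *)

theory Defs
  imports "HOL-Analysis.Analysis" "HOL-Analysis.Finite_Function_Topology"
begin

(* A finite dimensional real vector space is a finitely spanned subspace V of an arbitrary real
   vector space 'a. Maps and forms are total functions on 'a of which only the values on V count. *)

definition linear_on :: "'a::real_vector set \<Rightarrow> ('a \<Rightarrow> 'b::real_vector) \<Rightarrow> bool" where
  "linear_on V f \<longleftrightarrow>
     (\<forall>x\<in>V. \<forall>y\<in>V. f (x + y) = f x + f y) \<and> (\<forall>c. \<forall>x\<in>V. f (c *\<^sub>R x) = c *\<^sub>R f x)"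

definition symmetric_form :: "nat \<Rightarrow> 'a set \<Rightarrow> ('a \<Rightarrow> 'a \<Rightarrow> real) \<Rightarrow> bool" where
  "symmetric_form m V S \<longleftrightarrow> (\<forall>x\<in>V. \<forall>y\<in>V. S y x = (-1) ^ m * S x y)"

locale isometric_triple =
  fixes V :: "'a::real_vector set" and M :: "'a \<Rightarrow> 'a" and S :: "'a \<Rightarrow> 'a \<Rightarrow> real"
  assumes subspace: "subspace V"
    and finite_dim: "\<exists>B. finite B \<and> V = span B"
    and aut_linear: "linear_on V M"
    and aut_bij: "bij_betw M V V"
    and form_linear_right: "\<And>x. x \<in> V \<Longrightarrow> linear_on V (\<lambda>y. S x y)"
    and form_linear_left: "\<And>y. y \<in> V \<Longrightarrow> linear_on V (\<lambda>x. S x y)"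
    and nondegenerate: "\<And>x. x \<in> V \<Longrightarrow> (\<forall>y\<in>V. S x y = 0) \<Longrightarrow> x = 0"
    and symmetric: "\<exists>m\<in>{0, 1}. symmetric_form m V S"
    and isometry: "\<And>x y. x \<in> V \<Longrightarrow> y \<in> V \<Longrightarrow> S (M x) (M y) = S x y"

(* Internal direct sum: addition is a bijection from the product of the summands onto W. *)
definition direct_sum :: "'b::ab_group_add set list \<Rightarrow> 'b set \<Rightarrow> bool" where
  "direct_sum Hs W \<longleftrightarrow> bij_betw sum_list (listset Hs) W"

definition irreducible_triple ::
    "'a::real_vector set \<Rightarrow> ('a \<Rightarrow> 'a) \<Rightarrow> ('a \<Rightarrow> 'a \<Rightarrow> real) \<Rightarrow> bool" where
  "irreducible_triple V M S \<longleftrightarrow>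
     isometric_triple V M S \<and> V \<noteq> {0} \<and>
     \<not> (\<exists>U W. subspace U \<and> subspace W \<and> U \<noteq> {0} \<and> W \<noteq> {0} \<and> direct_sum [U, W] V \<and>
            M ` U \<subseteq> U \<and> M ` W \<subseteq> W \<and> (\<forall>u\<in>U. \<forall>w\<in>W. S u w = 0 \<and> S w u = 0))"

definition isomorphic_triples ::
    "'a::real_vector set \<Rightarrow> ('a \<Rightarrow> 'a) \<Rightarrow> ('a \<Rightarrow> 'a \<Rightarrow> real) \<Rightarrow>
     'b::real_vector set \<Rightarrow> ('b \<Rightarrow> 'b) \<Rightarrow> ('b \<Rightarrow> 'b \<Rightarrow> real) \<Rightarrow> bool" where
  "isomorphic_triples V M S V' M' S' \<longleftrightarrow>
     (\<exists>f. linear_on V f \<and> bij_betw f V V' \<and> (\<forall>x\<in>V. f (M x) = M' (f x)) \<and>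
          (\<forall>x\<in>V. \<forall>y\<in>V. S' (f x) (f y) = S x y))"

(* The complexification of V is V \<times> V, with (x, y) standing for x + i y. A real map f extends
   complex linearly to map_prod f f, a real bilinear form S complex bilinearly (not
   sesquilinearly) to cform S. *)

definition cscale :: "complex \<Rightarrow> 'a::real_vector \<times> 'a \<Rightarrow> 'a \<times> 'a" where
  "cscale c z = (Re c *\<^sub>R fst z - Im c *\<^sub>R snd z, Re c *\<^sub>R snd z + Im c *\<^sub>R fst z)"

global_interpretation cplx: vector_space "cscale :: complex \<Rightarrow> 'a::real_vector \<times> 'a \<Rightarrow> 'a \<times> 'a"
  by unfold_locales (simp_all add: cscale_def algebra_simps)

definition cconj :: "'a::real_vector \<times> 'a \<Rightarrow> 'a \<times> 'a" where
  "cconj z = (fst z, - snd z)"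

definition cform :: "('a \<Rightarrow> 'a \<Rightarrow> real) \<Rightarrow> 'a \<times> 'a \<Rightarrow> 'a \<times> 'a \<Rightarrow> complex" where
  "cform S z w = Complex (S (fst z) (fst w) - S (snd z) (snd w)) (S (fst z) (snd w) + S (snd z) (fst w))"

(* Semisimple over the reals means diagonalizable over the complex numbers. *)
definition semisimple_on :: "'a::real_vector set \<Rightarrow> ('a \<Rightarrow> 'a) \<Rightarrow> bool" where
  "semisimple_on V f \<longleftrightarrow> V \<times> V = cplx.span {z \<in> V \<times> V. \<exists>c. map_prod f f z = cscale c z}"

definition unipotent_on :: "'a::real_vector set \<Rightarrow> ('a \<Rightarrow> 'a) \<Rightarrow> bool" where
  "unipotent_on V f \<longleftrightarrow> (\<exists>k. \<forall>x\<in>V. ((\<lambda>y. f y - y) ^^ k) x = 0)"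

(* Multiplicative Jordan decomposition; Ms and Mu are uniquely determined on V by M. *)
definition jordan_decomposition ::
    "'a::real_vector set \<Rightarrow> ('a \<Rightarrow> 'a) \<Rightarrow> ('a \<Rightarrow> 'a) \<Rightarrow> ('a \<Rightarrow> 'a) \<Rightarrow> bool" where
  "jordan_decomposition V M Ms Mu \<longleftrightarrow>
     linear_on V Ms \<and> bij_betw Ms V V \<and> semisimple_on V Ms \<and>
     linear_on V Mu \<and> bij_betw Mu V V \<and> unipotent_on V Mu \<and>
     (\<forall>x\<in>V. M x = Ms (Mu x) \<and> M x = Mu (Ms x))"

(* log u = sum over k \<ge> 1 of (-1)^(k+1)/k (u - id)^k; on a space on which u is unipotent only
   finitely many terms are nonzero. *)
definition unipotent_log :: "('a::real_vector \<Rightarrow> 'a) \<Rightarrow> 'a \<Rightarrow> 'a" where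
  "unipotent_log u x =
     (\<Sum>k | 1 \<le> k \<and> ((\<lambda>y. u y - y) ^^ k) x \<noteq> 0.
        ((-1) ^ (k + 1) / real k) *\<^sub>R ((\<lambda>y. u y - y) ^^ k) x)"

(* Rows (a 1, ..., a n) are functions on nat used on the indices {1..n}. *)

definition row_basis :: "nat \<Rightarrow> (nat \<Rightarrow> 'a::real_vector) \<Rightarrow> 'a set \<Rightarrow> bool" where
  "row_basis n a H \<longleftrightarrow> inj_on a {1..n} \<and> independent (a ` {1..n}) \<and> span (a ` {1..n}) = H"

definition crow_basis ::
    "nat \<Rightarrow> (nat \<Rightarrow> 'a::real_vector \<times> 'a) \<Rightarrow> ('a \<times> 'a) set \<Rightarrow> bool" where
  "crow_basis n a H \<longleftrightarrow>
     inj_on a {1..n} \<and> cplx.independent (a ` {1..n}) \<and> cplx.span (a ` {1..n}) = H"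

(* N a = a J_n *)
definition jordan_row :: "nat \<Rightarrow> ('b \<Rightarrow> 'b) \<Rightarrow> (nat \<Rightarrow> 'b::zero) \<Rightarrow> bool" where
  "jordan_row n N a \<longleftrightarrow> (\<forall>k\<in>{1..<n}. N (a k) = a (k + 1)) \<and> N (a n) = 0"

definition E_per :: "nat \<Rightarrow> nat \<Rightarrow> nat \<Rightarrow> 'c::comm_ring_1" where
  "E_per n j k = (if j = n + 1 - k then (-1) ^ (j - 1) else 0)"

(* S(a^t, b) = c E_n^per *)
definition gram_eq ::
    "nat \<Rightarrow> ('b \<Rightarrow> 'b \<Rightarrow> 'c::comm_ring_1) \<Rightarrow> (nat \<Rightarrow> 'b) \<Rightarrow> (nat \<Rightarrow> 'b) \<Rightarrow> 'c \<Rightarrow> bool" where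
  "gram_eq n S a b c \<longleftrightarrow> (\<forall>j\<in>{1..n}. \<forall>k\<in>{1..n}. S (a j) (b k) = c * E_per n j k)"

(* Tr1 l n e      is  Tr(l,1,n,e)
   Tr2e l n m e   is  Tr(l,2,n,m,e)  with l on the unit circle
   Tr2 l n m      is  Tr(l,2,n,m)    with l real
   Tr4 l n m      is  Tr(l,4,n,m) *)
datatype triple_type =
    Tr1 real nat real
  | Tr2e complex nat nat real
  | Tr2 real nat nat
  | Tr4 complex nat nat

definition is_Tr1 where
  "is_Tr1 V Ms N S l n e \<longleftrightarrow>
     dim V = n \<and>
     (\<exists>a. row_basis n a V \<and> (\<forall>x\<in>V. Ms x = l *\<^sub>R x) \<and> jordan_row n N a \<and> gram_eq n S a a e)"

definition is_Tr2e where
  "is_Tr2e V Ms N S l n m e \<longleftrightarrow>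
     dim V = 2 * n \<and> symmetric_form m V S \<and>
     (\<exists>H a. direct_sum [H, cconj ` H] (V \<times> V) \<and> crow_basis n a H \<and>
        (\<forall>z\<in>H. map_prod Ms Ms z = cscale l z) \<and>
        (\<forall>z\<in>cconj ` H. map_prod Ms Ms z = cscale (cnj l) z) \<and>
        jordan_row n (map_prod N N) a \<and> jordan_row n (map_prod N N) (cconj \<circ> a) \<and>
        gram_eq n (cform S) a a 0 \<and> gram_eq n (cform S) (cconj \<circ> a) (cconj \<circ> a) 0 \<and>
        gram_eq n (cform S) a (cconj \<circ> a) (\<i> ^ (n + m + 1) * complex_of_real e) \<and>
        gram_eq n (cform S) (cconj \<circ> a) a
          (\<i> ^ (n + m + 1) * complex_of_real e * (-1) ^ (n + m + 1)))"

definition is_Tr2 where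
  "is_Tr2 V Ms N S l n m \<longleftrightarrow>
     (\<exists>H1 H2 a b. direct_sum [H1, H2] V \<and> row_basis n a H1 \<and> row_basis n b H2 \<and>
        (\<forall>x\<in>H1. Ms x = l *\<^sub>R x) \<and> (\<forall>x\<in>H2. Ms x = inverse l *\<^sub>R x) \<and>
        jordan_row n N a \<and> jordan_row n N b \<and>
        gram_eq n S a a 0 \<and> gram_eq n S b b 0 \<and>
        gram_eq n S a b 1 \<and> gram_eq n S b a ((-1) ^ (n + m + 1)))"

definition is_Tr4 where
  "is_Tr4 V Ms N S l n m \<longleftrightarrow>
     dim V = 4 * n \<and>
     (\<exists>H1 H2 a b. direct_sum [H1, H2, cconj ` H1, cconj ` H2] (V \<times> V) \<and>
        crow_basis n a H1 \<and> crow_basis n b H2 \<and>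
        (\<forall>z\<in>H1. map_prod Ms Ms z = cscale l z) \<and>
        (\<forall>z\<in>H2. map_prod Ms Ms z = cscale (inverse l) z) \<and>
        (\<forall>z\<in>cconj ` H1. map_prod Ms Ms z = cscale (cnj l) z) \<and>
        (\<forall>z\<in>cconj ` H2. map_prod Ms Ms z = cscale (inverse (cnj l)) z) \<and>
        (\<forall>r\<in>{a, b, cconj \<circ> a, cconj \<circ> b}. jordan_row n (map_prod N N) r) \<and>
        gram_eq n (cform S) a b 1 \<and> gram_eq n (cform S) (cconj \<circ> a) (cconj \<circ> b) 1 \<and>
        gram_eq n (cform S) b a ((-1) ^ (n + m + 1)) \<and>
        gram_eq n (cform S) (cconj \<circ> b) (cconj \<circ> a) ((-1) ^ (n + m + 1)) \<and>
        gram_eq n (cform S) a a 0 \<and>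
        gram_eq n (cform S) a (cconj \<circ> a) 0 \<and>
        gram_eq n (cform S) a (cconj \<circ> b) 0 \<and>
        gram_eq n (cform S) b b 0 \<and>
        gram_eq n (cform S) b (cconj \<circ> a) 0 \<and>
        gram_eq n (cform S) b (cconj \<circ> b) 0 \<and>
        gram_eq n (cform S) (cconj \<circ> a) a 0 \<and>
        gram_eq n (cform S) (cconj \<circ> a) b 0 \<and>
        gram_eq n (cform S) (cconj \<circ> a) (cconj \<circ> a) 0 \<and>
        gram_eq n (cform S) (cconj \<circ> b) a 0 \<and>
        gram_eq n (cform S) (cconj \<circ> b) b 0 \<and>
        gram_eq n (cform S) (cconj \<circ> b) (cconj \<circ> b) 0)"

definition of_type ::
    "'a::real_vector set \<Rightarrow> ('a \<Rightarrow> 'a) \<Rightarrow> ('a \<Rightarrow> 'a \<Rightarrow> real) \<Rightarrow> triple_type \<Rightarrow> bool" where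
  "of_type V M S t \<longleftrightarrow>
     isometric_triple V M S \<and>
     (\<exists>Ms Mu. jordan_decomposition V M Ms Mu \<and>
        (case t of
           Tr1 l n e \<Rightarrow> is_Tr1 V Ms (unipotent_log Mu) S l n e
         | Tr2e l n m e \<Rightarrow> is_Tr2e V Ms (unipotent_log Mu) S l n m e
         | Tr2 l n m \<Rightarrow> is_Tr2 V Ms (unipotent_log Mu) S l n m
         | Tr4 l n m \<Rightarrow> is_Tr4 V Ms (unipotent_log Mu) S l n m))"

inductive listed_type :: "triple_type \<Rightarrow> bool" where
  "n \<ge> 1 \<Longrightarrow> l \<in> {1, -1} \<Longrightarrow> e \<in> {1, -1} \<Longrightarrow> listed_type (Tr1 l n e)"
| "n \<ge> 1 \<Longrightarrow> l \<in> {1, -1} \<Longrightarrow> m \<in> {0, 1} \<Longrightarrow> m mod 2 = n mod 2 \<Longrightarrow> listed_type (Tr2e l n m 1)"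
| "n \<ge> 1 \<Longrightarrow> cmod l = 1 \<Longrightarrow> Im l > 0 \<Longrightarrow> m \<in> {0, 1} \<Longrightarrow> e \<in> {1, -1} \<Longrightarrow>
     listed_type (Tr2e l n m e)"
| "n \<ge> 1 \<Longrightarrow> l > 1 \<or> l < -1 \<Longrightarrow> m \<in> {0, 1} \<Longrightarrow> listed_type (Tr2 l n m)"
| "n \<ge> 1 \<Longrightarrow> cmod l > 1 \<Longrightarrow> Im l > 0 \<Longrightarrow> m \<in> {0, 1} \<Longrightarrow> listed_type (Tr4 l n m)"

end

theory Submission
  imports Defs "HOL-Computational_Algebra.Formal_Power_Series"
    "HOL-Computational_Algebra.Fundamental_Theorem_Algebra"
begin

text \<open>
  The argument takes place on the complexification \<open>V \<times> V\<close>. Each of the five families prescribes a basis of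
  Jordan strings there, and all that distinguishes the families is a small table: the number of
  strings, their common length, the eigenvalue of each string, the string conjugate to it, the only
  string it pairs with under \<open>S\<close>, and the constant of that pairing. A basis that obeys the table of
  \<open>t\<close> is called a frame of type \<open>t\<close>. In a frame \<open>M\<close> is described by
  \<open>M a\<^sub>k = \<lambda> (a\<^sub>k + a\<^sub>k\<^sub>+\<^sub>1 / 1! + a\<^sub>k\<^sub>+\<^sub>2 / 2! + \<dots>)\<close>, that is by \<open>M = \<lambda> exp N\<close> without any reference to
  the Jordan decomposition. Since \<open>exp\<close> and \<open>log\<close> are inverse to each other as power series, and power
  series can be applied to nilpotent maps, a triple is of type \<open>t\<close> if and only if it has a frame of
  type \<open>t\<close> (\<open>framed_if_of_type\<close>, \<open>framed.of_type\<close>). The classification thus becomes four statements on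
  frames.

  An irreducible triple has a frame (\<open>frame_exists_if_irreducible\<close>). The eigenvalues of \<open>M\<close> are closed
  under inversion and conjugation, so that one of them, \<open>\<lambda>\<close>, satisfies \<open>\<bar>\<lambda>\<bar> \<ge> 1\<close> and \<open>Im \<lambda> \<ge> 0\<close>. The
  generalized eigenspaces of \<open>\<lambda>\<close> and \<open>1/\<lambda>\<close> are dual to each other, and \<open>N\<close> is skew for this duality.
  If \<open>n\<close> is least with \<open>N\<^sup>n = 0\<close> on them, then \<open>S(a, N\<^sup>n\<^sup>-\<^sup>1 b) \<noteq> 0\<close> for suitable \<open>a\<close>, \<open>b\<close> (\<open>top_pairing\<close>),
  and adding multiples of \<open>N b, N\<^sup>2 b, \<dots>\<close> to \<open>b\<close> makes the other values \<open>S(a, N\<^sup>k b)\<close> vanish. The strings of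
  \<open>a\<close> and \<open>b\<close> are then in duality by \<open>E_per\<close>. If \<open>1/\<lambda>\<close> is neither \<open>\<lambda>\<close> nor its conjugate, these two
  strings and their conjugates obey the table. If \<open>\<bar>\<lambda>\<bar> = 1\<close>, the top form \<open>S(x, N\<^sup>n\<^sup>-\<^sup>1 \<theta> y)\<close>, where
  \<open>\<theta>\<close> is the conjugation for nonreal \<open>\<lambda>\<close> and the identity for \<open>\<lambda> = \<plusminus>1\<close>, is Hermitian up to a factor,
  symmetric or alternating. If it has a nonzero diagonal value \<open>\<rho>\<close>, a single string, rescaled and
  corrected, suffices, and \<open>\<epsilon>\<close> is the sign of \<open>\<rho>\<close>. Otherwise it is alternating, which happens only
  for \<open>\<lambda> = \<plusminus>1\<close> and \<open>m \<equiv> n\<close> modulo 2, and one gets two dual isotropic strings. In each case the Gram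
  matrix of the strings is invertible, so they span a summand that \<open>M\<close> respects. By irreducibility it
  is everything (\<open>frame_if_irreducible\<close>).

  A triple with a frame is irreducible (\<open>framed.irreducible\<close>). An orthogonal summand has an eigenvalue
  of its own, and since its eigenvalues are again closed under inversion and conjugation, \<open>\<lambda>\<close> is one of
  them. If the eigenvalues of the strings are distinct, the eigenspace of \<open>\<lambda>\<close> is a line and cannot meet
  two independent summands. In the family with \<open>\<lambda> = \<plusminus>1\<close> and two strings it is a plane, but there the
  top form is alternating: an eigenvector \<open>c\<close> in one summand is orthogonal to every \<open>z\<close> in the
  other, which forces \<open>N\<^sup>n\<^sup>-\<^sup>1 z\<close> to be a multiple of \<open>c\<close> and hence zero, contradicting the length of
  the strings.

  The type can be read off (\<open>type_unique\<close>): \<open>\<lambda>\<close> is the eigenvalue with \<open>\<bar>\<lambda>\<bar> \<ge> 1\<close> and \<open>Im \<lambda> \<ge> 0\<close>, the dimension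
  of its eigenspace decides between one and two strings for \<open>\<plusminus>1\<close>, the dimension of \<open>V\<close> gives \<open>n\<close>, the
  symmetry of \<open>S\<close> gives \<open>m\<close>, and another choice of string multiplies the top value by some \<open>\<bar>c\<bar>\<^sup>2 > 0\<close>,
  so that \<open>\<epsilon>\<close> does not change. Conversely, mapping one frame to another of the same type is an
  isomorphism (\<open>isomorphic_if_framed\<close>).

  Finally every type occurs (\<open>model_exists\<close>): on a space whose complexification has a basis permuted by
  conjugation according to the table, the table defines \<open>M\<close> and \<open>S\<close>, and both are real.
\<close>

unbundle fps_syntax and no vec_syntax

section \<open>Power series in a nilpotent map\<close>

text \<open>
  The same linear algebra is needed for \<open>V\<close> over the reals and for \<open>V \<times> V\<close> over the complex numbers, where
  the scalar multiplication is \<open>cscale\<close>; hence a locale over an arbitrary field of characteristic zero.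
  Maps are total functions and only their values on a subspace count, as for the triples themselves.
\<close>

locale char0_space = vector_space scale
  for scale :: "'k::field_char_0 \<Rightarrow> 'v::ab_group_add \<Rightarrow> 'v"
begin

definition endo_on :: "'v set \<Rightarrow> ('v \<Rightarrow> 'v) \<Rightarrow> bool" where
  "endo_on V A \<longleftrightarrow> subspace V \<and> (\<forall>x\<in>V. A x \<in> V) \<and>
     (\<forall>x\<in>V. \<forall>y\<in>V. A (x + y) = A x + A y) \<and> (\<forall>c. \<forall>x\<in>V. A (scale c x) = scale c (A x))"

lemma endo_onD:
  assumes "endo_on V A"
  shows "subspace V" and "x \<in> V \<Longrightarrow> A x \<in> V"
    and "x \<in> V \<Longrightarrow> y \<in> V \<Longrightarrow> A (x + y) = A x + A y"
    and "x \<in> V \<Longrightarrow> A (scale c x) = scale c (A x)"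
  using assms unfolding endo_on_def by auto

lemma endo_on_0: "endo_on V A \<Longrightarrow> A 0 = 0"
  using endo_onD(4)[of V A 0 0] endo_onD(1)[of V A] subspace_0 by auto

lemma endo_on_minus: "endo_on V A \<Longrightarrow> x \<in> V \<Longrightarrow> A (- x) = - A x"
  using endo_onD(4)[of V A x "-1"] by simp

lemma endo_on_diff: "endo_on V A \<Longrightarrow> x \<in> V \<Longrightarrow> y \<in> V \<Longrightarrow> A (x - y) = A x - A y"
  using endo_onD(3)[of V A x "- y"] endo_on_minus[of V A y] subspace_neg[of V y] endo_onD(1)[of V A]
  by simp

lemma endo_on_sum:
  assumes "endo_on V A" and "\<And>i. i \<in> I \<Longrightarrow> f i \<in> V"
  shows "A (\<Sum>i\<in>I. f i) = (\<Sum>i\<in>I. A (f i))"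
  using assms(2)
proof (induction I rule: infinite_finite_induct)
  case (insert i I)
  then have "(\<Sum>i\<in>I. f i) \<in> V"
    by (intro subspace_sum endo_onD(1)[OF assms(1)]) auto
  with insert show ?case
    by (simp add: endo_onD(3)[OF assms(1)])
qed (simp_all add: endo_on_0[OF assms(1)])

lemma endo_on_funpow: "endo_on V A \<Longrightarrow> endo_on V (A ^^ k)"
  by (induction k) (auto simp: endo_on_def)

lemma endo_on_scale: "endo_on V A \<Longrightarrow> endo_on V (\<lambda>x. scale c (A x))"
  by (auto simp: endo_on_def scale_right_distrib subspace_scale scale_left_commute)

lemma endo_on_minus_id: "endo_on V A \<Longrightarrow> endo_on V (\<lambda>x. A x - x)"
  by (auto simp: endo_on_def scale_right_diff_distrib subspace_diff)

lemma endo_on_uminus: "endo_on V A \<Longrightarrow> endo_on V (\<lambda>x. - A x)"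
  using endo_on_scale[of V A "-1"] by simp

lemma endo_on_subset:
  "endo_on V A \<Longrightarrow> subspace U \<Longrightarrow> U \<subseteq> V \<Longrightarrow> (\<And>x. x \<in> U \<Longrightarrow> A x \<in> U) \<Longrightarrow> endo_on U A"
  unfolding endo_on_def by blast

lemma endo_on_kernel:
  assumes "endo_on V A" "endo_on V B" and "\<And>x. x \<in> V \<Longrightarrow> A (B x) = B (A x)"
  shows "endo_on {x \<in> V. (A ^^ k) x = 0} B"
proof -
  have Ak: "endo_on V (A ^^ k)" by (rule endo_on_funpow[OF assms(1)])
  have comm: "(A ^^ k) (B x) = B ((A ^^ k) x)" if "x \<in> V" for x
    using that
  proof (induction k)
    case (Suc k)
    then show ?case
      using assms(3) endo_onD(2)[OF endo_on_funpow[OF assms(1)]] by simp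
  qed simp
  have sub: "subspace {x \<in> V. (A ^^ k) x = 0}"
    using endo_onD[OF Ak] endo_on_0[OF Ak] endo_onD(1)[OF assms(1)]
    by (intro subspaceI) (auto simp: subspace_0 subspace_add subspace_scale)
  show ?thesis
    using comm endo_on_0[OF assms(2)] endo_onD(2)[OF assms(2)]
    by (intro endo_on_subset[OF assms(2) sub]) auto
qed

definition nilp :: "'v set \<Rightarrow> ('v \<Rightarrow> 'v) \<Rightarrow> nat \<Rightarrow> bool" where
  "nilp V A d \<longleftrightarrow> endo_on V A \<and> (\<forall>x\<in>V. (A ^^ d) x = 0)"

lemma nilpD:
  assumes "nilp V A d"
  shows "endo_on V A" and "x \<in> V \<Longrightarrow> d \<le> k \<Longrightarrow> (A ^^ k) x = 0"
proof -
  show e: "endo_on V A" using assms by (simp add: nilp_def)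
  assume x: "x \<in> V" and k: "d \<le> k"
  then have "(A ^^ k) x = (A ^^ (k - d)) ((A ^^ d) x)"
    by (metis comp_apply funpow_add le_add_diff_inverse2)
  also have "(A ^^ d) x = 0" using assms x by (simp add: nilp_def)
  finally show "(A ^^ k) x = 0" by (simp add: endo_on_0[OF endo_on_funpow[OF e]])
qed

text \<open>
  Summation over the nonzero terms gives a definition that needs neither the subspace nor the
  nilpotency index.
\<close>

definition fps_app :: "'k fps \<Rightarrow> ('v \<Rightarrow> 'v) \<Rightarrow> 'v \<Rightarrow> 'v" where
  "fps_app F A x = (\<Sum>k | (A ^^ k) x \<noteq> 0. scale (F $ k) ((A ^^ k) x))"

lemma fps_app_eq:
  assumes "nilp V A d" "x \<in> V" "d \<le> D"
  shows "fps_app F A x = (\<Sum>k<D. scale (F $ k) ((A ^^ k) x))"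
proof -
  have "{k. (A ^^ k) x \<noteq> 0} \<subseteq> {..<D}"
    using nilpD(2)[OF assms(1,2)] assms(3)
    by (metis (mono_tags, lifting) lessThan_iff mem_Collect_eq not_le order_trans subsetI)
  then show ?thesis
    unfolding fps_app_def by (intro sum.mono_neutral_left) auto
qed

lemma fps_app_endo:
  assumes A: "nilp V A d"
  shows "endo_on V (fps_app F A)"
proof -
  note e = endo_on_funpow[OF nilpD(1)[OF A]]
  note s = endo_onD(1)[OF nilpD(1)[OF A]]
  have eq: "fps_app F A x = (\<Sum>k<d. scale (F $ k) ((A ^^ k) x))" if "x \<in> V" for x
    using fps_app_eq[OF A that order_refl] .
  show ?thesis
    unfolding endo_on_def
  proof (intro conjI ballI allI)
    show "subspace V" by fact
    fix x assume x: "x \<in> V"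
    then show "fps_app F A x \<in> V"
      by (simp add: eq[OF x] subspace_sum[OF s] subspace_scale[OF s] endo_onD(2)[OF e])
    fix y assume y: "y \<in> V"
    then have xy: "x + y \<in> V" using x s by (simp add: subspace_add)
    show "fps_app F A (x + y) = fps_app F A x + fps_app F A y"
      using x y by (simp add: eq[OF x] eq[OF y] eq[OF xy] endo_onD(3)[OF e] scale_right_distrib sum.distrib)
  next
    fix c x assume x: "x \<in> V"
    then have cx: "scale c x \<in> V" using s by (simp add: subspace_scale)
    show "fps_app F A (scale c x) = scale c (fps_app F A x)"
      using x by (simp add: eq[OF x] eq[OF cx] endo_onD(4)[OF e] scale_sum_right mult.commute)
  qed
qed

lemma fps_app_add:
  assumes A: "nilp V A d" and x: "x \<in> V"
  shows "fps_app (F + G) A x = fps_app F A x + fps_app G A x"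
    and "fps_app (F - G) A x = fps_app F A x - fps_app G A x"
  by (simp_all add: fps_app_eq[OF A x order_refl] scale_left_distrib scale_left_diff_distrib
      sum.distrib sum_subtractf)

lemma fps_app_1: "nilp V A d \<Longrightarrow> x \<in> V \<Longrightarrow> fps_app 1 A x = x"
proof -
  assume A: "nilp V A d" and x: "x \<in> V"
  have "fps_app 1 A x = (\<Sum>k<Suc d. scale ((1::'k fps) $ k) ((A ^^ k) x))"
    by (rule fps_app_eq[OF A x]) simp
  then show ?thesis
    by (subst (asm) sum.lessThan_Suc_shift) simp
qed

lemma fps_app_X: "nilp V A d \<Longrightarrow> x \<in> V \<Longrightarrow> fps_app fps_X A x = A x"
proof -
  assume A: "nilp V A d" and x: "x \<in> V"
  have "fps_app fps_X A x = (\<Sum>k<Suc (Suc d). scale ((fps_X :: 'k fps) $ k) ((A ^^ k) x))"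
    by (rule fps_app_eq[OF A x]) simp
  then show ?thesis
    unfolding sum.lessThan_Suc_shift by (simp add: fps_X_def)
qed

text \<open>
  The double sum runs over a square and the product needs a triangle. The difference consists of powers
  beyond the nilpotency index, so it vanishes.
\<close>

lemma fps_app_mult:
  assumes A: "nilp V A d" and x: "x \<in> V"
  shows "fps_app (F * G) A x = fps_app F A (fps_app G A x)"
proof -
  note e = endo_on_funpow[OF nilpD(1)[OF A]]
  note s = endo_onD(1)[OF nilpD(1)[OF A]]
  define f where "f = (\<lambda>i j. scale (F $ i * G $ j) ((A ^^ (i + j)) x))"
  have in_V: "(A ^^ k) x \<in> V" for k using endo_onD(2)[OF e x] .
  have Gx: "fps_app G A x \<in> V" using endo_onD(2)[OF fps_app_endo[OF A] x] .
  have "fps_app F A (fps_app G A x)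
      = (\<Sum>i<d. scale (F $ i) ((A ^^ i) (\<Sum>j<d. scale (G $ j) ((A ^^ j) x))))"
    by (subst fps_app_eq[OF A Gx order_refl]) (simp add: fps_app_eq[OF A x order_refl])
  also have "\<dots> = (\<Sum>i<d. \<Sum>j<d. f i j)"
    by (simp add: endo_on_sum[OF e] subspace_scale[OF s] in_V endo_onD(4)[OF e] scale_sum_right
        f_def funpow_add)
  also have "\<dots> = (\<Sum>(i,j)\<in>{..<d} \<times> {..<d}. f i j)"
    by (simp add: sum.cartesian_product)
  also have "\<dots> = (\<Sum>(i,j)\<in>{(i,j). i + j < d}. f i j)"
    by (intro sum.mono_neutral_right) (auto simp: f_def, meson nilpD(2)[OF A x] not_le)
  also have "\<dots> = (\<Sum>k<d. \<Sum>i\<le>k. f i (k - i))"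
    by (rule sum.triangle_reindex)
  also have "\<dots> = fps_app (F * G) A x"
    by (simp add: fps_app_eq[OF A x order_refl] fps_mult_nth f_def scale_sum_left atLeast0AtMost)
  finally show ?thesis by simp
qed

lemma fps_app_power:
  assumes A: "nilp V A d" and x: "x \<in> V"
  shows "(fps_app F A ^^ k) x = fps_app (F ^ k) A x"
proof (induction k)
  case 0
  then show ?case by (simp add: fps_app_1[OF A x])
next
  case (Suc k)
  then show ?case by (simp add: fps_app_mult[OF A x])
qed

lemma fps_app_nilp:
  assumes A: "nilp V A d" and G: "G $ 0 = 0"
  shows "nilp V (fps_app G A) d"
  unfolding nilp_def
proof (intro conjI ballI fps_app_endo[OF A])
  fix x assume x: "x \<in> V"
  show "(fps_app G A ^^ d) x = 0"
    unfolding fps_app_power[OF A x] fps_app_eq[OF A x order_refl]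
    by (intro sum.neutral ballI) (simp add: startsby_zero_power_prefix[OF G])
qed

text \<open>
  Without a constant term \<open>G ^ i\<close> starts in degree \<open>i\<close>, so that both sides are finite sums over the same
  terms.
\<close>

lemma fps_app_compose:
  assumes A: "nilp V A d" and G: "G $ 0 = 0" and x: "x \<in> V"
  shows "fps_app (F oo G) A x = fps_app F (fps_app G A) x"
proof -
  have "fps_app F (fps_app G A) x
      = (\<Sum>i<d. \<Sum>n<d. scale (F $ i * (G ^ i) $ n) ((A ^^ n) x))"
    by (simp add: fps_app_eq[OF fps_app_nilp[OF A G] x order_refl] fps_app_power[OF A x]
        fps_app_eq[OF A x order_refl] scale_sum_right)
  also have "\<dots> = (\<Sum>n<d. \<Sum>i<d. scale (F $ i * (G ^ i) $ n) ((A ^^ n) x))"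
    by (rule sum.swap)
  also have "\<dots> = (\<Sum>n<d. \<Sum>i=0..n. scale (F $ i * (G ^ i) $ n) ((A ^^ n) x))"
    by (intro sum.cong refl sum.mono_neutral_right)
      (auto simp: startsby_zero_power_prefix[OF G])
  also have "\<dots> = fps_app (F oo G) A x"
    by (simp add: fps_app_eq[OF A x order_refl] fps_compose_nth scale_sum_left)
  finally show ?thesis by simp
qed


definition op_exp :: "('v \<Rightarrow> 'v) \<Rightarrow> 'v \<Rightarrow> 'v" where "op_exp = fps_app (fps_exp 1)"

definition op_log :: "('v \<Rightarrow> 'v) \<Rightarrow> 'v \<Rightarrow> 'v" where "op_log u = fps_app (fps_ln 1) (\<lambda>x. u x - x)"

lemma nilp_op_exp_minus_id:
  assumes A: "nilp V A d"
  shows "nilp V (\<lambda>x. op_exp A x - x) d"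
    and "x \<in> V \<Longrightarrow> op_exp A x - x = fps_app (fps_exp 1 - 1) A x"
proof -
  show eq: "op_exp A x - x = fps_app (fps_exp 1 - 1) A x" if "x \<in> V" for x
    using that by (simp add: fps_app_add(2)[OF A] fps_app_1[OF A] op_exp_def)
  have n: "nilp V (fps_app (fps_exp 1 - 1) A) d"
    by (rule fps_app_nilp[OF A]) simp
  have "((\<lambda>x. op_exp A x - x) ^^ k) x = (fps_app (fps_exp 1 - 1) A ^^ k) x" if "x \<in> V" for k x
  proof (induction k)
    case (Suc k)
    then show ?case
      using eq[of "(fps_app (fps_exp 1 - 1) A ^^ k) x"]
        endo_onD(2)[OF endo_on_funpow[OF nilpD(1)[OF n]] that] by simp
  qed simp
  moreover have "endo_on V (\<lambda>x. op_exp A x - x)"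
    unfolding op_exp_def by (intro endo_on_minus_id fps_app_endo[OF A])
  ultimately show "nilp V (\<lambda>x. op_exp A x - x) d"
    using n unfolding nilp_def by auto
qed

lemma fps_app_cong:
  assumes "nilp V A d" "\<And>y. y \<in> V \<Longrightarrow> A y = B y" "x \<in> V"
  shows "fps_app F A x = fps_app F B x"
proof -
  have "(B ^^ k) x = (A ^^ k) x" for k
  proof (induction k)
    case (Suc k)
    then show ?case
      using assms(2)[of "(A ^^ k) x"] endo_onD(2)[OF endo_on_funpow[OF nilpD(1)[OF assms(1)]] assms(3)]
      by simp
  qed simp
  then show ?thesis by (simp add: fps_app_def)
qed

text \<open>
  The logarithm of \<open>u\<close> is the power series \<open>ln (1 + X)\<close> at \<open>u - id\<close>, and \<open>exp - 1\<close> is its compositional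
  inverse; applying power series to nilpotent maps is compatible with composition.
\<close>

lemma op_log_op_exp:
  assumes A: "nilp V A d" and x: "x \<in> V"
  shows "op_log (op_exp A) x = A x"
proof -
  have "op_log (op_exp A) x = fps_app (fps_ln 1) (fps_app (fps_exp 1 - 1) A) x"
    unfolding op_log_def
    by (rule fps_app_cong[OF nilp_op_exp_minus_id(1)[OF A] _ x]) (rule nilp_op_exp_minus_id(2)[OF A])
  also have "\<dots> = fps_app (fps_ln 1 oo (fps_exp 1 - 1)) A x"
    by (rule fps_app_compose[OF A _ x, symmetric]) simp
  also have "fps_ln (1::'k) oo (fps_exp 1 - 1) = fps_X"
    by (simp add: fps_ln_fps_exp_inv fps_inv_fps_exp_compose)
  finally show ?thesis by (simp add: fps_app_X[OF A x])
qed

lemma op_exp_op_log: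
  assumes u: "nilp V (\<lambda>x. u x - x) d" and x: "x \<in> V"
  shows "op_exp (op_log u) x = u x"
proof -
  have n: "nilp V (op_log u) d"
    unfolding op_log_def by (rule fps_app_nilp[OF u]) simp
  have "op_exp (op_log u) x - x = fps_app (fps_exp 1 - 1) (op_log u) x"
    by (rule nilp_op_exp_minus_id(2)[OF n x])
  also have "\<dots> = fps_app ((fps_exp 1 - 1) oo fps_ln 1) (\<lambda>x. u x - x) x"
    unfolding op_log_def by (rule fps_app_compose[OF u _ x, symmetric]) simp
  also have "(fps_exp (1::'k) - 1) oo fps_ln 1 = fps_X"
    by (simp add: fps_ln_fps_exp_inv fps_inv_fps_exp_compose)
  finally show ?thesis by (simp add: fps_app_X[OF u x])
qed

lemma nilp_op_log: "nilp V (\<lambda>x. u x - x) d \<Longrightarrow> nilp V (op_log u) d"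
  unfolding op_log_def by (rule fps_app_nilp) simp_all

lemma uminus_funpow:
  assumes "endo_on V A" "x \<in> V"
  shows "((\<lambda>y. - A y) ^^ k) x = scale ((-1) ^ k) ((A ^^ k) x)"
proof (induction k)
  case (Suc k)
  then show ?case
    using endo_onD(2)[OF endo_on_funpow[OF assms(1)] assms(2)]
    by (simp add: endo_onD(4)[OF assms(1)] scale_minus_left)
qed simp

lemma nilp_uminus: "nilp V A d \<Longrightarrow> nilp V (\<lambda>y. - A y) d"
  by (auto simp: nilp_def endo_on_uminus uminus_funpow)

lemma op_exp_uminus:
  assumes A: "nilp V A d" and x: "x \<in> V"
  shows "op_exp (\<lambda>y. - A y) (op_exp A x) = x" and "op_exp A (op_exp (\<lambda>y. - A y) x) = x"
proof -
  have eq: "op_exp (\<lambda>y. - A y) z = fps_app (fps_exp (-1)) A z" if "z \<in> V" for z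
    using that
    by (simp add: op_exp_def fps_app_eq[OF nilp_uminus[OF A] that order_refl]
        fps_app_eq[OF A that order_refl] uminus_funpow[OF nilpD(1)[OF A]] mult.commute)
  have m: "fps_exp (-1) * fps_exp (1::'k) = 1" "fps_exp (1::'k) * fps_exp (-1) = 1"
    by (simp_all flip: fps_exp_add_mult)
  have in_V: "op_exp A x \<in> V" using endo_onD(2)[OF fps_app_endo[OF A] x] by (simp add: op_exp_def)
  show "op_exp (\<lambda>y. - A y) (op_exp A x) = x"
    by (simp add: eq[OF in_V]) (simp add: op_exp_def m fps_app_1[OF A x] flip: fps_app_mult[OF A x])
  show "op_exp A (op_exp (\<lambda>y. - A y) x) = x"
    by (simp add: eq[OF x]) (simp add: op_exp_def m fps_app_1[OF A x] flip: fps_app_mult[OF A x])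
qed

end

global_interpretation real0: char0_space "scaleR :: real \<Rightarrow> 'a::real_vector \<Rightarrow> 'a"
  by unfold_locales

global_interpretation cplx0: char0_space "cscale :: complex \<Rightarrow> 'a::real_vector \<times> 'a \<Rightarrow> 'a \<times> 'a"
  by unfold_locales

section \<open>Fitting decomposition and exponential strings\<close>

context char0_space
begin

lemma subspace_eq_if_dim_le:
  assumes S: "subspace S" and ST: "S \<subseteq> T" and T: "T \<subseteq> span B" "finite B" and le: "dim T \<le> dim S"
  shows "S = T"
proof (rule ccontr)
  assume "S \<noteq> T"
  then obtain t where t: "t \<in> T" "t \<notin> S" using ST by blast
  obtain BS where BS: "BS \<subseteq> S" "independent BS" "S \<subseteq> span BS" "card BS = dim S"
    using basis_exists[of S] by blast
  obtain BT where BT: "BT \<subseteq> T" "independent BT" "T \<subseteq> span BT" "card BT = dim T"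
    using basis_exists[of T] by blast
  have fT: "finite BT" using independent_span_bound[OF T(2) BT(2)] BT(1) T(1) by blast
  have fS: "finite BS" using independent_span_bound[OF T(2) BS(2)] BS(1) ST T(1) by blast
  have "t \<notin> span BS" using t(2) span_minimal[OF BS(1) S] by blast
  then have "independent (insert t BS)" using BS(2) by (simp add: independent_insertI)
  moreover have "insert t BS \<subseteq> span BT" using t BT(3) BS(1) ST by blast
  ultimately have "card (insert t BS) \<le> card BT" using independent_span_bound[OF fT] by blast
  moreover have "t \<notin> BS" using BS(1) t by blast
  ultimately show False using fS BS(4) BT(4) le by simp
qed

text \<open>
  The images of the powers of \<open>A\<close> are decreasing subspaces of a finite dimensional space, so they become
  stationary: for large \<open>k\<close> every \<open>A\<^sup>k x\<close> is also of the form \<open>A\<^sup>2\<^sup>k y\<close>. Thus \<open>x\<close> is the sum of the vector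
  \<open>x - A\<^sup>k y\<close> in the kernel of \<open>A\<^sup>k\<close> and of a vector in the image.
\<close>

lemma fitting:
  assumes A: "endo_on V A" and B: "V \<subseteq> span B" "finite B"
  shows "\<exists>d. \<forall>k\<ge>d. \<forall>x\<in>V. \<exists>y\<in>V. (A ^^ k) (x - (A ^^ k) y) = 0"
proof -
  note e = endo_on_funpow[OF A]
  define I where "I = (\<lambda>k. (A ^^ k) ` V)"
  have sub: "subspace (I k)" for k
  proof (rule subspaceI)
    show "0 \<in> I k" unfolding I_def
      using endo_on_0[OF e, of k] subspace_0[OF endo_onD(1)[OF A]] by (metis image_eqI)
    show "x + y \<in> I k" if xy: "x \<in> I k" "y \<in> I k" for x y
    proof -
      obtain x' y' where "x' \<in> V" "y' \<in> V" "x = (A ^^ k) x'" "y = (A ^^ k) y'"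
        using xy unfolding I_def by blast
      then show ?thesis unfolding I_def
        using endo_onD(3)[OF e, of x' y' k] subspace_add[OF endo_onD(1)[OF A]]
        by (metis image_eqI)
    qed
    show "scale c x \<in> I k" if x: "x \<in> I k" for c x
    proof -
      obtain x' where "x' \<in> V" "x = (A ^^ k) x'"
        using x unfolding I_def by blast
      then show ?thesis unfolding I_def
        using endo_onD(4)[OF e, of x' k c] subspace_scale[OF endo_onD(1)[OF A]]
        by (metis image_eqI)
    qed
  qed
  have dec: "I k \<subseteq> I d" if "d \<le> k" for d k
  proof
    fix z assume "z \<in> I k"
    then obtain x where x: "x \<in> V" "z = (A ^^ k) x" unfolding I_def by blast
    have "(A ^^ k) x = (A ^^ d) ((A ^^ (k - d)) x)"
      using that by (metis comp_apply funpow_add le_add_diff_inverse)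
    then show "z \<in> I d" using x endo_onD(2)[OF e] unfolding I_def by blast
  qed
  obtain d where d: "dim (I d) \<le> dim (I k)" for k
    using ex_has_least_nat[of "\<lambda>_. True" _ "\<lambda>k. dim (I k)"] by blast
  have I_B: "I k \<subseteq> span B" for k
    using endo_onD(2)[OF e] B(1) unfolding I_def by blast
  have eq: "I k = I d" if "d \<le> k" for k
    by (rule subspace_eq_if_dim_le[OF sub dec[OF that] I_B B(2) d])
  show ?thesis
  proof (intro exI allI impI ballI)
    fix k x assume k: "d \<le> k" and x: "x \<in> V"
    have "(A ^^ k) x \<in> I (k + k)"
      using eq[OF k] eq[of "k + k"] k x unfolding I_def by auto
    then obtain y where y: "y \<in> V" "(A ^^ k) x = (A ^^ (k + k)) y" unfolding I_def by blast
    have "(A ^^ k) (x - (A ^^ k) y) = 0"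
      using endo_on_diff[OF e x endo_onD(2)[OF e y(1)], of k k] y(2) by (simp add: funpow_add)
    then show "\<exists>y\<in>V. (A ^^ k) (x - (A ^^ k) y) = 0" using y(1) by blast
  qed
qed

text \<open>
  If \<open>N\<close> shifts the string \<open>r\<close>, then \<open>l exp N\<close> acts on it in this way. Stated for \<open>M\<close> alone, the condition can be
  checked and transported without knowing semisimple and unipotent parts.
\<close>

definition exp_chain :: "nat \<Rightarrow> 'k \<Rightarrow> ('v \<Rightarrow> 'v) \<Rightarrow> (nat \<Rightarrow> 'v) \<Rightarrow> bool" where
  "exp_chain n l M r \<longleftrightarrow>
     (\<forall>k\<in>{1..n}. M (r k) = scale l (\<Sum>j=0..n-k. scale (1 / fact j) (r (k + j))))"

lemma op_exp_jordan:
  assumes N: "nilp V N d" and r: "\<And>k. k \<in> {1..n} \<Longrightarrow> r k \<in> V"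
    and step: "\<And>k. k \<in> {1..<n} \<Longrightarrow> N (r k) = r (k + 1)" and last: "N (r n) = 0"
    and k: "k \<in> {1..n}"
  shows "op_exp N (r k) = (\<Sum>j=0..n-k. scale (1 / fact j) (r (k + j)))"
proof -
  have N0: "N 0 = 0" by (rule endo_on_0[OF nilpD(1)[OF N]])
  have pow: "(N ^^ j) (r k) = (if k + j \<le> n then r (k + j) else 0)" for j
  proof (induction j)
    case (Suc j)
    consider "k + j < n" | "k + j = n" | "k + j > n" by linarith
    then show ?case
    proof cases
      case 1
      then have "N (r (k + j)) = r (k + j + 1)" using step[of "k + j"] k by simp
      then show ?thesis using Suc 1 by simp
    next
      case 2
      then show ?thesis using Suc last by auto
    next
      case 3
      then show ?thesis using Suc N0 by simp
    qed
  qed (use k in auto)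
  have rk: "r k \<in> V" using r k by simp
  have "op_exp N (r k) = (\<Sum>j<max d (Suc n). scale (1 / fact j) ((N ^^ j) (r k)))"
    by (simp add: op_exp_def fps_app_eq[OF N rk, of "max d (Suc n)"])
  also have "\<dots> = (\<Sum>j=0..n-k. scale (1 / fact j) ((N ^^ j) (r k)))"
    using k by (intro sum.mono_neutral_right) (auto simp: pow)
  also have "\<dots> = (\<Sum>j=0..n-k. scale (1 / fact j) (r (k + j)))"
    using k by (intro sum.cong) (auto simp: pow)
  finally show ?thesis .
qed

end

section \<open>Isometries and generalized eigenspaces\<close>

text \<open>
  The form enters only through bilinearity, nondegeneracy on both sides and invariance. In this
  generality the locale covers \<open>S\<close> on \<open>V\<close> as well as \<open>cform S\<close> on \<open>V \<times> V\<close>.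
\<close>

locale iso_space = char0_space scale
  for scale :: "'k::field_char_0 \<Rightarrow> 'v::ab_group_add \<Rightarrow> 'v" +
  fixes V :: "'v set" and M :: "'v \<Rightarrow> 'v" and S :: "'v \<Rightarrow> 'v \<Rightarrow> 'k"
  assumes fin_dim: "\<exists>B. finite B \<and> V = span B"
    and M_endo: "endo_on V M"
    and M_surj: "M ` V = V"
    and S_add_left: "\<And>x y z. x \<in> V \<Longrightarrow> y \<in> V \<Longrightarrow> z \<in> V \<Longrightarrow> S (x + y) z = S x z + S y z"
    and S_add_right: "\<And>x y z. x \<in> V \<Longrightarrow> y \<in> V \<Longrightarrow> z \<in> V \<Longrightarrow> S z (x + y) = S z x + S z y"
    and S_scale_left: "\<And>c x z. x \<in> V \<Longrightarrow> z \<in> V \<Longrightarrow> S (scale c x) z = c * S x z"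
    and S_scale_right: "\<And>c x z. x \<in> V \<Longrightarrow> z \<in> V \<Longrightarrow> S z (scale c x) = c * S z x"
    and nondeg_left: "\<And>x. x \<in> V \<Longrightarrow> (\<And>y. y \<in> V \<Longrightarrow> S x y = 0) \<Longrightarrow> x = 0"
    and nondeg_right: "\<And>x. x \<in> V \<Longrightarrow> (\<And>y. y \<in> V \<Longrightarrow> S y x = 0) \<Longrightarrow> x = 0"
    and isom: "\<And>x y. x \<in> V \<Longrightarrow> y \<in> V \<Longrightarrow> S (M x) (M y) = S x y"
begin

lemma V_sub: "subspace V" using endo_onD(1)[OF M_endo] .

lemma S_0 [simp]: "x \<in> V \<Longrightarrow> S x 0 = 0" "x \<in> V \<Longrightarrow> S 0 x = 0"
  using S_scale_left[of 0 x 0] S_scale_right[of 0 x 0] subspace_0[OF V_sub] by auto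

lemma S_diff_left: "x \<in> V \<Longrightarrow> y \<in> V \<Longrightarrow> z \<in> V \<Longrightarrow> S (x - y) z = S x z - S y z"
  using S_add_left[of "x - y" y z] subspace_diff[OF V_sub] by simp

lemma S_diff_right: "x \<in> V \<Longrightarrow> y \<in> V \<Longrightarrow> z \<in> V \<Longrightarrow> S z (x - y) = S z x - S z y"
  using S_add_right[of "x - y" y z] subspace_diff[OF V_sub] by simp

lemma S_sum_left:
  assumes "\<And>i. i \<in> I \<Longrightarrow> f i \<in> V" "z \<in> V"
  shows "S (\<Sum>i\<in>I. f i) z = (\<Sum>i\<in>I. S (f i) z)"
  using assms(1)
proof (induction I rule: infinite_finite_induct)
  case (insert i I)
  then have "(\<Sum>i\<in>I. f i) \<in> V" by (intro subspace_sum V_sub) auto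
  with insert assms(2) show ?case by (simp add: S_add_left)
qed (simp_all add: assms(2))

lemma S_sum_right:
  assumes "\<And>i. i \<in> I \<Longrightarrow> f i \<in> V" "z \<in> V"
  shows "S z (\<Sum>i\<in>I. f i) = (\<Sum>i\<in>I. S z (f i))"
  using assms(1)
proof (induction I rule: infinite_finite_induct)
  case (insert i I)
  then have "(\<Sum>i\<in>I. f i) \<in> V" by (intro subspace_sum V_sub) auto
  with insert assms(2) show ?case by (simp add: S_add_right)
qed (simp_all add: assms(2))

lemma adjoint_funpow:
  assumes A: "endo_on U A" and B: "endo_on W B" and adj: "\<And>x y. x \<in> U \<Longrightarrow> y \<in> W \<Longrightarrow> S (A x) y = S x (B y)"
    and x: "x \<in> U" and y: "y \<in> W"
  shows "S ((A ^^ k) x) y = S x ((B ^^ k) y)"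
  using x
proof (induction k arbitrary: x)
  case (Suc k)
  then have "S ((A ^^ Suc k) x) y = S (A x) ((B ^^ k) y)"
    using endo_onD(2)[OF A] by (simp add: funpow_Suc_right del: funpow.simps)
  then show ?case using adj[of x "(B ^^ k) y"] Suc.prems endo_onD(2)[OF endo_on_funpow[OF B] y] by simp
qed simp

text \<open>
  Adjoint maps have adjoint powers, and \<open>fps_app\<close> is a linear combination of powers with the same
  coefficients on both sides.
\<close>

lemma adjoint_fps_app:
  assumes A: "nilp U A d" and B: "nilp W B d" and UW: "U \<subseteq> V" "W \<subseteq> V"
    and adj: "\<And>x y. x \<in> U \<Longrightarrow> y \<in> W \<Longrightarrow> S (A x) y = S x (B y)"
    and x: "x \<in> U" and y: "y \<in> W"
  shows "S (fps_app F A x) y = S x (fps_app F B y)"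
proof -
  note eA = endo_on_funpow[OF nilpD(1)[OF A]] and eB = endo_on_funpow[OF nilpD(1)[OF B]]
  have in_V: "(A ^^ k) x \<in> V" "(B ^^ k) y \<in> V" "x \<in> V" "y \<in> V" for k
    using endo_onD(2)[OF eA x] endo_onD(2)[OF eB y] UW x y by auto
  then show ?thesis
    unfolding fps_app_eq[OF A x order_refl] fps_app_eq[OF B y order_refl]
    by (simp add: S_sum_left S_sum_right subspace_scale[OF V_sub] S_scale_left S_scale_right
        adjoint_funpow[OF nilpD(1)[OF A] nilpD(1)[OF B] adj x y])
qed

text \<open>
  On the generalized eigenspace \<open>gen l D\<close> of \<open>l\<close> the map \<open>M / l\<close> is unipotent, with \<open>defect l\<close> as its nilpotent
  part, and \<open>mlog l\<close> is its logarithm \<open>N\<close>. The exponent \<open>D\<close> is a parameter so that the spaces for \<open>l\<close> and for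
  \<open>1/l\<close> can be taken with the same one.
\<close>

definition defect :: "'k \<Rightarrow> 'v \<Rightarrow> 'v" where "defect l x = scale (inverse l) (M x) - x"

definition gen :: "'k \<Rightarrow> nat \<Rightarrow> 'v set" where "gen l D = {x \<in> V. (defect l ^^ D) x = 0}"

definition mlog :: "'k \<Rightarrow> 'v \<Rightarrow> 'v" where "mlog l = op_log (\<lambda>x. scale (inverse l) (M x))"

lemma defect_endo: "endo_on V (defect l)"
  using endo_on_minus_id[OF endo_on_scale[OF M_endo]] by (simp add: defect_def[abs_def])

lemma M_in: "x \<in> V \<Longrightarrow> M x \<in> V"
  by (rule endo_onD(2)[OF M_endo])

lemma M_defect: "x \<in> V \<Longrightarrow> M (defect l x) = defect l (M x)"
  by (simp add: defect_def endo_on_diff[OF M_endo] endo_onD(4)[OF M_endo] M_in subspace_scale[OF V_sub])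

lemma gen_sub_V: "gen l D \<subseteq> V"
  by (auto simp: gen_def)

lemma gen_endo: "endo_on (gen l D) (defect l)" "endo_on (gen l D) M"
  using endo_on_kernel[OF defect_endo defect_endo] endo_on_kernel[OF defect_endo M_endo, of l D] M_defect
  by (simp_all add: gen_def)

lemma defect_nilp: "nilp (gen l D) (defect l) D"
  using gen_endo by (auto simp: nilp_def gen_def)

lemma mlog_nilp: "nilp (gen l D) (mlog l) D"
  using nilp_op_log[of "gen l D" "\<lambda>x. scale (inverse l) (M x)" D] defect_nilp[of l D]
  by (simp add: mlog_def defect_def[abs_def])

lemma M_eq_exp:
  assumes "x \<in> gen l D" "l \<noteq> 0"
  shows "M x = scale l (op_exp (mlog l) x)"
proof -
  have "op_exp (mlog l) x = scale (inverse l) (M x)"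
    unfolding mlog_def using defect_nilp[of l D] assms(1)
    by (intro op_exp_op_log) (auto simp: defect_def[abs_def])
  then show ?thesis using assms(2) by simp
qed

text \<open>
  Write \<open>M x = l (x + x')\<close> and \<open>M y = l' (y + y')\<close> with \<open>x'\<close>, \<open>y'\<close> of lower order. By induction invariance of the
  form reads \<open>S x y = l l' S x y\<close>.
\<close>

lemma gen_orthogonal:
  assumes "x \<in> gen l p" "y \<in> gen l' q" "l \<noteq> 0" "l' \<noteq> 0" "l * l' \<noteq> 1"
  shows "S x y = 0"
  using assms(1,2)
proof (induction "p + q" arbitrary: p q x y rule: less_induct)
  case less
  show ?case
  proof (cases "p = 0 \<or> q = 0")
    case True
    then show ?thesis using less.prems by (auto simp: gen_def)
  next
    case False
    then obtain p' q' where pq: "p = Suc p'" "q = Suc q'" by (meson not0_implies_Suc)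
    have x: "x \<in> V" and y: "y \<in> V" using less.prems by (auto simp: gen_def)
    define x1 y1 where "x1 = defect l x" and "y1 = defect l' y"
    have x1: "x1 \<in> gen l p'" and y1: "y1 \<in> gen l' q'"
      using less.prems endo_onD(2)[OF defect_endo] x y
      by (auto simp: gen_def x1_def y1_def pq funpow_Suc_right simp del: funpow.simps)
    have z: "S x1 y = 0" "S x y1 = 0" "S x1 y1 = 0"
      using less.hyps[OF _ x1 less.prems(2)] less.hyps[OF _ less.prems(1) y1]
        less.hyps[OF _ x1 y1] by (auto simp: pq)
    have x1V: "x1 \<in> V" and y1V: "y1 \<in> V" using x1 y1 by (auto simp: gen_def)
    have Mx: "M x = scale l (x + x1)" and My: "M y = scale l' (y + y1)"
      using assms(3,4) by (simp_all add: x1_def y1_def defect_def)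
    have "S x y = S (M x) (M y)" using isom[OF x y] by simp
    also have "\<dots> = l * l' * (S x y + S x1 y + (S x y1 + S x1 y1))"
      using x y x1V y1V
      by (simp add: Mx My S_scale_left S_scale_right S_add_left S_add_right subspace_add[OF V_sub]
          subspace_scale[OF V_sub] algebra_simps)
    finally have "(1 - l * l') * S x y = 0" by (simp add: z algebra_simps)
    then show ?thesis using assms(5) by auto
  qed
qed

text \<open>
  Moving one factor across the form, \<open>S(M u, (M l - 1) v) = - l S((M / l - 1) u, v)\<close>. Since \<open>M\<close> is bijective,
  \<open>x = M\<^sup>D u\<close>, and \<open>u\<close> lies in the generalized eigenspace together with \<open>x\<close>; \<open>D\<close> such moves give zero.
  In combination with \<open>fitting\<close> this makes the generalized eigenspaces of \<open>l\<close> and \<open>1/l\<close> dual.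
\<close>

lemma defect_image_orthogonal:
  assumes l: "l \<noteq> 0" and x: "x \<in> gen l D" and y: "y \<in> V"
  shows "S x ((defect (inverse l) ^^ D) y) = 0"
    and "S ((defect (inverse l) ^^ D) y) x = 0"
proof -
  have shift: "S ((M ^^ k) u) ((defect (inverse l) ^^ k) v) = (- l) ^ k * S ((defect l ^^ k) u) v \<and>
     S ((defect (inverse l) ^^ k) v) ((M ^^ k) u) = (- l) ^ k * S v ((defect l ^^ k) u)"
    if "u \<in> V" "v \<in> V" for u v k
    using that
  proof (induction k arbitrary: u v)
    case (Suc k)
    define v' where "v' = defect (inverse l) v"
    define u' where "u' = (M ^^ k) u"
    have v': "v' \<in> V" using endo_onD(2)[OF defect_endo Suc.prems(2)] by (simp add: v'_def)
    have pow: "(defect l ^^ k) u \<in> V" using endo_onD(2)[OF endo_on_funpow[OF defect_endo] Suc.prems(1)] .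
    have Mu: "M u \<in> V" using M_in Suc.prems by simp
    have dM: "(defect l ^^ k) (M u) = M ((defect l ^^ k) u)"
    proof (induction k)
      case (Suc k)
      then show ?case
        using M_defect endo_onD(2)[OF endo_on_funpow[OF defect_endo] \<open>u \<in> V\<close>] by simp
    qed simp
    have step: "S (M w) (defect (inverse l) v) = - l * S (defect l w) v"
         "S (defect (inverse l) v) (M w) = - l * S v (defect l w)" if w: "w \<in> V" for w
      using l w Suc.prems M_in subspace_scale[OF V_sub]
      by (simp_all add: defect_def S_diff_right S_diff_left S_scale_right S_scale_left isom algebra_simps)
    have "S ((M ^^ Suc k) u) ((defect (inverse l) ^^ Suc k) v)
        = S ((M ^^ k) (M u)) ((defect (inverse l) ^^ k) v')"
      by (simp only: funpow_Suc_right o_apply v'_def)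
    also have "\<dots> = (- l) ^ k * S (M ((defect l ^^ k) u)) v'"
      using Suc.IH[OF Mu v'] dM by simp
    also have "\<dots> = (- l) ^ Suc k * S ((defect l ^^ Suc k) u) v"
      using step(1)[OF pow] by (simp add: v'_def)
    finally have 1: "S ((M ^^ Suc k) u) ((defect (inverse l) ^^ Suc k) v)
        = (- l) ^ Suc k * S ((defect l ^^ Suc k) u) v" .
    have "S ((defect (inverse l) ^^ Suc k) v) ((M ^^ Suc k) u)
        = S ((defect (inverse l) ^^ k) v') ((M ^^ k) (M u))"
      by (simp only: funpow_Suc_right o_apply v'_def)
    also have "\<dots> = (- l) ^ k * S v' (M ((defect l ^^ k) u))"
      using Suc.IH[OF Mu v'] dM by simp
    also have "\<dots> = (- l) ^ Suc k * S v ((defect l ^^ Suc k) u)"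
      using step(2)[OF pow] by (simp add: v'_def)
    finally show ?case using 1 by blast
  qed simp
  have "\<exists>u\<in>V. x = (M ^^ D) u" if "x \<in> V" for x
    using that
  proof (induction D arbitrary: x)
    case (Suc D)
    then obtain u where "u \<in> V" "x = M u" using M_surj by blast
    moreover from this obtain w where "w \<in> V" "u = (M ^^ D) w" using Suc.IH by blast
    ultimately show ?case by auto
  qed auto
  then obtain u where u: "u \<in> V" "x = (M ^^ D) u" using x gen_sub_V by blast
  have M_inj: "w = 0" if "w \<in> V" "M w = 0" for w
  proof (rule nondeg_left[OF that(1)])
    fix y assume "y \<in> V"
    then show "S w y = 0" using isom[OF that(1), of y] that M_in by simp
  qed
  have "(M ^^ k) w = 0 \<Longrightarrow> w = 0" if "w \<in> V" for w k
  proof (induction k)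
    case (Suc k)
    then show ?case using M_inj endo_onD(2)[OF endo_on_funpow[OF M_endo] that] by simp
  qed simp
  moreover have "(M ^^ D) ((defect l ^^ D) u) = (defect l ^^ D) x"
  proof -
    have "(defect l ^^ k) ((M ^^ j) u) = (M ^^ j) ((defect l ^^ k) u)" for k j
    proof (induction j)
      case (Suc j)
      have "(defect l ^^ k) (M w) = M ((defect l ^^ k) w)" if "w \<in> V" for w
      proof (induction k)
        case (Suc k)
        then show ?case
          using M_defect endo_onD(2)[OF endo_on_funpow[OF defect_endo] that] by simp
      qed simp
      then show ?case using Suc endo_onD(2)[OF endo_on_funpow[OF M_endo] u(1)] by simp
    qed simp
    then show ?thesis by (simp add: u(2))
  qed
  ultimately have "(defect l ^^ D) u = 0"
    using x endo_onD(2)[OF endo_on_funpow[OF defect_endo] u(1)] by (auto simp: gen_def)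
  then show "S x ((defect (inverse l) ^^ D) y) = 0" "S ((defect (inverse l) ^^ D) y) x = 0"
    using shift[OF u(1) y, of D] u(2) y by simp_all
qed

text \<open>
  By invariance of the form the adjoint of \<open>exp N\<close> on the space of \<open>l\<close> is the inverse of \<open>exp N\<close> on the
  space of \<open>1/l\<close>, which is \<open>exp (-N)\<close>. Taking logarithms on both sides, which is possible because adjoints
  are compatible with power series, gives the claim.
\<close>

lemma mlog_adjoint:
  assumes l: "l \<noteq> 0" and x: "x \<in> gen l D" and y: "y \<in> gen (inverse l) D"
  shows "S (mlog l x) y = - S x (mlog (inverse l) y)"
proof -
  let ?N = "mlog l" and ?N' = "\<lambda>y. - mlog (inverse l) y"
  let ?U = "gen l D" and ?W = "gen (inverse l) D"
  have n: "nilp ?U ?N D" "nilp ?W ?N' D" "nilp ?W (mlog (inverse l)) D"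
    using mlog_nilp nilp_uminus by auto
  have l': "inverse l \<noteq> 0" using l by simp
  have adj: "S (op_exp ?N x - x) y = S x (op_exp ?N' y - y)" if xy: "x \<in> ?U" "y \<in> ?W" for x y
  proof -
    have V: "x \<in> V" "y \<in> V" using xy gen_sub_V by auto
    have eU: "endo_on ?U (op_exp ?N)" and eW: "endo_on ?W (op_exp ?N')"
      unfolding op_exp_def by (rule fps_app_endo n)+
    define y' where "y' = op_exp ?N' y"
    have y': "y' \<in> ?W" unfolding y'_def by (rule endo_onD(2)[OF eW xy(2)])
    have V': "op_exp ?N x \<in> V" "y' \<in> V"
      using endo_onD(2)[OF eU xy(1)] y' gen_sub_V by blast+
    have "op_exp (mlog (inverse l)) y' = y"
      unfolding y'_def by (rule op_exp_uminus(2)[OF n(3) xy(2)])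
    then have "M y' = scale (inverse l) y" using M_eq_exp[OF y' l'] by simp
    moreover have "M x = scale l (op_exp ?N x)" by (rule M_eq_exp[OF xy(1) l])
    ultimately have "S x y' = S (op_exp ?N x) y"
      using isom[OF V(1) V'(2)] V V' l subspace_scale[OF V_sub]
      by (simp add: S_scale_left S_scale_right mult.assoc[symmetric])
    then show ?thesis using V V' by (simp add: S_diff_left S_diff_right y'_def)
  qed
  have "S (fps_app (fps_ln 1) (\<lambda>x. op_exp ?N x - x) x) y
      = S x (fps_app (fps_ln 1) (\<lambda>y. op_exp ?N' y - y) y)"
    by (rule adjoint_fps_app[OF nilp_op_exp_minus_id(1)[OF n(1)] nilp_op_exp_minus_id(1)[OF n(2)]
          gen_sub_V gen_sub_V adj x y])
  then have "S (op_log (op_exp ?N) x) y = S x (op_log (op_exp ?N') y)"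
    by (simp add: op_log_def)
  then have "S (?N x) y = S x (?N' y)"
    by (simp add: op_log_op_exp[OF n(1) x] op_log_op_exp[OF n(2) y])
  moreover have "mlog (inverse l) y \<in> V"
    using endo_onD(2)[OF nilpD(1)[OF n(3)] y] gen_sub_V by blast
  ultimately show ?thesis
    using S_scale_right[of "mlog (inverse l) y" x "-1"] x gen_sub_V by auto
qed

lemma mlog_pow_adjoint:
  assumes l: "l \<noteq> 0" and x: "x \<in> gen l D" and y: "y \<in> gen (inverse l) D"
  shows "S ((mlog l ^^ k) x) y = (-1) ^ k * S x ((mlog (inverse l) ^^ k) y)"
proof -
  let ?N = "mlog l" and ?N' = "mlog (inverse l)" and ?U = "gen l D" and ?W = "gen (inverse l) D"
  have e: "endo_on ?U ?N" "endo_on ?W ?N'" using nilpD(1)[OF mlog_nilp] by auto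
  have s: "S (?N x) y = S x (- ?N' y)" if "x \<in> ?U" "y \<in> ?W" for x y
  proof -
    have "?N' y \<in> V" "x \<in> V" using endo_onD(2)[OF e(2) that(2)] that gen_sub_V by blast+
    then show ?thesis using mlog_adjoint[OF l that] S_scale_right[of "?N' y" x "-1"] by simp
  qed
  have "S ((?N ^^ k) x) y = S x (((\<lambda>y. - ?N' y) ^^ k) y)"
    by (rule adjoint_funpow[OF e(1) endo_on_uminus[OF e(2)] s x y])
  moreover have "(?N' ^^ k) y \<in> V" "x \<in> V"
    using endo_onD(2)[OF endo_on_funpow[OF e(2)] y] x gen_sub_V by blast+
  ultimately show ?thesis
    by (simp add: uminus_funpow[OF e(2) y] S_scale_right)
qed

text \<open>
  Let \<open>n\<close> be least such that \<open>N\<^sup>n = 0\<close> on the generalized eigenspace of \<open>l\<close>, and \<open>N\<^sup>n\<^sup>-\<^sup>1 a \<noteq> 0\<close>. By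
  nondegeneracy this vector pairs nontrivially with some \<open>y\<close>, and the component of \<open>y\<close> in the image of a
  high power of \<open>defect (1/l)\<close> does not contribute. As \<open>N\<close> is skew, \<open>N\<^sup>n = 0\<close> on the dual space as well.
\<close>

lemma top_pairing:
  assumes l: "l \<noteq> 0" and z: "z \<in> V" "z \<noteq> 0" "M z = scale l z"
  obtains n D a b where "n \<ge> 1" "a \<in> gen l D" "b \<in> gen (inverse l) D"
    "\<And>x. x \<in> gen l D \<Longrightarrow> (mlog l ^^ n) x = 0"
    "\<And>y. y \<in> gen (inverse l) D \<Longrightarrow> (mlog (inverse l) ^^ n) y = 0"
    "S a ((mlog (inverse l) ^^ (n - 1)) b) \<noteq> 0"
proof -
  obtain B where B: "V \<subseteq> span B" "finite B" using fin_dim by blast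
  obtain d1 where d1: "\<And>k x. d1 \<le> k \<Longrightarrow> x \<in> V \<Longrightarrow> \<exists>y\<in>V. (defect l ^^ k) (x - (defect l ^^ k) y) = 0"
    using fitting[OF defect_endo B] by blast
  obtain d2 where d2: "\<And>k x. d2 \<le> k \<Longrightarrow> x \<in> V \<Longrightarrow> \<exists>y\<in>V. (defect (inverse l) ^^ k) (x - (defect (inverse l) ^^ k) y) = 0"
    using fitting[OF defect_endo B] by blast
  define D where "D = Suc (max d1 d2)"
  have D: "d1 \<le> D" "d2 \<le> D" by (simp_all add: D_def)
  let ?N = "mlog l" and ?N' = "mlog (inverse l)" and ?U = "gen l D" and ?W = "gen (inverse l) D"
  have l': "inverse l \<noteq> 0" using l by simp
  \<comment> \<open>the Fitting decomposition for the two eigenvalues, with a common exponent\<close>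
  have split: "\<exists>u\<in>gen \<mu> D. \<exists>y\<in>V. x = u + (defect \<mu> ^^ D) y" if x: "x \<in> V" and \<mu>: "\<mu> = l \<or> \<mu> = inverse l" for x \<mu>
  proof -
    obtain y where y: "y \<in> V" "(defect \<mu> ^^ D) (x - (defect \<mu> ^^ D) y) = 0"
      using d1[OF D(1) x] d2[OF D(2) x] \<mu> by blast
    then show ?thesis
      using x endo_onD(2)[OF endo_on_funpow[OF defect_endo] y(1)]
      by (intro bexI[of _ "x - (defect \<mu> ^^ D) y"] bexI[of _ y]) (auto simp: gen_def subspace_diff[OF V_sub])
  qed
  have n: "nilp ?U ?N D" "nilp ?W ?N' D" by (rule mlog_nilp)+
  note eU = endo_on_funpow[OF nilpD(1)[OF n(1)]] and eW = endo_on_funpow[OF nilpD(1)[OF n(2)]]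
  have zU: "z \<in> ?U"
  proof -
    have "defect l z = 0" using z l by (simp add: defect_def)
    then have "(defect l ^^ D) z = 0"
      unfolding D_def by (simp add: funpow_Suc_right endo_on_0[OF endo_on_funpow[OF defect_endo]] del: funpow.simps)
    then show ?thesis using z by (simp add: gen_def)
  qed
  define P where "P = (\<lambda>n. \<forall>x\<in>?U. (?N ^^ n) x = 0)"
  have "P D" using nilpD(2)[OF n(1)] by (simp add: P_def)
  then obtain m where m: "P m" "\<And>k. k < m \<Longrightarrow> \<not> P k"
    using exists_least_iff[of P] by blast
  have m1: "m \<ge> 1"
    using m(1) zU z(2) by (cases m) (auto simp: P_def)
  then obtain a where a: "a \<in> ?U" "(?N ^^ (m - 1)) a \<noteq> 0"
    using m(2)[of "m - 1"] by (auto simp: P_def)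
  note adj = mlog_pow_adjoint[OF l]
  have aV: "(?N ^^ (m - 1)) a \<in> V" using endo_onD(2)[OF eU a(1)] gen_sub_V by blast
  then obtain y where y: "y \<in> V" "S ((?N ^^ (m - 1)) a) y \<noteq> 0"
    using nondeg_left[OF aV] a(2) by blast
  obtain b w where b: "b \<in> ?W" "w \<in> V" "y = b + (defect (inverse l) ^^ D) w"
    using split[OF y(1)] by blast
  have "S ((?N ^^ (m - 1)) a) ((defect (inverse l) ^^ D) w) = 0"
    by (rule defect_image_orthogonal(1)[OF l endo_onD(2)[OF eU a(1)] b(2)])
  then have "S ((?N ^^ (m - 1)) a) b \<noteq> 0"
    using y(2) b aV gen_sub_V endo_onD(2)[OF endo_on_funpow[OF defect_endo] b(2)]
    by (auto simp: S_add_right subset_iff)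
  then have ab: "S a ((?N' ^^ (m - 1)) b) \<noteq> 0" using adj[OF a(1) b(1)] by simp
  show thesis
  proof (rule that[OF m1 a(1) b(1) _ _ ab])
    show "(?N ^^ m) x = 0" if "x \<in> ?U" for x using m(1) that by (simp add: P_def)
    show "(?N' ^^ m) y = 0" if y: "y \<in> ?W" for y
    proof (rule nondeg_right)
      show V': "(?N' ^^ m) y \<in> V" using endo_onD(2)[OF eW y] gen_sub_V by blast
      fix x assume x: "x \<in> V"
      obtain u v where u: "u \<in> ?U" "v \<in> V" "x = u + (defect l ^^ D) v"
        using split[OF x] by blast
      have "S ((defect l ^^ D) v) ((?N' ^^ m) y) = 0"
        using defect_image_orthogonal(2)[OF l', of "(?N' ^^ m) y" D v] endo_onD(2)[OF eW y] u(2) by simp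
      moreover have "(-1) ^ m * S u ((?N' ^^ m) y) = 0"
        using adj[OF u(1) y, of m] m(1) u(1) gen_sub_V y by (auto simp: P_def subset_iff)
      ultimately show "S x ((?N' ^^ m) y) = 0"
        using u V' endo_onD(2)[OF endo_on_funpow[OF defect_endo] u(2)] gen_sub_V
        by (auto simp: S_add_left subset_iff)
    qed
  qed
qed

end

section \<open>Eigenvectors of complex maps\<close>

context char0_space
begin

definition poly_app :: "'k poly \<Rightarrow> ('v \<Rightarrow> 'v) \<Rightarrow> 'v \<Rightarrow> 'v" where
  "poly_app p A x = (\<Sum>i\<le>degree p. scale (coeff p i) ((A ^^ i) x))"

lemma poly_app_eq:
  assumes "degree p \<le> n"
  shows "poly_app p A x = (\<Sum>i\<le>n. scale (coeff p i) ((A ^^ i) x))"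
  unfolding poly_app_def using assms
  by (intro sum.mono_neutral_left) (auto intro: coeff_eq_0)

lemma poly_app_linear_factor:
  assumes A: "endo_on V A" and x: "x \<in> V"
  shows "poly_app ([:-c, 1:] * q) A x = A (poly_app q A x) - scale c (poly_app q A x)"
    and "poly_app q A x \<in> V"
proof -
  have in_V: "(A ^^ i) x \<in> V" for i using endo_onD(2)[OF endo_on_funpow[OF A] x] .
  note s = endo_onD(1)[OF A]
  show "poly_app q A x \<in> V"
    unfolding poly_app_def by (intro subspace_sum s subspace_scale in_V)
  define n where "n = degree q"
  have c: "coeff ([:-c, 1:] * q) i = (if i = 0 then 0 else coeff q (i - 1)) - c * coeff q i" for i
    by (simp add: coeff_pCons split: nat.splits)
  have "degree ([:-c, 1:] * q) \<le> Suc n"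
    using degree_mult_le[of "[:-c, 1:]" q] by (simp add: n_def)
  then have "poly_app ([:-c, 1:] * q) A x
      = (\<Sum>i\<le>Suc n. scale (coeff ([:-c, 1:] * q) i) ((A ^^ i) x))"
    by (rule poly_app_eq)
  also have "\<dots> = (\<Sum>i\<le>Suc n. scale (if i = 0 then 0 else coeff q (i - 1)) ((A ^^ i) x))
      - (\<Sum>i\<le>Suc n. scale (c * coeff q i) ((A ^^ i) x))"
    unfolding c by (simp only: scale_left_diff_distrib sum_subtractf)
  also have "(\<Sum>i\<le>Suc n. scale (if i = 0 then 0 else coeff q (i - 1)) ((A ^^ i) x))
      = A (poly_app q A x)"
    by (subst sum.atMost_Suc_shift)
      (simp add: poly_app_def n_def endo_on_sum[OF A] subspace_scale[OF s] in_V endo_onD(4)[OF A])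
  also have "(\<Sum>i\<le>Suc n. scale (c * coeff q i) ((A ^^ i) x)) = scale c (poly_app q A x)"
    by (simp add: poly_app_eq[of q "Suc n"] n_def scale_sum_right coeff_eq_0 scale_right_distrib)
  finally show "poly_app ([:-c, 1:] * q) A x = A (poly_app q A x) - scale c (poly_app q A x)" .
qed

text \<open>
  The vectors \<open>x, A x, A\<^sup>2 x, \<dots>\<close> lie in a finite dimensional space, so \<open>dim + 1\<close> of them satisfy a linear
  relation. Only one vector has to be annihilated, which avoids characteristic polynomials.
\<close>

lemma annihilating_poly:
  assumes A: "endo_on V A" and x: "x \<in> V" and B: "V \<subseteq> span B" "finite B"
  shows "\<exists>p. p \<noteq> 0 \<and> poly_app p A x = 0"
proof -
  define n where "n = card B"
  define f where "f = (\<lambda>i. (A ^^ i) x)"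
  have f_V: "f i \<in> V" for i unfolding f_def using endo_onD(2)[OF endo_on_funpow[OF A] x] .
  have "\<exists>c. (\<exists>i\<le>n. c i \<noteq> 0) \<and> (\<Sum>i\<le>n. scale (c i) (f i)) = 0"
  proof (cases "inj_on f {..n}")
    case True
    have "dependent (f ` {..n})"
    proof (rule ccontr)
      assume i: "independent (f ` {..n})"
      have "card (f ` {..n}) \<le> card B"
        using independent_span_bound[OF B(2) i] f_V B(1) by blast
      then show False using card_image[OF True] by (simp add: n_def)
    qed
    then obtain u where u: "\<exists>v\<in>f ` {..n}. u v \<noteq> 0" "(\<Sum>v\<in>f ` {..n}. scale (u v) v) = 0"
      by (auto simp: dependent_finite)
    then show ?thesis
      by (intro exI[of _ "\<lambda>i. u (f i)"]) (auto simp: sum.reindex[OF True])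
  next
    case False
    then obtain i j where ij: "i \<le> n" "j \<le> n" "i \<noteq> j" "f i = f j" by (auto simp: inj_on_def)
    define c where "c = (\<lambda>k. if k = i then 1 else if k = j then -1 else (0::'k))"
    have "(\<Sum>k\<le>n. scale (c k) (f k)) = (\<Sum>k\<in>{i, j}. scale (c k) (f k))"
      using ij by (intro sum.mono_neutral_right) (auto simp: c_def)
    also have "\<dots> = 0" using ij by (simp add: c_def)
    finally show ?thesis using ij by (intro exI[of _ c]) (auto simp: c_def)
  qed
  then obtain c k where c: "k \<le> n" "c k \<noteq> 0" "(\<Sum>i\<le>n. scale (c i) (f i)) = 0" by blast
  define p where "p = (\<Sum>i\<le>n. monom (c i) i)"
  have coeff: "coeff p i = (if i \<le> n then c i else 0)" for i
    by (simp add: p_def coeff_sum)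
  have "degree p \<le> n" by (intro degree_le) (simp add: coeff)
  then have "poly_app p A x = (\<Sum>i\<le>n. scale (c i) (f i))"
    unfolding poly_app_eq[OF \<open>degree p \<le> n\<close>] by (intro sum.cong) (simp_all add: coeff f_def)
  then have "poly_app p A x = 0" using c(3) by simp
  moreover have "p \<noteq> 0" using c(1,2) coeff[of k] by auto
  ultimately show ?thesis by blast
qed

section \<open>Correcting the lower values of a string\<close>

text \<open>
  For a nilpotent \<open>N\<close> and a linear functional \<open>s\<close> with \<open>s (N\<^sup>n\<^sup>-\<^sup>1 b) \<noteq> 0\<close>, the values \<open>s (N\<^sup>k b)\<close> for \<open>k < n - 1\<close> can
  be made zero one after the other from the top: adding a multiple of \<open>N\<^sup>j b\<close> changes the value for
  \<open>k = n - 1 - j\<close> by a multiple of the top value and leaves those for larger \<open>k\<close> alone. The corrected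
  vector stays in the span of the string of \<open>b\<close>, so it inherits isotropy from this span.
\<close>

lemma top_normalise_pair:
  assumes N: "endo_on W N" and n: "n \<ge> 1" and nil: "\<And>y. y \<in> W \<Longrightarrow> (N ^^ n) y = 0"
    and s: "\<And>x y. x \<in> W \<Longrightarrow> y \<in> W \<Longrightarrow> s (x + y) = s x + s y"
      "\<And>c x. x \<in> W \<Longrightarrow> s (scale c x) = c * s x"
    and b: "b \<in> W" "s ((N ^^ (n - 1)) b) \<noteq> 0" and c: "c \<noteq> (0::'k)"
  shows "\<exists>b'\<in>W \<inter> span (range (\<lambda>k. (N ^^ k) b)). \<forall>k<n. s ((N ^^ k) b') = (if k = n - 1 then c else 0)"
proof -
  let ?Z = "W \<inter> span (range (\<lambda>k. (N ^^ k) b))"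
  note e = endo_on_funpow[OF N]
  have s0: "s 0 = 0" using s(2)[OF b(1), of 0] by simp
  have nil': "(N ^^ k) y = 0" if "y \<in> W" "n \<le> k" for y k
    using nilpD(2)[of W N n] N nil that by (auto simp: nilp_def)
  have Z_pow: "(N ^^ j) y \<in> ?Z" if "y \<in> ?Z" for y j
  proof -
    have "y \<in> span (range (\<lambda>k. (N ^^ k) b))" using that by blast
    then have "y \<in> W \<and> (N ^^ j) y \<in> span (range (\<lambda>k. (N ^^ k) b))"
    proof (induction rule: span_induct_alt)
      case base
      then show ?case using endo_on_0[OF e] subspace_0[OF endo_onD(1)[OF N]] by (simp add: span_zero)
    next
      case (step d x y)
      then obtain k where k: "x = (N ^^ k) b" by blast
      have xW: "x \<in> W" using k endo_onD(2)[OF e b(1)] by simp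
      have "(N ^^ j) x = (N ^^ (j + k)) b" by (simp add: k funpow_add)
      then have "(N ^^ j) x \<in> span (range (\<lambda>k. (N ^^ k) b))" by (auto intro: span_base)
      then show ?case
        using step xW endo_onD(1)[OF N]
        by (simp add: endo_onD(3)[OF e] endo_onD(4)[OF e] subspace_scale subspace_add span_add span_scale)
    qed
    then show ?thesis using endo_onD(2)[OF e] by blast
  qed
  have "\<exists>b'\<in>?Z. \<forall>k<n. n - 1 - j \<le> k \<longrightarrow> s ((N ^^ k) b') = (if k = n - 1 then c else 0)" if "j < n" for j
    using that
  proof (induction j)
    case 0
    define t where "t = s ((N ^^ (n - 1)) b)"
    have "b \<in> range (\<lambda>k. (N ^^ k) b)" by (rule range_eqI[of _ _ 0]) simp
    then have "b \<in> ?Z" using b(1) by (simp add: span_base)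
    then have "scale (c / t) b \<in> ?Z" using endo_onD(1)[OF N] by (auto simp: subspace_scale span_scale)
    moreover have "s ((N ^^ (n - 1)) (scale (c / t) b)) = c"
      using b endo_onD(2)[OF e b(1)] by (simp add: endo_onD(4)[OF e] s(2) t_def)
    moreover have "k = n - 1" if "k < n" "n - 1 - 0 \<le> k" for k using that by simp
    ultimately show ?case by (metis (no_types, lifting))
  next
    case (Suc j)
    then obtain b1 where b1: "b1 \<in> ?Z" "\<And>k. k < n \<Longrightarrow> n - 1 - j \<le> k \<Longrightarrow> s ((N ^^ k) b1) = (if k = n - 1 then c else 0)"
      by auto
    define u where "u = s ((N ^^ (n - 1 - Suc j)) b1)"
    \<comment> \<open>the multiple that cancels the value \<open>u\<close> in position \<open>n - 1 - Suc j\<close> against the top value \<open>c\<close>\<close>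
    define b2 where "b2 = b1 + scale (- u / c) ((N ^^ Suc j) b1)"
    have in_Z: "(N ^^ Suc j) b1 \<in> ?Z" by (rule Z_pow[OF b1(1)])
    then have b2: "b2 \<in> ?Z"
      using b1(1) endo_onD(1)[OF N] by (auto simp: b2_def subspace_diff subspace_scale span_diff span_scale)
    have val: "s ((N ^^ k) b2) = s ((N ^^ k) b1) + (- u / c) * s ((N ^^ (k + Suc j)) b1)" for k
    proof -
      have W: "b1 \<in> W" "(N ^^ Suc j) b1 \<in> W" using b1(1) in_Z by auto
      have p: "(N ^^ k) ((N ^^ Suc j) b1) = (N ^^ (k + Suc j)) b1"
        by (simp only: funpow_add o_apply)
      have "(N ^^ k) b2 = (N ^^ k) b1 + scale (- u / c) ((N ^^ (k + Suc j)) b1)"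
        using W subspace_scale[OF endo_onD(1)[OF N]]
        by (simp only: b2_def endo_onD(3)[OF e] endo_onD(4)[OF e] p)
      then show ?thesis
        using endo_onD(2)[OF e W(1)] subspace_scale[OF endo_onD(1)[OF N]]
        by (simp only: s)
    qed
    have "s ((N ^^ k) b2) = (if k = n - 1 then c else 0)" if k: "k < n" "n - 1 - Suc j \<le> k" for k
    proof (cases "k = n - 1 - Suc j")
      case True
      then have kj: "k + Suc j = n - 1" "k \<noteq> n - 1" using Suc.prems by auto
      have top: "s ((N ^^ (n - 1)) b1) = c" using b1(2)[of "n - 1"] n by simp
      have "s ((N ^^ k) b2) = u + (- u / c) * c" using val[of k] unfolding kj(1) top by (simp add: u_def True)
      then show ?thesis using c kj(2) by simp
    next
      case False
      then have "n - 1 - j \<le> k" "n \<le> k + Suc j" using k Suc.prems by auto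
      then show ?thesis using val[of k] b1 k nil'[of b1 "k + Suc j"] s0 by simp
    qed
    then show ?case using b2 by blast
  qed
  from this[of "n - 1"] show ?thesis using n by auto
qed

lemma skew_funpow:
  fixes h :: "'v \<Rightarrow> 'v \<Rightarrow> 'k"
  assumes N: "endo_on W N" and skew: "\<And>x y. x \<in> W \<Longrightarrow> y \<in> W \<Longrightarrow> h (N x) y = - h x (N y)"
    and xy: "x \<in> W" "y \<in> W"
  shows "h ((N ^^ k) x) y = (-1) ^ k * h x ((N ^^ k) y)"
  using xy(1)
proof (induction k arbitrary: x)
  case (Suc k)
  then have "h ((N ^^ Suc k) x) y = h ((N ^^ k) (N x)) y" by (simp add: funpow_Suc_right del: funpow.simps)
  also have "\<dots> = (-1) ^ Suc k * h x ((N ^^ Suc k) y)"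
    using Suc endo_onD(2)[OF N] endo_onD(2)[OF endo_on_funpow[OF N] xy(2)] by (simp add: skew)
  finally show ?case .
qed simp

text \<open>
  The analogue of \<open>top_normalise_pair\<close> for a vector paired with itself, where \<open>h\<close> is sesquilinear for an
  automorphism \<open>\<kappa>\<close> of the field (the conjugation or the identity). The correction now enters in both
  arguments. By the symmetry \<open>herm\<close> the two contributions agree, hence the factor 2 in the denominator
  below.
\<close>

lemma top_normalise_self:
  assumes N: "endo_on W N" and n: "n \<ge> 1" and nil: "\<And>y. y \<in> W \<Longrightarrow> (N ^^ n) y = 0"
    and h: "\<And>x y z. x \<in> W \<Longrightarrow> y \<in> W \<Longrightarrow> z \<in> W \<Longrightarrow> h (x + y) z = h x z + h y z"
      "\<And>x y z. x \<in> W \<Longrightarrow> y \<in> W \<Longrightarrow> z \<in> W \<Longrightarrow> h z (x + y) = h z x + h z y"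
      "\<And>c x z. x \<in> W \<Longrightarrow> z \<in> W \<Longrightarrow> h (scale c x) z = c * h x z"
      "\<And>c x z. x \<in> W \<Longrightarrow> z \<in> W \<Longrightarrow> h z (scale c x) = \<kappa> c * h z x"
      "\<And>x y. x \<in> W \<Longrightarrow> y \<in> W \<Longrightarrow> h (N x) y = - h x (N y)"
    and \<kappa>: "\<And>x y. \<kappa> (x * y) = \<kappa> x * \<kappa> y" "\<And>x y. \<kappa> (x + y) = \<kappa> x + \<kappa> y" "\<kappa> 1 = (1::'k)"
    and herm: "\<And>k x. x \<in> W \<Longrightarrow> \<kappa> (h x ((N ^^ k) x)) = \<zeta> * (-1) ^ k * h x ((N ^^ k) x)"
    and \<zeta>: "\<zeta> * \<zeta> = 1"
    and a: "a \<in> W" "h a ((N ^^ (n - 1)) a) = t" "t \<noteq> 0"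
  shows "\<exists>a'\<in>W. \<forall>k<n. h a' ((N ^^ k) a') = (if k = n - 1 then t else 0)"
proof -
  note e = endo_on_funpow[OF N]
  have \<kappa>0: "\<kappa> 0 = 0" using \<kappa>(2)[of 0 0] by simp
  have \<kappa>m: "\<kappa> (- x) = - \<kappa> x" for x using \<kappa>(2)[of x "- x"] \<kappa>0 by (simp add: eq_neg_iff_add_eq_0 add.commute)
  have \<kappa>i: "\<kappa> (x / y) = \<kappa> x / \<kappa> y" if "y \<noteq> 0" for x y
    using \<kappa>(1)[of "x / y" y] \<kappa>(1)[of y "1 / y"] \<kappa>(3) that by (auto simp: eq_divide_eq)
  have \<kappa>2: "\<kappa> 2 = 2" using \<kappa>(2)[of 1 1] \<kappa>(3) by simp
  have \<kappa>s: "\<kappa> ((-1) ^ k) = (-1) ^ k" for k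
    by (induction k) (simp_all add: \<kappa> \<kappa>m)
  have h0: "h x 0 = 0" if "x \<in> W" for x using h(4)[OF that that, of 0] \<kappa>0 by simp
  have nil': "(N ^^ k) y = 0" if "y \<in> W" "n \<le> k" for y k
    using nilpD(2)[of W N n] N nil that by (auto simp: nilp_def)
  have adj: "h ((N ^^ k) x) y = (-1) ^ k * h x ((N ^^ k) y)" if "x \<in> W" "y \<in> W" for x y k
    by (rule skew_funpow[where h = h, OF N h(5) that])
  have "\<exists>a'\<in>W. \<forall>k<n. n - 1 - j \<le> k \<longrightarrow> h a' ((N ^^ k) a') = (if k = n - 1 then t else 0)" if "j < n" for j
    using that
  proof (induction j)
    case 0
    then show ?case using a by (intro bexI[of _ a]) auto
  next
    case (Suc j)
    then obtain a1 where a1: "a1 \<in> W"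
      "\<And>k. k < n \<Longrightarrow> n - 1 - j \<le> k \<Longrightarrow> h a1 ((N ^^ k) a1) = (if k = n - 1 then t else 0)"
      by auto
    define J where "J = Suc j"
    define u where "u = h a1 ((N ^^ (n - 1 - J)) a1)"
    \<comment> \<open>\<open>a1 + c N\<^sup>J a1\<close> has value \<open>u + (\<kappa> c + (-1)\<^sup>J c) t\<close> in position \<open>n - 1 - J\<close>\<close>
    define c where "c = - ((-1) ^ J * u / (2 * t))"
    define a2 where "a2 = a1 + scale c ((N ^^ J) a1)"
    have W: "(N ^^ k) a1 \<in> W" "scale d ((N ^^ k) a1) \<in> W" for k d
      using endo_onD(2)[OF e a1(1)] subspace_scale[OF endo_onD(1)[OF N]] by auto
    have a2: "a2 \<in> W" using a1(1) W subspace_add[OF endo_onD(1)[OF N]] by (simp add: a2_def)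
    have pow: "(N ^^ k) a2 = (N ^^ k) a1 + scale c ((N ^^ (k + J)) a1)" for k
      unfolding a2_def using W a1(1) by (simp add: endo_onD(3)[OF e] endo_onD(4)[OF e] funpow_add)
    have shift: "h ((N ^^ J) a1) ((N ^^ k) a1) = (-1) ^ J * h a1 ((N ^^ (k + J)) a1)" for k
      using adj[OF a1(1) W(1)] by (simp add: funpow_add[symmetric] add.commute flip: o_apply[of "N ^^ _" "N ^^ _"])
    have val: "h a2 ((N ^^ k) a2) = h a1 ((N ^^ k) a1) + (\<kappa> c + c * (-1) ^ J) * h a1 ((N ^^ (k + J)) a1)
        + c * \<kappa> c * (-1) ^ J * h a1 ((N ^^ (k + J + J)) a1)" for k
      unfolding pow unfolding a2_def using W a1(1) subspace_add[OF endo_onD(1)[OF N]]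
      by (simp add: h(1-4) shift) (simp add: algebra_simps)
    have "h a2 ((N ^^ k) a2) = (if k = n - 1 then t else 0)" if k: "k < n" "n - 1 - J \<le> k" for k
    proof (cases "k = n - 1 - J")
      case True
      then have kJ: "k + J = n - 1" "k \<noteq> n - 1" "n \<le> k + J + J" using Suc.prems by (auto simp: J_def)
      have top: "h a1 ((N ^^ (n - 1)) a1) = t" using a1(2)[of "n - 1"] n by simp
      have \<kappa>t: "\<kappa> t = \<zeta> * (-1) ^ (n - 1) * t" using herm[OF a1(1), of "n - 1"] top by simp
      have \<kappa>u: "\<kappa> u = \<zeta> * (-1) ^ k * u" using herm[OF a1(1), of k] True by (simp add: u_def)
      have nz: "\<zeta> \<noteq> 0" using \<zeta> by auto
      have sgn: "(-1::'k) ^ (n - 1) = (-1) ^ k * (-1) ^ J" using kJ(1) by (metis power_add)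
      have "\<kappa> c = - ((-1) ^ J * (\<zeta> * (-1) ^ k * u) / (2 * (\<zeta> * (-1) ^ (n - 1) * t)))"
        using a(3) by (simp add: c_def \<kappa>m \<kappa>i \<kappa> \<kappa>s \<kappa>u \<kappa>t \<kappa>2)
      also have "\<dots> = - (u / (2 * t))"
        unfolding sgn using nz a(3) by (simp add: field_simps)
      finally have "\<kappa> c + c * (-1) ^ J = - (u / t)"
        using a(3) by (simp add: c_def field_simps flip: power_mult_distrib)
      then show ?thesis
        using val[of k] kJ top a(3) nil'[OF a1(1) kJ(3)] h0[OF a1(1)] True by (simp add: u_def)
    next
      case False
      then have *: "n - 1 - j \<le> k" "n \<le> k + J" "n \<le> k + J + J" using k Suc.prems by (auto simp: J_def)
      then show ?thesis
        using val[of k] a1(2)[OF k(1) *(1)] nil'[OF a1(1) *(2)] nil'[OF a1(1) *(3)] h0[OF a1(1)] by simp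
    qed
    then show ?case using a2 unfolding J_def by blast
  qed
  from this[of "n - 1"] show ?thesis using n by auto
qed

text \<open>
  With the symmetry \<open>(-1)\<^sup>n\<close> the top form \<open>h(x, N\<^sup>n\<^sup>-\<^sup>1 y)\<close> is alternating. In the positions \<open>k\<close> with
  \<open>n + k\<close> odd all diagonal values vanish for this reason. In the others they are removed from the top
  downwards by adding multiples of \<open>N\<^sup>J b\<close> to \<open>a\<close>; this does not touch the top pairing with \<open>b\<close>, because
  it only adds values \<open>h(b, N\<^sup>k b)\<close> with \<open>k \<ge> n\<close>, which vanish.
\<close>

lemma top_isotropic:
  assumes N: "endo_on W N" and n: "n \<ge> 1" and nil: "\<And>y. y \<in> W \<Longrightarrow> (N ^^ n) y = 0"
    and h: "\<And>x y z. x \<in> W \<Longrightarrow> y \<in> W \<Longrightarrow> z \<in> W \<Longrightarrow> h (x + y) z = h x z + h y z"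
      "\<And>x y z. x \<in> W \<Longrightarrow> y \<in> W \<Longrightarrow> z \<in> W \<Longrightarrow> h z (x + y) = h z x + h z y"
      "\<And>c x z. x \<in> W \<Longrightarrow> z \<in> W \<Longrightarrow> h (scale c x) z = c * h x z"
      "\<And>c x z. x \<in> W \<Longrightarrow> z \<in> W \<Longrightarrow> h z (scale c x) = c * h z x"
      "\<And>x y. x \<in> W \<Longrightarrow> y \<in> W \<Longrightarrow> h (N x) y = - h x (N y)"
    and sym: "\<And>x y. x \<in> W \<Longrightarrow> y \<in> W \<Longrightarrow> h y x = (-1) ^ n * h x y"
    and a: "a \<in> W" "b \<in> W" "h a ((N ^^ (n - 1)) b) \<noteq> (0::'k)"
  shows "\<exists>a'\<in>W. h a' ((N ^^ (n - 1)) b) \<noteq> 0 \<and> (\<forall>k. h a' ((N ^^ k) a') = 0)"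
proof -
  define t where "t = h a ((N ^^ (n - 1)) b)"
  note e = endo_on_funpow[OF N]
  have h0: "h x 0 = 0" if "x \<in> W" for x using h(4)[OF that that, of 0] by simp
  have nil': "(N ^^ k) y = 0" if "y \<in> W" "n \<le> k" for y k
    using nilpD(2)[of W N n] N nil that by (auto simp: nilp_def)
  have adj: "h ((N ^^ k) x) y = (-1) ^ k * h x ((N ^^ k) y)" if "x \<in> W" "y \<in> W" for x y k
    by (rule skew_funpow[where h = h, OF N h(5) that])
  have skew: "h y ((N ^^ k) x) = (-1) ^ (n + k) * h x ((N ^^ k) y)" if "x \<in> W" "y \<in> W" for x y k
    using sym[OF endo_onD(2)[OF e that(1)] that(2), of k] adj[OF that, of k]
    by (simp add: power_add)
  have diag: "h x ((N ^^ k) x) = 0" if "x \<in> W" "odd (n + k)" for x k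
    using skew[OF that(1,1), of k] that(2) by simp
  have "\<exists>a'\<in>W. h a' ((N ^^ (n - 1)) b) = t \<and> (\<forall>k<n. n - 1 - j \<le> k \<longrightarrow> h a' ((N ^^ k) a') = 0)"
    if "j < n" for j
    using that
  proof (induction j)
    case 0
    have "k = n - 1" if "k < n" "n - 1 - 0 \<le> k" for k using that by simp
    then show ?case using a diag[OF a(1), of "n - 1"] n by (intro bexI[of _ a]) (auto simp: t_def)
  next
    case (Suc j)
    then obtain a1 where a1: "a1 \<in> W" "h a1 ((N ^^ (n - 1)) b) = t"
      "\<And>k. k < n \<Longrightarrow> n - 1 - j \<le> k \<Longrightarrow> h a1 ((N ^^ k) a1) = 0"
      by auto
    define J where "J = Suc j"
    define u where "u = h a1 ((N ^^ (n - 1 - J)) a1)"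
    \<comment> \<open>for odd \<open>J\<close> both mixed terms contribute \<open>c t\<close>\<close>
    define c where "c = - (u / (2 * t))"
    define a2 where "a2 = a1 + scale c ((N ^^ J) b)"
    have W: "(N ^^ k) a1 \<in> W" "(N ^^ k) b \<in> W" "scale d ((N ^^ k) b) \<in> W" for k d
      using endo_onD(2)[OF e a1(1)] endo_onD(2)[OF e a(2)] subspace_scale[OF endo_onD(1)[OF N]] by auto
    have a2: "a2 \<in> W" using a1(1) W subspace_add[OF endo_onD(1)[OF N]] by (simp add: a2_def)
    have pow: "(N ^^ k) a2 = (N ^^ k) a1 + scale c ((N ^^ (k + J)) b)" for k
      unfolding a2_def using W a1(1) by (simp add: endo_onD(3)[OF e] endo_onD(4)[OF e] funpow_add)
    have comp: "(N ^^ J) ((N ^^ k) y) = (N ^^ (k + J)) y" for k y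
      by (metis add.commute comp_apply funpow_add)
    have val: "h a2 ((N ^^ k) a2) = h a1 ((N ^^ k) a1) + c * h a1 ((N ^^ (k + J)) b)
        + c * (-1) ^ J * h b ((N ^^ (k + J)) a1) + c * c * (-1) ^ J * h b ((N ^^ (k + J + J)) b)" for k
      unfolding pow unfolding a2_def using W a1(1) a(2) subspace_add[OF endo_onD(1)[OF N]]
      by (simp add: h(1-4) adj comp) (simp add: algebra_simps)
    have "h a2 ((N ^^ (n - 1)) b) = h a1 ((N ^^ (n - 1)) b) + c * ((-1) ^ J * h b ((N ^^ (n - 1 + J)) b))"
      unfolding a2_def using W a1(1) a(2) by (simp add: h(1,3) adj comp)
    then have t2: "h a2 ((N ^^ (n - 1)) b) = t"
      using nil'[OF a(2), of "n - 1 + J"] h0[OF a(2)] a1(2) by (simp add: J_def)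
    have "h a2 ((N ^^ k) a2) = 0" if k: "k < n" "n - 1 - J \<le> k" for k
    proof (cases "k = n - 1 - J")
      case True
      then have kJ: "k + J = n - 1" "n \<le> k + J + J" using Suc.prems by (auto simp: J_def)
      show ?thesis
      proof (cases "odd (n + k)")
        case True
        then show ?thesis by (rule diag[OF a2])
      next
        case False
        then have "odd J" using kJ n by presburger
        moreover have "h b ((N ^^ (n - 1)) a1) = - t"
          using skew[OF a1(1) a(2), of "n - 1"] a1(2) n by simp
        moreover have "t \<noteq> 0" using a(3) by (simp add: t_def)
        ultimately show ?thesis
          using val[of k] nil'[OF a(2) kJ(2)] h0[OF a(2)] kJ(1) a1(2) True by (simp add: c_def u_def)
      qed
    next
      case False
      then have *: "n - 1 - j \<le> k" "n \<le> k + J" "n \<le> k + J + J" using k Suc.prems by (auto simp: J_def)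
      then show ?thesis
        using val[of k] a1(3)[OF k(1) *(1)] nil'[OF a1(1) *(2)] nil'[OF a(2) *(2)] nil'[OF a(2) *(3)]
          h0[OF a1(1)] h0[OF a(2)] by simp
    qed
    then show ?case using a2 t2 unfolding J_def by blast
  qed
  from this[of "n - 1"] n obtain a' where "a' \<in> W" "h a' ((N ^^ (n - 1)) b) = t" "\<And>k. k < n \<Longrightarrow> h a' ((N ^^ k) a') = 0"
    by auto
  moreover from this(1) have "h a' ((N ^^ k) a') = 0" if "k \<ge> n" for k using nil'[OF _ that] h0 by simp
  ultimately show ?thesis using a(3) unfolding t_def by (metis not_le)
qed

end

text \<open>
  Take a nonzero polynomial \<open>p\<close> with \<open>p(A) x = 0\<close> and split off a root \<open>c\<close>. Either the remaining factor already
  annihilates \<open>x\<close>, and its degree is smaller, or it maps \<open>x\<close> to an eigenvector for \<open>c\<close>.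
\<close>

lemma complex_eigenvector:
  fixes V :: "('a::real_vector \<times> 'a) set"
  assumes A: "cplx0.endo_on V A" and B: "V \<subseteq> cplx.span B" "finite B" and x: "x \<in> V" "x \<noteq> 0"
  obtains c z where "z \<in> V" "z \<noteq> 0" "A z = cscale c z"
proof -
  obtain p where "p \<noteq> 0" "cplx0.poly_app p A x = 0"
    using cplx0.annihilating_poly[OF A x(1) B] by blast
  then have "\<exists>c z. z \<in> V \<and> z \<noteq> 0 \<and> A z = cscale c z"
  proof (induction "degree p" arbitrary: p rule: less_induct)
    case less
    show ?case
    proof (cases "degree p = 0")
      case True
      then obtain a where p: "p = [:a:]" by (rule degree_eq_zeroE)
      then have "cscale a x = 0" using less.prems by (simp add: cplx0.poly_app_def)
      then show ?thesis using less.prems p x by (simp add: cplx.scale_eq_0_iff)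
    next
      case False
      then have "\<not> constant (poly p)" by (simp add: constant_degree)
      then obtain c where "poly p c = 0" using fundamental_theorem_of_algebra by blast
      then obtain q where q: "p = [:-c, 1:] * q" by (metis dvdE poly_eq_0_iff_dvd)
      have q0: "q \<noteq> 0" using less.prems q by auto
      have qV: "cplx0.poly_app q A x \<in> V" by (rule cplx0.poly_app_linear_factor(2)[OF A x(1)])
      have eq: "A (cplx0.poly_app q A x) = cscale c (cplx0.poly_app q A x)"
        using less.prems cplx0.poly_app_linear_factor(1)[OF A x(1), of c q] by (simp add: q del: mult_pCons_left)
      show ?thesis
      proof (cases "cplx0.poly_app q A x = 0")
        case True
        have "degree q < degree p" using q0 by (simp add: q degree_mult_eq del: mult_pCons_left)
        from less.hyps[OF this q0 True] show ?thesis .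
      next
        case False
        then show ?thesis using qV eq by blast
      qed
    qed
  qed
  then show thesis using that by blast
qed

section \<open>Dual strings in generalized eigenspaces\<close>

context iso_space
begin

lemma string_exp_chain:
  assumes l: "l \<noteq> 0" and a: "a \<in> gen l D" and nil: "(mlog l ^^ n) a = 0"
  shows "exp_chain n l M (\<lambda>k. (mlog l ^^ (k - 1)) a)" and "(mlog l ^^ k) a \<in> gen l D"
proof -
  show in_gen: "(mlog l ^^ k) a \<in> gen l D" for k
    by (rule endo_onD(2)[OF endo_on_funpow[OF nilpD(1)[OF mlog_nilp]] a])
  show "exp_chain n l M (\<lambda>k. (mlog l ^^ (k - 1)) a)"
    unfolding exp_chain_def
  proof
    fix k assume k: "k \<in> {1..n}"
    have step: "mlog l ((mlog l ^^ (i - 1)) a) = (mlog l ^^ (i + 1 - 1)) a" if "i \<ge> 1" for i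
      using that by (cases i) auto
    have last: "mlog l ((mlog l ^^ (n - 1)) a) = 0"
      using step[of n] nil k by simp
    have "op_exp (mlog l) ((mlog l ^^ (k - 1)) a)
        = (\<Sum>j=0..n-k. scale (1 / fact j) ((mlog l ^^ (k + j - 1)) a))"
      by (rule op_exp_jordan[OF mlog_nilp[of l D] in_gen step last k]) simp
    then show "M ((mlog l ^^ (k - 1)) a)
        = scale l (\<Sum>j=0..n-k. scale (1 / fact j) ((mlog l ^^ (k + j - 1)) a))"
      using M_eq_exp[OF in_gen l] by simp
  qed
qed

text \<open>
  As \<open>N\<close> is skew, \<open>S(N\<^sup>j x, N\<^sup>k y) = (-1)\<^sup>j S(x, N\<^sup>j\<^sup>+\<^sup>k y)\<close>: the Gram matrix of two strings is determined by
  the values \<open>S(x, N\<^sup>k y)\<close>, and only a single one of them is nonzero. The result is a multiple of \<open>E_per\<close>.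
\<close>

lemma string_gram:
  assumes l: "l \<noteq> 0" and x: "x \<in> gen l D" and y: "y \<in> gen (inverse l) D"
    and top: "\<And>k. k < n \<Longrightarrow> S x ((mlog (inverse l) ^^ k) y) = (if k = n - 1 then c else 0)"
    and nil: "(mlog (inverse l) ^^ n) y = 0"
  shows "gram_eq n S (\<lambda>k. (mlog l ^^ (k - 1)) x) (\<lambda>k. (mlog (inverse l) ^^ (k - 1)) y) c"
  unfolding gram_eq_def
proof (intro ballI)
  fix j k assume jk: "j \<in> {1..n}" "k \<in> {1..n}"
  let ?N = "mlog l" and ?N' = "mlog (inverse l)"
  have yk: "(?N' ^^ i) y \<in> gen (inverse l) D" for i
    by (rule endo_onD(2)[OF endo_on_funpow[OF nilpD(1)[OF mlog_nilp]] y])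
  have "S ((?N ^^ (j - 1)) x) ((?N' ^^ (k - 1)) y) = (-1) ^ (j - 1) * S x ((?N' ^^ (j - 1 + (k - 1))) y)"
    using mlog_pow_adjoint[OF l x yk] by (simp add: funpow_add)
  moreover have "S x ((?N' ^^ (j - 1 + (k - 1))) y) = (if j = n + 1 - k then c else 0)"
  proof (cases "j - 1 + (k - 1) < n")
    case True
    then show ?thesis using top[OF True] jk by auto
  next
    case False
    then have "(?N' ^^ (j - 1 + (k - 1))) y = (?N' ^^ (j - 1 + (k - 1) - n)) ((?N' ^^ n) y)"
      by (metis comp_apply funpow_add le_add_diff_inverse2 not_less)
    then have "(?N' ^^ (j - 1 + (k - 1))) y = 0"
      by (simp add: nil endo_on_0[OF endo_on_funpow[OF nilpD(1)[OF mlog_nilp]]])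
    moreover have "x \<in> V" using x gen_sub_V by blast
    ultimately show ?thesis using False jk by auto
  qed
  ultimately show "S ((?N ^^ (j - 1)) x) ((?N' ^^ (k - 1)) y) = c * E_per n j k"
    by (simp add: E_per_def)
qed

text \<open>
  Used when \<open>1/l\<close> is an eigenvalue different from \<open>l\<close> and from \<open>cnj l\<close>, so that nothing ties the two
  strings together and the constant can be normalised to 1.
\<close>

lemma hyperbolic_strings:
  assumes l: "l \<noteq> 0" and z: "z \<in> V" "z \<noteq> 0" "M z = scale l z"
  obtains n D A B where "n \<ge> 1" "\<And>k. A k \<in> gen l D" "\<And>k. B k \<in> gen (inverse l) D"
    "exp_chain n l M A" "exp_chain n (inverse l) M B" "gram_eq n S A B 1"
proof -
  obtain n D a b where ab: "n \<ge> 1" "a \<in> gen l D" "b \<in> gen (inverse l) D"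
    "\<And>x. x \<in> gen l D \<Longrightarrow> (mlog l ^^ n) x = 0"
    "\<And>y. y \<in> gen (inverse l) D \<Longrightarrow> (mlog (inverse l) ^^ n) y = 0"
    "S a ((mlog (inverse l) ^^ (n - 1)) b) \<noteq> 0"
    by (rule top_pairing[OF l z]) blast
  have aV: "a \<in> V" using ab(2) gen_sub_V by blast
  have l': "inverse l \<noteq> 0" using l by simp
  obtain b' where b': "b' \<in> gen (inverse l) D"
    "\<And>k. k < n \<Longrightarrow> S a ((mlog (inverse l) ^^ k) b') = (if k = n - 1 then 1 else 0)"
    using top_normalise_pair[where s = "S a" and c = 1, OF nilpD(1)[OF mlog_nilp] ab(1) ab(5) _ _ ab(3) ab(6)]
      S_add_right[OF _ _ aV] S_scale_right[OF _ aV] subsetD[OF gen_sub_V] by fastforce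
  show thesis
    by (rule that[OF ab(1) string_exp_chain(2)[OF l ab(2) ab(4)[OF ab(2)]] string_exp_chain(2)[OF l' b'(1) ab(5)[OF b'(1)]]
        string_exp_chain(1)[OF l ab(2) ab(4)[OF ab(2)]] string_exp_chain(1)[OF l' b'(1) ab(5)[OF b'(1)]]
        string_gram[OF l ab(2) b'(1) b'(2) ab(5)[OF b'(1)]]])
qed

text \<open>
  The last nonzero vector among the powers of \<open>defect l\<close> applied to \<open>x\<close> is an eigenvector.
\<close>

lemma eigenvector_in_gen:
  assumes "x \<in> gen l D" "x \<noteq> 0" "l \<noteq> 0"
  obtains z where "z \<in> V" "z \<noteq> 0" "M z = scale l z"
proof -
  define P where "P = (\<lambda>k. (defect l ^^ k) x = 0)"
  have "P D" using assms by (simp add: P_def gen_def)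
  then obtain m where m: "P m" "\<And>k. k < m \<Longrightarrow> \<not> P k" using exists_least_iff[of P] by blast
  have "m \<noteq> 0"
  proof
    assume "m = 0"
    then show False using m(1) assms(2) by (simp add: P_def)
  qed
  then obtain k where k: "m = Suc k" by (cases m) auto
  define z where "z = (defect l ^^ k) x"
  have zV: "z \<in> V"
    unfolding z_def using endo_onD(2)[OF endo_on_funpow[OF defect_endo]] assms(1) gen_sub_V by blast
  have "z \<noteq> 0" using m(2)[of k] k by (simp add: P_def z_def)
  moreover have "defect l z = 0" using m(1) k by (simp add: P_def z_def)
  then have "scale l (scale (inverse l) (M z)) = scale l z" by (simp add: defect_def)
  then have "M z = scale l z" using assms(3) by simp
  ultimately show thesis using that zV by blast
qed

lemma reciprocal_eigenvalue:
  assumes l: "l \<noteq> 0" and z: "z \<in> V" "z \<noteq> 0" "M z = scale l z"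
  obtains w where "w \<in> V" "w \<noteq> 0" "M w = scale (inverse l) w"
proof -
  obtain n D a b where ab: "n \<ge> 1" "a \<in> gen l D" "b \<in> gen (inverse l) D"
    "\<And>x. x \<in> gen l D \<Longrightarrow> (mlog l ^^ n) x = 0"
    "\<And>y. y \<in> gen (inverse l) D \<Longrightarrow> (mlog (inverse l) ^^ n) y = 0"
    "S a ((mlog (inverse l) ^^ (n - 1)) b) \<noteq> 0"
    by (rule top_pairing[OF l z]) blast
  have "b \<noteq> 0"
  proof
    assume "b = 0"
    moreover have "a \<in> V" using ab(2) gen_sub_V by blast
    ultimately show False
      using ab(6) endo_on_0[OF endo_on_funpow[OF nilpD(1)[OF mlog_nilp]]] by auto
  qed
  with eigenvector_in_gen[OF ab(3)] l that show thesis by (metis inverse_nonzero_iff_nonzero)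
qed

text \<open>
  Used for \<open>\<bar>l\<bar> = 1\<close>. Here \<open>\<theta>\<close> identifies the generalized eigenspace of \<open>l\<close> with that of \<open>1/l\<close>; it is the complex
  conjugation for nonreal \<open>l\<close> and the identity for \<open>l = \<plusminus>1\<close>. The form \<open>S(x, \<theta> y)\<close> is sesquilinear and
  \<open>N\<close> is skew for it, so a vector with nonzero top value can be corrected by \<open>top_normalise_self\<close>.
\<close>

lemma self_dual_string:
  assumes l: "l \<noteq> 0" and n: "n \<ge> 1"
    and nil: "\<And>x. x \<in> gen l D \<Longrightarrow> (mlog l ^^ n) x = 0"
    and \<theta>: "\<And>x. x \<in> gen l D \<Longrightarrow> \<theta> x \<in> gen (inverse l) D"
      "\<And>x y. x \<in> gen l D \<Longrightarrow> y \<in> gen l D \<Longrightarrow> \<theta> (x + y) = \<theta> x + \<theta> y"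
      "\<And>c x. x \<in> gen l D \<Longrightarrow> \<theta> (scale c x) = scale (\<kappa> c) (\<theta> x)"
      "\<And>x. x \<in> gen l D \<Longrightarrow> \<theta> (mlog l x) = mlog (inverse l) (\<theta> x)"
    and \<kappa>: "\<And>x y. \<kappa> (x * y) = \<kappa> x * \<kappa> y" "\<And>x y. \<kappa> (x + y) = \<kappa> x + \<kappa> y" "\<kappa> 1 = 1"
    and herm: "\<And>x y. x \<in> gen l D \<Longrightarrow> y \<in> gen l D \<Longrightarrow> \<kappa> (S x (\<theta> y)) = \<zeta> * S y (\<theta> x)"
    and \<zeta>: "\<zeta> * \<zeta> = 1"
    and a: "a \<in> gen l D" "S a (\<theta> ((mlog l ^^ (n - 1)) a)) = t" "t \<noteq> 0"
  obtains A where "\<And>k. A k \<in> gen l D" "exp_chain n l M A" "gram_eq n S A (\<lambda>k. \<theta> (A k)) t"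
proof -
  let ?W = "gen l D" and ?N = "mlog l"
  have e: "endo_on ?W ?N" using nilpD(1)[OF mlog_nilp] .
  define h where "h = (\<lambda>x y. S x (\<theta> y))"
  have WV: "x \<in> V" "\<theta> x \<in> V" if "x \<in> ?W" for x using that \<theta>(1)[OF that] gen_sub_V by auto
  have pow_W: "(?N ^^ k) x \<in> ?W" if "x \<in> ?W" for x k using endo_onD(2)[OF endo_on_funpow[OF e] that] .
  have \<theta>_pow: "\<theta> ((?N ^^ k) x) = (mlog (inverse l) ^^ k) (\<theta> x)" if "x \<in> ?W" for x k
    by (induction k) (simp_all add: \<theta>(4)[OF pow_W[OF that]])
  have h5: "h (?N x) y = - h x (?N y)" if "x \<in> ?W" "y \<in> ?W" for x y
    using mlog_adjoint[OF l that(1) \<theta>(1)[OF that(2)]] that by (simp add: h_def \<theta>(4))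
  have adj: "h ((?N ^^ k) x) y = (-1) ^ k * h x ((?N ^^ k) y)" if "x \<in> ?W" "y \<in> ?W" for x y k
    using mlog_pow_adjoint[OF l that(1) \<theta>(1)[OF that(2)]] that by (simp add: h_def \<theta>_pow)
  have herm': "\<kappa> (h x ((?N ^^ k) x)) = \<zeta> * (-1) ^ k * h x ((?N ^^ k) x)" if "x \<in> ?W" for x k
    using herm[OF that pow_W[OF that], of k] adj[OF that that, of k] by (simp add: h_def)
  have a': "h a ((?N ^^ (n - 1)) a) = t" using a(2) by (simp add: h_def)
  have "\<exists>a'\<in>?W. \<forall>k<n. h a' ((?N ^^ k) a') = (if k = n - 1 then t else 0)"
    by (rule top_normalise_self[OF e n nil _ _ _ _ h5 \<kappa> herm' \<zeta> a(1) a' a(3)])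
      (simp_all add: h_def \<theta> WV S_add_left S_add_right S_scale_left S_scale_right)
  then obtain a' where b: "a' \<in> ?W" "\<And>k. k < n \<Longrightarrow> h a' ((?N ^^ k) a') = (if k = n - 1 then t else 0)"
    by blast
  have \<theta>0: "\<theta> 0 = 0" using \<theta>(2)[of 0 0] subspace_0[OF endo_onD(1)[OF e]] by simp
  have "gram_eq n S (\<lambda>k. (?N ^^ (k - 1)) a') (\<lambda>k. (mlog (inverse l) ^^ (k - 1)) (\<theta> a')) t"
  proof (rule string_gram[OF l b(1) \<theta>(1)[OF b(1)]])
    show "S a' ((mlog (inverse l) ^^ k) (\<theta> a')) = (if k = n - 1 then t else 0)" if "k < n" for k
      using b(2)[OF that] by (simp add: h_def \<theta>_pow[OF b(1)])
    show "(mlog (inverse l) ^^ n) (\<theta> a') = 0"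
      using nil[OF b(1)] \<theta>0 by (simp flip: \<theta>_pow[OF b(1)])
  qed
  then have "gram_eq n S (\<lambda>k. (?N ^^ (k - 1)) a') (\<lambda>k. \<theta> ((?N ^^ (k - 1)) a')) t"
    by (simp add: \<theta>_pow[OF b(1)])
  then show thesis
    using that[of "\<lambda>k. (?N ^^ (k - 1)) a'"] string_exp_chain[OF l b(1) nil[OF b(1)]] by blast
qed

text \<open>
  Used for \<open>l = \<plusminus>1\<close> when the top form is alternating, so that no single string is dual to itself. Both
  \<open>a\<close> and \<open>b\<close> are made isotropic by \<open>top_isotropic\<close>, one after the other. Normalising the mutual values
  afterwards stays within the span of the string of \<open>b\<close>, which is isotropic.
\<close>

lemma symplectic_strings:
  assumes l: "inverse l = l" "l \<noteq> 0" and n: "n \<ge> 1"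
    and nil: "\<And>x. x \<in> gen l D \<Longrightarrow> (mlog l ^^ n) x = 0"
    and sym: "\<And>x y. x \<in> V \<Longrightarrow> y \<in> V \<Longrightarrow> S y x = (-1) ^ n * S x y"
    and ab: "a \<in> gen l D" "b \<in> gen l D" "S a ((mlog l ^^ (n - 1)) b) \<noteq> 0" and c: "c \<noteq> 0"
  obtains A B where "\<And>k. A k \<in> gen l D" "\<And>k. B k \<in> gen l D" "exp_chain n l M A" "exp_chain n l M B"
    "gram_eq n S A A 0" "gram_eq n S B B 0" "gram_eq n S A B c"
proof -
  let ?W = "gen l D" and ?N = "mlog l"
  have e: "endo_on ?W ?N" using nilpD(1)[OF mlog_nilp] .
  have WV: "x \<in> V" if "x \<in> ?W" for x using that gen_sub_V by auto
  have pow_W: "(?N ^^ k) x \<in> ?W" if "x \<in> ?W" for x k using endo_onD(2)[OF endo_on_funpow[OF e] that] .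
  have S5: "S (?N x) y = - S x (?N y)" if "x \<in> ?W" "y \<in> ?W" for x y
    using mlog_adjoint[OF l(2) that(1)] that l(1) by simp
  have adj: "S ((?N ^^ k) x) y = (-1) ^ k * S x ((?N ^^ k) y)" if "x \<in> ?W" "y \<in> ?W" for x y k
    using mlog_pow_adjoint[OF l(2) that(1)] that l(1) by simp
  have iso: "\<exists>a'\<in>?W. S a' ((?N ^^ (n - 1)) b) \<noteq> 0 \<and> (\<forall>k. S a' ((?N ^^ k) a') = 0)"
    if "a \<in> ?W" "b \<in> ?W" "S a ((?N ^^ (n - 1)) b) \<noteq> 0" for a b
    by (rule top_isotropic[OF e n nil _ _ _ _ S5 sym[OF WV WV] that])
      (simp_all add: WV S_add_left S_add_right S_scale_left S_scale_right)
  obtain a1 where a1: "a1 \<in> ?W" "S a1 ((?N ^^ (n - 1)) b) \<noteq> 0" "\<And>k. S a1 ((?N ^^ k) a1) = 0"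
    using iso[OF ab] by blast
  have "S b ((?N ^^ (n - 1)) a1) \<noteq> 0"
    using a1(2) adj[OF ab(2) a1(1), of "n - 1"] sym[of a1 "(?N ^^ (n - 1)) b"] sym[of "(?N ^^ (n - 1)) b" a1]
      WV[OF pow_W[OF ab(2)]] WV[OF a1(1)] by auto
  then obtain b1 where b1: "b1 \<in> ?W" "S b1 ((?N ^^ (n - 1)) a1) \<noteq> 0" "\<And>k. S b1 ((?N ^^ k) b1) = 0"
    using iso[OF ab(2) a1(1)] by blast
  have "S a1 ((?N ^^ (n - 1)) b1) \<noteq> 0"
    using b1(2) adj[OF a1(1) b1(1), of "n - 1"] sym[of b1 "(?N ^^ (n - 1)) a1"] sym[of "(?N ^^ (n - 1)) a1" b1]
      WV[OF pow_W[OF a1(1)]] WV[OF b1(1)] by auto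
  moreover have "\<And>x y. x \<in> ?W \<Longrightarrow> y \<in> ?W \<Longrightarrow> S a1 (x + y) = S a1 x + S a1 y"
    "\<And>c x. x \<in> ?W \<Longrightarrow> S a1 (scale c x) = c * S a1 x"
    using WV[OF a1(1)] WV by (simp_all add: S_add_right S_scale_right)
  ultimately obtain b2 where b2: "b2 \<in> ?W" "b2 \<in> span (range (\<lambda>k. (?N ^^ k) b1))"
    "\<And>k. k < n \<Longrightarrow> S a1 ((?N ^^ k) b2) = (if k = n - 1 then c else 0)"
    using top_normalise_pair[OF e n nil, of "S a1" b1 c] b1(1) c by blast
  have sub_b1: "x \<in> ?W" if "x \<in> span (range (\<lambda>k. (?N ^^ k) b1))" for x
    using span_minimal[OF _ endo_onD(1)[OF e], of "range (\<lambda>k. (?N ^^ k) b1)"] pow_W[OF b1(1)] that by blast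
  have iso1: "S ((?N ^^ i) b1) ((?N ^^ j) b1) = 0" for i j
    using adj[OF b1(1) pow_W[OF b1(1)], of i j] b1(3)[of "i + j"] by (simp add: funpow_add)
  let ?Z = "span (range (\<lambda>k. (?N ^^ k) b1))"
  have powV: "(?N ^^ i) b1 \<in> V" for i using WV[OF pow_W[OF b1(1)]] .
  have iso2: "S ((?N ^^ i) b1) x = 0" if "x \<in> ?Z" for x i
  proof -
    have "x \<in> V \<and> S ((?N ^^ i) b1) x = 0" using that
    proof (induction rule: span_induct_alt)
      case base
      then show ?case using powV subspace_0[OF V_sub] by simp
    next
      case (step c x y)
      then obtain k where "x = (?N ^^ k) b1" by blast
      then show ?case
        using step powV
        by (simp add: S_add_right S_scale_right iso1 subspace_scale[OF V_sub] subspace_add[OF V_sub])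
    qed
    then show ?thesis ..
  qed
  have iso3: "S y x = 0" if "x \<in> ?Z" "y \<in> ?Z" for x y
  proof -
    have xV: "x \<in> V" by (rule WV[OF sub_b1[OF that(1)]])
    have "y \<in> V \<and> S y x = 0" using that(2)
    proof (induction rule: span_induct_alt)
      case base
      then show ?case using xV subspace_0[OF V_sub] by simp
    next
      case (step c z y)
      then obtain k where "z = (?N ^^ k) b1" by blast
      then show ?case
        using step powV xV iso2[OF that(1)]
        by (simp add: S_add_left S_scale_left subspace_scale[OF V_sub] subspace_add[OF V_sub])
    qed
    then show ?thesis ..
  qed
  have N_span: "(?N ^^ k) x \<in> ?Z" if "x \<in> ?Z" for x k
  proof -
    have "x \<in> ?W \<and> (?N ^^ k) x \<in> ?Z" using that
    proof (induction rule: span_induct_alt)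
      case base
      then show ?case
        using subspace_0[OF endo_onD(1)[OF e]] by (simp add: endo_on_0[OF endo_on_funpow[OF e]] span_zero)
    next
      case (step c x y)
      then obtain j where j: "x = (?N ^^ j) b1" by blast
      then have "(?N ^^ k) x = (?N ^^ (k + j)) b1" by (simp add: funpow_add)
      then have "(?N ^^ k) x \<in> ?Z" by (auto intro: span_base)
      then show ?case
        using step j pow_W[OF b1(1)] subspace_scale[OF endo_onD(1)[OF e]] subspace_add[OF endo_onD(1)[OF e]]
        by (simp add: endo_onD(3,4)[OF endo_on_funpow[OF e]] span_add span_scale)
    qed
    then show ?thesis ..
  qed
  have b2iso: "S b2 ((?N ^^ k) b2) = 0" for k
    by (rule iso3[OF N_span[OF b2(2)] b2(2)])
  have gram: "gram_eq n S (\<lambda>k. (?N ^^ (k - 1)) x) (\<lambda>k. (?N ^^ (k - 1)) y) d"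
    if "x \<in> ?W" "y \<in> ?W" "\<And>k. k < n \<Longrightarrow> S x ((?N ^^ k) y) = (if k = n - 1 then d else 0)" for x y d
    using string_gram[OF l(2) that(1), of y n d] that nil[OF that(2)] l(1) by simp
  show thesis
    by (rule that[OF string_exp_chain(2)[OF l(2) a1(1) nil[OF a1(1)]] string_exp_chain(2)[OF l(2) b2(1) nil[OF b2(1)]]
          string_exp_chain(1)[OF l(2) a1(1) nil[OF a1(1)]] string_exp_chain(1)[OF l(2) b2(1) nil[OF b2(1)]]
          gram[OF a1(1) a1(1)] gram[OF b2(1) b2(1)] gram[OF a1(1) b2(1) b2(3)]])
      (simp_all add: a1(3) b2iso)
qed

end

section \<open>Complexification\<close>

lemma linear_onD:
  assumes "linear_on V f"
  shows "x \<in> V \<Longrightarrow> y \<in> V \<Longrightarrow> f (x + y) = f x + f y"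
    and "x \<in> V \<Longrightarrow> f (c *\<^sub>R x) = c *\<^sub>R f x"
  using assms by (auto simp: linear_on_def)

lemma linear_on_0: "linear_on V f \<Longrightarrow> subspace V \<Longrightarrow> f 0 = 0"
  using linear_onD(2)[of V f 0 0] subspace_0 by auto

lemma linear_on_uminus: "linear_on V f \<Longrightarrow> x \<in> V \<Longrightarrow> f (- x) = - f x"
  using linear_onD(2)[of V f x "-1"] by simp

lemma linear_on_diff: "linear_on V f \<Longrightarrow> subspace V \<Longrightarrow> x \<in> V \<Longrightarrow> y \<in> V \<Longrightarrow> f (x - y) = f x - f y"
  using linear_onD(1)[of V f x "- y"] linear_on_uminus[of V f y] subspace_neg[of V y] by simp

lemma endo_on_linear_on: "real0.endo_on V f \<longleftrightarrow> subspace V \<and> linear_on V f \<and> f ` V \<subseteq> V"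
  by (auto simp: real0.endo_on_def linear_on_def)

lemma csub: "subspace V \<Longrightarrow> cplx.subspace (V \<times> V)"
  by (intro cplx.subspaceI)
    (auto simp: cscale_def zero_prod_def subspace_0 subspace_add subspace_diff subspace_scale)

lemma csum_mem:
  assumes V: "subspace V" and z: "\<And>i. i \<in> I \<Longrightarrow> z i \<in> V \<times> V"
  shows "(\<Sum>i\<in>I. cscale (a i) (z i)) \<in> V \<times> V"
  by (intro cplx.subspace_sum[OF csub[OF V]] cplx.subspace_scale[OF csub[OF V]] z)

lemma cconj_add: "cconj (z + w) = cconj z + cconj w"
  by (simp add: cconj_def plus_prod_def)

lemma cconj_scale: "cconj (cscale c z) = cscale (cnj c) (cconj z)"
  by (simp add: cconj_def cscale_def)

lemma cconj_cconj [simp]: "cconj (cconj z) = z"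
  by (simp add: cconj_def)

lemma cconj_0 [simp]: "cconj 0 = 0"
  by (simp add: cconj_def zero_prod_def)

lemma cconj_eq_0_iff [simp]: "cconj z = 0 \<longleftrightarrow> z = 0"
  using cconj_cconj[of z] cconj_0 by metis

lemma cconj_diff: "cconj (z - w) = cconj z - cconj w"
  by (simp add: cconj_def minus_prod_def)

lemma cconj_sum: "cconj (\<Sum>i\<in>I. f i) = (\<Sum>i\<in>I. cconj (f i))"
  by (induction I rule: infinite_finite_induct) (simp_all add: cconj_add)

lemma cconj_mem: "subspace V \<Longrightarrow> cconj z \<in> V \<times> V \<longleftrightarrow> z \<in> V \<times> V"
  using subspace_neg[of V "snd z"] subspace_neg[of V "- snd z"]
  by (cases z) (auto simp: cconj_def)

lemma cconj_map_prod:
  "linear_on V f \<Longrightarrow> z \<in> V \<times> V \<Longrightarrow> cconj (map_prod f f z) = map_prod f f (cconj z)"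
  by (cases z) (auto simp: cconj_def linear_on_uminus)

lemma map_prod_endo:
  assumes "real0.endo_on V f"
  shows "cplx0.endo_on (V \<times> V) (map_prod f f)"
  using assms real0.endo_on_diff[OF assms] csub[of V]
  unfolding cplx0.endo_on_def
  by (auto simp: real0.endo_on_def cscale_def plus_prod_def subspace_scale)

lemma csum_linear:
  assumes f: "linear_on V f" and V: "subspace V" and z: "\<And>i. i \<in> I \<Longrightarrow> z i \<in> V \<times> V"
  shows "map_prod f f (\<Sum>i\<in>I. cscale (a i) (z i)) = (\<Sum>i\<in>I. cscale (a i) (map_prod f f (z i)))"
proof -
  have add: "map_prod f f (u + v) = map_prod f f u + map_prod f f v" if "u \<in> V \<times> V" "v \<in> V \<times> V" for u v
    using that linear_onD(1)[OF f] by (auto simp: plus_prod_def)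
  have sc: "map_prod f f (cscale c u) = cscale c (map_prod f f u)" if "u \<in> V \<times> V" for u c
    using that linear_onD[OF f] linear_on_diff[OF f V] subspace_scale[OF V] by (auto simp: cscale_def)
  show "map_prod f f (\<Sum>i\<in>I. cscale (a i) (z i)) = (\<Sum>i\<in>I. cscale (a i) (map_prod f f (z i)))"
    using z
  proof (induction I rule: infinite_finite_induct)
    case (insert i I)
    then have "(\<Sum>i\<in>I. cscale (a i) (z i)) \<in> V \<times> V" "cscale (a i) (z i) \<in> V \<times> V"
      by (intro csum_mem[OF V] cplx.subspace_scale[OF csub[OF V]]; simp)+
    with insert show ?case by (simp add: add sc)
  qed (simp_all add: linear_on_0[OF f V] zero_prod_def)
qed

text \<open>
  Reduces statements on the complexification to real vectors \<open>(x, 0)\<close>.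
\<close>

lemma cplx_split: "(x, y) = (x, 0) + cscale \<i> (y, 0)"
  by (simp add: cscale_def plus_prod_def)

text \<open>
  The way back and forth between real and complex bases: complex combinations of real vectors have
  arbitrary real combinations as real and imaginary parts.
\<close>

lemma cplx_span_real: "cplx.span ((\<lambda>x. (x, 0)) ` B) = span B \<times> span B"
proof
  show "cplx.span ((\<lambda>x. (x, 0)) ` B) \<subseteq> span B \<times> span B"
    by (intro cplx.span_minimal csub subspace_span) (auto simp: span_base span_0)
  have re: "(x, 0) \<in> cplx.span ((\<lambda>x. (x, 0)) ` B)" if "x \<in> span B" for x
    using that
  proof (induction rule: span_induct_alt)
    case base
    then show ?case using cplx.span_zero by (simp add: zero_prod_def)
  next
    case (step c x y)
    have "(c *\<^sub>R x + y, 0) = cscale (of_real c) (x, 0) + (y, 0)"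
      by (simp add: cscale_def plus_prod_def)
    then show ?case
      using cplx.span_add[OF cplx.span_scale[OF cplx.span_base[OF imageI[OF step(1)]]] step(2)] by simp
  qed
  show "span B \<times> span B \<subseteq> cplx.span ((\<lambda>x. (x, 0)) ` B)"
  proof (clarify, subst cplx_split)
    fix x y assume "x \<in> span B" "y \<in> span B"
    then show "(x, 0) + cscale \<i> (y, 0) \<in> cplx.span ((\<lambda>x. (x, 0)) ` B)"
      by (intro cplx.span_add cplx.span_scale re)
  qed
qed

lemma cplx_independent_real:
  assumes B: "independent B"
  shows "cplx.independent ((\<lambda>x. (x, 0)) ` B)"
  unfolding cplx.independent_explicit_finite_subsets
proof (intro allI impI ballI)
  fix A u v
  assume A: "A \<subseteq> (\<lambda>x. (x, 0)) ` B" "finite A" and s: "(\<Sum>v\<in>A. cscale (u v) v) = 0" and v: "v \<in> A"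
  then obtain C where C: "C \<subseteq> B" "A = (\<lambda>x. (x, 0)) ` C" by (meson subset_imageE)
  have inj: "inj_on (\<lambda>x. (x, 0)) C" by (simp add: inj_on_def)
  have fC: "finite C" using A(2) C(2) finite_imageD[OF _ inj] by blast
  have "(\<Sum>x\<in>C. cscale (u (x, 0)) (x, 0)) = 0" using s by (simp add: C(2) sum.reindex[OF inj])
  moreover have "(\<Sum>x\<in>C. cscale (u (x, 0)) (x, 0)) = (\<Sum>x\<in>C. Re (u (x, 0)) *\<^sub>R x, \<Sum>x\<in>C. Im (u (x, 0)) *\<^sub>R x)"
    by (simp add: cscale_def sum_prod)
  ultimately have "(\<Sum>x\<in>C. Re (u (x, 0)) *\<^sub>R x) = 0" "(\<Sum>x\<in>C. Im (u (x, 0)) *\<^sub>R x) = 0"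
    by (simp_all add: zero_prod_def)
  then have "\<forall>x\<in>C. Re (u (x, 0)) = 0" "\<forall>x\<in>C. Im (u (x, 0)) = 0"
    using B C(1) fC unfolding real_vector.independent_explicit_finite_subsets by metis+
  then show "u v = 0" using v C(2) by (auto simp: complex_eq_iff)
qed

lemma dim_complexification:
  assumes V: "subspace V"
  shows "cplx.dim (V \<times> V) = dim V"
proof -
  obtain B where B: "B \<subseteq> V" "independent B" "V \<subseteq> span B" "card B = dim V"
    using basis_exists[of V] by blast
  have "span B = V" using B(1,3) span_minimal[OF B(1) V] by blast
  then have s: "cplx.span ((\<lambda>x. (x, 0)) ` B) = V \<times> V" by (simp add: cplx_span_real)
  have "card ((\<lambda>x. (x, 0::'a)) ` B) = cplx.dim (V \<times> V)"
    using s cplx_independent_real[OF B(2)] B(1) subspace_0[OF V]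
    by (intro cplx.basis_card_eq_dim) auto
  moreover have "card ((\<lambda>x. (x, 0::'a)) ` B) = card B" by (rule card_image) (simp add: inj_on_def)
  ultimately show ?thesis using B(4) by simp
qed

lemma cform_bilinear:
  assumes V: "subspace V" and S: "\<And>x. x \<in> V \<Longrightarrow> linear_on V (S x)" "\<And>y. y \<in> V \<Longrightarrow> linear_on V (\<lambda>x. S x y)"
    and z: "x \<in> V \<times> V" "y \<in> V \<times> V" "z \<in> V \<times> V"
  shows "cform S (x + y) z = cform S x z + cform S y z" "cform S z (x + y) = cform S z x + cform S z y"
    "cform S (cscale c x) z = c * cform S x z" "cform S z (cscale c x) = c * cform S z x"
proof -
  have add: "S (a + b) d = S a d + S b d" "S d (a + b) = S d a + S d b" if "a \<in> V" "b \<in> V" "d \<in> V" for a b d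
    using that linear_onD(1)[OF S(1)] linear_onD(1)[OF S(2)] by blast+
  have sc: "S (r *\<^sub>R a) d = r * S a d" "S d (r *\<^sub>R a) = r * S d a" if "a \<in> V" "d \<in> V" for a d r
    using that linear_onD(2)[OF S(1), of d a r] linear_onD(2)[OF S(2), of d a r] by simp_all
  have df: "S (a - b) d = S a d - S b d" "S d (a - b) = S d a - S d b" if "a \<in> V" "b \<in> V" "d \<in> V" for a b d
    using that linear_on_diff[OF S(1) V, of d a b] linear_on_diff[OF S(2) V, of d a b] by simp_all
  note m = subspace_scale[OF V] subspace_add[OF V] subspace_diff[OF V]
  show "cform S (x + y) z = cform S x z + cform S y z" "cform S z (x + y) = cform S z x + cform S z y"
    using z by (auto simp: cform_def add m complex_eq_iff)
  show "cform S (cscale c x) z = c * cform S x z" "cform S z (cscale c x) = c * cform S z x"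
    using z by (auto simp: cform_def cscale_def add sc df m complex_eq_iff algebra_simps)
qed

lemma cform_cconj:
  assumes V: "subspace V" and S: "\<And>x. x \<in> V \<Longrightarrow> linear_on V (S x)" "\<And>y. y \<in> V \<Longrightarrow> linear_on V (\<lambda>x. S x y)"
    and z: "z \<in> V \<times> V" "w \<in> V \<times> V"
  shows "cform S (cconj z) (cconj w) = cnj (cform S z w)"
proof -
  have "S (- a) d = - S a d" "S d (- a) = - S d a" if "a \<in> V" "d \<in> V" for a d
    using that linear_on_uminus[OF S(1), of d a] linear_on_uminus[OF S(2), of d a] by simp_all
  then show ?thesis
    using z subspace_neg[OF V] by (auto simp: cform_def cconj_def complex_eq_iff)
qed

lemma cform_swap:
  assumes sym: "\<And>x y. x \<in> V \<Longrightarrow> y \<in> V \<Longrightarrow> S y x = (-1) ^ m * S x y"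
    and zw: "z \<in> V \<times> V" "w \<in> V \<times> V"
  shows "cform S w z = (-1) ^ m * cform S z w"
proof -
  have v: "fst z \<in> V" "snd z \<in> V" "fst w \<in> V" "snd w \<in> V" using zw by auto
  show ?thesis
    using sym[OF v(1,3)] sym[OF v(1,4)] sym[OF v(2,3)] sym[OF v(2,4)]
    by (simp add: cform_def complex_eq_iff minus_one_power_iff)
qed

lemma cform_real: "subspace V \<Longrightarrow> linear_on V (S x) \<Longrightarrow> (\<And>y. y \<in> V \<Longrightarrow> linear_on V (\<lambda>x. S x y)) \<Longrightarrow>
    y \<in> V \<Longrightarrow> cform S (x, 0) (y, 0) = of_real (S x y)"
  using linear_on_0[of V "S x"] linear_on_0[of V "\<lambda>x. S x y"] linear_on_0[of V "\<lambda>x. S x 0"] subspace_0[of V]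
  by (simp add: cform_def complex_eq_iff)

lemma E_per_of_real: "complex_of_real (E_per n j k) = E_per n j k"
  by (simp add: E_per_def)

context isometric_triple
begin

lemma M_in: "x \<in> V \<Longrightarrow> M x \<in> V"
  using aut_bij by (auto simp: bij_betw_def)

lemma M_endo_on: "real0.endo_on V M"
  using subspace aut_linear aut_bij by (auto simp: endo_on_linear_on bij_betw_def)

lemmas cS = cform_bilinear[OF subspace form_linear_right form_linear_left]
lemmas cS_cconj = cform_cconj[OF subspace form_linear_right form_linear_left]

lemma cS_real: "x \<in> V \<Longrightarrow> y \<in> V \<Longrightarrow> cform S (x, 0) (y, 0) = of_real (S x y)"
  by (rule cform_real[OF subspace form_linear_right form_linear_left])

lemma gram_embed:
  assumes "gram_eq n S a b c" "\<And>k. k \<in> {1..n} \<Longrightarrow> a k \<in> V" "\<And>k. k \<in> {1..n} \<Longrightarrow> b k \<in> V"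
  shows "gram_eq n (cform S) (\<lambda>k. (a k, 0)) (\<lambda>k. (b k, 0)) (of_real c)"
  using assms by (simp add: gram_eq_def cS_real E_per_of_real)

lemma sign: obtains m where "m \<in> {0, 1::nat}" "\<And>x y. x \<in> V \<Longrightarrow> y \<in> V \<Longrightarrow> S y x = (-1) ^ m * S x y"
  using symmetric unfolding symmetric_form_def by blast

lemma nondegenerate_right: "x \<in> V \<Longrightarrow> (\<And>y. y \<in> V \<Longrightarrow> S y x = 0) \<Longrightarrow> x = 0"
proof -
  assume x: "x \<in> V" and z: "\<And>y. y \<in> V \<Longrightarrow> S y x = 0"
  obtain m :: nat where m: "\<And>x y. x \<in> V \<Longrightarrow> y \<in> V \<Longrightarrow> S y x = (-1) ^ m * S x y" by (rule sign) blast
  have "S x y = 0" if "y \<in> V" for y using z[OF that] m[OF x that] by simp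
  then show "x = 0" using nondegenerate x by blast
qed

lemma real_space: "iso_space scaleR V M S"
proof
  show "\<exists>B. finite B \<and> V = module.span scaleR B" using finite_dim by (simp add: span_raw_def)
  show "real0.endo_on V M" by (rule M_endo_on)
  show "M ` V = V" using aut_bij by (simp add: bij_betw_def)
  show "S (M x) (M y) = S x y" if "x \<in> V" "y \<in> V" for x y using that by (rule isometry)
  show "x = 0" if "x \<in> V" "\<And>y. y \<in> V \<Longrightarrow> S x y = 0" for x using that nondegenerate by blast
  show "x = 0" if "x \<in> V" "\<And>y. y \<in> V \<Longrightarrow> S y x = 0" for x using that nondegenerate_right by blast
qed (use form_linear_left form_linear_right in \<open>auto simp: linear_on_def\<close>)

lemma cplx_space: "iso_space cscale (V \<times> V) (map_prod M M) (cform S)"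
proof
  obtain B where B: "finite B" "V = span B" using finite_dim by blast
  then show "\<exists>B. finite B \<and> V \<times> V = cplx.span B"
    by (intro exI[of _ "(\<lambda>x. (x, 0)) ` B"]) (simp add: cplx_span_real)
  show "cplx0.endo_on (V \<times> V) (map_prod M M)" by (rule map_prod_endo[OF M_endo_on])
  show "map_prod M M ` (V \<times> V) = V \<times> V"
    using aut_bij map_prod_surj_on[of M V V M V V] by (simp add: bij_betw_def)
  show "cform S (map_prod M M x) (map_prod M M y) = cform S x y" if "x \<in> V \<times> V" "y \<in> V \<times> V" for x y
    using that isometry by (auto simp: cform_def)
  have z: "S 0 x = 0" "S x 0 = 0" if "x \<in> V" for x
    using that linear_on_0[OF form_linear_right subspace] linear_on_0[OF form_linear_left subspace] by auto
  show "x = 0" if x: "x \<in> V \<times> V" "\<And>y. y \<in> V \<times> V \<Longrightarrow> cform S x y = 0" for x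
  proof -
    have "S (fst x) y = 0 \<and> S (snd x) y = 0" if "y \<in> V" for y
      using x(2)[of "(y, 0)"] x(1) that z subspace_0[OF subspace] by (auto simp: cform_def complex_eq_iff)
    then show ?thesis using nondegenerate[of "fst x"] nondegenerate[of "snd x"] x(1) by (auto simp: zero_prod_def)
  qed
  show "x = 0" if x: "x \<in> V \<times> V" "\<And>y. y \<in> V \<times> V \<Longrightarrow> cform S y x = 0" for x
  proof -
    have "S y (fst x) = 0 \<and> S y (snd x) = 0" if "y \<in> V" for y
      using x(2)[of "(y, 0)"] x(1) that z subspace_0[OF subspace] by (auto simp: cform_def complex_eq_iff)
    then show ?thesis using nondegenerate_right[of "fst x"] nondegenerate_right[of "snd x"] x(1)
      by (auto simp: zero_prod_def)
  qed
  fix x y z assume m: "x \<in> V \<times> V" "y \<in> V \<times> V" "z \<in> V \<times> V"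
  show "cform S (x + y) z = cform S x z + cform S y z" by (rule cS(1)[OF _ _ m])
  show "cform S z (x + y) = cform S z x + cform S z y" by (rule cS(2)[OF _ _ m])
next
  fix a x z assume m: "x \<in> V \<times> V" "z \<in> V \<times> V"
  show "cform S (cscale a x) z = a * cform S x z" by (rule cS(3)[OF _ _ m(1) m(1) m(2)])
  show "cform S z (cscale a x) = a * cform S z x" by (rule cS(4)[OF _ _ m(1) m(1) m(2)])
qed

end

section \<open>Coordinates\<close>

text \<open>
  A finite basis \<open>r\<close> of the complexification with its dual basis \<open>\<phi>\<close>, on which conjugation acts as the
  involution \<open>c\<close> of the index set. Real maps and real forms on \<open>V\<close> correspond to complex values on the basis
  that are compatible with \<open>c\<close>.
\<close>

locale coords =
  fixes V :: "'a::real_vector set" and P :: "'p set" and r :: "'p \<Rightarrow> 'a \<times> 'a"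
    and \<phi> :: "'p \<Rightarrow> 'a \<times> 'a \<Rightarrow> complex" and c :: "'p \<Rightarrow> 'p"
  assumes sub: "subspace V" and fin: "finite P" and r_in: "\<And>p. p \<in> P \<Longrightarrow> r p \<in> V \<times> V"
    and c_in: "\<And>p. p \<in> P \<Longrightarrow> c p \<in> P" and c_c: "\<And>p. p \<in> P \<Longrightarrow> c (c p) = p"
    and r_conj: "\<And>p. p \<in> P \<Longrightarrow> cconj (r p) = r (c p)"
    and \<phi>_add: "\<And>p z w. p \<in> P \<Longrightarrow> z \<in> V \<times> V \<Longrightarrow> w \<in> V \<times> V \<Longrightarrow> \<phi> p (z + w) = \<phi> p z + \<phi> p w"
    and \<phi>_scale: "\<And>p a z. p \<in> P \<Longrightarrow> z \<in> V \<times> V \<Longrightarrow> \<phi> p (cscale a z) = a * \<phi> p z"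
    and \<phi>_r: "\<And>p q. p \<in> P \<Longrightarrow> q \<in> P \<Longrightarrow> \<phi> p (r q) = (if p = q then 1 else 0)"
    and expand: "\<And>z. z \<in> V \<times> V \<Longrightarrow> z = (\<Sum>p\<in>P. cscale (\<phi> p z) (r p))"
begin

lemma \<phi>_0: "p \<in> P \<Longrightarrow> \<phi> p 0 = 0"
  using \<phi>_scale[of p 0 0] subspace_0[OF sub] by (simp add: zero_prod_def)

lemma \<phi>_sum:
  assumes "p \<in> P" "\<And>i. i \<in> I \<Longrightarrow> z i \<in> V \<times> V"
  shows "\<phi> p (\<Sum>i\<in>I. cscale (a i) (z i)) = (\<Sum>i\<in>I. a i * \<phi> p (z i))"
  using assms(2)
proof (induction I rule: infinite_finite_induct)
  case (insert i I)
  then have "(\<Sum>i\<in>I. cscale (a i) (z i)) \<in> V \<times> V" "cscale (a i) (z i) \<in> V \<times> V"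
    by (intro csum_mem[OF sub] cplx.subspace_scale[OF csub[OF sub]]; simp)+
  with insert assms(1) show ?case by (simp add: \<phi>_add \<phi>_scale)
qed (simp_all add: \<phi>_0[OF assms(1)])

lemma \<phi>_unique:
  assumes "p \<in> P" shows "\<phi> p (\<Sum>q\<in>P. cscale (a q) (r q)) = a p"
proof -
  have "\<phi> p (\<Sum>q\<in>P. cscale (a q) (r q)) = (\<Sum>q\<in>P. if p = q then a q else 0)"
    using assms by (subst \<phi>_sum) (auto simp: r_in \<phi>_r intro!: sum.cong)
  then show ?thesis using assms fin by simp
qed

lemma sum_c: "(\<Sum>p\<in>P. f (c p)) = (\<Sum>p\<in>P. f p)"
  by (rule sum.reindex_bij_witness[of _ c c]) (simp_all add: c_in c_c)

lemma \<phi>_conj: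
  assumes p: "p \<in> P" and z: "z \<in> V \<times> V"
  shows "\<phi> (c p) (cconj z) = cnj (\<phi> p z)"
proof -
  have "cconj z = (\<Sum>q\<in>P. cscale (cnj (\<phi> q z)) (r (c q)))"
    by (subst expand[OF z]) (simp add: cconj_sum cconj_scale r_conj)
  also have "\<dots> = (\<Sum>q\<in>P. cscale (cnj (\<phi> (c q) z)) (r q))"
    by (subst sum_c[symmetric]) (simp add: c_c)
  finally show ?thesis using \<phi>_unique[OF c_in[OF p], of "\<lambda>q. cnj (\<phi> (c q) z)"] p by (simp add: c_c)
qed

lemma r_inj: "inj_on r P"
proof (rule inj_onI)
  fix p q assume pq: "p \<in> P" "q \<in> P" "r p = r q"
  then show "p = q" using \<phi>_r[of p p] \<phi>_r[of p q] by (auto split: if_splits)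
qed

lemma r_span: "cplx.span (r ` P) = V \<times> V"
proof
  show "cplx.span (r ` P) \<subseteq> V \<times> V"
    by (intro cplx.span_minimal csub sub image_subsetI r_in)
  show "V \<times> V \<subseteq> cplx.span (r ` P)"
  proof
    fix z assume "z \<in> V \<times> V"
    then have "z = (\<Sum>p\<in>P. cscale (\<phi> p z) (r p))" by (rule expand)
    also have "\<dots> \<in> cplx.span (r ` P)"
      by (intro cplx.span_sum cplx.span_scale cplx.span_base) auto
    finally show "z \<in> cplx.span (r ` P)" .
  qed
qed

lemma r_independent: "cplx.independent (r ` P)"
proof (rule cplx.independent_if_scalars_zero)
  show "finite (r ` P)" using fin by simp
  fix f x assume s: "(\<Sum>x\<in>r ` P. cscale (f x) x) = 0" and x: "x \<in> r ` P"
  then obtain p where p: "p \<in> P" "x = r p" by blast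
  have "(\<Sum>q\<in>P. cscale (f (r q)) (r q)) = 0" using s by (simp add: sum.reindex[OF r_inj])
  then show "f x = 0" using \<phi>_unique[OF p(1), of "\<lambda>q. f (r q)"] \<phi>_0[OF p(1)] p(2) by simp
qed

lemma dim_eq_card: "dim V = card P"
proof -
  have "card (r ` P) = cplx.dim (V \<times> V)"
    by (rule cplx.basis_card_eq_dim[OF image_subsetI[OF r_in]]) (simp_all add: r_span r_independent)
  then show ?thesis by (simp add: card_image[OF r_inj] dim_complexification[OF sub])
qed

text \<open>
  The complex linear extension of \<open>r p \<mapsto> w p\<close> commutes with conjugation because it does so on the basis.
  Hence it maps real vectors to real vectors and is the complexification of a real map.
\<close>

lemma extend_linear:
  assumes V': "subspace V'" and w: "\<And>p. p \<in> P \<Longrightarrow> w p \<in> V' \<times> V'" "\<And>p. p \<in> P \<Longrightarrow> cconj (w p) = w (c p)"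
  obtains f where "linear_on V f" "\<And>x. x \<in> V \<Longrightarrow> f x \<in> V'" "\<And>p. p \<in> P \<Longrightarrow> map_prod f f (r p) = w p"
proof -
  define T where "T = (\<lambda>z. \<Sum>p\<in>P. cscale (\<phi> p z) (w p))"
  define f where "f = (\<lambda>x. fst (T (x, 0)))"
  have in_C: "(x, 0) \<in> V \<times> V" if "x \<in> V" for x using that subspace_0[OF sub] by simp
  have T_add: "T (z + u) = T z + T u" if "z \<in> V \<times> V" "u \<in> V \<times> V" for z u
    using that by (simp add: T_def \<phi>_add cplx.scale_left_distrib sum.distrib)
  have T_scale: "T (cscale a z) = cscale a (T z)" if "z \<in> V \<times> V" for a z
    using that by (simp add: T_def \<phi>_scale cplx.scale_sum_right)
  have T_conj: "T (cconj z) = cconj (T z)" if z: "z \<in> V \<times> V" for z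
  proof -
    have "T (cconj z) = (\<Sum>p\<in>P. cscale (\<phi> (c p) (cconj z)) (w (c p)))"
      unfolding T_def by (rule sum_c[symmetric])
    then show ?thesis by (simp add: \<phi>_conj[OF _ z] T_def cconj_sum cconj_scale w(2))
  qed
  have T_mem: "T z \<in> V' \<times> V'" for z
    unfolding T_def by (intro cplx.subspace_sum[OF csub[OF V']] cplx.subspace_scale[OF csub[OF V']] w(1))
  have T_real: "T (x, 0) = (f x, 0)" if "x \<in> V" for x
  proof -
    have "cconj (T (x, 0)) = T (x, 0)"
      using T_conj[OF in_C[OF that]] by (simp add: cconj_def)
    then have "2 *\<^sub>R snd (T (x, 0)) = 0"
      unfolding scaleR_2 by (simp add: cconj_def prod_eq_iff neg_eq_iff_add_eq_0)
    then have "snd (T (x, 0)) = 0" by simp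
    then show ?thesis by (simp add: f_def prod_eq_iff)
  qed
  have T_eq: "T z = map_prod f f z" if z: "z \<in> V \<times> V" for z
  proof -
    obtain x y where xy: "z = (x, y)" "x \<in> V" "y \<in> V" using z by blast
    have "T z = T (x, 0) + cscale \<i> (T (y, 0))"
      unfolding xy(1) cplx_split[of x y]
      using in_C xy cplx.subspace_scale[OF csub[OF sub]] by (simp add: T_add T_scale)
    then show ?thesis using xy by (simp add: T_real cscale_def plus_prod_def)
  qed
  show thesis
  proof
    show "linear_on V f"
      unfolding linear_on_def
    proof (intro conjI ballI allI)
      fix x y assume "x \<in> V" "y \<in> V"
      then show "f (x + y) = f x + f y"
        using T_add[OF in_C in_C, of x y] by (simp add: f_def plus_prod_def)
    next
      fix a x assume "x \<in> V"
      then show "f (a *\<^sub>R x) = a *\<^sub>R f x"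
        using T_scale[OF in_C, of x "of_real a"] by (simp add: f_def cscale_def)
    qed
    show "f x \<in> V'" for x using T_mem[of "(x, 0)"] by (auto simp: f_def mem_Times_iff)
    show "map_prod f f (r p) = w p" if "p \<in> P" for p
    proof -
      have "T (r p) = (\<Sum>q\<in>P. if q = p then w q else 0)"
        unfolding T_def using that by (intro sum.cong) (auto simp: \<phi>_r)
      then have "T (r p) = w p" using that fin by simp
      then show ?thesis using T_eq[OF r_in[OF that]] by simp
    qed
  qed
qed

lemma linear_eq:
  assumes f: "linear_on V f" "linear_on V g" and eq: "\<And>p. p \<in> P \<Longrightarrow> map_prod f f (r p) = map_prod g g (r p)"
    and z: "z \<in> V \<times> V"
  shows "map_prod f f z = map_prod g g z"
  by (subst (1 2) expand[OF z]) (simp add: csum_linear(1)[OF f(1) sub] csum_linear(1)[OF f(2) sub] r_in eq)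

lemma linear_eq_real:
  assumes f: "linear_on V f" "linear_on V g" and eq: "\<And>p. p \<in> P \<Longrightarrow> map_prod f f (r p) = map_prod g g (r p)"
    and x: "x \<in> V"
  shows "f x = g x"
  using linear_eq[OF f eq, of "(x, x)"] x by simp

lemma form_expand:
  assumes S: "\<And>x. x \<in> V \<Longrightarrow> linear_on V (S x)" "\<And>y. y \<in> V \<Longrightarrow> linear_on V (\<lambda>x. S x y)"
    and z: "z \<in> V \<times> V" "w \<in> V \<times> V"
  shows "cform S z w = (\<Sum>p\<in>P. \<Sum>q\<in>P. \<phi> p z * \<phi> q w * cform S (r p) (r q))"
proof -
  note b = cform_bilinear[OF sub S]
  have z0: "(0::'a\<times>'a) \<in> V \<times> V" using subspace_0[OF sub] by (simp add: zero_prod_def)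
  have l: "cform S (\<Sum>p\<in>A. cscale (a p) (r p)) u = (\<Sum>p\<in>A. a p * cform S (r p) u)"
    if "A \<subseteq> P" "u \<in> V \<times> V" for A a u
    using finite_subset[OF that(1) fin] that(1)
  proof (induction A rule: finite_induct)
    case empty
    then show ?case using b(3)[of 0 u u 0] that(2) z0 by simp
  next
    case (insert p A)
    then have "(\<Sum>p\<in>A. cscale (a p) (r p)) \<in> V \<times> V" "cscale (a p) (r p) \<in> V \<times> V" "r p \<in> V \<times> V"
      by (intro csum_mem[OF sub] cplx.subspace_scale[OF csub[OF sub]] r_in; blast)+
    with insert that(2) show ?case by (simp add: b(1)[where y = "\<Sum>p\<in>A. cscale (a p) (r p)"] b(3)[where y = "r p"])
  qed
  have rr: "cform S u (\<Sum>p\<in>A. cscale (a p) (r p)) = (\<Sum>p\<in>A. a p * cform S u (r p))"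
    if "A \<subseteq> P" "u \<in> V \<times> V" for A a u
    using finite_subset[OF that(1) fin] that(1)
  proof (induction A rule: finite_induct)
    case empty
    then show ?case using b(4)[of 0 u u 0] that(2) z0 by simp
  next
    case (insert p A)
    then have "(\<Sum>p\<in>A. cscale (a p) (r p)) \<in> V \<times> V" "cscale (a p) (r p) \<in> V \<times> V" "r p \<in> V \<times> V"
      by (intro csum_mem[OF sub] cplx.subspace_scale[OF csub[OF sub]] r_in; blast)+
    with insert that(2) show ?case by (simp add: b(2)[where y = "\<Sum>p\<in>A. cscale (a p) (r p)"] b(4)[where y = "r p"])
  qed
  have "cform S z w = (\<Sum>p\<in>P. \<phi> p z * cform S (r p) w)"
    by (subst expand[OF z(1)]) (rule l[OF order_refl z(2)])
  also have "\<dots> = (\<Sum>p\<in>P. \<phi> p z * (\<Sum>q\<in>P. \<phi> q w * cform S (r p) (r q)))"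
    by (intro sum.cong refl, subst expand[OF z(2)]) (simp add: rr[OF order_refl r_in])
  finally show ?thesis by (simp add: sum_distrib_left mult.assoc)
qed

text \<open>
  The complex bilinear form with Gram matrix \<open>g\<close> takes conjugate values on conjugate vectors, so it is real
  on real vectors and is the complexification of its restriction.
\<close>

lemma extend_form:
  assumes g: "\<And>p q. p \<in> P \<Longrightarrow> q \<in> P \<Longrightarrow> g (c p) (c q) = cnj (g p q)"
  obtains S where "\<And>x. x \<in> V \<Longrightarrow> linear_on V (S x)" "\<And>y. y \<in> V \<Longrightarrow> linear_on V (\<lambda>x. S x y)"
    "\<And>p q. p \<in> P \<Longrightarrow> q \<in> P \<Longrightarrow> cform S (r p) (r q) = g p q"
proof -
  define G where "G = (\<lambda>z w. \<Sum>p\<in>P. \<Sum>q\<in>P. \<phi> p z * \<phi> q w * g p q)"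
  define S where "S = (\<lambda>x y. Re (G (x, 0) (y, 0)))"
  have in_C: "(x, 0) \<in> V \<times> V" if "x \<in> V" for x using that subspace_0[OF sub] by simp
  have G_add: "G (z + u) w = G z w + G u w" "G w (z + u) = G w z + G w u"
    if "z \<in> V \<times> V" "u \<in> V \<times> V" for z u w
    using that by (simp_all add: G_def \<phi>_add sum.distrib algebra_simps)
  have G_scale: "G (cscale a z) w = a * G z w" "G w (cscale a z) = a * G w z" if "z \<in> V \<times> V" for a z w
    using that by (simp_all add: G_def \<phi>_scale sum_distrib_left algebra_simps)
  have G_conj: "G (cconj z) (cconj w) = cnj (G z w)" if z: "z \<in> V \<times> V" "w \<in> V \<times> V" for z w
  proof -
    have "G (cconj z) (cconj w)
        = (\<Sum>p\<in>P. \<Sum>q\<in>P. \<phi> (c p) (cconj z) * \<phi> (c q) (cconj w) * g (c p) (c q))"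
      unfolding G_def by (subst sum_c[symmetric]) (simp only: sum_c[of "\<lambda>q. _ * \<phi> q _ * g _ q"])
    then show ?thesis by (simp add: \<phi>_conj z g G_def)
  qed
  have real: "G (x, 0) (y, 0) = of_real (S x y)" if "x \<in> V" "y \<in> V" for x y
    using G_conj[OF in_C in_C, OF that] by (auto simp: cconj_def S_def complex_eq_iff)
  have lin: "linear_on V (S x)" "linear_on V (\<lambda>y. S y x)" if x: "x \<in> V" for x
    unfolding linear_on_def
  proof (safe)
    fix y z assume yz: "y \<in> V" "z \<in> V"
    show "S x (y + z) = S x y + S x z" "S (y + z) x = S y x + S z x"
      using G_add[OF in_C[OF yz(1)] in_C[OF yz(2)], of "(x, 0)"] by (simp_all add: S_def)
  next
    fix a y assume y: "y \<in> V"
    show "S x (a *\<^sub>R y) = a *\<^sub>R S x y" "S (a *\<^sub>R y) x = a *\<^sub>R S y x"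
      using G_scale[OF in_C[OF y], where a = "of_real a" and w = "(x, 0)"] by (simp_all add: S_def cscale_def)
  qed
  have eq: "cform S z w = G z w" if zw: "z \<in> V \<times> V" "w \<in> V \<times> V" for z w
  proof -
    obtain x y x' y' where xy: "z = (x, y)" "w = (x', y')" "x \<in> V" "y \<in> V" "x' \<in> V" "y' \<in> V"
      using zw by blast
    have "G z w = G (x, 0) (x', 0) + \<i> * G (x, 0) (y', 0) + \<i> * (G (y, 0) (x', 0) + \<i> * G (y, 0) (y', 0))"
      unfolding xy(1,2) cplx_split[of x y] cplx_split[of x' y']
      using in_C xy cplx.subspace_scale[OF csub[OF sub]] by (simp add: G_add G_scale algebra_simps)
    then show ?thesis using xy by (simp add: real cform_def complex_eq_iff)
  qed
  have "G (r p) (r q) = g p q" if "p \<in> P" "q \<in> P" for p q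
  proof -
    have "G (r p) (r q) = (\<Sum>p'\<in>P. \<Sum>q'\<in>P. if p' = p \<and> q' = q then g p q else 0)"
      unfolding G_def using that by (intro sum.cong) (auto simp: \<phi>_r)
    also have "\<dots> = (\<Sum>p'\<in>P. if p' = p then g p q else 0)"
      using that fin by (intro sum.cong refl) auto
    finally show ?thesis using that fin by simp
  qed
  with eq lin r_in that show thesis by metis
qed

end

section \<open>Frames\<close>

text \<open>
  The table behind the five families. Row \<open>i\<close> is the \<open>i\<close>-th string of basis vectors, numbered from 0 in
  the order in which the family lists its rows.
\<close>

fun n_rows :: "triple_type \<Rightarrow> nat" where
  "n_rows (Tr1 l n e) = 1"
| "n_rows (Tr2e l n m e) = 2"
| "n_rows (Tr2 l n m) = 2"
| "n_rows (Tr4 l n m) = 4"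

fun row_len :: "triple_type \<Rightarrow> nat" where
  "row_len (Tr1 l n e) = n"
| "row_len (Tr2e l n m e) = n"
| "row_len (Tr2 l n m) = n"
| "row_len (Tr4 l n m) = n"

text \<open>
  The exponent of the symmetry of \<open>S\<close>. For one string it is forced by \<open>E_per\<close> to be \<open>n - 1\<close>, replaced by \<open>n + 1\<close> to
  avoid truncated subtraction.
\<close>

fun parity :: "triple_type \<Rightarrow> nat" where
  "parity (Tr1 l n e) = n + 1"
| "parity (Tr2e l n m e) = m"
| "parity (Tr2 l n m) = m"
| "parity (Tr4 l n m) = m"

fun eigval :: "triple_type \<Rightarrow> nat \<Rightarrow> complex" where
  "eigval (Tr1 l n e) i = of_real l"
| "eigval (Tr2e l n m e) i = (if i = 0 then l else cnj l)"
| "eigval (Tr2 l n m) i = (if i = 0 then of_real l else inverse (of_real l))"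
| "eigval (Tr4 l n m) i = [l, inverse l, cnj l, inverse (cnj l)] ! i"

fun conj_row :: "triple_type \<Rightarrow> nat \<Rightarrow> nat" where
  "conj_row (Tr1 l n e) i = i"
| "conj_row (Tr2e l n m e) i = 1 - i"
| "conj_row (Tr2 l n m) i = i"
| "conj_row (Tr4 l n m) i = [2, 3, 0, 1] ! i"

text \<open>
  Row \<open>i\<close> and row \<open>dual_row t i\<close> have the Gram matrix \<open>gram_const t i\<close> times \<open>E_per\<close>; all other blocks are zero.
\<close>

fun dual_row :: "triple_type \<Rightarrow> nat \<Rightarrow> nat" where
  "dual_row (Tr1 l n e) i = i"
| "dual_row (Tr2e l n m e) i = 1 - i"
| "dual_row (Tr2 l n m) i = 1 - i"
| "dual_row (Tr4 l n m) i = [1, 0, 3, 2] ! i"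

fun gram_const :: "triple_type \<Rightarrow> nat \<Rightarrow> complex" where
  "gram_const (Tr1 l n e) i = of_real e"
| "gram_const (Tr2e l n m e) i = \<i> ^ (n + m + 1) * of_real e * (if i = 0 then 1 else (-1) ^ (n + m + 1))"
| "gram_const (Tr2 l n m) i = (if i = 0 then 1 else (-1) ^ (n + m + 1))"
| "gram_const (Tr4 l n m) i = (if even i then 1 else (-1) ^ (n + m + 1))"

lemma lt_4_cases: "i < 4 \<Longrightarrow> i = 0 \<or> i = 1 \<or> i = 2 \<or> i = (3::nat)"
  by auto

lemma lt_2_cases: "i < 2 \<Longrightarrow> i = 0 \<or> i = (1::nat)"
  by auto

text \<open>
  Conjugation and duality are commuting involutions of the rows, compatible with eigenvalues and with
  the constants of the form. These identities are what general arguments on frames need to know of the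
  table, so that they require no distinction of the families.
\<close>

lemma datum:
  assumes "listed_type t" "i < n_rows t"
  shows "conj_row t i < n_rows t" "dual_row t i < n_rows t" "conj_row t (conj_row t i) = i" "dual_row t (dual_row t i) = i"
    "dual_row t (conj_row t i) = conj_row t (dual_row t i)" "eigval t (conj_row t i) = cnj (eigval t i)" "eigval t (dual_row t i) = inverse (eigval t i)"
    "eigval t i \<noteq> 0" "gram_const t i \<noteq> 0" "gram_const t (conj_row t i) = cnj (gram_const t i)"
    "gram_const t (dual_row t i) = (-1) ^ (parity t + row_len t + 1) * gram_const t i" "row_len t \<ge> 1"
proof -
  have c1: "cnj l = inverse l" if "cmod l = 1" for l
  proof -
    have "l * cnj l = 1" using that by (simp add: complex_norm_square[symmetric])
    then show ?thesis by (metis inverse_unique)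
  qed
  have c2: "cnj l = inverse l" if "l = 1 \<or> l = -1" for l using that by auto
  have ci: "(- \<i>) ^ k = (-1) ^ k * \<i> ^ k" for k
    by (rule power_minus)
  have sq: "(-1::complex) ^ k * (-1) ^ k = 1" for k by (simp flip: power_mult_distrib)
  from assms
  have "conj_row t i < n_rows t \<and> dual_row t i < n_rows t \<and> conj_row t (conj_row t i) = i \<and> dual_row t (dual_row t i) = i \<and>
    dual_row t (conj_row t i) = conj_row t (dual_row t i) \<and> eigval t (conj_row t i) = cnj (eigval t i) \<and> eigval t (dual_row t i) = inverse (eigval t i) \<and>
    eigval t i \<noteq> 0 \<and> gram_const t i \<noteq> 0 \<and> gram_const t (conj_row t i) = cnj (gram_const t i) \<and>
    gram_const t (dual_row t i) = (-1) ^ (parity t + row_len t + 1) * gram_const t i \<and> row_len t \<ge> 1"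
  proof (cases rule: listed_type.cases)
    case (1 n l e)
    then show ?thesis using assms by (auto simp: power_add)
  next
    case (2 n l m)
    then show ?thesis using assms lt_2_cases[of i] by (auto simp: ci sq c2 power_add mult_ac)
  next
    case (3 n l m e)
    then have "l \<noteq> 0" by auto
    then show ?thesis using 3 assms lt_2_cases[of i] c1[OF 3(3)] by (auto simp: ci sq power_add mult_ac)
  next
    case (4 n l m)
    then show ?thesis using assms lt_2_cases[of i] by (auto simp: sq add.commute)
  next
    case (5 n l m)
    then have "l \<noteq> 0" by auto
    moreover have "i = 0 \<or> i = 1 \<or> i = 2 \<or> i = 3" using 5 assms lt_4_cases[of i] by simp
    ultimately show ?thesis using 5(1,2) by (elim disjE) (simp_all add: sq add.commute)
  qed
  then show "conj_row t i < n_rows t" "dual_row t i < n_rows t" "conj_row t (conj_row t i) = i" "dual_row t (dual_row t i) = i"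
    "dual_row t (conj_row t i) = conj_row t (dual_row t i)" "eigval t (conj_row t i) = cnj (eigval t i)" "eigval t (dual_row t i) = inverse (eigval t i)"
    "eigval t i \<noteq> 0" "gram_const t i \<noteq> 0" "gram_const t (conj_row t i) = cnj (gram_const t i)"
    "gram_const t (dual_row t i) = (-1) ^ (parity t + row_len t + 1) * gram_const t i" "row_len t \<ge> 1" by blast+
qed

definition idx :: "triple_type \<Rightarrow> (nat \<times> nat) set" where
  "idx t = {..<n_rows t} \<times> {1..row_len t}"

text \<open>
  The equations for a frame without the spanning condition. Linear independence follows from them,
  since the Gram matrix is invertible; see \<open>coord_r\<close>.
\<close>

definition preframe ::
    "'a::real_vector set \<Rightarrow> ('a \<Rightarrow> 'a) \<Rightarrow> ('a \<Rightarrow> 'a \<Rightarrow> real) \<Rightarrow> triple_type \<Rightarrow> (nat \<Rightarrow> nat \<Rightarrow> 'a \<times> 'a) \<Rightarrow> bool" where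
  "preframe V M S t r \<longleftrightarrow>
     (\<forall>i<n_rows t. \<forall>k\<in>{1..row_len t}. r i k \<in> V \<times> V \<and> cconj (r i k) = r (conj_row t i) k) \<and>
     (\<forall>i<n_rows t. cplx0.exp_chain (row_len t) (eigval t i) (map_prod M M) (r i)) \<and>
     (\<forall>i<n_rows t. \<forall>j<n_rows t. gram_eq (row_len t) (cform S) (r i) (r j) (if j = dual_row t i then gram_const t i else 0))"

definition frame ::
    "'a::real_vector set \<Rightarrow> ('a \<Rightarrow> 'a) \<Rightarrow> ('a \<Rightarrow> 'a \<Rightarrow> real) \<Rightarrow> triple_type \<Rightarrow> (nat \<Rightarrow> nat \<Rightarrow> 'a \<times> 'a) \<Rightarrow> bool" where
  "frame V M S t r \<longleftrightarrow> preframe V M S t r \<and> cplx.span (case_prod r ` idx t) = V \<times> V"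

text \<open>
  The coefficient of \<open>r i k\<close> is obtained by pairing with the vector in the dual row at the position opposite
  to \<open>k\<close>, the only vector of the family that does not annihilate \<open>r i k\<close>.
\<close>

definition coord ::
    "('a::real_vector \<Rightarrow> 'a \<Rightarrow> real) \<Rightarrow> triple_type \<Rightarrow> (nat \<Rightarrow> nat \<Rightarrow> 'a \<times> 'a) \<Rightarrow> nat \<times> nat \<Rightarrow> 'a \<times> 'a \<Rightarrow> complex" where
  "coord S t r p z = cform S z (r (dual_row t (fst p)) (row_len t + 1 - snd p)) / (gram_const t (fst p) * (-1) ^ (snd p - 1))"

locale preframed = isometric_triple V M S
  for V :: "'a::real_vector set" and M S +
  fixes t :: triple_type and r :: "nat \<Rightarrow> nat \<Rightarrow> 'a \<times> 'a"
  assumes listed: "listed_type t" and pre: "preframe V M S t r"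
begin

abbreviation "n \<equiv> row_len t"
abbreviation "s \<equiv> n_rows t"
abbreviation "\<phi> \<equiv> coord S t r"
abbreviation "conj_idx \<equiv> \<lambda>p. (conj_row t (fst p), snd p)"

sublocale C: iso_space cscale "V \<times> V" "map_prod M M" "cform S"
  by (rule cplx_space)

lemma r_mem: "i < s \<Longrightarrow> k \<in> {1..n} \<Longrightarrow> r i k \<in> V \<times> V"
  and r_conj: "i < s \<Longrightarrow> k \<in> {1..n} \<Longrightarrow> cconj (r i k) = r (conj_row t i) k"
  using pre unfolding preframe_def by blast+

lemma r_chain: "i < s \<Longrightarrow> k \<in> {1..n} \<Longrightarrow>
    map_prod M M (r i k) = cscale (eigval t i) (\<Sum>j=0..n-k. cscale (1 / fact j) (r i (k + j)))"
  using pre unfolding preframe_def cplx0.exp_chain_def by blast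

lemma r_gram: "i < s \<Longrightarrow> i' < s \<Longrightarrow> j \<in> {1..n} \<Longrightarrow> k \<in> {1..n} \<Longrightarrow>
    cform S (r i j) (r i' k) = (if i' = dual_row t i \<and> j = n + 1 - k then gram_const t i * (-1) ^ (j - 1) else 0)"
  using pre unfolding preframe_def gram_eq_def E_per_def by simp

lemma dual_mem: "p \<in> idx t \<Longrightarrow> r (dual_row t (fst p)) (n + 1 - snd p) \<in> V \<times> V"
  by (rule r_mem) (auto simp: idx_def datum(2)[OF listed])

lemma coord_add: "p \<in> idx t \<Longrightarrow> z \<in> V \<times> V \<Longrightarrow> w \<in> V \<times> V \<Longrightarrow> \<phi> p (z + w) = \<phi> p z + \<phi> p w"
  by (simp only: coord_def C.S_add_left dual_mem add_divide_distrib)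

lemma coord_scale: "p \<in> idx t \<Longrightarrow> z \<in> V \<times> V \<Longrightarrow> \<phi> p (cscale a z) = a * \<phi> p z"
  by (simp only: coord_def C.S_scale_left dual_mem times_divide_eq_right)

lemma coord_r: "p \<in> idx t \<Longrightarrow> q \<in> idx t \<Longrightarrow> \<phi> p (case_prod r q) = (if p = q then 1 else 0)"
proof -
  assume pq: "p \<in> idx t" "q \<in> idx t"
  obtain i k j l where eq: "p = (i, k)" "q = (j, l)" by (metis surj_pair)
  have b: "i < s" "j < s" "k \<in> {1..n}" "l \<in> {1..n}" using pq by (auto simp: eq idx_def)
  have "dual_row t i = dual_row t j \<longleftrightarrow> i = j"
    using datum(4)[OF listed b(1)] datum(4)[OF listed b(2)] by metis
  moreover have "n + 1 - k \<in> {1..n}" using b by auto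
  moreover have "l = n + 1 - (n + 1 - k) \<longleftrightarrow> k = l" using b by auto
  ultimately show ?thesis
    using r_gram[OF b(2) datum(2)[OF listed b(1)] b(4), of "n + 1 - k"] datum(9)[OF listed b(2)] b
    by (simp add: coord_def eq)
qed

lemma r_mem': "p \<in> idx t \<Longrightarrow> case_prod r p \<in> V \<times> V"
  by (cases p) (auto simp: idx_def intro: r_mem)

lemma span_subset: "cplx.span (case_prod r ` idx t) \<subseteq> V \<times> V"
  by (intro cplx.span_minimal csub subspace image_subsetI r_mem')

lemma coord_sum:
  assumes "p \<in> idx t" "\<And>i. i \<in> I \<Longrightarrow> z i \<in> V \<times> V"
  shows "\<phi> p (\<Sum>i\<in>I. cscale (a i) (z i)) = (\<Sum>i\<in>I. a i * \<phi> p (z i))"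
  using assms(2)
proof (induction I rule: infinite_finite_induct)
  case (insert i I)
  then have "(\<Sum>i\<in>I. cscale (a i) (z i)) \<in> V \<times> V" "cscale (a i) (z i) \<in> V \<times> V"
    by (intro csum_mem[OF subspace] cplx.subspace_scale[OF csub[OF subspace]]; simp)+
  with insert assms(1) show ?case by (simp add: coord_add coord_scale)
qed (use coord_scale[OF assms(1), of 0 0] subspace_0[OF subspace] in \<open>simp_all add: zero_prod_def\<close>)

lemma finite_idx: "finite (idx t)"
  by (simp add: idx_def)

lemma span_expand:
  assumes "z \<in> cplx.span (case_prod r ` idx t)"
  shows "z = (\<Sum>p\<in>idx t. cscale (\<phi> p z) (case_prod r p))"
proof -
  have "z \<in> V \<times> V \<and> z = (\<Sum>p\<in>idx t. cscale (\<phi> p z) (case_prod r p))"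
    using assms
  proof (induction rule: cplx.span_induct_alt)
    case base
    have "\<phi> p 0 = 0" if "p \<in> idx t" for p
      using coord_scale[OF that, of 0 0] subspace_0[OF subspace] by (simp add: zero_prod_def)
    then have "(\<Sum>p\<in>idx t. cscale (\<phi> p 0) (case_prod r p)) = 0" by (intro sum.neutral) simp
    then show ?case using cplx.subspace_0[OF csub[OF subspace]] by simp
  next
    case (step c x y)
    then obtain q where q: "q \<in> idx t" "x = case_prod r q" by blast
    have x: "x \<in> V \<times> V" using q r_mem' by simp
    have cx: "cscale c x \<in> V \<times> V" by (rule cplx.subspace_scale[OF csub[OF subspace] x])
    have "(\<Sum>p\<in>idx t. cscale (\<phi> p x) (case_prod r p)) = (\<Sum>p\<in>idx t. if p = q then x else 0)"
      using q by (intro sum.cong) (auto simp: coord_r)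
    also have "\<dots> = x" using q finite_idx by simp
    finally have "(\<Sum>p\<in>idx t. cscale (\<phi> p (cscale c x + y)) (case_prod r p))
        = cscale c x + (\<Sum>p\<in>idx t. cscale (\<phi> p y) (case_prod r p))"
      using step cx x
      by (simp add: coord_add coord_scale cplx.scale_left_distrib sum.distrib
          flip: cplx.scale_scale cplx.scale_sum_right)
    then show ?case using step cx cplx.subspace_add[OF csub[OF subspace] cx] by auto
  qed
  then show ?thesis ..
qed

lemma coord_conj:
  assumes p: "p \<in> idx t" and z: "z \<in> V \<times> V"
  shows "\<phi> (conj_idx p) (cconj z) = cnj (\<phi> p z)"
proof -
  obtain i k where eq: "p = (i, k)" and ik: "i < s" "k \<in> {1..n}" using p by (auto simp: idx_def)
  have k': "n + 1 - k \<in> {1..n}" using ik by auto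
  note d = datum(2)[OF listed ik(1)]
  have "cform S (cconj z) (r (conj_row t (dual_row t i)) (n + 1 - k)) = cnj (cform S z (r (dual_row t i) (n + 1 - k)))"
    using cS_cconj[OF _ _ z r_mem[OF d k']] unfolding r_conj[OF d k'] .
  then show ?thesis
    using datum[OF listed ik(1)] by (simp add: coord_def eq)
qed

end

text \<open>
  Internal direct sums are given as bijections on lists; this is the usual criterion for two summands.
\<close>

lemma direct_sum_2:
  assumes "subspace U" "subspace W" "subspace V"
    and "U \<subseteq> V" "W \<subseteq> V" and "U \<inter> W = {0}" and "\<And>x. x \<in> V \<Longrightarrow> \<exists>u\<in>U. x - u \<in> W"
  shows "direct_sum [U, W] (V :: 'a::real_vector set)"
proof -
  have ls: "listset [U, W] = {[u, w] | u w. u \<in> U \<and> w \<in> W}" by (auto simp: set_Cons_def)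
  have "inj_on sum_list (listset [U, W])"
  proof (rule inj_onI)
    fix xs ys assume "xs \<in> listset [U, W]" "ys \<in> listset [U, W]" and eq: "sum_list xs = sum_list ys"
    then obtain u w u' w' where xy: "xs = [u, w]" "ys = [u', w']" "u \<in> U" "u' \<in> U" "w \<in> W" "w' \<in> W"
      unfolding ls by blast
    have "u - u' = w' - w" using eq xy by (simp add: algebra_simps)
    moreover have "u - u' \<in> U" "w' - w \<in> W" using xy assms(1,2) by (simp_all add: subspace_diff)
    ultimately have "u - u' \<in> U \<inter> W" "w' - w \<in> U \<inter> W" by auto
    then show "xs = ys" using assms(6) xy by simp
  qed
  moreover have "sum_list ` listset [U, W] = V"
  proof
    show "sum_list ` listset [U, W] \<subseteq> V"
      unfolding ls using assms by (auto intro!: subspace_add)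
    show "V \<subseteq> sum_list ` listset [U, W]"
    proof
      fix x assume "x \<in> V"
      then obtain u where "u \<in> U" "x - u \<in> W" using assms(7) by blast
      then have "[u, x - u] \<in> listset [U, W]" unfolding ls by blast
      moreover have "x = sum_list [u, x - u]" by simp
      ultimately show "x \<in> sum_list ` listset [U, W]" by blast
    qed
  qed
  ultimately show ?thesis by (simp add: direct_sum_def bij_betw_def)
qed

context preframed
begin

lemma M_span:
  assumes "z \<in> cplx.span (case_prod r ` idx t)"
  shows "map_prod M M z \<in> cplx.span (case_prod r ` idx t)"
proof -
  have "z \<in> V \<times> V \<and> map_prod M M z \<in> cplx.span (case_prod r ` idx t)"
    using assms
  proof (induction rule: cplx.span_induct_alt)
    case base
    then show ?case
      using C.V_sub C.endo_on_0[OF C.M_endo] by (simp add: cplx.subspace_0 cplx.span_zero)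
  next
    case (step c x y)
    then obtain i k where x: "i < s" "k \<in> {1..n}" "x = r i k" by (auto simp: idx_def)
    have xV: "x \<in> V \<times> V" "cscale c x \<in> V \<times> V"
      using r_mem[OF x(1,2)] x(3) cplx.subspace_scale[OF C.V_sub] by auto
    have "map_prod M M x \<in> cplx.span (case_prod r ` idx t)"
      unfolding x(3) r_chain[OF x(1,2)]
      using x by (intro cplx.span_scale cplx.span_sum cplx.span_base) (auto simp: idx_def)
    then show ?case
      using step xV cplx.subspace_add[OF C.V_sub xV(2)]
      by (simp add: C.endo_onD(3,4)[OF C.M_endo] cplx.span_add cplx.span_scale)
  qed
  then show ?thesis ..
qed

text \<open>
  The orthogonal complement of the strings is invariant. By invariance of the form \<open>M z\<close> is orthogonal
  to \<open>M (r i k)\<close>, which is a multiple of \<open>r i k\<close> plus later vectors of the string; the induction therefore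
  runs from the end of the string.
\<close>

lemma orthogonal_M:
  assumes z: "z \<in> V \<times> V" and orth: "\<And>i k. i < s \<Longrightarrow> k \<in> {1..n} \<Longrightarrow> cform S z (r i k) = 0"
    and i: "i < s" "k \<in> {1..n}"
  shows "cform S (map_prod M M z) (r i k) = 0"
  using i(2)
proof (induction "n - k" arbitrary: k rule: less_induct)
  case less
  have Mz: "map_prod M M z \<in> V \<times> V" by (rule C.M_in[OF z])
  define w where "w = (\<Sum>j=1..n-k. cscale (1 / fact j) (r i (k + j)))"
  have w: "w \<in> V \<times> V"
    unfolding w_def using less.prems by (intro csum_mem[OF subspace] r_mem[OF i(1)]) auto
  have "(\<Sum>j=0..n-k. cscale (1 / fact j) (r i (k + j))) = r i k + w"
    unfolding w_def by (subst sum.atLeast_Suc_atMost) simp_all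
  then have eq: "map_prod M M (r i k) = cscale (eigval t i) (r i k + w)"
    using r_chain[OF i(1) less.prems] by simp
  have "cform S (map_prod M M z) w = (\<Sum>j=1..n-k. 1 / fact j * cform S (map_prod M M z) (r i (k + j)))"
    unfolding w_def using less.prems
    by (subst C.S_sum_right)
      (auto intro!: cplx.subspace_scale[OF C.V_sub] sum.cong simp: C.S_scale_right Mz[simplified] r_mem[OF i(1), simplified] r_mem[OF i(1)] Mz)
  also have "\<dots> = 0"
    using less.hyps less.prems by (intro sum.neutral) auto
  finally have "cform S (map_prod M M z) w = 0" .
  moreover have "cform S (map_prod M M z) (map_prod M M (r i k)) = 0"
    using C.isom[OF z r_mem[OF i(1) less.prems]] orth[OF i(1) less.prems] by simp
  moreover have "r i k + w \<in> V \<times> V"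
    by (rule cplx.subspace_add[OF C.V_sub r_mem[OF i(1) less.prems] w])
  ultimately show ?case
    using Mz r_mem[OF i(1) less.prems] w datum(8)[OF listed i(1)]
    unfolding eq by (simp add: C.S_scale_right C.S_add_right)
qed

text \<open>
  The span of a preframe is closed under conjugation, so it is the complexification of a subspace \<open>U\<close>, and
  the form is nondegenerate on it. Thus \<open>V\<close> is the direct sum of \<open>U\<close> and its orthogonal complement \<open>W\<close>,
  both are \<open>M\<close>-invariant, and irreducibility leaves only \<open>W = 0\<close>.
\<close>

lemma frame_if_irreducible:
  assumes irr: "irreducible_triple V M S"
  shows "frame V M S t r"
proof -
  let ?Z = "cplx.span (case_prod r ` idx t)"
  define U where "U = {x \<in> V. (x, 0) \<in> ?Z}"
  define W where "W = {x \<in> V. \<forall>p\<in>idx t. cform S (x, 0) (case_prod r p) = 0}"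
  have in_C: "(x, 0) \<in> V \<times> V" if "x \<in> V" for x using that subspace_0[OF subspace] by simp
  have p_add: "(x + y, 0) = (x, 0) + (y, 0::'a)" and p_sc: "(a *\<^sub>R x, 0::'a) = cscale (of_real a) (x, 0)" for x y :: 'a and a
    by (simp_all add: cscale_def)
  have M_real: "(M x, 0) = map_prod M M (x, 0)" if "x \<in> V" for x
    using linear_on_0[OF aut_linear subspace] by simp
  have subU: "subspace U"
    unfolding U_def using subspace cplx.span_zero
    by (intro subspaceI)
      (auto simp: subspace_0 subspace_add subspace_scale p_add p_sc zero_prod_def simp del: add_Pair
        intro: cplx.span_add cplx.span_scale)
  have subW: "subspace W"
    unfolding W_def using subspace in_C r_mem'
    by (intro subspaceI)
      (auto simp: subspace_0 subspace_add subspace_scale p_add p_sc simp del: add_Pair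
        simp: C.S_add_left C.S_scale_left C.S_0 zero_prod_def[symmetric] mem_Times_iff)
  have orth_Z: "cform S (x, 0) z = 0" if "x \<in> W" "z \<in> ?Z" for x z
  proof -
    have xC: "(x, 0) \<in> V \<times> V" by (rule in_C) (use that(1) in \<open>simp add: W_def\<close>)
    have "z \<in> V \<times> V \<and> cform S (x, 0) z = 0" using that(2)
    proof (induction rule: cplx.span_induct_alt)
      case base
      then show ?case using xC C.V_sub by (simp add: cplx.subspace_0)
    next
      case (step c y z)
      then obtain p where p: "p \<in> idx t" "y = case_prod r p" by blast
      have "y \<in> V \<times> V" "cscale c y \<in> V \<times> V"
        using p r_mem' cplx.subspace_scale[OF C.V_sub] by auto
      moreover have "cform S (x, 0) y = 0" using that(1) p by (simp add: W_def)
      ultimately show ?case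
        using step xC cplx.subspace_add[OF C.V_sub, of "cscale c y" z] by (simp add: C.S_add_right C.S_scale_right)
    qed
    then show ?thesis ..
  qed
  have split: "\<exists>u\<in>U. x - u \<in> W" if x: "x \<in> V" for x
  proof -
    \<comment> \<open>the orthogonal projection of the real vector \<open>x\<close>, which is real as well\<close>
    define z where "z = (\<Sum>p\<in>idx t. cscale (\<phi> p (x, 0)) (case_prod r p))"
    have zZ: "z \<in> ?Z" unfolding z_def by (intro cplx.span_sum cplx.span_scale cplx.span_base) auto
    have cp: "conj_idx p \<in> idx t" "conj_idx (conj_idx p) = p" if "p \<in> idx t" for p
      using that datum[OF listed, of "fst p"] by (auto simp: idx_def)
    have "cconj z = (\<Sum>p\<in>idx t. cscale (\<phi> (conj_idx p) (x, 0)) (case_prod r (conj_idx p)))"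
      unfolding z_def cconj_sum cconj_scale
    proof (intro sum.cong refl)
      fix p assume p: "p \<in> idx t"
      then have "cconj (case_prod r p) = case_prod r (conj_idx p)" by (cases p) (auto simp: idx_def r_conj)
      moreover have "\<phi> (conj_idx p) (x, 0) = cnj (\<phi> p (x, 0))"
        using coord_conj[OF p in_C[OF x]] by (simp add: cconj_def)
      ultimately show "cscale (cnj (\<phi> p (x, 0))) (cconj (case_prod r p)) = cscale (\<phi> (conj_idx p) (x, 0)) (case_prod r (conj_idx p))"
        by simp
    qed
    also have "\<dots> = z"
      unfolding z_def by (rule sum.reindex_bij_witness[of _ conj_idx conj_idx]) (use cp in auto)
    finally have "- snd z = snd z" by (simp add: cconj_def prod_eq_iff)
    then have "2 *\<^sub>R snd z = 0" unfolding scaleR_2 by (simp add: neg_eq_iff_add_eq_0)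
    then obtain u where u: "z = (u, 0)" by (metis prod.collapse scaleR_eq_0_iff zero_neq_numeral)
    have uU: "u \<in> U" using zZ u span_subset by (auto simp: U_def)
    have uV: "u \<in> V" using uU by (simp add: U_def)
    have d: "\<phi> p (x - u, 0) = 0" if p: "p \<in> idx t" for p
    proof -
      have "\<phi> p z = (\<Sum>q\<in>idx t. \<phi> q (x, 0) * \<phi> p (case_prod r q))"
        unfolding z_def by (rule coord_sum[OF p r_mem'])
      also have "\<dots> = (\<Sum>q\<in>idx t. if q = p then \<phi> q (x, 0) else 0)"
        using p by (intro sum.cong) (auto simp: coord_r)
      finally have "\<phi> p z = \<phi> p (x, 0)" using p finite_idx by simp
      moreover have "\<phi> p ((x - u, 0) + z) = \<phi> p (x - u, 0) + \<phi> p z"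
        unfolding u by (intro coord_add p in_C uV subspace_diff subspace x)
      ultimately show ?thesis by (simp add: u)
    qed
    have "cform S (x - u, 0) (r i k) = 0" if ik: "i < s" "k \<in> {1..n}" for i k
    proof -
      have "(dual_row t i, n + 1 - k) \<in> idx t" using ik datum(2)[OF listed ik(1)] by (auto simp: idx_def)
      from d[OF this] show ?thesis
        using datum[OF listed ik(1)] datum(9)[OF listed datum(2)[OF listed ik(1)]] ik by (simp add: coord_def)
    qed
    then have "x - u \<in> W" using x uV subspace_diff[OF subspace] by (auto simp: W_def idx_def)
    then show ?thesis using uU by blast
  qed
  have "U \<inter> W = {0}"
  proof
    show "U \<inter> W \<subseteq> {0}"
    proof
      fix x assume x: "x \<in> U \<inter> W"
      then have Z: "(x, 0) \<in> ?Z" by (simp add: U_def)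
      have "\<phi> p (x, 0) = 0" if "p \<in> idx t" for p
      proof -
        have "(dual_row t (fst p), n + 1 - snd p) \<in> idx t" using that datum(2)[OF listed] by (auto simp: idx_def)
        then have "cform S (x, 0) (r (dual_row t (fst p)) (n + 1 - snd p)) = 0" using x by (auto simp: W_def)
        then show ?thesis by (simp add: coord_def)
      qed
      then have "(x, 0) = (0 :: 'a \<times> 'a)" using span_expand[OF Z] by simp
      then show "x \<in> {0}" by (simp add: zero_prod_def)
    qed
    show "{0} \<subseteq> U \<inter> W" using subU subW by (simp add: subspace_0)
  qed
  then have ds: "direct_sum [U, W] V"
    by (intro direct_sum_2 subU subW subspace split) (auto simp: U_def W_def)
  have MU: "M ` U \<subseteq> U"
    using M_span M_real M_in unfolding U_def by (metis (no_types, lifting) image_subsetI mem_Collect_eq)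
  have MW: "M ` W \<subseteq> W"
  proof
    fix y assume "y \<in> M ` W"
    then obtain x where x: "x \<in> W" "y = M x" by blast
    then have xV: "x \<in> V" by (simp add: W_def)
    have "cform S (map_prod M M (x, 0)) (r i k) = 0" if "i < s" "k \<in> {1..n}" for i k
      by (rule orthogonal_M[OF in_C[OF xV] _ that]) (use x in \<open>auto simp: W_def idx_def\<close>)
    then show "y \<in> W" using x xV M_real[OF xV] M_in by (auto simp: W_def idx_def)
  qed
  have orth: "S u w = 0 \<and> S w u = 0" if "u \<in> U" "w \<in> W" for u w
  proof -
    have V: "u \<in> V" "w \<in> V" using that by (auto simp: U_def W_def)
    have "S w u = 0" using orth_Z[OF that(2), of "(u, 0)"] that(1) cS_real[OF V(2,1)] by (simp add: U_def)
    moreover obtain m :: nat where m: "\<And>x y. x \<in> V \<Longrightarrow> y \<in> V \<Longrightarrow> S y x = (-1) ^ m * S x y" by (rule sign) blast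
    ultimately show ?thesis using m[OF V(2,1)] by simp
  qed
  have "U = {0} \<or> W = {0}"
    using irr subU subW ds MU MW orth unfolding irreducible_triple_def by blast
  moreover have "U \<noteq> {0}"
  proof
    assume U0: "U = {0}"
    have "x \<in> W" if "x \<in> V" for x using split[OF that] U0 by simp
    moreover have "W \<subseteq> V" by (auto simp: W_def)
    ultimately have WV: "W = V" by blast
    have s0: "0 < s" by (cases t) auto
    have n1: "1 \<in> {1..n}" "n \<in> {1..n}" using datum(12)[OF listed s0] by auto
    note d = datum(2)[OF listed s0]
    obtain x y where xy: "r 0 1 = (x, y)" "x \<in> V" "y \<in> V" using r_mem[OF s0 n1(1)] by blast
    have z: "cform S (v, 0) (r (dual_row t 0) n) = 0" if "v \<in> V" for v
    proof -
      have "v \<in> W" using that WV by simp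
      moreover have "(dual_row t 0, n) \<in> idx t" using n1 d by (simp add: idx_def)
      ultimately show ?thesis by (auto simp: W_def)
    qed
    have "cform S (r 0 1) (r (dual_row t 0) n) = cform S (x, 0) (r (dual_row t 0) n) + \<i> * cform S (y, 0) (r (dual_row t 0) n)"
      unfolding xy(1) cplx_split[of x y]
      using in_C xy r_mem[OF d n1(2)] cplx.subspace_scale[OF C.V_sub] by (simp add: C.S_add_left C.S_scale_left)
    also have "\<dots> = 0" using z xy by simp
    finally show False
      using r_gram[OF s0 d n1] datum(9)[OF listed s0] by simp
  qed
  ultimately have W0: "W = {0}" by blast
  have UV: "U = V" using split W0 by (fastforce simp: U_def)
  have "V \<times> V \<subseteq> ?Z"
  proof (clarify, subst cplx_split)
    fix x y assume "x \<in> V" "y \<in> V"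
    then show "(x, 0) + cscale \<i> (y, 0) \<in> ?Z"
      using UV by (intro cplx.span_add cplx.span_scale) (auto simp: U_def)
  qed
  then show ?thesis using pre span_subset by (auto simp: frame_def)
qed

end

locale framed = preframed +
  assumes fr: "frame V M S t r"
begin

lemma span_r: "cplx.span (case_prod r ` idx t) = V \<times> V"
  using fr by (simp add: frame_def)

sublocale K: coords V "idx t" "case_prod r" \<phi> conj_idx
proof
  show "subspace V" by (rule subspace)
  show "finite (idx t)" by (rule finite_idx)
  show "conj_idx p \<in> idx t" "conj_idx (conj_idx p) = p" if "p \<in> idx t" for p
    using that datum[OF listed, of "fst p"] by (auto simp: idx_def)
  show "cconj (case_prod r p) = case_prod r (conj_idx p)" if "p \<in> idx t" for p
    using that by (cases p) (auto simp: idx_def r_conj)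
  show "z = (\<Sum>p\<in>idx t. cscale (\<phi> p z) (case_prod r p))" if "z \<in> V \<times> V" for z
    using span_expand span_r that by blast
qed (use r_mem' coord_add coord_scale coord_r in auto)

end

section \<open>Isomorphisms and frames\<close>

lemma clin_scale: "linear_on V f \<Longrightarrow> subspace V \<Longrightarrow> u \<in> V \<times> V \<Longrightarrow> map_prod f f (cscale c u) = cscale c (map_prod f f u)"
  using csum_linear[of V f "{()}" "\<lambda>_. u" "\<lambda>_. c"] by simp

lemma exp_chain_image:
  assumes f: "linear_on V f" "subspace V" and r: "\<And>k. k \<in> {1..n} \<Longrightarrow> r k \<in> V \<times> V"
    and ch: "cplx0.exp_chain n l (map_prod M M) r" and comm: "\<And>x. x \<in> V \<Longrightarrow> f (M x) = M' (f x)"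
  shows "cplx0.exp_chain n l (map_prod M' M') (\<lambda>k. map_prod f f (r k))"
  unfolding cplx0.exp_chain_def
proof
  fix k assume k: "k \<in> {1..n}"
  have "map_prod M' M' (map_prod f f (r k)) = map_prod f f (map_prod M M (r k))"
    using r[OF k] comm by auto
  also have "\<dots> = map_prod f f (cscale l (\<Sum>j=0..n-k. cscale (1 / fact j) (r (k + j))))"
    using ch k by (simp add: cplx0.exp_chain_def)
  also have "\<dots> = cscale l (\<Sum>j=0..n-k. cscale (1 / fact j) (map_prod f f (r (k + j))))"
  proof -
    have m: "r (k + j) \<in> V \<times> V" if "j \<in> {0..n-k}" for j using that k by (intro r) auto
    have "(\<Sum>j=0..n-k. cscale (1 / fact j) (r (k + j))) \<in> V \<times> V" by (rule csum_mem[OF f(2) m])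
    then show ?thesis
      by (subst clin_scale[OF f]) (simp_all only: csum_linear[OF f m])
  qed
  finally show "map_prod M' M' (map_prod f f (r k))
      = cscale l (\<Sum>j=0..n-k. cscale (1 / fact j) (map_prod f f (r (k + j))))" .
qed

text \<open>
  Frames are transported by isomorphisms, as every condition is expressed by \<open>M\<close>, \<open>S\<close> and conjugation.
\<close>

lemma framed_isomorphic:
  assumes fr: "framed V M S t r" and it: "isometric_triple V' M' S'" and iso: "isomorphic_triples V M S V' M' S'"
  shows "\<exists>r'. framed V' M' S' t r'"
proof -
  interpret framed V M S t r by fact
  interpret I: isometric_triple V' M' S' by fact
  obtain f where f: "linear_on V f" "bij_betw f V V'" "\<And>x. x \<in> V \<Longrightarrow> f (M x) = M' (f x)"
    "\<And>x y. x \<in> V \<Longrightarrow> y \<in> V \<Longrightarrow> S' (f x) (f y) = S x y"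
    using iso unfolding isomorphic_triples_def by blast
  define F where "F = map_prod f f"
  have fV: "f x \<in> V'" if "x \<in> V" for x using f(2) that by (auto simp: bij_betw_def)
  have FV: "F z \<in> V' \<times> V'" if "z \<in> V \<times> V" for z using that fV by (auto simp: F_def)
  have FS: "cform S' (F z) (F w) = cform S z w" if "z \<in> V \<times> V" "w \<in> V \<times> V" for z w
    using that f(4) by (auto simp: F_def cform_def)
  define r' where "r' = (\<lambda>i k. F (r i k))"
  have pre': "preframe V' M' S' t r'"
    unfolding preframe_def
  proof (intro conjI allI impI ballI)
    fix i k assume ik: "i < s" "k \<in> {1..n}"
    show "r' i k \<in> V' \<times> V'" using FV r_mem[OF ik] by (simp add: r'_def)
    show "cconj (r' i k) = r' (conj_row t i) k"
      unfolding r'_def F_def using cconj_map_prod[OF f(1) r_mem[OF ik]] r_conj[OF ik] by simp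
  next
    fix i assume i: "i < s"
    have ch: "cplx0.exp_chain n (eigval t i) (map_prod M M) (r i)" using pre i by (simp add: preframe_def)
    show "cplx0.exp_chain n (eigval t i) (map_prod M' M') (r' i)"
      unfolding r'_def F_def by (rule exp_chain_image[where r = "r i" and M = M and M' = M', OF f(1) subspace r_mem[OF i] ch f(3)])
  next
    fix i j assume "i < s" "j < s"
    then show "gram_eq n (cform S') (r' i) (r' j) (if j = dual_row t i then gram_const t i else 0)"
      using pre r_mem by (simp add: preframe_def gram_eq_def r'_def FS)
  qed
  have "V' \<times> V' \<subseteq> cplx.span (case_prod r' ` idx t)"
  proof
    fix z' assume "z' \<in> V' \<times> V'"
    then obtain z where z: "z \<in> V \<times> V" "z' = F z"
      using f(2) by (auto simp: F_def bij_betw_def image_iff)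
    have "F z = F (\<Sum>p\<in>idx t. cscale (\<phi> p z) (case_prod r p))" using K.expand[OF z(1)] by simp
    also have "\<dots> = (\<Sum>p\<in>idx t. cscale (\<phi> p z) (F (case_prod r p)))"
      unfolding F_def by (rule csum_linear(1)[OF f(1) subspace r_mem'])
    also have "\<dots> = (\<Sum>p\<in>idx t. cscale (\<phi> p z) (case_prod r' p))"
      by (simp add: r'_def case_prod_beta)
    also have "\<dots> \<in> cplx.span (case_prod r' ` idx t)"
      by (intro cplx.span_sum cplx.span_scale cplx.span_base) auto
    finally show "z' \<in> cplx.span (case_prod r' ` idx t)" using z by simp
  qed
  moreover have "cplx.span (case_prod r' ` idx t) \<subseteq> V' \<times> V'"
    by (intro cplx.span_minimal csub I.subspace) (use r_mem' FV in \<open>force simp: r'_def idx_def\<close>)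
  ultimately have "frame V' M' S' t r'" using pre' by (auto simp: frame_def)
  then have "framed V' M' S' t r'"
    using it listed pre' by (intro framed.intro preframed.intro framed_axioms.intro preframed_axioms.intro)
  then show ?thesis by blast
qed

lemma map_prod_comp: "map_prod f f (map_prod g g z) = map_prod (\<lambda>x. f (g x)) (\<lambda>x. f (g x)) z"
  by (cases z) simp

lemma map_prod_id: "map_prod (\<lambda>x. x) (\<lambda>x. x) z = z"
  by (cases z) simp

lemma linear_on_comp:
  "linear_on V f \<Longrightarrow> (\<And>x. x \<in> V \<Longrightarrow> f x \<in> W) \<Longrightarrow> linear_on W g \<Longrightarrow> linear_on V (\<lambda>x. g (f x))"
  by (simp add: linear_on_def)

lemma (in coords) form_eq:
  assumes S: "\<And>x. x \<in> V \<Longrightarrow> linear_on V (S x)" "\<And>y. y \<in> V \<Longrightarrow> linear_on V (\<lambda>x. S x y)"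
    and T: "\<And>x. x \<in> V \<Longrightarrow> linear_on V (T x)" "\<And>y. y \<in> V \<Longrightarrow> linear_on V (\<lambda>x. T x y)"
    and eq: "\<And>p q. p \<in> P \<Longrightarrow> q \<in> P \<Longrightarrow> cform S (r p) (r q) = cform T (r p) (r q)"
  shows "z \<in> V \<times> V \<Longrightarrow> w \<in> V \<times> V \<Longrightarrow> cform S z w = cform T z w"
    and "x \<in> V \<Longrightarrow> y \<in> V \<Longrightarrow> S x y = T x y"
proof -
  show C: "cform S z w = cform T z w" if "z \<in> V \<times> V" "w \<in> V \<times> V" for z w
  proof -
    have "cform S z w = (\<Sum>p\<in>P. \<Sum>q\<in>P. \<phi> p z * \<phi> q w * cform S (r p) (r q))"
      using S that by (rule form_expand)
    also have "\<dots> = (\<Sum>p\<in>P. \<Sum>q\<in>P. \<phi> p z * \<phi> q w * cform T (r p) (r q))"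
      by (intro sum.cong refl) (simp add: eq)
    also have "\<dots> = cform T z w"
      using T that by (rule form_expand[symmetric])
    finally show ?thesis .
  qed
  show "S x y = T x y" if "x \<in> V" "y \<in> V"
  proof -
    have "(x, 0) \<in> V \<times> V" "(y, 0) \<in> V \<times> V" using that subspace_0[OF sub] by auto
    from C[OF this] have "complex_of_real (S x y) = of_real (T x y)"
      using cform_real[OF sub S that(2), of x] cform_real[OF sub T that(2), of x] that(1) by simp
    then show ?thesis by simp
  qed
qed

text \<open>
  Two frames of the same type have the same conjugation, the same matrix of \<open>M\<close> and the same Gram matrix.
  The linear map that matches them is therefore real, bijective and compatible with the whole structure.
\<close>

lemma isomorphic_if_framed:
  assumes fr: "framed V M S t r" and fr': "framed V' M' S' t r'"
  shows "isomorphic_triples V M S V' M' S'"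
proof -
  interpret A: framed V M S t r by fact
  interpret B: framed V' M' S' t r' by fact
  have A_conj: "cconj (case_prod r p) = case_prod r (conj_row t (fst p), snd p)"
    and B_conj: "cconj (case_prod r' p) = case_prod r' (conj_row t (fst p), snd p)" if "p \<in> idx t" for p
    using A.K.r_conj[OF that] B.K.r_conj[OF that] .
  obtain f where f: "linear_on V f" "\<And>x. x \<in> V \<Longrightarrow> f x \<in> V'"
    "\<And>p. p \<in> idx t \<Longrightarrow> map_prod f f (case_prod r p) = case_prod r' p"
    by (rule A.K.extend_linear[where w = "case_prod r'", OF B.subspace B.r_mem' B_conj]) (assumption | rule that)+
  obtain g where g: "linear_on V' g" "\<And>x. x \<in> V' \<Longrightarrow> g x \<in> V"
    "\<And>p. p \<in> idx t \<Longrightarrow> map_prod g g (case_prod r' p) = case_prod r p"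
    by (rule B.K.extend_linear[where w = "case_prod r", OF A.subspace A.r_mem' A_conj]) (assumption | rule that)+
  have id: "linear_on W (\<lambda>x. x)" for W :: "'c::real_vector set" by (simp add: linear_on_def)
  have gf: "g (f x) = x" if "x \<in> V" for x
  proof (rule A.K.linear_eq_real[OF linear_on_comp[OF f(1,2) g(1)] id _ that])
    fix p assume p: "p \<in> idx t"
    show "map_prod (\<lambda>x. g (f x)) (\<lambda>x. g (f x)) (case_prod r p) = map_prod (\<lambda>x. x) (\<lambda>x. x) (case_prod r p)"
      unfolding map_prod_id map_prod_comp[of g f, symmetric] f(3)[OF p] g(3)[OF p] ..
  qed
  have fg: "f (g x) = x" if "x \<in> V'" for x
  proof (rule B.K.linear_eq_real[OF linear_on_comp[OF g(1,2) f(1)] id _ that])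
    fix p assume p: "p \<in> idx t"
    show "map_prod (\<lambda>x. f (g x)) (\<lambda>x. f (g x)) (case_prod r' p) = map_prod (\<lambda>x. x) (\<lambda>x. x) (case_prod r' p)"
      unfolding map_prod_id map_prod_comp[of f g, symmetric] f(3)[OF p] g(3)[OF p] ..
  qed
  have "bij_betw f V V'"
    by (rule bij_betw_byWitness[of _ g]) (use gf fg f(2) g(2) in auto)
  moreover have "f (M x) = M' (f x)" if "x \<in> V" for x
  proof (rule A.K.linear_eq_real[OF linear_on_comp[OF A.aut_linear A.M_in f(1)] linear_on_comp[OF f(1,2) B.aut_linear] _ that])
    fix p assume "p \<in> idx t"
    then obtain i k where p: "p = (i, k)" "i < A.s" "k \<in> {1..A.n}" by (auto simp: idx_def)
    have m: "r i (k + j) \<in> V \<times> V" if "j \<in> {0..A.n-k}" for j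
      using that p(3) by (intro A.r_mem[OF p(2)]) auto
    have fr: "map_prod f f (r i (k + j)) = r' i (k + j)" if "j \<in> {0..A.n-k}" for j
      using f(3)[of "(i, k + j)"] that p by (auto simp: idx_def)
    have "map_prod f f (map_prod M M (r i k)) = cscale (eigval t i) (\<Sum>j=0..A.n-k. cscale (1 / fact j) (map_prod f f (r i (k + j))))"
      unfolding A.r_chain[OF p(2,3)]
      using csum_mem[OF A.subspace m, where a = "\<lambda>j. 1 / fact j"]
      by (subst clin_scale[OF f(1) A.subspace]) (simp_all only: csum_linear[OF f(1) A.subspace m])
    also have "\<dots> = map_prod M' M' (r' i k)"
      unfolding B.r_chain[OF p(2,3)] by (simp add: fr)
    finally show "map_prod (\<lambda>x. f (M x)) (\<lambda>x. f (M x)) (case_prod r p) = map_prod (\<lambda>x. M' (f x)) (\<lambda>x. M' (f x)) (case_prod r p)"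
      using f(3)[OF \<open>p \<in> idx t\<close>] by (simp add: p(1) flip: map_prod_comp)
  qed
  moreover have "S' (f x) (f y) = S x y" if xy: "x \<in> V" "y \<in> V" for x y
  proof -
    define S2 where "S2 = (\<lambda>x y. S' (f x) (f y))"
    have S2: "linear_on V (S2 x)" "linear_on V (\<lambda>y. S2 y x)" if "x \<in> V" for x
      unfolding S2_def using that f(2)
      by (auto intro!: linear_on_comp[OF f(1,2)] B.form_linear_right B.form_linear_left)
    have "cform S2 (case_prod r p) (case_prod r q) = cform S (case_prod r p) (case_prod r q)"
      if pq: "p \<in> idx t" "q \<in> idx t" for p q
    proof -
      have "cform S2 (case_prod r p) (case_prod r q) = cform S' (map_prod f f (case_prod r p)) (map_prod f f (case_prod r q))"
        by (simp add: cform_def S2_def)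
      also have "\<dots> = cform S (case_prod r p) (case_prod r q)"
        using pq by (auto simp: f(3) idx_def A.r_gram B.r_gram)
      finally show ?thesis .
    qed
    from A.K.form_eq(2)[OF S2 A.form_linear_right A.form_linear_left this xy]
    show ?thesis by (simp add: S2_def)
  qed
  ultimately show ?thesis using f(1) unfolding isomorphic_triples_def by blast
qed

section \<open>Models\<close>

text \<open>
  A conjugation that permutes a basis in a prescribed way: from real vectors \<open>e p\<close> put
  \<open>r p = ((e p + e (c p)) + \<i> (e p - e (c p))) / 2\<close>. For a fixed point \<open>c p = p\<close> this is the real vector \<open>e p\<close>, and
  exchanging \<open>p\<close> and \<open>c p\<close> changes the sign of the imaginary part, so one formula serves both cases.
\<close>

lemma coords_of_involution:
  fixes e :: "'p \<Rightarrow> 'a::real_vector" and \<zeta> :: "'p \<Rightarrow> 'a \<Rightarrow> real"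
  assumes V: "subspace V" and P: "finite P" and c: "\<And>p. p \<in> P \<Longrightarrow> c p \<in> P" "\<And>p. p \<in> P \<Longrightarrow> c (c p) = p"
    and e: "\<And>p. p \<in> P \<Longrightarrow> e p \<in> V" and \<zeta>: "\<And>p. p \<in> P \<Longrightarrow> linear_on V (\<zeta> p)"
    and dual: "\<And>p q. p \<in> P \<Longrightarrow> q \<in> P \<Longrightarrow> \<zeta> p (e q) = (if p = q then 1 else 0)"
    and exp: "\<And>x. x \<in> V \<Longrightarrow> x = (\<Sum>p\<in>P. \<zeta> p x *\<^sub>R e p)"
  defines "r \<equiv> \<lambda>p. ((1/2) *\<^sub>R (e p + e (c p)), (1/2) *\<^sub>R (e p - e (c p)))"
    and "\<zeta>' \<equiv> \<lambda>p z. Complex (\<zeta> p (fst z)) (\<zeta> p (snd z))"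
  defines "\<phi> \<equiv> \<lambda>p z. ((1 - \<i>) * \<zeta>' p z + (1 + \<i>) * \<zeta>' (c p) z) / 2"
  shows "coords V P r \<phi> c"
proof
  have \<zeta>_add: "\<zeta>' p (z + w) = \<zeta>' p z + \<zeta>' p w" if "p \<in> P" "z \<in> V \<times> V" "w \<in> V \<times> V" for p z w
    using that linear_onD(1)[OF \<zeta>] by (auto simp: \<zeta>'_def complex_eq_iff)
  have \<zeta>_scale: "\<zeta>' p (cscale a z) = a * \<zeta>' p z" if "p \<in> P" "z \<in> V \<times> V" for p z a
    using that linear_onD[OF \<zeta>] linear_on_diff[OF \<zeta> V] subspace_scale[OF V]
    by (auto simp: \<zeta>'_def complex_eq_iff cscale_def)
  show "subspace V" "finite P" by fact+
  show "c p \<in> P" "c (c p) = p" if "p \<in> P" for p using that c by auto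
  show "r p \<in> V \<times> V" if "p \<in> P" for p
    using that V e c by (simp add: r_def subspace_add subspace_diff subspace_scale)
  show "cconj (r p) = r (c p)" if "p \<in> P" for p
    using that c by (simp add: r_def cconj_def scaleR_right_distrib scaleR_right_diff_distrib)
  show "\<phi> p (z + w) = \<phi> p z + \<phi> p w" if "p \<in> P" "z \<in> V \<times> V" "w \<in> V \<times> V" for p z w
    unfolding \<phi>_def \<zeta>_add[OF that] \<zeta>_add[OF c(1)[OF that(1)] that(2,3)] by (simp add: field_simps)
  show "\<phi> p (cscale a z) = a * \<phi> p z" if "p \<in> P" "z \<in> V \<times> V" for p a z
    unfolding \<phi>_def \<zeta>_scale[OF that] \<zeta>_scale[OF c(1)[OF that(1)] that(2)] by (simp add: field_simps)
  have r_eq: "r p = cscale ((1 + \<i>) / 2) (e p, 0) + cscale ((1 - \<i>) / 2) (e (c p), 0)" for p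
    by (simp add: r_def cscale_def scaleR_right_distrib scaleR_right_diff_distrib)
  show "\<phi> p (r q) = (if p = q then 1 else 0)" if pq: "p \<in> P" "q \<in> P" for p q
  proof -
    have z0: "\<zeta> p 0 = 0" if "p \<in> P" for p using linear_on_0[OF \<zeta>[OF that] V] .
    have ee: "\<zeta>' p (e q, 0) = (if p = q then 1 else 0)" if "p \<in> P" "q \<in> P" for p q
      using that by (simp add: \<zeta>'_def dual z0 complex_eq_iff)
    have eV: "(e p, 0) \<in> V \<times> V" if "p \<in> P" for p using e[OF that] subspace_0[OF V] by simp
    have \<zeta>r: "\<zeta>' p (r q) = (1 + \<i>) / 2 * (if p = q then 1 else 0) + (1 - \<i>) / 2 * (if p = c q then 1 else 0)"
      if "p \<in> P" "q \<in> P" for p q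
      unfolding r_eq using that c eV cplx.subspace_scale[OF csub[OF V]]
      by (simp add: \<zeta>_add \<zeta>_scale ee del: add_Pair)
    have cc: "c p = c q \<longleftrightarrow> p = q" "c p = q \<longleftrightarrow> p = c q" using pq c by metis+
    show ?thesis
      using pq c by (simp add: \<phi>_def \<zeta>r cc) (simp add: complex_eq_iff)
  qed
  show "z = (\<Sum>p\<in>P. cscale (\<phi> p z) (r p))" if z: "z \<in> V \<times> V" for z
  proof -
    have reidx: "(\<Sum>p\<in>P. f (c p)) = (\<Sum>p\<in>P. f p)" for f :: "'p \<Rightarrow> 'a \<times> 'a"
      by (rule sum.reindex_bij_witness[of _ c c]) (simp_all add: c)
    have "(\<Sum>p\<in>P. cscale (\<phi> p z) (r p))
        = (\<Sum>p\<in>P. cscale (\<phi> p z * ((1 + \<i>) / 2)) (e p, 0)) + (\<Sum>p\<in>P. cscale (\<phi> p z * ((1 - \<i>) / 2)) (e (c p), 0))"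
      unfolding r_eq by (simp add: cplx.scale_right_distrib sum.distrib del: add_Pair)
    also have "(\<Sum>p\<in>P. cscale (\<phi> p z * ((1 - \<i>) / 2)) (e (c p), 0))
        = (\<Sum>p\<in>P. cscale (\<phi> (c p) z * ((1 - \<i>) / 2)) (e (c (c p)), 0))"
      by (rule reidx[symmetric])
    also have "\<dots> = (\<Sum>p\<in>P. cscale (\<phi> (c p) z * ((1 - \<i>) / 2)) (e p, 0))"
      by (simp add: c)
    also have "(\<Sum>p\<in>P. cscale (\<phi> p z * ((1 + \<i>) / 2)) (e p, 0)) + \<dots>
        = (\<Sum>p\<in>P. cscale (\<zeta>' p z) (e p, 0))"
      unfolding sum.distrib[symmetric] cplx.scale_left_distrib[symmetric]
    proof (intro sum.cong refl arg_cong2[of _ _ _ _ cscale])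
      fix p assume p: "p \<in> P"
      show "\<phi> p z * ((1 + \<i>) / 2) + \<phi> (c p) z * ((1 - \<i>) / 2) = \<zeta>' p z"
        by (simp add: \<phi>_def c(2)[OF p] complex_eq_iff field_simps)
    qed
    also have "\<dots> = (\<Sum>p\<in>P. \<zeta> p (fst z) *\<^sub>R e p, \<Sum>p\<in>P. \<zeta> p (snd z) *\<^sub>R e p)"
      by (simp add: cscale_def \<zeta>'_def sum_prod)
    also have "\<dots> = z" using exp[of "fst z"] exp[of "snd z"] z by (auto simp: prod_eq_iff)
    finally show ?thesis by simp
  qed
qed

lemma (in coords) finite_dim: "\<exists>B. finite B \<and> V = span B"
proof (intro exI conjI)
  let ?B = "fst ` r ` P \<union> snd ` r ` P"
  show "finite ?B" using fin by simp
  show "V = span ?B"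
  proof
    show "span ?B \<subseteq> V" by (rule span_minimal[OF _ sub]) (use r_in in \<open>force simp: mem_Times_iff\<close>)
    show "V \<subseteq> span ?B"
    proof
      fix x assume "x \<in> V"
      then have "(x, 0) \<in> V \<times> V" using subspace_0[OF sub] by simp
      from expand[OF this] have "x = fst (\<Sum>p\<in>P. cscale (\<phi> p (x, 0)) (r p))" by (metis fst_conv)
      also have "\<dots> = (\<Sum>p\<in>P. Re (\<phi> p (x, 0)) *\<^sub>R fst (r p) - Im (\<phi> p (x, 0)) *\<^sub>R snd (r p))"
        by (simp add: fst_sum cscale_def)
      also have "\<dots> \<in> span ?B"
        by (intro span_sum span_diff span_scale span_base) auto
      finally show "x \<in> span ?B" .
    qed
  qed
qed

lemma (in coords) form_left:
  assumes S: "\<And>x. x \<in> V \<Longrightarrow> linear_on V (S x)" "\<And>y. y \<in> V \<Longrightarrow> linear_on V (\<lambda>x. S x y)"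
    and z: "z \<in> V \<times> V" "q \<in> P"
  shows "cform S z (r q) = (\<Sum>p\<in>P. \<phi> p z * cform S (r p) (r q))"
proof -
  have "cform S z (r q) = (\<Sum>p\<in>P. \<Sum>q'\<in>P. \<phi> p z * \<phi> q' (r q) * cform S (r p) (r q'))"
    by (rule form_expand[OF S z(1) r_in[OF z(2)]])
  also have "\<dots> = (\<Sum>p\<in>P. \<Sum>q'\<in>P. if q' = q then \<phi> p z * cform S (r p) (r q) else 0)"
    by (intro sum.cong refl) (use z(2) in \<open>auto simp: \<phi>_r\<close>)
  finally show ?thesis using z(2) fin by simp
qed

text \<open>
  The shift along the strings commutes with conjugation of rows, hence it is a real nilpotent map.
\<close>

lemma shift_exists:
  assumes t: "listed_type t" and K: "coords V (idx t) (case_prod r) \<phi> (\<lambda>p. (conj_row t (fst p), snd p))"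
  obtains N where "linear_on V N" "\<And>x. x \<in> V \<Longrightarrow> N x \<in> V" "cplx0.nilp (V \<times> V) (map_prod N N) (row_len t)"
    "\<And>i k. i < n_rows t \<Longrightarrow> k \<in> {1..row_len t} \<Longrightarrow> map_prod N N (r i k) = (if k < row_len t then r i (k + 1) else 0)"
proof -
  interpret K: coords V "idx t" "case_prod r" \<phi> "\<lambda>p. (conj_row t (fst p), snd p)" by (rule K)
  let ?n = "row_len t" and ?s = "n_rows t"
  have rV: "r i k \<in> V \<times> V" if "i < ?s" "k \<in> {1..?n}" for i k
    using K.r_in[of "(i, k)"] that by (simp add: idx_def)
  have r_conj: "cconj (r i k) = r (conj_row t i) k" if "i < ?s" "k \<in> {1..?n}" for i k
    using K.r_conj[of "(i, k)"] that by (simp add: idx_def)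
  note csV = csub[OF K.sub]
  define w where "w = (\<lambda>p. if snd p < ?n then r (fst p) (snd p + 1) else 0)"
  have w: "w p \<in> V \<times> V" "cconj (w p) = w (conj_row t (fst p), snd p)" if "p \<in> idx t" for p
    using that rV[of "fst p" "snd p + 1"] r_conj[of "fst p" "snd p + 1"] subspace_0[OF K.sub]
    by (auto simp: w_def idx_def zero_prod_def cconj_def)
  obtain N where N: "linear_on V N" "\<And>x. x \<in> V \<Longrightarrow> N x \<in> V" "\<And>p. p \<in> idx t \<Longrightarrow> map_prod N N (case_prod r p) = w p"
    by (rule K.extend_linear[where w = w, OF K.sub w]) (assumption | rule that)+
  define NC where "NC = map_prod N N"
  have NC_endo: "cplx0.endo_on (V \<times> V) NC"
    unfolding NC_def using N K.sub by (intro map_prod_endo) (auto simp: endo_on_linear_on)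
  have NC_r: "NC (r i k) = (if k < ?n then r i (k + 1) else 0)" if "i < ?s" "k \<in> {1..?n}" for i k
    using N(3)[of "(i, k)"] that by (simp add: NC_def w_def idx_def)
  note NC0 = cplx0.endo_on_0[OF NC_endo]
  have NC_pow: "(NC ^^ j) (r i k) = (if k + j \<le> ?n then r i (k + j) else 0)" if "i < ?s" "k \<in> {1..?n}" for i j k
    by (induction j) (use that NC_r NC0 in auto)
  have NC_nilp: "cplx0.nilp (V \<times> V) NC ?n"
    unfolding cplx0.nilp_def
  proof (intro conjI ballI NC_endo)
    fix z assume z: "z \<in> V \<times> V"
    note e = cplx0.endo_on_funpow[OF NC_endo, of ?n]
    have "(NC ^^ ?n) z = (NC ^^ ?n) (\<Sum>p\<in>idx t. cscale (\<phi> p z) (case_prod r p))"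
      using K.expand[OF z] by simp
    also have "\<dots> = (\<Sum>p\<in>idx t. (NC ^^ ?n) (cscale (\<phi> p z) (case_prod r p)))"
      by (intro cplx0.endo_on_sum[OF e] cplx.subspace_scale[OF csV] K.r_in)
    also have "\<dots> = 0"
    proof (intro sum.neutral ballI)
      fix p assume p: "p \<in> idx t"
      then have "(NC ^^ ?n) (case_prod r p) = 0" by (auto simp: idx_def NC_pow)
      then show "(NC ^^ ?n) (cscale (\<phi> p z) (case_prod r p)) = 0"
        using cplx0.endo_onD(4)[OF e K.r_in[OF p]] by simp
    qed
    finally show "(NC ^^ ?n) z = 0" .
  qed
  show thesis
    by (rule that[OF N(1,2) NC_nilp[unfolded NC_def] NC_r[unfolded NC_def]])
qed

text \<open>
  The table defines a form \<open>S\<close> by its Gram matrix and a map \<open>M\<close> by its values on the strings. They are real by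
  compatibility with conjugation. The shift \<open>N\<close> is skew for \<open>S\<close>, so \<open>exp N\<close> is an isometry, and the factors
  \<open>eigval t i\<close> are reciprocal on the two rows of each nonzero block.
\<close>

lemma frame_exists:
  assumes t: "listed_type t" and K: "coords V (idx t) (case_prod r) \<phi> (\<lambda>p. (conj_row t (fst p), snd p))"
  shows "\<exists>M S. framed V M S t r"
proof -
  interpret K: coords V "idx t" "case_prod r" \<phi> "\<lambda>p. (conj_row t (fst p), snd p)" by (rule K)
  let ?n = "row_len t" and ?s = "n_rows t"
  note d = datum[OF t]
  have rV: "r i k \<in> V \<times> V" if "i < ?s" "k \<in> {1..?n}" for i k
    using K.r_in[of "(i, k)"] that by (simp add: idx_def)
  have r_conj: "cconj (r i k) = r (conj_row t i) k" if "i < ?s" "k \<in> {1..?n}" for i k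
    using K.r_conj[of "(i, k)"] that by (simp add: idx_def)
  note csV = csub[OF K.sub]
  define g where "g = (\<lambda>p q. if fst q = dual_row t (fst p) \<and> snd p = ?n + 1 - snd q
      then gram_const t (fst p) * (-1) ^ (snd p - 1) else 0 :: complex)"
  have g_conj: "g (conj_row t (fst p), snd p) (conj_row t (fst q), snd q) = cnj (g p q)" if "p \<in> idx t" "q \<in> idx t" for p q
  proof -
    have b: "fst p < ?s" "fst q < ?s" using that by (auto simp: idx_def)
    have "conj_row t (fst q) = conj_row t (dual_row t (fst p)) \<longleftrightarrow> fst q = dual_row t (fst p)"
      using d(3)[OF b(2)] d(3)[OF d(2)[OF b(1)]] by metis
    then show ?thesis by (simp add: g_def d(5,10)[OF b(1)])
  qed
  obtain S where S: "\<And>x. x \<in> V \<Longrightarrow> linear_on V (S x)" "\<And>y. y \<in> V \<Longrightarrow> linear_on V (\<lambda>x. S x y)"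
    "\<And>p q. p \<in> idx t \<Longrightarrow> q \<in> idx t \<Longrightarrow> cform S (case_prod r p) (case_prod r q) = g p q"
    by (rule K.extend_form[where g = g, OF g_conj]) (assumption | rule that)+
  note cS = cform_bilinear[OF K.sub S(1,2)]
  have gram: "cform S (r i j) (r i' k) = (if i' = dual_row t i \<and> j = ?n + 1 - k then gram_const t i * (-1) ^ (j - 1) else 0)"
    if "i < ?s" "i' < ?s" "j \<in> {1..?n}" "k \<in> {1..?n}" for i i' j k
    using S(3)[of "(i, j)" "(i', k)"] that by (simp add: idx_def g_def)
  have neg: "linear_on V (\<lambda>y. c * f y)" if "linear_on V f" for f :: "'a \<Rightarrow> real" and c
    using that by (simp add: linear_on_def algebra_simps)
  \<comment> \<open>compare \<open>S\<close> with its transpose on the basis\<close>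
  have sym: "S y x = (-1) ^ parity t * S x y" if xy: "x \<in> V" "y \<in> V" for x y
  proof -
    define S2 where "S2 = (\<lambda>x y. (-1) ^ parity t * S y x)"
    have 2: "linear_on V (S2 x)" "linear_on V (\<lambda>y. S2 y x)" if "x \<in> V" for x
      unfolding S2_def using that by (intro neg S; simp)+
    have c2: "cform S2 z w = (-1) ^ parity t * cform S w z" for z w
      by (simp add: cform_def S2_def complex_eq_iff minus_one_power_iff)
    have "cform S (case_prod r q) (case_prod r p) = (-1) ^ parity t * cform S (case_prod r p) (case_prod r q)"
      if pq: "p \<in> idx t" "q \<in> idx t" for p q
    proof -
      obtain i j i' k where eq: "p = (i, j)" "q = (i', k)" by (metis surj_pair)
      have b: "i < ?s" "i' < ?s" "j \<in> {1..?n}" "k \<in> {1..?n}" using pq by (auto simp: eq idx_def)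
      have e1: "i = dual_row t i' \<longleftrightarrow> i' = dual_row t i" using d(4)[OF b(1)] d(4)[OF b(2)] by metis
      have e2: "k = ?n + 1 - j \<longleftrightarrow> j = ?n + 1 - k" using b by auto
      have e3: "gram_const t (dual_row t i) * (-1) ^ (k - 1) = (-1) ^ parity t * (gram_const t i * (-1) ^ (?n - k))"
      proof -
        have "(-1::complex) ^ (parity t + ?n + 1) * (-1) ^ (k - 1) = (-1) ^ parity t * (-1) ^ (?n - k)"
        proof -
          have eq: "parity t + ?n + 1 + (k - 1) = parity t + (?n - k) + 2 * k" using b by auto
          have "(-1::complex) ^ (parity t + (?n - k) + 2 * k) = (-1) ^ (parity t + (?n - k))"
            by (simp only: power_add power_mult) simp
          then show ?thesis unfolding power_add[symmetric] eq .
        qed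
        then have "gram_const t i * ((-1) ^ (parity t + ?n + 1) * (-1) ^ (k - 1)) = gram_const t i * ((-1) ^ parity t * (-1) ^ (?n - k))"
          by (simp only:)
        then show ?thesis unfolding d(11)[OF b(1)] by (simp only: mult_ac)
      qed
      show ?thesis
        unfolding eq prod.case gram[OF b] gram[OF b(2,1,4,3)] e1 e2
        using e3 by (auto simp del: One_nat_def)
    qed
    then have "cform S (case_prod r p) (case_prod r q) = cform S2 (case_prod r p) (case_prod r q)"
      if "p \<in> idx t" "q \<in> idx t" for p q
      unfolding c2 using that by blast
    from K.form_eq(2)[OF S(1,2) 2 this xy(2,1)] show ?thesis by (simp add: S2_def)
  qed
  have nondeg: "z = 0" if z: "z \<in> V \<times> V" "\<And>w. w \<in> V \<times> V \<Longrightarrow> cform S z w = 0" for z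
  proof -
    have "\<phi> p z = 0" if p: "p \<in> idx t" for p
    proof -
      obtain i k where eq: "p = (i, k)" by (metis surj_pair)
      have b: "i < ?s" "k \<in> {1..?n}" using p by (auto simp: eq idx_def)
      define q where "q = (dual_row t i, ?n + 1 - k)"
      have q: "q \<in> idx t" using b d(2)[OF b(1)] by (auto simp: q_def idx_def)
      have "cform S z (case_prod r q) = (\<Sum>p'\<in>idx t. \<phi> p' z * g p' q)"
        using K.form_left[OF S(1,2) z(1) q] S(3) q by simp
      also have "\<dots> = (\<Sum>p'\<in>idx t. if p' = p then \<phi> p z * g p q else 0)"
      proof (intro sum.cong refl)
        fix p' assume p': "p' \<in> idx t"
        obtain i' k' where eq': "p' = (i', k')" by (metis surj_pair)
        have b': "i' < ?s" "k' \<in> {1..?n}" using p' by (auto simp: eq' idx_def)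
        have "dual_row t i = dual_row t i' \<longleftrightarrow> i' = i" using d(4)[OF b(1)] d(4)[OF b'(1)] by metis
        then show "\<phi> p' z * g p' q = (if p' = p then \<phi> p z * g p q else 0)"
          using b b' by (auto simp: g_def q_def eq eq')
      qed
      also have "\<dots> = \<phi> p z * g p q" using p K.fin by simp
      finally have "\<phi> p z * g p q = 0" using z(2) K.r_in[OF q] by simp
      moreover have "g p q \<noteq> 0" using b d(9)[OF b(1)] by (auto simp: g_def q_def eq)
      ultimately show ?thesis by simp
    qed
    then have "(\<Sum>p\<in>idx t. cscale (\<phi> p z) (case_prod r p)) = 0" by (intro sum.neutral) simp
    with K.expand[OF z(1)] show ?thesis by (rule trans)
  qed
  have sym_C: "cform S w z = (-1) ^ parity t * cform S z w" if "z \<in> V \<times> V" "w \<in> V \<times> V" for z w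
    by (rule cform_swap[OF sym that])
  obtain B where B: "finite B" "V = span B" using K.finite_dim by blast
  \<comment> \<open>with the identity as isometry, this gives adjoints and bilinearity of \<open>cform S\<close> before \<open>M\<close> is constructed\<close>
  interpret Id: iso_space cscale "V \<times> V" "\<lambda>x. x" "cform S"
  proof
    show "\<exists>B. finite B \<and> V \<times> V = cplx.span B"
      using B by (intro exI[of _ "(\<lambda>x. (x, 0)) ` B"]) (simp add: cplx_span_real)
    show "cplx0.endo_on (V \<times> V) (\<lambda>x. x)" using csV by (auto simp: cplx0.endo_on_def cplx.subspace_scale)
    show "(\<lambda>x. x) ` (V \<times> V) = V \<times> V" by simp
    fix x y z assume m: "x \<in> V \<times> V" "y \<in> V \<times> V" "z \<in> V \<times> V"
    show "cform S (x + y) z = cform S x z + cform S y z" by (rule cS(1)[OF _ _ m])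
    show "cform S z (x + y) = cform S z x + cform S z y" by (rule cS(2)[OF _ _ m])
  next
    fix a x z assume m: "x \<in> V \<times> V" "z \<in> V \<times> V"
    show "cform S (cscale a x) z = a * cform S x z" by (rule cS(3)[OF _ _ m(1) m(1) m(2)])
    show "cform S z (cscale a x) = a * cform S z x" by (rule cS(4)[OF _ _ m(1) m(1) m(2)])
  next
    show "x = 0" if "x \<in> V \<times> V" "\<And>y. y \<in> V \<times> V \<Longrightarrow> cform S x y = 0" for x
      by (rule nondeg[OF that])
    show "x = 0" if "x \<in> V \<times> V" "\<And>y. y \<in> V \<times> V \<Longrightarrow> cform S y x = 0" for x
    proof (rule nondeg[OF that(1)])
      fix y assume y: "y \<in> V \<times> V"
      show "cform S x y = 0" using that(2)[OF y] sym_C[OF that(1) y] by simp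
    qed
  qed (rule refl)
  obtain N where N: "linear_on V N" "\<And>x. x \<in> V \<Longrightarrow> N x \<in> V" "cplx0.nilp (V \<times> V) (map_prod N N) ?n"
    "\<And>i k. i < ?s \<Longrightarrow> k \<in> {1..?n} \<Longrightarrow> map_prod N N (r i k) = (if k < ?n then r i (k + 1) else 0)"
    by (rule shift_exists[OF t K]) (assumption | rule that)+
  define NC where "NC = map_prod N N"
  note NC_nilp = N(3)[folded NC_def] and NC_r = N(4)[folded NC_def]
  note NC_endo = cplx0.nilpD(1)[OF NC_nilp]
  note NC0 = cplx0.endo_on_0[OF NC_endo]
  \<comment> \<open>\<open>N\<close> is skew: moving it across the form changes the position and with it the sign in \<open>E_per\<close>\<close>
  have NC_adj: "cform S (NC z) u = cform S z (- NC u)" if zu: "z \<in> V \<times> V" "u \<in> V \<times> V" for z u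
  proof -
    define S1 where "S1 = (\<lambda>x y. S (N x) y)"
    define S2 where "S2 = (\<lambda>x y. (-1) * S x (N y))"
    have 1: "linear_on V (S1 x)" "linear_on V (\<lambda>y. S1 y x)" if "x \<in> V" for x
      unfolding S1_def using that N S(1,2) by (auto intro: linear_on_comp[OF N(1,2), of "\<lambda>y. S y x"])
    have 2: "linear_on V (S2 x)" "linear_on V (\<lambda>y. S2 y x)" if "x \<in> V" for x
      unfolding S2_def
      by (rule neg[OF linear_on_comp[OF N(1,2) S(1)[OF that]]], assumption)
        (rule neg[OF S(2)[OF N(2)[OF that]]])
    have c1: "cform S1 z u = cform S (NC z) u" for z u by (simp add: cform_def S1_def NC_def)
    have c2: "cform S2 z u = cform S z (- NC u)" if "u \<in> V \<times> V" "z \<in> V \<times> V" for z u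
      using that N(2) linear_on_uminus[OF S(1)] by (auto simp: cform_def S2_def NC_def complex_eq_iff)
    have c2': "cform S z (- NC u) = - cform S z (NC u)" if "u \<in> V \<times> V" "z \<in> V \<times> V" for z u
      using Id.S_scale_right[of "NC u" z "-1"] cplx0.endo_onD(2)[OF NC_endo that(1)] that(2) by simp
    have "cform S1 (case_prod r p) (case_prod r q) = cform S2 (case_prod r p) (case_prod r q)"
      if pq: "p \<in> idx t" "q \<in> idx t" for p q
    proof -
      obtain i j i' k where eq: "p = (i, j)" "q = (i', k)" by (metis surj_pair)
      have b: "i < ?s" "i' < ?s" "j \<in> {1..?n}" "k \<in> {1..?n}" using pq by (auto simp: eq idx_def)
      have Z: "cform S x 0 = 0" "cform S 0 x = 0" if "x \<in> V \<times> V" for x using that by simp_all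
      have "cform S (NC (r i j)) (r i' k) = - cform S (r i j) (NC (r i' k))"
      proof (cases "j < ?n"; cases "k < ?n")
        assume jk: "j < ?n" "k < ?n"
        have NC: "NC (r i j) = r i (j + 1)" "NC (r i' k) = r i' (k + 1)" using b jk by (auto simp: NC_r)
        define C where "C \<longleftrightarrow> i' = dual_row t i \<and> j = ?n - k"
        have g1: "cform S (r i (j + 1)) (r i' k) = (if C then gram_const t i * (-1) ^ j else 0)"
          using gram[of i i' "j + 1" k] b jk by (auto simp: Suc_diff_le C_def)
        have g2: "cform S (r i j) (r i' (k + 1)) = (if C then gram_const t i * (-1) ^ (j - 1) else 0)"
          using gram[of i i' j "k + 1"] b jk by (auto simp: C_def)
        have "(-1::complex) ^ j = - ((-1) ^ (j - 1))" using b by (cases j) auto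
        then show ?thesis unfolding NC g1 g2 by simp
      next
        assume jk: "\<not> j < ?n" "k < ?n"
        then have "NC (r i j) = 0" "NC (r i' k) = r i' (k + 1)" using b by (auto simp: NC_r)
        then show ?thesis using b jk Z rV by (auto simp: gram)
      next
        assume jk: "j < ?n" "\<not> k < ?n"
        then have "NC (r i j) = r i (j + 1)" "NC (r i' k) = 0" using b by (auto simp: NC_r)
        then show ?thesis using b jk Z rV by (auto simp: gram)
      next
        assume jk: "\<not> j < ?n" "\<not> k < ?n"
        then have "NC (r i j) = 0" "NC (r i' k) = 0" using b by (auto simp: NC_r)
        then show ?thesis using b Z rV by simp
      qed
      then show ?thesis
        using K.r_in[OF pq(1)] K.r_in[OF pq(2)] by (simp add: c1 c2 c2' eq)
    qed
    from K.form_eq(1)[OF 1 2 this zu] show ?thesis using c1 c2 zu by simp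
  qed
  \<comment> \<open>the prescribed value of \<open>M\<close> on \<open>r i k\<close>, which is \<open>eigval t i\<close> times \<open>exp N (r i k)\<close>\<close>
  define v where "v = (\<lambda>i k. cscale (eigval t i) (\<Sum>j=0..?n-k. cscale (1 / fact j) (r i (k + j))))"
  have v_exp: "v i k = cscale (eigval t i) (cplx0.op_exp NC (r i k))" if "i < ?s" "k \<in> {1..?n}" for i k
    unfolding v_def using that
    by (subst cplx0.op_exp_jordan[OF NC_nilp, where r = "r i" and n = ?n]) (auto simp: rV NC_r)
  have exp_V: "cplx0.op_exp NC z \<in> V \<times> V" if "z \<in> V \<times> V" for z
    using cplx0.endo_onD(2)[OF cplx0.fps_app_endo[OF NC_nilp] that] by (simp add: cplx0.op_exp_def)
  have v_V: "v i k \<in> V \<times> V" if "i < ?s" "k \<in> {1..?n}" for i k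
    using exp_V[OF rV[OF that]] cplx.subspace_scale[OF csV] by (simp only: v_exp[OF that])
  have v_conj: "cconj (v i k) = v (conj_row t i) k" if "i < ?s" "k \<in> {1..?n}" for i k
  proof -
    have "cconj (r i (k + j)) = r (conj_row t i) (k + j)" if "j \<in> {0..?n - k}" for j
      using that \<open>k \<in> {1..?n}\<close> by (intro r_conj[OF \<open>i < ?s\<close>]) auto
    then show ?thesis
      by (simp add: v_def cconj_scale cconj_sum d(6)[OF \<open>i < ?s\<close>])
  qed
  have v: "case_prod v p \<in> V \<times> V" "cconj (case_prod v p) = case_prod v (conj_row t (fst p), snd p)" if "p \<in> idx t" for p
    using that v_V v_conj by (auto simp: idx_def)
  obtain M where M: "linear_on V M" "\<And>x. x \<in> V \<Longrightarrow> M x \<in> V" "\<And>p. p \<in> idx t \<Longrightarrow> map_prod M M (case_prod r p) = case_prod v p"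
    by (rule K.extend_linear[where w = "case_prod v", OF K.sub v]) (assumption | rule that)+
  have M_r: "map_prod M M (r i k) = v i k" if "i < ?s" "k \<in> {1..?n}" for i k
    using M(3)[of "(i, k)"] that by (simp add: idx_def)
  have isom: "S (M x) (M y) = S x y" if xy: "x \<in> V" "y \<in> V" for x y
  proof -
    define S2 where "S2 = (\<lambda>x y. S (M x) (M y))"
    have 2: "linear_on V (S2 x)" "linear_on V (\<lambda>y. S2 y x)" if "x \<in> V" for x
      unfolding S2_def
      by (rule linear_on_comp[OF M(1,2) S(1)[OF M(2)[OF that]]], assumption)
        (rule linear_on_comp[OF M(1,2) S(2)[OF M(2)[OF that]]])
    have c2: "cform S2 z w = cform S (map_prod M M z) (map_prod M M w)" for z w
      by (simp add: cform_def S2_def)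
    have "cform S2 (case_prod r p) (case_prod r q) = cform S (case_prod r p) (case_prod r q)"
      if pq: "p \<in> idx t" "q \<in> idx t" for p q
    proof -
      obtain i j i' k where eq: "p = (i, j)" "q = (i', k)" by (metis surj_pair)
      have b: "i < ?s" "i' < ?s" "j \<in> {1..?n}" "k \<in> {1..?n}" using pq by (auto simp: eq idx_def)
      have rr: "r i j \<in> V \<times> V" "r i' k \<in> V \<times> V" using b rV by auto
      have "cform S (cplx0.op_exp NC (r i j)) (cplx0.op_exp NC (r i' k))
          = cform S (r i j) (cplx0.op_exp (\<lambda>y. - NC y) (cplx0.op_exp NC (r i' k)))"
        unfolding cplx0.op_exp_def
        by (rule Id.adjoint_fps_app[OF NC_nilp cplx0.nilp_uminus[OF NC_nilp] order_refl order_refl NC_adj rr(1)])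
          (use exp_V[OF rr(2)] in \<open>simp_all add: cplx0.op_exp_def\<close>)
      also have "\<dots> = cform S (r i j) (r i' k)" by (simp add: cplx0.op_exp_uminus(1)[OF NC_nilp rr(2)])
      finally have e: "cform S (v i j) (v i' k) = eigval t i * eigval t i' * cform S (r i j) (r i' k)"
        using exp_V rr cplx.subspace_scale[OF csV] b by (simp add: v_exp Id.S_scale_left Id.S_scale_right)
      have "cform S2 (case_prod r p) (case_prod r q) = cform S (v i j) (v i' k)"
        unfolding c2 eq prod.case M_r[OF b(1,3)] M_r[OF b(2,4)] ..
      also have "\<dots> = cform S (r i j) (r i' k)"
      proof (cases "i' = dual_row t i")
        case True
        then have "eigval t i * eigval t i' = 1" using d(7,8)[OF b(1)] by simp
        then show ?thesis using e by simp
      next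
        case False
        then show ?thesis using e b by (simp add: gram)
      qed
      finally show ?thesis
        by (simp add: eq)
    qed
    from K.form_eq(2)[OF 2 S(1,2) this xy] show ?thesis by (simp add: S2_def)
  qed
  have nondeg_real: "x = 0" if x: "x \<in> V" "\<And>y. y \<in> V \<Longrightarrow> S x y = 0" for x
  proof -
    have "(x, 0) = (0 :: 'a \<times> 'a)"
    proof (rule nondeg)
      show "(x, 0) \<in> V \<times> V" using x subspace_0[OF K.sub] by simp
      show "cform S (x, 0) w = 0" if "w \<in> V \<times> V" for w
        using that x linear_on_0[OF S(2) K.sub] by (auto simp: cform_def complex_eq_iff)
    qed
    then show ?thesis by (simp add: zero_prod_def)
  qed
  have M_endo: "cplx0.endo_on (V \<times> V) (map_prod M M)"
    using M K.sub by (intro map_prod_endo) (auto simp: endo_on_linear_on)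
  have inj: "inj_on M V"
  proof (rule inj_onI)
    fix x y assume xy: "x \<in> V" "y \<in> V" "M x = M y"
    have "x - y = 0"
    proof (rule nondeg_real)
      show "x - y \<in> V" using xy K.sub by (simp add: subspace_diff)
      fix z assume "z \<in> V"
      then show "S (x - y) z = 0"
        using isom[of "x - y" z] xy K.sub linear_on_diff[OF M(1) K.sub xy(1,2)] linear_on_0[OF S(2) K.sub] M(2)
        by (simp add: subspace_diff)
    qed
    then show "x = y" by simp
  qed
  have surj: "M ` V = V"
  proof
    show "M ` V \<subseteq> V" using M(2) by blast
    define I where "I = map_prod M M ` (V \<times> V)"
    have I_sub: "cplx.subspace I"
    proof (rule cplx.subspaceI)
      show "0 \<in> I" unfolding I_def
        using cplx0.endo_on_0[OF M_endo] cplx.subspace_0[OF csV] by (metis image_eqI)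
      show "x + y \<in> I" if xy: "x \<in> I" "y \<in> I" for x y
      proof -
        obtain x' where x': "x = map_prod M M x'" "x' \<in> V \<times> V" using xy(1) unfolding I_def by (rule imageE)
        obtain y' where y': "y = map_prod M M y'" "y' \<in> V \<times> V" using xy(2) unfolding I_def by (rule imageE)
        show ?thesis
          unfolding I_def x'(1) y'(1) cplx0.endo_onD(3)[OF M_endo x'(2) y'(2), symmetric]
          by (rule imageI[OF cplx.subspace_add[OF csV x'(2) y'(2)]])
      qed
      show "cscale a x \<in> I" if x: "x \<in> I" for a x
      proof -
        obtain x' where x': "x = map_prod M M x'" "x' \<in> V \<times> V" using x unfolding I_def by (rule imageE)
        show ?thesis
          unfolding I_def x'(1) cplx0.endo_onD(4)[OF M_endo x'(2), symmetric]
          by (rule imageI[OF cplx.subspace_scale[OF csV x'(2)]])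
      qed
    qed
    \<comment> \<open>\<open>M\<close> is triangular on each string with nonzero diagonal, so its image contains the strings, last vectors first\<close>
    have "r i k \<in> I" if "i < ?s" "k \<in> {1..?n}" for i k
      using that(2)
    proof (induction "?n - k" arbitrary: k rule: less_induct)
      case less
      define u where "u = (\<Sum>j=1..?n-k. cscale (1 / fact j) (r i (k + j)))"
      have u: "u \<in> I"
        unfolding u_def using less by (intro cplx.subspace_sum[OF I_sub] cplx.subspace_scale[OF I_sub]) auto
      have "(\<Sum>j=0..?n-k. cscale (1 / fact j) (r i (k + j))) = r i k + u"
        unfolding u_def by (subst sum.atLeast_Suc_atMost) simp_all
      then have "map_prod M M (r i k) = cscale (eigval t i) (r i k + u)"
        using M_r[OF that(1) less.prems] by (simp add: v_def)
      then have "r i k = cscale (inverse (eigval t i)) (map_prod M M (r i k)) - u"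
        using d(8)[OF that(1)] by simp
      moreover have "map_prod M M (r i k) \<in> I" unfolding I_def by (rule imageI[OF rV[OF that(1) less.prems]])
      ultimately show ?case
        using u cplx.subspace_diff[OF I_sub] cplx.subspace_scale[OF I_sub] by metis
    qed
    then have "cplx.span (case_prod r ` idx t) \<subseteq> I"
      by (intro cplx.span_minimal I_sub) (auto simp: idx_def)
    then have "V \<times> V \<subseteq> map_prod M M ` (V \<times> V)" unfolding I_def K.r_span .
    then show "V \<subseteq> M ` V" by force
  qed
  have "isometric_triple V M S"
  proof
    show "subspace V" by (rule K.sub)
    show "\<exists>B. finite B \<and> V = span B" by (rule K.finite_dim)
    show "linear_on V M" by (rule M(1))
    show "bij_betw M V V" using inj surj by (simp add: bij_betw_def)
    show "linear_on V (S x)" if "x \<in> V" for x using S(1) that .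
    show "linear_on V (\<lambda>x. S x y)" if "y \<in> V" for y using S(2) that .
    show "x = 0" if "x \<in> V" "\<forall>y\<in>V. S x y = 0" for x using nondeg_real that by blast
    show "\<exists>m\<in>{0, 1}. symmetric_form m V S"
    proof (intro bexI[of _ "parity t mod 2"])
      have "(-1::real) ^ parity t = (-1) ^ (parity t mod 2)" by (simp add: minus_one_power_iff)
      then show "symmetric_form (parity t mod 2) V S" unfolding symmetric_form_def using sym by metis
    qed auto
    show "S (M x) (M y) = S x y" if "x \<in> V" "y \<in> V" for x y using isom that .
  qed
  moreover have "preframe V M S t r"
    unfolding preframe_def
  proof (intro conjI allI impI ballI)
    show "r i k \<in> V \<times> V" "cconj (r i k) = r (conj_row t i) k" if "i < ?s" "k \<in> {1..?n}" for i k
      using rV r_conj that by auto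
    show "cplx0.exp_chain ?n (eigval t i) (map_prod M M) (r i)" if "i < ?s" for i
      using M_r[OF that] by (simp add: cplx0.exp_chain_def v_def)
    show "gram_eq ?n (cform S) (r i) (r j) (if j = dual_row t i then gram_const t i else 0)" if "i < ?s" "j < ?s" for i j
      using gram[OF that] by (simp add: gram_eq_def E_per_def)
  qed
  moreover have "cplx.span (case_prod r ` idx t) = V \<times> V" by (rule K.r_span)
  ultimately have "framed V M S t r"
    using t by (intro framed.intro preframed.intro framed_axioms.intro preframed_axioms.intro) (auto simp: frame_def)
  then show ?thesis by blast
qed

lemma lookup_scaleR:
  fixes x :: "'b \<Rightarrow>\<^sub>0 real"
  shows "Poly_Mapping.lookup (c *\<^sub>R x) i = c * Poly_Mapping.lookup x i"
proof -
  have "finite {i. c * Poly_Mapping.lookup x i \<noteq> 0}"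
    by (rule finite_subset[OF _ finite_lookup[of x]]) auto
  then show ?thesis by (simp add: scaleR_poly_mapping_def Abs_poly_mapping_inverse)
qed

text \<open>
  The unit vectors with indices coding the pairs in \<open>idx t\<close> provide the real vectors from which a basis with
  the required conjugation is built.
\<close>

lemma model_exists:
  assumes t: "listed_type t"
  shows "\<exists>(V :: (nat \<Rightarrow>\<^sub>0 real) set) M S r. framed V M S t r"
proof -
  let ?P = "idx t" and ?c = "\<lambda>p. (conj_row t (fst p), snd p)"
  define e where "e = (\<lambda>p. Poly_Mapping.single (prod_encode p) (1::real))"
  define \<zeta> where "\<zeta> = (\<lambda>p (x :: nat \<Rightarrow>\<^sub>0 real). Poly_Mapping.lookup x (prod_encode p))"
  define V where "V = span (e ` ?P)"
  have fin: "finite ?P" by (simp add: idx_def)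
  have lin: "linear_on W (\<zeta> p)" for W p by (simp add: linear_on_def \<zeta>_def lookup_add lookup_scaleR)
  have dual: "\<zeta> p (e q) = (if p = q then 1 else 0)" for p q
    by (auto simp: \<zeta>_def e_def lookup_single when_def)
  have exp: "x = (\<Sum>p\<in>?P. \<zeta> p x *\<^sub>R e p)" if "x \<in> V" for x
    using that unfolding V_def
  proof (induction rule: span_induct_alt)
    case base
    then show ?case by (simp add: \<zeta>_def)
  next
    case (step a x y)
    then obtain q where q: "q \<in> ?P" "x = e q" by blast
    have "(\<Sum>p\<in>?P. \<zeta> p x *\<^sub>R e p) = (\<Sum>p\<in>?P. if p = q then e q else 0)"
      using q by (intro sum.cong) (auto simp: dual)
    also have "\<dots> = x" using q fin by simp
    finally have "(\<Sum>p\<in>?P. \<zeta> p (a *\<^sub>R x + y) *\<^sub>R e p) = a *\<^sub>R x + y"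
      using step by (simp add: \<zeta>_def lookup_add lookup_scaleR scaleR_left_distrib sum.distrib flip: scaleR_scaleR scaleR_sum_right)
    then show ?case by simp
  qed
  have c: "?c p \<in> ?P" "?c (?c p) = p" if "p \<in> ?P" for p
    using that datum(1,3)[OF t] by (auto simp: idx_def)
  define r where "r = (\<lambda>i k. ((1/2) *\<^sub>R (e (i, k) + e (?c (i, k))), (1/2) *\<^sub>R (e (i, k) - e (?c (i, k)))))"
  have r: "case_prod r = (\<lambda>p. ((1/2) *\<^sub>R (e p + e (?c p)), (1/2) *\<^sub>R (e p - e (?c p))))"
    by (auto simp: r_def fun_eq_iff)
  have eV: "e p \<in> V" if "p \<in> ?P" for p unfolding V_def using that by (intro span_base) auto
  have "coords V ?P (case_prod r)
      (\<lambda>p z. ((1 - \<i>) * Complex (\<zeta> p (fst z)) (\<zeta> p (snd z))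
        + (1 + \<i>) * Complex (\<zeta> (?c p) (fst z)) (\<zeta> (?c p) (snd z))) / 2) ?c"
    unfolding r
    by (rule coords_of_involution[OF _ fin c eV lin dual exp]) (simp_all add: V_def)
  then have "\<exists>M S. framed V M S t r" by (rule frame_exists[OF t])
  then show ?thesis by blast
qed

section \<open>Eigenvalues of an isometry\<close>

context isometric_triple
begin

definition eigenvalue :: "complex \<Rightarrow> bool" where
  "eigenvalue c \<longleftrightarrow> (\<exists>z\<in>V \<times> V. z \<noteq> 0 \<and> map_prod M M z = cscale c z)"

lemma eigenvalueI: "z \<in> V \<times> V \<Longrightarrow> z \<noteq> 0 \<Longrightarrow> map_prod M M z = cscale c z \<Longrightarrow> eigenvalue c"
  unfolding eigenvalue_def by (intro bexI[of _ z] conjI)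

lemma eigenvalueE:
  assumes "eigenvalue c"
  obtains z where "z \<in> V \<times> V" "z \<noteq> 0" "map_prod M M z = cscale c z"
  using assms unfolding eigenvalue_def by (elim bexE conjE) (rule that)

lemma eigenvalue_exists:
  assumes "V \<noteq> {0}" shows "\<exists>c. eigenvalue c"
proof -
  interpret C: iso_space cscale "V \<times> V" "map_prod M M" "cform S" by (rule cplx_space)
  obtain u where u: "u \<in> V" "u \<noteq> 0" using assms subspace_0[OF subspace] by blast
  have u': "(u, 0) \<in> V \<times> V" "(u, 0) \<noteq> (0 :: 'a \<times> 'a)"
    using u subspace_0[OF subspace] by (auto simp: zero_prod_def)
  obtain B where B: "finite B" "V \<times> V = cplx.span B" using C.fin_dim by blast
  obtain c z where z: "z \<in> V \<times> V" "z \<noteq> 0" "map_prod M M z = cscale c z"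
    by (rule complex_eigenvector[OF C.M_endo _ B(1) u']) (use B(2) in auto)
  then have "eigenvalue c" by (rule eigenvalueI)
  then show ?thesis by blast
qed

lemma eigenvalue_nonzero: "eigenvalue c \<Longrightarrow> c \<noteq> 0"
proof
  assume "eigenvalue c" and c: "c = 0"
  then obtain z where z: "z \<in> V \<times> V" "z \<noteq> 0" "map_prod M M z = cscale c z" by (elim eigenvalueE)
  have "M x = 0 \<Longrightarrow> x = 0" if "x \<in> V" for x
    using aut_bij that linear_on_0[OF aut_linear subspace] subspace_0[OF subspace]
    unfolding bij_betw_def by (metis inj_onD)
  then show False using z c by (cases z) (auto simp: zero_prod_def)
qed

lemma eigenvalue_inverse: "eigenvalue c \<Longrightarrow> eigenvalue (inverse c)"
proof -
  interpret C: iso_space cscale "V \<times> V" "map_prod M M" "cform S" by (rule cplx_space)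
  assume c: "eigenvalue c"
  then obtain z where z: "z \<in> V \<times> V" "z \<noteq> 0" "map_prod M M z = cscale c z" by (elim eigenvalueE)
  obtain w where "w \<in> V \<times> V" "w \<noteq> 0" "map_prod M M w = cscale (inverse c) w"
    by (rule C.reciprocal_eigenvalue[OF eigenvalue_nonzero[OF c] z])
  then show ?thesis by (rule eigenvalueI)
qed

lemma eigenvalue_cnj: "eigenvalue c \<Longrightarrow> eigenvalue (cnj c)"
proof -
  assume "eigenvalue c"
  then obtain z where z: "z \<in> V \<times> V" "z \<noteq> 0" "map_prod M M z = cscale c z" by (elim eigenvalueE)
  have "map_prod M M (cconj z) = cscale (cnj c) (cconj z)"
    using cconj_map_prod[OF aut_linear z(1)] z(3) by (simp add: cconj_scale)
  moreover have "cconj z \<in> V \<times> V" "cconj z \<noteq> 0" using z cconj_mem[OF subspace] by auto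
  ultimately show ?thesis by (intro eigenvalueI)
qed

end

section \<open>Eigenvectors of a framed triple\<close>

lemma sum_times_singleton: "(\<Sum>q\<in>A \<times> {b}. f q) = (\<Sum>a\<in>A. f (a, b))"
  by (rule sum.reindex_bij_witness[of _ "\<lambda>a. (a, b)" fst]) auto

lemma sum_singleton_times: "(\<Sum>q\<in>{b} \<times> A. f q) = (\<Sum>a\<in>A. f (b, a))"
  by (rule sum.reindex_bij_witness[of _ "\<lambda>a. (b, a)" snd]) auto

context framed
begin

text \<open>
  Since \<open>M\<close> spreads each vector to the later positions of its string, a coordinate collects from the earlier ones:
  \<open>M\<close> is block triangular in the frame.
\<close>

lemma M_coord:
  assumes ik: "i < s" "k \<in> {1..n}" and z: "z \<in> V \<times> V"
  shows "\<phi> (i, k) (map_prod M M z) = eigval t i * (\<Sum>l\<in>{1..k}. \<phi> (i, l) z / fact (k - l))"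
proof -
  have p: "(i, k) \<in> idx t" using ik by (simp add: idx_def)
  have Mr: "\<phi> (i, k) (map_prod M M (case_prod r q)) = (if fst q = i \<and> snd q \<le> k then eigval t i / fact (k - snd q) else 0)"
    if q: "q \<in> idx t" for q
  proof -
    obtain i' l where eq: "q = (i', l)" and b: "i' < s" "l \<in> {1..n}" using q by (auto simp: idx_def)
    have m: "r i' (l + j) \<in> V \<times> V" if "j \<in> {0..n-l}" for j
      using that b by (intro r_mem[OF b(1)]) auto
    have "\<phi> (i, k) (map_prod M M (case_prod r q)) = eigval t i' * (\<Sum>j=0..n-l. 1 / fact j * \<phi> (i, k) (r i' (l + j)))"
    proof -
      have "(\<Sum>j=0..n-l. cscale (1 / fact j) (r i' (l + j))) \<in> V \<times> V"
        by (rule csum_mem[OF subspace m])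
      moreover have "\<phi> (i, k) (\<Sum>j=0..n-l. cscale (1 / fact j) (r i' (l + j)))
          = (\<Sum>j=0..n-l. 1 / fact j * \<phi> (i, k) (r i' (l + j)))"
        by (rule coord_sum[OF p m])
      ultimately show ?thesis by (simp only: eq prod.case r_chain[OF b] coord_scale[OF p])
    qed
    also have "(\<Sum>j=0..n-l. 1 / fact j * \<phi> (i, k) (r i' (l + j)))
        = (\<Sum>j=0..n-l. if i' = i \<and> l \<le> k \<and> j = k - l then 1 / fact j else 0)"
    proof (intro sum.cong refl)
      fix j assume j: "j \<in> {0..n-l}"
      then have "(i', l + j) \<in> idx t" using b by (auto simp: idx_def)
      then show "1 / fact j * \<phi> (i, k) (r i' (l + j)) = (if i' = i \<and> l \<le> k \<and> j = k - l then 1 / fact j else 0)"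
        using coord_r[OF p, of "(i', l + j)"] by auto
    qed
    also have "\<dots> = (if i' = i \<and> l \<le> k then 1 / fact (k - l) else 0)"
      using ik by auto
    finally show ?thesis by (auto simp: eq)
  qed
  have "\<phi> (i, k) (map_prod M M z) = (\<Sum>q\<in>idx t. \<phi> q z * \<phi> (i, k) (map_prod M M (case_prod r q)))"
  proof -
    have "map_prod M M z = map_prod M M (\<Sum>q\<in>idx t. cscale (\<phi> q z) (case_prod r q))"
      using K.expand[OF z] by simp
    also have "\<dots> = (\<Sum>q\<in>idx t. cscale (\<phi> q z) (map_prod M M (case_prod r q)))"
      by (rule csum_linear(1)[OF aut_linear subspace r_mem'])
    finally show ?thesis
      using coord_sum[OF p C.M_in[OF r_mem']] by simp
  qed
  also have "\<dots> = (\<Sum>q\<in>idx t. \<phi> q z * (if fst q = i \<and> snd q \<le> k then eigval t i / fact (k - snd q) else 0))"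
    by (intro sum.cong refl) (simp add: Mr)
  also have "\<dots> = (\<Sum>q\<in>{i} \<times> {1..k}. \<phi> q z * (eigval t i / fact (k - snd q)))"
    by (rule sum.mono_neutral_cong_right) (use ik in \<open>auto simp: finite_idx idx_def\<close>)
  also have "\<dots> = (\<Sum>l\<in>{1..k}. \<phi> (i, l) z * (eigval t i / fact (k - l)))"
    by (simp add: sum_singleton_times)
  finally show ?thesis by (simp add: sum_distrib_left field_simps)
qed

text \<open>
  By triangularity the first coordinate equation that is not trivial kills the coordinate: in a row with a
  different eigenvalue at position \<open>k\<close> itself, in a row with the same eigenvalue at position \<open>k + 1\<close>. Only the
  end of a row with the same eigenvalue remains.
\<close>

lemma eigenvector_coord:
  assumes z: "z \<in> V \<times> V" "map_prod M M z = cscale \<mu> z" and ik: "i < s" "k \<in> {1..n}"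
    and nz: "eigval t i \<noteq> \<mu> \<or> k < n"
  shows "\<phi> (i, k) z = 0"
  using ik(2) nz
proof (induction k rule: less_induct)
  case (less k)
  have low: "\<phi> (i, l) z = 0" if "l \<in> {1..<k}" for l
    using less.IH[of l] less.prems that by auto
  show ?case
  proof (cases "eigval t i = \<mu>")
    case False
    have "(\<Sum>l\<in>{1..k}. \<phi> (i, l) z / fact (k - l)) = (\<Sum>l\<in>{1..k}. if l = k then \<phi> (i, k) z else 0)"
      using low by (intro sum.cong) auto
    then have "eigval t i * \<phi> (i, k) z = \<mu> * \<phi> (i, k) z"
      using M_coord[OF ik(1) less.prems(1) z(1)] z(2) coord_scale[of "(i, k)" z \<mu>] z(1) ik less.prems
      by (auto simp: idx_def)
    then show ?thesis using False by simp
  next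
    case True
    then have k: "Suc k \<in> {1..n}" using less.prems by auto
    have "(\<Sum>l\<in>{1..Suc k}. \<phi> (i, l) z / fact (Suc k - l))
        = (\<Sum>l\<in>{1..k}. \<phi> (i, l) z / fact (Suc k - l)) + \<phi> (i, Suc k) z"
      by simp
    also have "(\<Sum>l\<in>{1..k}. \<phi> (i, l) z / fact (Suc k - l)) = (\<Sum>l\<in>{1..k}. if l = k then \<phi> (i, k) z else 0)"
      using low by (intro sum.cong) auto
    finally have "(\<Sum>l\<in>{1..Suc k}. \<phi> (i, l) z / fact (Suc k - l)) = \<phi> (i, k) z + \<phi> (i, Suc k) z"
      using less.prems(1) by simp
    then have "\<mu> * (\<phi> (i, k) z + \<phi> (i, Suc k) z) = \<mu> * \<phi> (i, Suc k) z"
      using M_coord[OF ik(1) k z(1)] z(2) coord_scale[of "(i, Suc k)" z \<mu>] z(1) ik k True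
      by (auto simp: idx_def)
    then show ?thesis using datum(8)[OF listed ik(1)] True by simp
  qed
qed

lemma n1: "1 \<in> {1..n}" "n \<in> {1..n}"
proof -
  have "0 < s" by (cases t) auto
  then show "1 \<in> {1..n}" "n \<in> {1..n}" using datum(12)[OF listed] by auto
qed

lemma s_pos: "0 < s"
  by (cases t) auto

lemma eigenvector_expand:
  assumes z: "z \<in> V \<times> V" "map_prod M M z = cscale \<mu> z"
  shows "z = (\<Sum>i | i < s \<and> eigval t i = \<mu>. cscale (\<phi> (i, n) z) (r i n))"
proof -
  have "z = (\<Sum>q\<in>idx t. cscale (\<phi> q z) (case_prod r q))" by (rule K.expand[OF z(1)])
  also have "\<dots> = (\<Sum>q\<in>{i. i < s \<and> eigval t i = \<mu>} \<times> {n}. cscale (\<phi> q z) (case_prod r q))"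
  proof (rule sum.mono_neutral_right[OF finite_idx])
    show "{i. i < s \<and> eigval t i = \<mu>} \<times> {n} \<subseteq> idx t" using n1 by (auto simp: idx_def)
    show "\<forall>q\<in>idx t - {i. i < s \<and> eigval t i = \<mu>} \<times> {n}. cscale (\<phi> q z) (case_prod r q) = 0"
      using eigenvector_coord[OF z] by (force simp: idx_def)
  qed
  finally show ?thesis by (simp add: sum_times_singleton)
qed

lemma M_last: "i < s \<Longrightarrow> map_prod M M (r i n) = cscale (eigval t i) (r i n)"
  using r_chain[OF _ n1(2), of i] by simp

lemma r_nonzero: "i < s \<Longrightarrow> k \<in> {1..n} \<Longrightarrow> r i k \<noteq> 0"
  using coord_r[of "(i, k)" "(i, k)"] K.\<phi>_0[of "(i, k)"] by (auto simp: idx_def)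

lemma eigenvalue_in: "z \<in> V \<times> V \<Longrightarrow> z \<noteq> 0 \<Longrightarrow> map_prod M M z = cscale \<mu> z \<Longrightarrow> \<exists>i<s. eigval t i = \<mu>"
  using eigenvector_expand[of z \<mu>] by (metis (mono_tags, lifting) empty_Collect_eq sum.empty)

text \<open>
  Takes over the role of \<open>N\<close>: on the generalized eigenspace its powers agree with those of \<open>\<mu> N\<close> up to
  higher order, and its definition involves no frame. This matters when two frames are compared.
\<close>

definition D :: "complex \<Rightarrow> 'a \<times> 'a \<Rightarrow> 'a \<times> 'a" where
  "D \<mu> z = map_prod M M z - cscale \<mu> z"

lemma D_mem: "z \<in> V \<times> V \<Longrightarrow> D \<mu> z \<in> V \<times> V"
  unfolding D_def by (intro cplx.subspace_diff[OF C.V_sub] C.M_in cplx.subspace_scale[OF C.V_sub])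

lemma D_pow_mem: "z \<in> V \<times> V \<Longrightarrow> (D \<mu> ^^ j) z \<in> V \<times> V"
  by (induction j) (simp_all only: funpow_0 funpow.simps id_apply o_apply D_mem)

lemma D_coord:
  assumes ik: "i < s" "k \<in> {1..n}" and z: "z \<in> V \<times> V"
  shows "\<phi> (i, k) (D \<mu> z) = \<phi> (i, k) (map_prod M M z) - \<mu> * \<phi> (i, k) z"
proof -
  have p: "(i, k) \<in> idx t" using ik by (simp add: idx_def)
  have D: "D \<mu> z = map_prod M M z + cscale (- \<mu>) z" by (simp add: D_def)
  have "\<phi> (i, k) (D \<mu> z) = \<phi> (i, k) (map_prod M M z) + \<phi> (i, k) (cscale (- \<mu>) z)"
    unfolding D by (rule coord_add[OF p C.M_in[OF z] cplx.subspace_scale[OF C.V_sub z]])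
  then show ?thesis using coord_scale[OF p z, of "- \<mu>"] by simp
qed

lemma D_pow_coord:
  assumes i: "i < s" "eigval t i = \<mu>" and z: "z \<in> V \<times> V"
  shows "k \<in> {1..n} \<Longrightarrow> k \<le> j \<Longrightarrow> \<phi> (i, k) ((D \<mu> ^^ j) z) = 0"
    and "Suc j \<le> n \<Longrightarrow> \<phi> (i, Suc j) ((D \<mu> ^^ j) z) = \<mu> ^ j * \<phi> (i, 1) z"
proof -
  have step: "\<phi> (i, k) (D \<mu> u) = \<mu> * (\<Sum>l\<in>{1..<k}. \<phi> (i, l) u / fact (k - l))"
    if "k \<in> {1..n}" "u \<in> V \<times> V" for k u
  proof -
    have "{1..k} = insert k {1..<k}" using that(1) by auto
    then show ?thesis
      using D_coord[OF i(1) that, of \<mu>] M_coord[OF i(1) that] i(2) by (simp add: algebra_simps)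
  qed
  have *: "(\<forall>k\<in>{1..n}. k \<le> j \<longrightarrow> \<phi> (i, k) ((D \<mu> ^^ j) z) = 0) \<and>
    (Suc j \<le> n \<longrightarrow> \<phi> (i, Suc j) ((D \<mu> ^^ j) z) = \<mu> ^ j * \<phi> (i, 1) z)" for j
  proof (induction j)
    case (Suc j)
    define u where "u = (D \<mu> ^^ j) z"
    have u: "u \<in> V \<times> V" unfolding u_def by (rule D_pow_mem[OF z])
    have low: "\<phi> (i, l) u = 0" if "l \<in> {1..n}" "l \<le> j" for l using Suc that by (simp add: u_def)
    show ?case
    proof (intro conjI ballI impI)
      fix k assume "k \<in> {1..n}" "k \<le> Suc j"
      then show "\<phi> (i, k) ((D \<mu> ^^ Suc j) z) = 0"
        using step[OF _ u, of k] low by (simp flip: u_def)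
    next
      assume j: "Suc (Suc j) \<le> n"
      have "(\<Sum>l\<in>{1..<Suc (Suc j)}. \<phi> (i, l) u / fact (Suc (Suc j) - l))
          = (\<Sum>l\<in>{1..<Suc (Suc j)}. if l = Suc j then \<phi> (i, Suc j) u else 0)"
        using low j by (intro sum.cong) auto
      also have "\<dots> = \<phi> (i, Suc j) u" by simp
      finally have "\<phi> (i, Suc (Suc j)) (D \<mu> u) = \<mu> * \<phi> (i, Suc j) u"
        using step[OF _ u, of "Suc (Suc j)"] j by simp
      then show "\<phi> (i, Suc (Suc j)) ((D \<mu> ^^ Suc j) z) = \<mu> ^ Suc j * \<phi> (i, 1) z"
        using Suc j by (simp add: u_def)
    qed
  qed simp
  show "k \<in> {1..n} \<Longrightarrow> k \<le> j \<Longrightarrow> \<phi> (i, k) ((D \<mu> ^^ j) z) = 0" using * by blast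
  show "Suc j \<le> n \<Longrightarrow> \<phi> (i, Suc j) ((D \<mu> ^^ j) z) = \<mu> ^ j * \<phi> (i, 1) z" using * by blast
qed

text \<open>
  On rows for \<open>\<mu>\<close> the map \<open>M - \<mu>\<close> shifts by one position up to higher order and multiplies by \<open>\<mu>\<close>. After \<open>n - 1\<close> steps only the
  first coordinates survive, at the end of their strings.
\<close>

lemma D_top:
  assumes z: "z \<in> V \<times> V" and other: "\<And>i k. i < s \<Longrightarrow> k \<in> {1..n} \<Longrightarrow> eigval t i \<noteq> \<mu> \<Longrightarrow> \<phi> (i, k) z = 0"
  shows "(D \<mu> ^^ (n - 1)) z = (\<Sum>i | i < s \<and> eigval t i = \<mu>. cscale (\<mu> ^ (n - 1) * \<phi> (i, 1) z) (r i n))"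
proof -
  let ?w = "(D \<mu> ^^ (n - 1)) z"
  have oth: "\<phi> (i, k) ((D \<mu> ^^ j) z) = 0" if "i < s" "k \<in> {1..n}" "eigval t i \<noteq> \<mu>" for i k j
    using that(2)
  proof (induction j arbitrary: k)
    case (Suc j)
    have "\<phi> (i, k) (map_prod M M ((D \<mu> ^^ j) z)) = 0"
      using M_coord[OF that(1) Suc.prems D_pow_mem[OF z]] Suc by simp
    then show ?case
      using D_coord[OF that(1) Suc.prems D_pow_mem[OF z]] Suc by simp
  qed (use other that in simp)
  have "?w = (\<Sum>q\<in>idx t. cscale (\<phi> q ?w) (case_prod r q))" by (rule K.expand[OF D_pow_mem[OF z]])
  also have "\<dots> = (\<Sum>q\<in>{i. i < s \<and> eigval t i = \<mu>} \<times> {n}. cscale (\<phi> q ?w) (case_prod r q))"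
  proof (rule sum.mono_neutral_right[OF finite_idx])
    show "{i. i < s \<and> eigval t i = \<mu>} \<times> {n} \<subseteq> idx t" using n1 by (auto simp: idx_def)
    show "\<forall>q\<in>idx t - {i. i < s \<and> eigval t i = \<mu>} \<times> {n}. cscale (\<phi> q ?w) (case_prod r q) = 0"
    proof
      fix q assume q: "q \<in> idx t - {i. i < s \<and> eigval t i = \<mu>} \<times> {n}"
      obtain i k where eq: "q = (i, k)" by (metis surj_pair)
      have b: "i < s" "k \<in> {1..n}" using q by (auto simp: eq idx_def)
      have "\<phi> (i, k) ?w = 0"
      proof (cases "eigval t i = \<mu>")
        case True
        then have "k \<le> n - 1" using q b by (auto simp: eq)
        then show ?thesis using D_pow_coord(1)[OF b(1) True z b(2)] by blast
      qed (use oth b in blast)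
      then show "cscale (\<phi> q ?w) (case_prod r q) = 0" by (simp add: eq)
    qed
  qed
  also have "\<dots> = (\<Sum>i | i < s \<and> eigval t i = \<mu>. cscale (\<phi> (i, n) ?w) (r i n))"
    by (simp add: sum_times_singleton)
  also have "\<dots> = (\<Sum>i | i < s \<and> eigval t i = \<mu>. cscale (\<mu> ^ (n - 1) * \<phi> (i, 1) z) (r i n))"
  proof (intro sum.cong refl)
    fix i assume "i \<in> {i. i < s \<and> eigval t i = \<mu>}"
    then show "cscale (\<phi> (i, n) ?w) (r i n) = cscale (\<mu> ^ (n - 1) * \<phi> (i, 1) z) (r i n)"
      using D_pow_coord(2)[OF _ _ z, of i \<mu> "n - 1"] n1(2) by simp
  qed
  finally show ?thesis .
qed

end

section \<open>Framed triples are irreducible\<close>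

text \<open>
  The types whose rows have distinct eigenvalues; see \<open>simple_type_inj\<close> and \<open>nonsimple_type\<close>. The exceptions are
  those with two strings for \<open>\<plusminus>1\<close>.
\<close>

fun simple_type :: "triple_type \<Rightarrow> bool" where
  "simple_type (Tr1 l n e) = True"
| "simple_type (Tr2e l n m e) = (Im l \<noteq> 0)"
| "simple_type (Tr2 l n m) = True"
| "simple_type (Tr4 l n m) = True"

lemma simple_type_inj:
  assumes "listed_type t" "simple_type t" "i < n_rows t" "j < n_rows t" "eigval t i = eigval t j"
  shows "i = j"
  using assms(1)
proof (cases rule: listed_type.cases)
  case (3 n l m e)
  then show ?thesis using assms lt_2_cases[of i] lt_2_cases[of j] by (auto simp: complex_eq_iff)
next
  case (4 n l m)
  then have "inverse l \<noteq> l" by (auto simp: field_simps square_eq_1_iff)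
  then show ?thesis
    using 4 assms lt_2_cases[of i] lt_2_cases[of j] by (auto simp flip: of_real_inverse)
next
  case (5 n l m)
  have lt: "cmod (inverse l) < 1" "cmod (inverse (cnj l)) < 1" "cmod (cnj l) > 1"
    using 5(3) by (auto simp: norm_inverse inverse_less_1_iff)
  then have ne: "inverse l \<noteq> l" "inverse (cnj l) \<noteq> l" "inverse l \<noteq> cnj l" "inverse (cnj l) \<noteq> cnj l"
    using 5(3) by (metis less_asym)+
  have ne': "cnj l \<noteq> l" using 5(4) by (simp add: complex_eq_iff)
  have "i = 0 \<or> i = 1 \<or> i = 2 \<or> i = 3" "j = 0 \<or> j = 1 \<or> j = 2 \<or> j = 3"
    using 5 assms lt_4_cases[of i] lt_4_cases[of j] by simp_all
  then show ?thesis using assms(5) ne ne' ne[symmetric] ne'[symmetric] unfolding 5(1)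
    by (elim disjE) simp_all
qed (use assms in auto)

text \<open>
  The sign between the two constants says that the top form is alternating on the plane of eigenvectors.
\<close>

lemma nonsimple_type:
  assumes "listed_type t" "\<not> simple_type t"
  shows "n_rows t = 2" "eigval t 1 = eigval t 0" "dual_row t i = 1 - i" "gram_const t 1 = - gram_const t 0"
proof -
  have "n_rows t = 2 \<and> eigval t 1 = eigval t 0 \<and> dual_row t i = 1 - i \<and> gram_const t 1 = - gram_const t 0"
    using assms(1)
  proof (cases rule: listed_type.cases)
    case (2 n l m)
    then have "odd (n + m + 1)" by presburger
    then show ?thesis using 2 by auto
  qed (use assms(2) in auto)
  then show "n_rows t = 2" "eigval t 1 = eigval t 0" "dual_row t i = 1 - i" "gram_const t 1 = - gram_const t 0" by auto
qed

lemma eigval_orbit: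
  assumes "listed_type t" "i < n_rows t"
  shows "eigval t 0 \<in> {eigval t i, inverse (eigval t i), cnj (eigval t i), inverse (cnj (eigval t i))}"
proof (cases t)
  case (Tr2e l n m e)
  then have "i = 0 \<or> i = 1" using assms(2) by auto
  then show ?thesis by (elim disjE) (simp_all add: Tr2e)
next
  case (Tr2 l n m)
  then have "i = 0 \<or> i = 1" using assms(2) by auto
  then show ?thesis by (elim disjE) (simp_all add: Tr2)
next
  case (Tr4 l n m)
  then have "i = 0 \<or> i = 1 \<or> i = 2 \<or> i = 3" using assms(2) by auto
  then show ?thesis by (elim disjE) (simp_all add: Tr4)
qed simp

lemma direct_sum_2D:
  fixes U W V :: "'a::real_vector set"
  assumes "direct_sum [U, W] V" "subspace U" "subspace W"
  shows "U \<subseteq> V" "W \<subseteq> V" "U \<inter> W = {0}" "\<And>x. x \<in> V \<Longrightarrow> \<exists>u\<in>U. \<exists>w\<in>W. x = u + w"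
proof -
  have ls: "listset [U, W] = {[u, w] | u w. u \<in> U \<and> w \<in> W}" by (auto simp: set_Cons_def)
  have inj: "inj_on sum_list (listset [U, W])" and im: "sum_list ` listset [U, W] = V"
    using assms(1) by (simp_all only: direct_sum_def bij_betw_def)
  have mem: "u + w \<in> V" if "u \<in> U" "w \<in> W" for u w
  proof -
    have "[u, w] \<in> listset [U, W]" using that unfolding ls by blast
    then have "sum_list [u, w] \<in> V" using im by blast
    then show ?thesis by simp
  qed
  note z = subspace_0[OF assms(2)] subspace_0[OF assms(3)]
  show "U \<subseteq> V" using mem[OF _ z(2)] by auto
  show "W \<subseteq> V" using mem[OF z(1)] by auto
  show "\<exists>u\<in>U. \<exists>w\<in>W. x = u + w" if "x \<in> V" for x
  proof -
    have "x \<in> sum_list ` listset [U, W]" using im that by simp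
    then obtain xs where "x = sum_list xs" "xs \<in> listset [U, W]" by (rule imageE)
    then obtain u w where "xs = [u, w]" "u \<in> U" "w \<in> W" unfolding ls by blast
    then show ?thesis using \<open>x = sum_list xs\<close> by (intro bexI[of _ u] bexI[of _ w]) simp_all
  qed
  show "U \<inter> W = {0}"
  proof -
    have "x = 0" if "x \<in> U" "x \<in> W" for x
    proof -
      have "[x, 0] \<in> listset [U, W]" "[0, x] \<in> listset [U, W]" using that z unfolding ls by auto
      moreover have "sum_list [x, 0] = sum_list [0, x]" by simp
      ultimately have "[x, 0] = [0, x]" using inj unfolding inj_on_def by blast
      then show ?thesis by simp
    qed
    then show ?thesis using z by auto
  qed
qed

text \<open>
  Orthogonality of the two summands lets nondegeneracy and surjectivity descend.
\<close>

lemma (in isometric_triple) summand: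
  assumes U: "subspace U" and W: "subspace W" and ds: "direct_sum [U, W] V"
    and M: "M ` U \<subseteq> U" "M ` W \<subseteq> W" and orth: "\<And>u w. u \<in> U \<Longrightarrow> w \<in> W \<Longrightarrow> S u w = 0"
  shows "isometric_triple U M S"
proof
  note d = direct_sum_2D[OF ds U W]
  have UV: "x \<in> V" if "x \<in> U" for x using d(1) that by blast
  show "subspace U" by (rule U)
  show "\<exists>B. finite B \<and> U = span B"
  proof -
    obtain B where B: "B \<subseteq> U" "independent B" "U \<subseteq> span B" "card B = dim U"
      by (rule basis_exists[of U])
    obtain C where C: "finite C" "V = span C" using finite_dim by blast
    have "finite B" using independent_span_bound[OF C(1) B(2)] B(1) d(1) C(2) by blast
    moreover have "U = span B" using B span_minimal[OF B(1) U] by blast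
    ultimately show ?thesis by blast
  qed
  show "linear_on U M" "\<And>x. x \<in> U \<Longrightarrow> linear_on U (S x)" "\<And>y. y \<in> U \<Longrightarrow> linear_on U (\<lambda>x. S x y)"
    using aut_linear form_linear_left form_linear_right UV by (simp_all add: linear_on_def)
  show "bij_betw M U U"
    unfolding bij_betw_def
  proof
    show "inj_on M U" using aut_bij d(1) by (auto simp: bij_betw_def intro: inj_on_subset)
    show "M ` U = U"
    proof
      show "U \<subseteq> M ` U"
      proof
        fix u assume u: "u \<in> U"
        then obtain v where v: "v \<in> V" "u = M v" using aut_bij UV by (metis bij_betw_imp_surj_on imageE)
        obtain a b where ab: "a \<in> U" "b \<in> W" "v = a + b" using d(4)[OF v(1)] by blast
        have "b \<in> V" using ab(2) d(2) by blast
        then have "u = M a + M b" using v(2) ab UV linear_onD(1)[OF aut_linear] by simp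
        moreover have "M a \<in> U" "M b \<in> W" using M ab by auto
        ultimately have "M b \<in> U \<inter> W" using u U subspace_diff[of U u "M a"] by simp
        then have "M b = 0" using d(3) by blast
        then show "u \<in> M ` U" using \<open>u = M a + M b\<close> ab(1) by simp
      qed
    qed (rule M(1))
  qed
  show "x = 0" if x: "x \<in> U" "\<forall>y\<in>U. S x y = 0" for x
  proof (rule nondegenerate[OF UV[OF x(1)]], rule ballI)
    fix y assume "y \<in> V"
    then obtain a b where ab: "a \<in> U" "b \<in> W" "y = a + b" using d(4) by blast
    then have "a \<in> V" "b \<in> V" using d by auto
    then show "S x y = 0"
      using ab x orth[OF x(1) ab(2)] linear_onD(1)[OF form_linear_right[OF UV[OF x(1)]], of a b] by simp
  qed
  show "\<exists>m\<in>{0, 1}. symmetric_form m U S"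
    using symmetric UV unfolding symmetric_form_def by blast
  show "S (M x) (M y) = S x y" if "x \<in> U" "y \<in> U" for x y using isometry UV that by blast
qed

context framed
begin

text \<open>
  A summand has some eigenvalue, and its eigenvalues are closed under inversion and conjugation. All
  eigenvalues of a framed triple form one orbit of these operations.
\<close>

lemma summand_eigenvector:
  assumes it: "isometric_triple U M S" and UV: "U \<subseteq> V" and U0: "U \<noteq> {0}"
  obtains z where "z \<in> U \<times> U" "z \<noteq> 0" "map_prod M M z = cscale (eigval t 0) z"
proof -
  interpret U: isometric_triple U M S by fact
  obtain c where c: "U.eigenvalue c" using U.eigenvalue_exists[OF U0] by blast
  then obtain z where "z \<in> U \<times> U" "z \<noteq> 0" "map_prod M M z = cscale c z" by (rule U.eigenvalueE)
  then obtain i where i: "i < s" "eigval t i = c" using eigenvalue_in[of z c] UV by blast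
  have "U.eigenvalue (eigval t 0)"
    using eigval_orbit[OF listed i(1)] c U.eigenvalue_inverse U.eigenvalue_cnj i(2) by auto
  then show thesis using that by (rule U.eigenvalueE)
qed

text \<open>
  Each of two complementary summands would contain an eigenvector for \<open>eigval t 0\<close>. For a simple type there
  is only one such vector up to scalars. For the other types the top form on the plane of eigenvectors is
  alternating, so a plane splits into two orthogonal lines only if the top form vanishes.
\<close>

lemma irreducible: "irreducible_triple V M S"
  unfolding irreducible_triple_def
proof (intro conjI notI)
  show "isometric_triple V M S" by (rule isometric_triple_axioms)
  show False if "V = {0}"
    using r_mem[OF s_pos n1(1)] r_nonzero[OF s_pos n1(1)] that by (auto simp: zero_prod_def)
  assume "\<exists>U W. subspace U \<and> subspace W \<and> U \<noteq> {0} \<and> W \<noteq> {0} \<and> direct_sum [U, W] V \<and>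
            M ` U \<subseteq> U \<and> M ` W \<subseteq> W \<and> (\<forall>u\<in>U. \<forall>w\<in>W. S u w = 0 \<and> S w u = 0)"
  then obtain U W where Q: "subspace U \<and> subspace W \<and> U \<noteq> {0} \<and> W \<noteq> {0} \<and> direct_sum [U, W] V \<and>
            M ` U \<subseteq> U \<and> M ` W \<subseteq> W \<and> (\<forall>u\<in>U. \<forall>w\<in>W. S u w = 0 \<and> S w u = 0)"
    by (elim exE)
  then have UW: "subspace U" "subspace W" "U \<noteq> {0}" "W \<noteq> {0}" "direct_sum [U, W] V"
    "M ` U \<subseteq> U" "M ` W \<subseteq> W"
    by simp_all
  have orth: "S u w = 0 \<and> S w u = 0" if "u \<in> U" "w \<in> W" for u w
  proof -
    have "\<forall>u\<in>U. \<forall>w\<in>W. S u w = 0 \<and> S w u = 0" using Q by simp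
    then show ?thesis using that by blast
  qed
  note d = direct_sum_2D[OF UW(5,1,2)]
  have "direct_sum [W, U] V"
    using d UW(1,2) subspace by (intro direct_sum_2) (auto, metis add_diff_cancel_right')
  then have itW: "isometric_triple W M S"
    using summand[OF UW(2,1) _ UW(7,6)] orth by (simp only:)
  have itU: "isometric_triple U M S"
    by (rule summand[OF UW(1,2,5,6,7)]) (simp only: orth)
  obtain a where a: "a \<in> U \<times> U" "a \<noteq> 0" "map_prod M M a = cscale (eigval t 0) a"
    by (rule summand_eigenvector[OF itU d(1) UW(3)])
  obtain b where b: "b \<in> W \<times> W" "b \<noteq> 0" "map_prod M M b = cscale (eigval t 0) b"
    by (rule summand_eigenvector[OF itW d(2) UW(4)])
  have aV: "a \<in> V \<times> V" and bV: "b \<in> V \<times> V" using a(1) b(1) d(1,2) by auto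
  have disj: "z = 0" if "z \<in> U \<times> U" "z \<in> W \<times> W" for z
    using that d(3) by (auto simp: zero_prod_def)
  note cU = csub[OF UW(1)] and cW = csub[OF UW(2)]
  show False
  proof (cases "simple_type t")
    case True
    have E: "{i. i < s \<and> eigval t i = eigval t 0} = {0}" using simple_type_inj[OF listed True _ s_pos] s_pos by auto
    have a': "a = cscale (\<phi> (0, n) a) (r 0 n)" and b': "b = cscale (\<phi> (0, n) b) (r 0 n)"
      using eigenvector_expand[OF aV a(3)] eigenvector_expand[OF bV b(3)] unfolding E by simp_all
    have nz: "\<phi> (0, n) a \<noteq> 0" using a(2) a' by (metis cplx.scale_zero_left)
    have "cscale (\<phi> (0, n) b / \<phi> (0, n) a) a = cscale (\<phi> (0, n) b / \<phi> (0, n) a * \<phi> (0, n) a) (r 0 n)"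
      by (subst a') (simp only: cplx.scale_scale)
    also have "\<dots> = b" using nz b' by simp
    finally have "b \<in> U \<times> U" using cplx.subspace_scale[OF cU a(1)] by metis
    then show False using disj b(1,2) by blast
  next
    case False
    note ns = nonsimple_type[OF listed False]
    have E: "{i. i < s \<and> eigval t i = eigval t 0} = {0, 1}" using ns(1,2) by (auto simp: less_2_cases_iff)
    define \<mu> where "\<mu> = eigval t 0"
    have \<mu>0: "\<mu> \<noteq> 0" using datum(8)[OF listed s_pos] by (simp add: \<mu>_def)
    have all\<mu>: "eigval t i = \<mu>" if "i < s" for i using that ns(1,2) lt_2_cases[of i] by (auto simp: \<mu>_def)
    have co0: "gram_const t 0 \<noteq> 0" by (rule datum(9)[OF listed s_pos])
    \<comment> \<open>A vector \<open>z\<close> of one summand \<open>X\<close> is orthogonal to the eigenvector \<open>c\<close> of the other. As the top form is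
      alternating, the first coordinates of \<open>z\<close> are then proportional to the last coordinates of \<open>c\<close>, so
      that \<open>(M - \<mu>)\<^sup>n\<^sup>-\<^sup>1 z\<close> is a multiple of \<open>c\<close> lying in \<open>X\<close>, hence zero.\<close>
    have key: "\<phi> (0, 1) z = 0 \<and> \<phi> (1, 1) z = 0"
      if X: "cplx.subspace X" "X \<subseteq> V \<times> V" "\<And>z. z \<in> X \<Longrightarrow> map_prod M M z \<in> X" and z: "z \<in> X"
        and c: "c \<in> V \<times> V" "c \<noteq> 0" "map_prod M M c = cscale (eigval t 0) c" "cform S z c = 0"
        and cX: "\<And>x. cscale x c \<in> X \<Longrightarrow> x = 0" for X z c
    proof -
      have zV: "z \<in> V \<times> V" using z X(2) by blast
      have c_eq: "c = cscale (\<phi> (0, n) c) (r 0 n) + cscale (\<phi> (1, n) c) (r 1 n)"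
        using eigenvector_expand[OF c(1,3)] unfolding E by simp
      have r01: "r 0 n \<in> V \<times> V" "r 1 n \<in> V \<times> V" using r_mem n1 ns(1) by auto
      have "cform S z (r 0 n) = - gram_const t 0 * \<phi> (1, 1) z" "cform S z (r 1 n) = gram_const t 0 * \<phi> (0, 1) z"
        using co0 ns(3,4) by (simp_all add: coord_def)
      moreover have "cform S z (cscale (\<phi> (0, n) c) (r 0 n) + cscale (\<phi> (1, n) c) (r 1 n)) = 0"
        by (subst c_eq[symmetric]) (rule c(4))
      moreover have "cform S z (cscale (\<phi> (0, n) c) (r 0 n) + cscale (\<phi> (1, n) c) (r 1 n))
          = \<phi> (0, n) c * cform S z (r 0 n) + \<phi> (1, n) c * cform S z (r 1 n)"
        by (simp only: C.S_add_right C.S_scale_right zV r01 cplx.subspace_scale[OF C.V_sub])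
      ultimately have "gram_const t 0 * (\<phi> (1, n) c * \<phi> (0, 1) z - \<phi> (0, n) c * \<phi> (1, 1) z) = 0"
        by (auto simp: algebra_simps)
      then have par_eq: "\<phi> (1, n) c * \<phi> (0, 1) z = \<phi> (0, n) c * \<phi> (1, 1) z" using co0 by simp
      have "\<exists>x. \<phi> (0, 1) z = x * \<phi> (0, n) c \<and> \<phi> (1, 1) z = x * \<phi> (1, n) c"
      proof (cases "\<phi> (0, n) c = 0")
        case True
        then have "\<phi> (1, n) c \<noteq> 0" using c(2) c_eq by (metis add_0 cplx.scale_zero_left)
        then show ?thesis using par_eq True by (intro exI[of _ "\<phi> (1, 1) z / \<phi> (1, n) c"]) simp
      next
        case False
        then show ?thesis using par_eq by (intro exI[of _ "\<phi> (0, 1) z / \<phi> (0, n) c"]) (simp add: field_simps)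
      qed
      then obtain x where x: "\<phi> (0, 1) z = x * \<phi> (0, n) c" "\<phi> (1, 1) z = x * \<phi> (1, n) c" by blast
      have "(D \<mu> ^^ (n - 1)) z = cscale (\<mu> ^ (n - 1) * x) c"
      proof -
        have E': "{i. i < s \<and> eigval t i = \<mu>} = {0, 1}" using E by (simp add: \<mu>_def)
        have "(D \<mu> ^^ (n - 1)) z = (\<Sum>i | i < s \<and> eigval t i = \<mu>. cscale (\<mu> ^ (n - 1) * \<phi> (i, 1) z) (r i n))"
          by (rule D_top[OF zV]) (use all\<mu> in blast)
        also have "\<dots> = (\<Sum>i\<in>{0, 1}. cscale (\<mu> ^ (n - 1) * \<phi> (i, 1) z) (r i n))"
          unfolding E' ..
        also have "\<dots> = cscale (\<mu> ^ (n - 1) * x) (cscale (\<phi> (0, n) c) (r 0 n) + cscale (\<phi> (1, n) c) (r 1 n))"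
          by (simp add: x[simplified] cplx.scale_right_distrib mult.assoc)
        also have "cscale (\<phi> (0, n) c) (r 0 n) + cscale (\<phi> (1, n) c) (r 1 n) = c" by (rule c_eq[symmetric])
        finally show ?thesis .
      qed
      moreover have "(D \<mu> ^^ j) z \<in> X" for j
      proof (induction j)
        case (Suc j)
        then have "map_prod M M ((D \<mu> ^^ j) z) - cscale \<mu> ((D \<mu> ^^ j) z) \<in> X"
          by (intro cplx.subspace_diff[OF X(1)] X(3) cplx.subspace_scale[OF X(1)])
        then show ?case unfolding funpow.simps o_apply D_def[symmetric] .
      qed (use z in simp)
      ultimately have "\<mu> ^ (n - 1) * x = 0" using cX by metis
      then show ?thesis using x \<mu>0 by simp
    qed
    have M_U: "map_prod M M z \<in> U \<times> U" if "z \<in> U \<times> U" for z using that image_subset_iff[of M U U] UW(6) by auto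
    have M_W: "map_prod M M z \<in> W \<times> W" if "z \<in> W \<times> W" for z using that image_subset_iff[of M W W] UW(7) by auto
    have aU: "x = 0" if "cscale x a \<in> W \<times> W" for x
      using disj[OF cplx.subspace_scale[OF cU a(1)] that] a(2) by simp
    have bW: "x = 0" if "cscale x b \<in> U \<times> U" for x
      using disj[OF that cplx.subspace_scale[OF cW b(1)]] b(2) by simp
    have orthC: "cform S u w = 0" "cform S w u = 0" if "u \<in> U \<times> U" "w \<in> W \<times> W" for u w
      using that orth by (auto simp: cform_def complex_eq_iff)
    \<comment> \<open>the first coordinate vanishes on both summands, although it is 1 on \<open>r 0 1\<close>\<close>
    have kU: "\<phi> (0, 1) z = 0" if "z \<in> U \<times> U" for z
      using key[OF cU _ M_U that bV b(2,3) orthC(1)[OF that b(1)] bW] d(1) by blast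
    have kW: "\<phi> (0, 1) z = 0" if "z \<in> W \<times> W" for z
      using key[OF cW _ M_W that aV a(2,3) orthC(2)[OF a(1) that] aU] d(2) by blast
    obtain x y where xy: "r 0 1 = (x, y)" "x \<in> V" "y \<in> V" using r_mem[OF s_pos n1(1)] by blast
    obtain u w u' w' where uw: "u \<in> U" "w \<in> W" "x = u + w" "u' \<in> U" "w' \<in> W" "y = u' + w'"
      using d(4) xy(2,3) by metis
    have p: "(0, 1) \<in> idx t" using n1 s_pos by (simp add: idx_def)
    have "r 0 1 = (u, u') + (w, w')" using xy(1) uw by simp
    then have "\<phi> (0, 1) (r 0 1) = \<phi> (0, 1) (u, u') + \<phi> (0, 1) (w, w')"
      using coord_add[OF p, of "(u, u')" "(w, w')"] uw d(1,2) by (auto simp del: add_Pair)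
    also have "\<dots> = 0" using kU[of "(u, u')"] kW[of "(w, w')"] uw by simp
    finally show False using coord_r[OF p p] by simp
  qed
qed

end

section \<open>The type is determined by the triple\<close>

text \<open>
  The remaining rows carry the conjugate and the inverses, which leave the closed upper half plane or the
  exterior of the open unit disc unless they coincide with \<open>eigval t 0\<close>.
\<close>

lemma eigval_0_char:
  assumes "listed_type t" "i < n_rows t" "Im (eigval t i) \<ge> 0" "cmod (eigval t i) \<ge> 1"
  shows "eigval t i = eigval t 0"
  using assms
proof (cases rule: listed_type.cases)
  case (2 n l m)
  then show ?thesis by auto
next
  case (3 n l m e)
  then show ?thesis using assms lt_2_cases[of i] by auto
next
  case (4 n l m)
  then have "\<bar>inverse l\<bar> < 1" by (auto simp: abs_if field_simps)
  then have "cmod (inverse (of_real l)) < 1" by (simp add: norm_inverse)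
  then show ?thesis using 4 assms lt_2_cases[of i] by auto
next
  case (5 n l m)
  have "cmod (inverse l) < 1" "cmod (inverse (cnj l)) < 1"
    using 5(3) by (auto simp: norm_inverse inverse_less_1_iff)
  moreover have "i = 0 \<or> i = 1 \<or> i = 2 \<or> i = 3" using 5 assms lt_4_cases[of i] by simp
  ultimately show ?thesis using 5 assms(3,4) by (elim disjE) simp_all
qed auto

lemma eigval_0_bounds:
  assumes "listed_type t" shows "Im (eigval t 0) \<ge> 0" "cmod (eigval t 0) \<ge> 1"
  using assms by (auto elim!: listed_type.cases)

text \<open>
  The pairing of the first vector of row 0 with the last one of its dual row
  is nonzero, so comparing it with its transpose determines the sign.
\<close>

lemma (in framed) form_sign:
  assumes m: "\<And>x y. x \<in> V \<Longrightarrow> y \<in> V \<Longrightarrow> S y x = (-1) ^ m * S x y"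
  shows "(-1) ^ parity t = ((-1) ^ m :: complex)"
proof -
  note d = datum[OF listed s_pos]
  have mem: "r 0 1 \<in> V \<times> V" "r (dual_row t 0) n \<in> V \<times> V" using r_mem s_pos d(2) n1 by auto
  have 1: "cform S (r 0 1) (r (dual_row t 0) n) = gram_const t 0"
    using r_gram[OF s_pos d(2) n1] n1 by simp
  have "cform S (r (dual_row t 0) n) (r 0 1) = gram_const t (dual_row t 0) * (-1) ^ (n - 1)"
    using r_gram[OF d(2) s_pos n1(2,1)] n1 d(4) by simp
  also have "\<dots> = (-1) ^ (parity t + n + 1 + (n - 1)) * gram_const t 0"
    unfolding d(11) by (simp add: power_add)
  also have "parity t + n + 1 + (n - 1) = parity t + 2 * n" using n1 by simp
  also have "(-1::complex) ^ (parity t + 2 * n) = (-1) ^ parity t" by (simp add: power_add power_mult)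
  finally have "(-1) ^ parity t * gram_const t 0 = (-1) ^ m * gram_const t 0"
    using cform_swap[where S = S, OF m mem] 1 by simp
  then show ?thesis using d(9) by simp
qed

text \<open>
  Both types are compared with the same invariants of \<open>(V, M, S)\<close>: the eigenvalue in the fundamental domain
  (\<open>F1\<close>), whether its eigenspace is a line (\<open>F2\<close>), the dimension (\<open>F3\<close>), the symmetry of the form (\<open>F4\<close>), and the sign of
  the top value (\<open>F5\<close>).
\<close>

lemma type_unique:
  assumes fr: "framed V M S t r" and fr': "framed V M S t' r'"
  shows "t = t'"
proof -
  interpret A: framed V M S t r by fact
  interpret B: framed V M S t' r' by fact
  have eigval: "\<exists>i<B.s. eigval t' i = eigval t 0" "\<exists>i<A.s. eigval t i = eigval t' 0"
    using B.eigenvalue_in[OF A.r_mem[OF A.s_pos A.n1(2)] A.r_nonzero[OF A.s_pos A.n1(2)] A.M_last[OF A.s_pos]]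
      A.eigenvalue_in[OF B.r_mem[OF B.s_pos B.n1(2)] B.r_nonzero[OF B.s_pos B.n1(2)] B.M_last[OF B.s_pos]] .
  have F1: "eigval t 0 = eigval t' 0"
    using eigval(1) eigval_0_char[OF B.listed] eigval_0_bounds[OF A.listed] by metis
  have multiple: "\<exists>c. z = cscale c (x n n0)"
    if "framed V M S u x" "simple_type u" "z \<in> V \<times> V" "map_prod M M z = cscale (eigval u 0) z" "n = 0" "n0 = row_len u" for u x z n n0
  proof -
    interpret X: framed V M S u x by fact
    have "{i. i < X.s \<and> eigval u i = eigval u 0} = {0}" using simple_type_inj[OF X.listed that(2) _ X.s_pos] X.s_pos by auto
    then show ?thesis using X.eigenvector_expand[OF that(3,4)] that by auto
  qed
  have nonsimple: False
    if X: "framed V M S u x" "simple_type u" and Y: "framed V M S v y" "\<not> simple_type v" and e: "eigval u 0 = eigval v 0" for u x v y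
  proof -
    interpret X: framed V M S u x by fact
    interpret Y: framed V M S v y by fact
    note ns = nonsimple_type[OF Y.listed Y(2)]
    have Y1: "1 < Y.s" using ns(1) by simp
    obtain c where c: "y 0 Y.n = cscale c (x 0 X.n)"
      using multiple[OF X Y.r_mem[OF Y.s_pos Y.n1(2)]] Y.M_last[OF Y.s_pos] e by metis
    obtain c' where c': "y 1 Y.n = cscale c' (x 0 X.n)"
      using multiple[OF X Y.r_mem[OF Y1 Y.n1(2)]] Y.M_last[OF Y1] e ns(2) by metis
    have "c \<noteq> 0" using c Y.r_nonzero[OF Y.s_pos Y.n1(2)] by auto
    then have "y 1 Y.n = cscale (c' / c) (y 0 Y.n)" using c c' by simp
    moreover have p: "(0, Y.n) \<in> idx v" "(1, Y.n) \<in> idx v" using Y.n1 Y.s_pos Y1 by (auto simp: idx_def)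
    ultimately show False
      using Y.coord_r[OF p(2,2)] Y.coord_r[OF p(2,1)] Y.coord_scale[OF p(2) Y.r_mem[OF Y.s_pos Y.n1(2)], of "c' / c"]
      by simp
  qed
  have F2: "simple_type t \<longleftrightarrow> simple_type t'"
    using nonsimple[OF fr _ fr' _ F1] nonsimple[OF fr' _ fr _ F1[symmetric]] by blast
  have F3: "n_rows t * row_len t = n_rows t' * row_len t'"
    using A.K.dim_eq_card B.K.dim_eq_card by (simp add: idx_def)
  obtain m where m: "\<And>x y. x \<in> V \<Longrightarrow> y \<in> V \<Longrightarrow> S y x = (-1) ^ m * S x y" by (rule A.sign) blast
  have F4: "even (parity t) \<longleftrightarrow> even (parity t')"
    using A.form_sign[OF m] B.form_sign[OF m] by (auto simp: minus_one_power_iff split: if_splits)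
  \<comment> \<open>if row 0 is dual to its conjugate and \<open>r' 0 n = c r 0 n\<close>, then \<open>r' 0 1\<close> is \<open>c r 0 1\<close> up to higher order,
    and the constants of the form differ by \<open>c\<close> times its conjugate\<close>
  have F5: "\<exists>x\<ge>0. gram_const t' 0 = of_real x * gram_const t 0"
    if h: "simple_type t" "dual_row t 0 = conj_row t 0" "dual_row t' 0 = conj_row t' 0" "row_len t = row_len t'"
  proof -
    define \<mu> where "\<mu> = eigval t 0"
    have \<mu>0: "\<mu> \<noteq> 0" using datum(8)[OF A.listed A.s_pos] by (simp add: \<mu>_def)
    let ?n = "row_len t"
    have r1: "r' 0 1 \<in> V \<times> V" and rn: "r' 0 ?n \<in> V \<times> V" using B.r_mem B.s_pos B.n1 h(4) by auto
    obtain c where c: "r' 0 ?n = cscale c (r 0 ?n)"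
      using multiple[OF fr h(1) rn] B.M_last[OF B.s_pos] F1 h(4) by auto
    have E': "{i. i < B.s \<and> eigval t' i = \<mu>} = {0}"
      using simple_type_inj[OF B.listed _ _ B.s_pos] F1 F2 h(1) B.s_pos by (auto simp: \<mu>_def)
    have p1: "(0, 1) \<in> idx t'" and pk: "k \<in> {1..?n} \<Longrightarrow> i < B.s \<Longrightarrow> (i, k) \<in> idx t'" for i k
      using B.n1 B.s_pos h(4) by (auto simp: idx_def)
    have "(A.D \<mu> ^^ (?n - 1)) (r' 0 1) = cscale (\<mu> ^ (?n - 1)) (r' 0 ?n)"
    proof -
      have "(B.D \<mu> ^^ (B.n - 1)) (r' 0 1)
          = (\<Sum>i | i < B.s \<and> eigval t' i = \<mu>. cscale (\<mu> ^ (B.n - 1) * B.\<phi> (i, 1) (r' 0 1)) (r' i B.n))"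
      proof (rule B.D_top[OF r1])
        fix i k assume ik: "i < B.s" "k \<in> {1..B.n}" "eigval t' i \<noteq> \<mu>"
        have "i \<noteq> 0"
        proof
          assume "i = 0"
          then show False using ik(3) F1 by (simp add: \<mu>_def)
        qed
        then show "B.\<phi> (i, k) (r' 0 1) = 0"
          using B.coord_r[of "(i, k)" "(0, 1)"] p1 ik by (simp add: idx_def)
      qed
      then show ?thesis using B.coord_r[OF p1 p1] unfolding E' h(4) by simp
    qed
    moreover have "A.\<phi> (0, ?n) ((A.D \<mu> ^^ (?n - 1)) (r' 0 1)) = \<mu> ^ (?n - 1) * A.\<phi> (0, 1) (r' 0 1)"
      using A.D_pow_coord(2)[OF A.s_pos _ r1, of \<mu> "?n - 1"] A.n1 by (simp add: \<mu>_def)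
    moreover have pn: "(0, ?n) \<in> idx t" using A.n1 A.s_pos by (auto simp: idx_def)
    moreover have "A.\<phi> (0, ?n) (r 0 ?n) = 1" using A.coord_r[OF pn pn] by simp
    moreover have "A.\<phi> (0, ?n) (r' 0 ?n) = c"
      unfolding c using A.coord_scale[OF pn A.r_mem[OF A.s_pos A.n1(2)]] A.coord_r[OF pn pn] by simp
    ultimately have c1: "A.\<phi> (0, 1) (r' 0 1) = c"
      using A.coord_scale[OF pn rn] \<mu>0 by simp
    have "gram_const t' 0 = cform S (r' 0 1) (r' (dual_row t' 0) B.n)"
      using B.r_gram[OF B.s_pos datum(2)[OF B.listed B.s_pos] B.n1] B.n1 by simp
    also have "r' (dual_row t' 0) B.n = cconj (r' 0 ?n)"
      using B.r_conj[OF B.s_pos B.n1(2)] h(3,4) by simp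
    also have "\<dots> = cscale (cnj c) (r (dual_row t 0) ?n)"
      using A.r_conj[OF A.s_pos A.n1(2)] h(2) by (simp add: c cconj_scale)
    also have "cform S (r' 0 1) (cscale (cnj c) (r (dual_row t 0) ?n)) = cnj c * cform S (r' 0 1) (r (dual_row t 0) ?n)"
      by (rule A.C.S_scale_right[OF A.r_mem[OF datum(2)[OF A.listed A.s_pos] A.n1(2)] r1])
    also have "cform S (r' 0 1) (r (dual_row t 0) ?n) = gram_const t 0 * A.\<phi> (0, 1) (r' 0 1)"
      using datum(9)[OF A.listed A.s_pos] by (simp add: coord_def)
    finally have "gram_const t' 0 = of_real ((cmod c)\<^sup>2) * gram_const t 0"
      by (simp only: c1 complex_norm_square mult_ac)
    then show ?thesis by (intro exI[of _ "(cmod c)\<^sup>2"]) simp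
  qed
  show ?thesis
    using A.listed
  proof (cases rule: listed_type.cases)
    case t: (1 n l e)
    show ?thesis
      using B.listed
    proof (cases rule: listed_type.cases)
      case t': (1 n' l' e')
      have "e = e'" using F5 F3 t t' by (auto simp: complex_eq_iff)
      then show ?thesis using F1 F3 t t' by simp
    qed (use t F1 F2 arg_cong[OF F1, of cmod] in \<open>auto simp: complex_eq_iff\<close>)
  next
    case t: (2 n l m)
    show ?thesis
      using B.listed
    proof (cases rule: listed_type.cases)
      case (2 n' l' m')
      then have "n = n'" "m = m'" using t F3 by auto
      then show ?thesis using t 2 F1 by simp
    qed (use t F1 F2 arg_cong[OF F1, of cmod] in \<open>auto simp: complex_eq_iff\<close>)
  next
    case t: (3 n l m e)
    show ?thesis
      using B.listed
    proof (cases rule: listed_type.cases)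
      case t': (3 n' l' m' e')
      have nm: "n = n'" "m = m'" using F3 F4 t t' by auto
      have "\<exists>x\<ge>0. of_real e' = complex_of_real x * of_real e" using F5 nm t t' by auto
      then have "e = e'" using t t' by (auto simp: complex_eq_iff)
      then show ?thesis using F1 nm t t' by simp
    qed (use t F1 F2 arg_cong[OF F1, of cmod] in \<open>auto simp: complex_eq_iff\<close>)
  next
    case t: (4 n l m)
    show ?thesis
      using B.listed
    proof (cases rule: listed_type.cases)
      case (4 n' l' m')
      then show ?thesis using t F1 F3 F4 by auto
    qed (use t F1 F2 arg_cong[OF F1, of cmod] in \<open>auto simp: complex_eq_iff\<close>)
  next
    case t: (5 n l m)
    show ?thesis
      using B.listed
    proof (cases rule: listed_type.cases)
      case (5 n' l' m')
      then show ?thesis using t F1 F3 F4 by auto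
    qed (use t F1 F2 arg_cong[OF F1, of cmod] in \<open>auto simp: complex_eq_iff\<close>)
  qed
qed

section \<open>Types and frames\<close>

lemma fps_app_map_prod:
  assumes A: "real0.nilp V A d" and F: "\<And>k. F $ k = complex_of_real (G $ k)" and z: "z \<in> V \<times> V"
  shows "cplx0.nilp (V \<times> V) (map_prod A A) d"
    and "cplx0.fps_app F (map_prod A A) z = map_prod (real0.fps_app G A) (real0.fps_app G A) z"
proof -
  note e = real0.nilpD(1)[OF A]
  have V: "subspace V" using e by (simp add: endo_on_linear_on)
  have pow: "(map_prod A A ^^ k) z = map_prod (A ^^ k) (A ^^ k) z" for k z
    by (induction k) (auto simp: map_prod_def split: prod.splits)
  show n: "cplx0.nilp (V \<times> V) (map_prod A A) d"
    unfolding cplx0.nilp_def using map_prod_endo[OF e] A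
    by (auto simp: pow real0.nilp_def zero_prod_def)
  obtain x y where xy: "z = (x, y)" "x \<in> V" "y \<in> V" using z by blast
  have "cplx0.fps_app F (map_prod A A) z = (\<Sum>k<d. cscale (complex_of_real (G $ k)) ((A ^^ k) x, (A ^^ k) y))"
    unfolding cplx0.fps_app_eq[OF n z order_refl] by (simp add: F pow xy(1))
  also have "\<dots> = (\<Sum>k<d. (G $ k) *\<^sub>R (A ^^ k) x, \<Sum>k<d. (G $ k) *\<^sub>R (A ^^ k) y)"
    by (simp add: cscale_def sum_prod)
  also have "\<dots> = map_prod (real0.fps_app G A) (real0.fps_app G A) z"
    by (simp add: xy(1) real0.fps_app_eq[OF A xy(2) order_refl] real0.fps_app_eq[OF A xy(3) order_refl])
  finally show "cplx0.fps_app F (map_prod A A) z = map_prod (real0.fps_app G A) (real0.fps_app G A) z" .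
qed

text \<open>
  The two sums differ only by the term for \<open>k = 0\<close>, whose coefficient in the logarithm series is zero.
\<close>

lemma unipotent_log_eq:
  assumes u: "real0.nilp V (\<lambda>x. u x - x) d" and x: "x \<in> V"
  shows "unipotent_log u x = real0.op_log u x"
proof -
  have "{k. ((\<lambda>y. u y - y) ^^ k) x \<noteq> 0} \<subseteq> {..<d}"
    using real0.nilpD(2)[OF u x] by (auto intro: ccontr simp: not_less)
  then have fin: "finite {k. ((\<lambda>y. u y - y) ^^ k) x \<noteq> 0}" by (rule finite_subset) simp
  show ?thesis
    unfolding unipotent_log_def real0.op_log_def real0.fps_app_def
  proof (rule sum.mono_neutral_cong_left[OF fin])
    fix k assume "k \<in> {k. 1 \<le> k \<and> ((\<lambda>y. u y - y) ^^ k) x \<noteq> 0}"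
    then have k: "k \<ge> 1" by simp
    then have "(-1::real) ^ (k + 1) = (-1) ^ (k - 1)" by (cases k) simp_all
    then have "(-1) ^ (k + 1) / real k = fps_ln 1 $ k" using k by (simp add: fps_ln_nth)
    then show "((-1) ^ (k + 1) / real k) *\<^sub>R ((\<lambda>y. u y - y) ^^ k) x = (fps_ln 1 $ k) *\<^sub>R ((\<lambda>y. u y - y) ^^ k) x"
      by simp
  next
    show "\<forall>k\<in>{k. ((\<lambda>y. u y - y) ^^ k) x \<noteq> 0} - {k. 1 \<le> k \<and> ((\<lambda>y. u y - y) ^^ k) x \<noteq> 0}.
        (fps_ln 1 $ k) *\<^sub>R ((\<lambda>y. u y - y) ^^ k) x = 0"
      by (auto simp: fps_ln_nth Suc_le_eq)
  qed auto
qed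

lemma fps_ln_of_real: "fps_ln (1::complex) $ k = complex_of_real (fps_ln 1 $ k)"
  by (simp add: fps_ln_nth)

lemma fps_exp_of_real: "fps_exp (1::complex) $ k = complex_of_real (fps_exp 1 $ k)"
  by simp

lemma jordan_row_cong:
  assumes "jordan_row n N a" "n \<ge> 1" and "\<And>k. k \<in> {1..n} \<Longrightarrow> a k = b k" and "\<And>k. k \<in> {1..n} \<Longrightarrow> N (a k) = N' (b k)"
  shows "jordan_row n N' b"
proof -
  have "N' (b k) = b (k + 1)" if "k \<in> {1..<n}" for k
    using that assms(3)[of "k + 1"] assms(4)[of k] assms(1) by (auto simp: jordan_row_def)
  moreover have "N' (b n) = 0" using assms(1,2) assms(4)[of n] by (simp add: jordan_row_def)
  ultimately show ?thesis by (simp add: jordan_row_def)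
qed

lemma gram_eq_cong:
  "gram_eq n S a b c \<Longrightarrow> (\<And>k. k \<in> {1..n} \<Longrightarrow> a k = a' k) \<Longrightarrow> (\<And>k. k \<in> {1..n} \<Longrightarrow> b k = b' k) \<Longrightarrow> gram_eq n S a' b' c"
  by (simp add: gram_eq_def)

text \<open>
  On the string \<open>N = log M\<^sub>u\<close> is the shift, so \<open>M\<^sub>u = exp N\<close> acts by the exponential of the shift, and \<open>M\<^sub>s\<close> contributes the
  factor \<open>l\<close>.
\<close>

lemma exp_chain_if_jordan:
  assumes it: "isometric_triple V M S" and jd: "jordan_decomposition V M Ms Mu"
    and r: "\<And>k. k \<in> {1..n} \<Longrightarrow> r k \<in> V \<times> V" and eigval: "\<And>k. k \<in> {1..n} \<Longrightarrow> map_prod Ms Ms (r k) = cscale l (r k)"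
    and jr: "jordan_row n (map_prod (unipotent_log Mu) (unipotent_log Mu)) r"
  shows "cplx0.exp_chain n l (map_prod M M) r"
proof -
  interpret isometric_triple V M S by fact
  have Ms: "linear_on V Ms" and Mu: "linear_on V Mu" "bij_betw Mu V V" and un: "unipotent_on V Mu"
    and M: "\<And>x. x \<in> V \<Longrightarrow> M x = Ms (Mu x)"
    using jd by (auto simp: jordan_decomposition_def)
  have MuV: "Mu x \<in> V" if "x \<in> V" for x using Mu(2) that by (auto simp: bij_betw_def)
  have Mu_endo: "real0.endo_on V Mu" using Mu(1) MuV subspace by (auto simp: endo_on_linear_on)
  obtain d where d: "real0.nilp V (\<lambda>x. Mu x - x) d"
    using un real0.endo_on_minus_id[OF Mu_endo] by (auto simp: unipotent_on_def real0.nilp_def)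
  let ?u = "map_prod Mu Mu"
  have uC: "(\<lambda>z. ?u z - z) = map_prod (\<lambda>x. Mu x - x) (\<lambda>x. Mu x - x)"
    by (auto simp: fun_eq_iff minus_prod_def)
  have zero: "(0, 0) \<in> V \<times> V" using subspace_0[OF subspace] by simp
  have nC: "cplx0.nilp (V \<times> V) (\<lambda>z. ?u z - z) d"
    unfolding uC by (rule fps_app_map_prod(1)[OF d fps_ln_of_real zero])
  have log: "cplx0.op_log ?u z = map_prod (unipotent_log Mu) (unipotent_log Mu) z" if z: "z \<in> V \<times> V" for z
  proof -
    have "cplx0.op_log ?u z = map_prod (real0.op_log Mu) (real0.op_log Mu) z"
      unfolding cplx0.op_log_def real0.op_log_def uC by (rule fps_app_map_prod(2)[OF d fps_ln_of_real z])
    then show ?thesis using z by (auto simp: unipotent_log_eq[OF d])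
  qed
  show ?thesis
    unfolding cplx0.exp_chain_def
  proof
    fix k assume k: "k \<in> {1..n}"
    have m: "r (k + j) \<in> V \<times> V" if "j \<in> {0..n-k}" for j using that k by (intro r) auto
    have "?u (r k) = cplx0.op_exp (cplx0.op_log ?u) (r k)"
      by (rule cplx0.op_exp_op_log[OF nC r[OF k], symmetric])
    also have "\<dots> = (\<Sum>j=0..n-k. cscale (1 / fact j) (r (k + j)))"
    proof (rule cplx0.op_exp_jordan[OF cplx0.nilp_op_log[OF nC] r _ _ k])
      show "cplx0.op_log ?u (r k) = r (k + 1)" if "k \<in> {1..<n}" for k
        using jr that by (simp add: log[OF r] jordan_row_def)
      show "cplx0.op_log ?u (r n) = 0"
        using jr k by (simp add: log[OF r] jordan_row_def)
    qed
    finally have u: "?u (r k) = (\<Sum>j=0..n-k. cscale (1 / fact j) (r (k + j)))" .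
    have "map_prod M M (r k) = map_prod Ms Ms (?u (r k))" using r[OF k] M by auto
    also have "\<dots> = (\<Sum>j=0..n-k. cscale (1 / fact j) (map_prod Ms Ms (r (k + j))))"
      unfolding u by (rule csum_linear[OF Ms subspace m])
    also have "\<dots> = (\<Sum>j=0..n-k. cscale l (cscale (1 / fact j) (r (k + j))))"
      using k by (intro sum.cong refl) (auto simp: eigval)
    also have "\<dots> = cscale l (\<Sum>j=0..n-k. cscale (1 / fact j) (r (k + j)))"
      by (simp add: cplx.scale_sum_right)
    finally show "map_prod M M (r k) = cscale l (\<Sum>j=0..n-k. cscale (1 / fact j) (r (k + j)))" .
  qed
qed

lemma direct_sumD:
  assumes "direct_sum Hs W"
  shows "xs \<in> listset Hs \<Longrightarrow> sum_list xs \<in> W" and "w \<in> W \<Longrightarrow> \<exists>xs\<in>listset Hs. w = sum_list xs"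
proof -
  have im: "sum_list ` listset Hs = W" using assms by (simp add: direct_sum_def bij_betw_def)
  show "xs \<in> listset Hs \<Longrightarrow> sum_list xs \<in> W" using im by blast
  show "w \<in> W \<Longrightarrow> \<exists>xs\<in>listset Hs. w = sum_list xs" using im by (metis imageE)
qed

lemma listset_2: "xs \<in> listset [A, B] \<Longrightarrow> \<exists>a\<in>A. \<exists>b\<in>B. xs = [a, b]"
  by (auto simp: set_Cons_def)

lemma listset_4: "xs \<in> listset [A, B, C, D] \<Longrightarrow> \<exists>a\<in>A. \<exists>b\<in>B. \<exists>c\<in>C. \<exists>d\<in>D. xs = [a, b, c, d]"
  by (auto simp: set_Cons_def)

lemma cconj_span: "cconj ` cplx.span B = cplx.span (cconj ` B)"
proof -
  have sub: "cconj ` cplx.span B \<subseteq> cplx.span (cconj ` B)" for B :: "('a \<times> 'a) set"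
  proof (rule image_subsetI)
    fix z assume "z \<in> cplx.span B"
    then show "cconj z \<in> cplx.span (cconj ` B)"
    proof (induction rule: cplx.span_induct_alt)
      case base
      then show ?case by (simp add: cplx.span_zero)
    next
      case (step c x y)
      then show ?case
        by (simp add: cconj_add cconj_scale cplx.span_add cplx.span_scale cplx.span_base)
    qed
  qed
  have "cplx.span (cconj ` B) = cconj ` cconj ` cplx.span (cconj ` B)" by (simp add: image_image)
  also have "\<dots> \<subseteq> cconj ` cplx.span (cconj ` cconj ` B)" by (intro image_mono sub)
  also have "cconj ` cconj ` B = B" by (simp add: image_image)
  finally show ?thesis using sub by blast
qed

lemma unipotent_log_0: "Mu 0 = 0 \<Longrightarrow> unipotent_log Mu 0 = 0"
proof -
  assume "Mu 0 = 0"
  then have "((\<lambda>y. Mu y - y) ^^ k) 0 = 0" for k by (induction k) simp_all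
  then show ?thesis by (simp add: unipotent_log_def)
qed

lemma framed_if_preframe:
  assumes "isometric_triple V M S" "listed_type t" "preframe V M S t r" "V \<times> V \<subseteq> cplx.span (case_prod r ` idx t)"
  shows "framed V M S t r"
proof -
  interpret preframed V M S t r
    using assms by (intro preframed.intro preframed_axioms.intro)
  show ?thesis
    by unfold_locales (use assms span_subset in \<open>auto simp: frame_def\<close>)
qed

text \<open>
  For the families with real rows the frame consists of the embedded rows \<open>(a k, 0)\<close>, for the others of the given
  rows and their conjugates. The Jordan decomposition is absorbed by \<open>exp_chain_if_jordan\<close>.
\<close>

lemma framed_if_of_type:
  assumes t: "listed_type t" and ot: "of_type V M S t"
  shows "\<exists>r. framed V M S t r"
proof -
  have it: "isometric_triple V M S" using ot by (simp add: of_type_def)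
  interpret isometric_triple V M S by fact
  obtain Ms Mu where jd: "jordan_decomposition V M Ms Mu" and
    T: "case t of Tr1 l n e \<Rightarrow> is_Tr1 V Ms (unipotent_log Mu) S l n e
         | Tr2e l n m e \<Rightarrow> is_Tr2e V Ms (unipotent_log Mu) S l n m e
         | Tr2 l n m \<Rightarrow> is_Tr2 V Ms (unipotent_log Mu) S l n m
         | Tr4 l n m \<Rightarrow> is_Tr4 V Ms (unipotent_log Mu) S l n m"
    using ot unfolding of_type_def by blast
  let ?N = "unipotent_log Mu"
  have N0: "?N 0 = 0"
    using jd linear_on_0[OF _ subspace] by (intro unipotent_log_0) (auto simp: jordan_decomposition_def)
  have Ms: "linear_on V Ms" using jd by (simp add: jordan_decomposition_def)
  have Ms0: "Ms 0 = 0" by (rule linear_on_0[OF Ms subspace])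
  note chain = exp_chain_if_jordan[OF it jd]
  have real_row: "(\<forall>k\<in>{1..n}. (a k, 0) \<in> V \<times> V) \<and> cplx0.exp_chain n (of_real l) (map_prod M M) (\<lambda>k. (a k, 0))"
    if a: "row_basis n a H" "H \<subseteq> V" and Msx: "\<forall>x\<in>H. Ms x = l *\<^sub>R x" and jr: "jordan_row n ?N a" for n a H l
  proof -
    have aH: "a k \<in> H" if "k \<in> {1..n}" for k using a(1) that span_base[of "a k" "a ` {1..n}"] by (auto simp: row_basis_def)
    have mem: "(a k, 0) \<in> V \<times> V" if "k \<in> {1..n}" for k using aH[OF that] a(2) subspace_0[OF subspace] by auto
    have "cplx0.exp_chain n (of_real l) (map_prod M M) (\<lambda>k. (a k, 0))"
    proof (rule chain[OF mem])
      show "map_prod Ms Ms (a k, 0) = cscale (of_real l) (a k, 0)" if "k \<in> {1..n}" for k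
        using Msx aH[OF that] Ms0 by (simp add: cscale_def)
      show "jordan_row n (map_prod ?N ?N) (\<lambda>k. (a k, 0))"
        using jr N0 by (simp add: jordan_row_def zero_prod_def)
    qed
    then show ?thesis using mem by blast
  qed
  note real_gram = gram_embed
  show ?thesis
  proof (cases t)
    case (Tr1 l n e)
    then obtain a where a: "row_basis n a V" "\<forall>x\<in>V. Ms x = l *\<^sub>R x" "jordan_row n ?N a" "gram_eq n S a a e"
      using T by (auto simp: is_Tr1_def)
    define r where "r = (\<lambda>i::nat. \<lambda>k. (a k, 0::'a))"
    note rr = real_row[OF a(1) order_refl a(2,3)]
    have aV: "a k \<in> V" if "k \<in> {1..n}" for k using rr that by auto
    have "preframe V M S t r"
      unfolding preframe_def Tr1 r_def using rr real_gram[OF a(4) aV aV] by (auto simp: cconj_def)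
    moreover have "V \<times> V \<subseteq> cplx.span (case_prod r ` idx t)"
    proof -
      have "case_prod r ` idx t = (\<lambda>x. (x, 0)) ` a ` {1..n}"
        by (auto simp: r_def idx_def Tr1 image_iff)
      then show ?thesis using a(1) by (simp add: cplx_span_real row_basis_def)
    qed
    ultimately show ?thesis using framed_if_preframe[OF it t] by blast
  next
    case (Tr2e l n m e)
    then obtain H a where H: "direct_sum [H, cconj ` H] (V \<times> V)" "crow_basis n a H"
        "\<forall>z\<in>H. map_prod Ms Ms z = cscale l z" "\<forall>z\<in>cconj ` H. map_prod Ms Ms z = cscale (cnj l) z"
        "jordan_row n (map_prod ?N ?N) a" "jordan_row n (map_prod ?N ?N) (cconj \<circ> a)"
      and G: "gram_eq n (cform S) a a 0" "gram_eq n (cform S) (cconj \<circ> a) (cconj \<circ> a) 0"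
        "gram_eq n (cform S) a (cconj \<circ> a) (\<i> ^ (n + m + 1) * complex_of_real e)"
        "gram_eq n (cform S) (cconj \<circ> a) a (\<i> ^ (n + m + 1) * complex_of_real e * (-1) ^ (n + m + 1))"
      using T by (auto simp: is_Tr2e_def)
    define r where "r = (\<lambda>i::nat. if i = 0 then a else cconj \<circ> a)"
    have Hspan: "H = cplx.span (a ` {1..n})" using H(2) by (simp add: crow_basis_def)
    have aH: "a k \<in> H" if "k \<in> {1..n}" for k unfolding Hspan using that by (auto intro: cplx.span_base)
    have H0: "0 \<in> H" unfolding Hspan by (rule cplx.span_zero)
    have HV: "H \<subseteq> V \<times> V"
    proof
      fix h assume "h \<in> H"
      moreover have "0 \<in> cconj ` H" using H0 cconj_0 by (metis imageI)
      ultimately have "[h, 0] \<in> listset [H, cconj ` H]" by (simp add: set_Cons_def del: split_paired_Ex)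
      from direct_sumD(1)[OF H(1) this] show "h \<in> V \<times> V" by simp
    qed
    have mem: "a k \<in> V \<times> V" "cconj (a k) \<in> V \<times> V" if "k \<in> {1..n}" for k
      using aH[OF that] HV cconj_mem[OF subspace] by auto
    have c0: "cplx0.exp_chain n l (map_prod M M) a"
      using H(3,5) aH by (intro chain mem) auto
    have c1: "cplx0.exp_chain n (cnj l) (map_prod M M) (cconj \<circ> a)"
      using H(4,6) aH mem by (intro chain) auto
    have i2: "i < n_rows t \<Longrightarrow> i = 0 \<or> i = 1" for i using Tr2e by auto
    have "preframe V M S t r"
      unfolding preframe_def
    proof (intro conjI allI impI ballI)
      fix i k assume "i < n_rows t" "k \<in> {1..row_len t}"
      then show "r i k \<in> V \<times> V" "cconj (r i k) = r (conj_row t i) k" using i2[of i] mem Tr2e by (auto simp: r_def)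
    next
      fix i assume "i < n_rows t"
      then show "cplx0.exp_chain (row_len t) (eigval t i) (map_prod M M) (r i)" using i2[of i] c0 c1 Tr2e by (auto simp: r_def)
    next
      fix i j assume "i < n_rows t" "j < n_rows t"
      then show "gram_eq (row_len t) (cform S) (r i) (r j) (if j = dual_row t i then gram_const t i else 0)"
        using i2[of i] i2[of j] G Tr2e by (auto simp: r_def)
    qed
    moreover have "V \<times> V \<subseteq> cplx.span (case_prod r ` idx t)"
    proof
      fix z assume "z \<in> V \<times> V"
      then obtain xs where xs: "xs \<in> listset [H, cconj ` H]" "z = sum_list xs" using direct_sumD(2)[OF H(1)] by metis
      obtain h h' where h: "h \<in> H" "h' \<in> cconj ` H" "xs = [h, h']" using listset_2[OF xs(1)] by metis
      then have z: "z = h + h'" using xs(2) by simp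
      have "a ` {1..n} \<subseteq> case_prod r ` idx t" "cconj ` a ` {1..n} \<subseteq> case_prod r ` idx t"
        by (force simp: r_def idx_def Tr2e)+
      then have "h \<in> cplx.span (case_prod r ` idx t)" "h' \<in> cplx.span (case_prod r ` idx t)"
        using h(1,2) unfolding Hspan cconj_span by (meson cplx.span_mono subsetD)+
      then show "z \<in> cplx.span (case_prod r ` idx t)" unfolding z by (rule cplx.span_add)
    qed
    ultimately show ?thesis using framed_if_preframe[OF it t] by blast
  next
    case (Tr2 l n m)
    then obtain H1 H2 a b where H: "direct_sum [H1, H2] V" "row_basis n a H1" "row_basis n b H2"
        "\<forall>x\<in>H1. Ms x = l *\<^sub>R x" "\<forall>x\<in>H2. Ms x = inverse l *\<^sub>R x" "jordan_row n ?N a" "jordan_row n ?N b"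
      and G: "gram_eq n S a a 0" "gram_eq n S b b 0" "gram_eq n S a b 1" "gram_eq n S b a ((-1) ^ (n + m + 1))"
      using T by (auto simp: is_Tr2_def)
    define r where "r = (\<lambda>i::nat. \<lambda>k. if i = 0 then (a k, 0::'a) else (b k, 0))"
    have sp: "H1 = span (a ` {1..n})" "H2 = span (b ` {1..n})" using H(2,3) by (auto simp: row_basis_def)
    have sub: "subspace H1" "subspace H2" unfolding sp by (rule subspace_span)+
    note d = direct_sum_2D[OF H(1) sub]
    note ra = real_row[OF H(2) d(1) H(4,6)] and rb = real_row[OF H(3) d(2) H(5,7)]
    have aV: "a k \<in> V" and bV: "b k \<in> V" if "k \<in> {1..n}" for k using ra rb that by auto
    have i2: "i < n_rows t \<Longrightarrow> i = 0 \<or> i = 1" for i using Tr2 by auto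
    have g: "gram_eq n (cform S) (r 0) (r 0) 0" "gram_eq n (cform S) (r 1) (r 1) 0"
      "gram_eq n (cform S) (r 0) (r 1) 1" "gram_eq n (cform S) (r 1) (r 0) ((-1) ^ (n + m + 1))"
      using real_gram[OF G(1) aV aV] real_gram[OF G(2) bV bV] real_gram[OF G(3) aV bV] real_gram[OF G(4) bV aV]
      by (simp_all add: r_def)
    have "preframe V M S t r"
      unfolding preframe_def
    proof (intro conjI allI impI ballI)
      fix i k assume "i < n_rows t" "k \<in> {1..row_len t}"
      then show "r i k \<in> V \<times> V" "cconj (r i k) = r (conj_row t i) k" using i2[of i] ra rb Tr2 by (auto simp: r_def cconj_def)
    next
      fix i assume "i < n_rows t"
      then show "cplx0.exp_chain (row_len t) (eigval t i) (map_prod M M) (r i)" using i2[of i] ra rb Tr2 by (auto simp: r_def)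
    next
      fix i j assume "i < n_rows t" "j < n_rows t"
      then show "gram_eq (row_len t) (cform S) (r i) (r j) (if j = dual_row t i then gram_const t i else 0)"
        using i2[of i] i2[of j] g Tr2 by auto
    qed
    moreover have "V \<times> V \<subseteq> cplx.span (case_prod r ` idx t)"
    proof -
      have "V \<subseteq> span (a ` {1..n} \<union> b ` {1..n})"
      proof
        fix x assume "x \<in> V"
        then obtain u w where uw: "u \<in> H1" "w \<in> H2" "x = u + w" using d(4) by blast
        have "u \<in> span (a ` {1..n} \<union> b ` {1..n})" "w \<in> span (a ` {1..n} \<union> b ` {1..n})"
          using uw(1,2) unfolding sp by (meson Un_upper1 Un_upper2 span_mono subsetD)+
        then show "x \<in> span (a ` {1..n} \<union> b ` {1..n})" unfolding uw(3) by (rule span_add)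
      qed
      then have "V \<times> V \<subseteq> cplx.span ((\<lambda>x. (x, 0)) ` (a ` {1..n} \<union> b ` {1..n}))"
        unfolding cplx_span_real by blast
      also have "\<dots> \<subseteq> cplx.span (case_prod r ` idx t)"
        by (intro cplx.span_mono) (force simp: r_def idx_def Tr2)
      finally show ?thesis .
    qed
    ultimately show ?thesis using framed_if_preframe[OF it t] by blast
  next
    case (Tr4 l n m)
    then have "is_Tr4 V Ms ?N S l n m" using T by simp
    then obtain H1 H2 a b where
        H: "direct_sum [H1, H2, cconj ` H1, cconj ` H2] (V \<times> V)" "crow_basis n a H1" "crow_basis n b H2"
        "\<forall>z\<in>H1. map_prod Ms Ms z = cscale l z" "\<forall>z\<in>H2. map_prod Ms Ms z = cscale (inverse l) z"
        "\<forall>z\<in>cconj ` H1. map_prod Ms Ms z = cscale (cnj l) z"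
        "\<forall>z\<in>cconj ` H2. map_prod Ms Ms z = cscale (inverse (cnj l)) z"
        "\<forall>r\<in>{a, b, cconj \<circ> a, cconj \<circ> b}. jordan_row n (map_prod ?N ?N) r"
      and G: "gram_eq n (cform S) a b 1" "gram_eq n (cform S) (cconj \<circ> a) (cconj \<circ> b) 1"
        "gram_eq n (cform S) b a ((-1) ^ (n + m + 1))"
        "gram_eq n (cform S) (cconj \<circ> b) (cconj \<circ> a) ((-1) ^ (n + m + 1))"
        "gram_eq n (cform S) a a 0" "gram_eq n (cform S) a (cconj \<circ> a) 0" "gram_eq n (cform S) a (cconj \<circ> b) 0"
        "gram_eq n (cform S) b b 0" "gram_eq n (cform S) b (cconj \<circ> a) 0" "gram_eq n (cform S) b (cconj \<circ> b) 0"
        "gram_eq n (cform S) (cconj \<circ> a) a 0" "gram_eq n (cform S) (cconj \<circ> a) b 0"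
        "gram_eq n (cform S) (cconj \<circ> a) (cconj \<circ> a) 0" "gram_eq n (cform S) (cconj \<circ> b) a 0"
        "gram_eq n (cform S) (cconj \<circ> b) b 0" "gram_eq n (cform S) (cconj \<circ> b) (cconj \<circ> b) 0"
      unfolding is_Tr4_def by (elim conjE exE) (rule that)
    define r where "r = (\<lambda>i::nat. [a, b, cconj \<circ> a, cconj \<circ> b] ! i)"
    have sp: "H1 = cplx.span (a ` {1..n})" "H2 = cplx.span (b ` {1..n})" using H(2,3) by (auto simp: crow_basis_def)
    have ab: "a k \<in> H1" "b k \<in> H2" if "k \<in> {1..n}" for k unfolding sp using that by (auto intro: cplx.span_base)
    have z: "0 \<in> H1" "0 \<in> H2" "0 \<in> cconj ` H1" "0 \<in> cconj ` H2"
      unfolding sp cconj_span by (rule cplx.span_zero)+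
    have HV: "H1 \<subseteq> V \<times> V" "H2 \<subseteq> V \<times> V"
    proof -
      have "h \<in> V \<times> V" if "h \<in> H1" for h
      proof -
        have "[h, 0, 0, 0] \<in> listset [H1, H2, cconj ` H1, cconj ` H2]" using z that by (simp add: set_Cons_def del: split_paired_Ex)
        from direct_sumD(1)[OF H(1) this] show ?thesis by simp
      qed
      moreover have "h \<in> V \<times> V" if "h \<in> H2" for h
      proof -
        have "[0, h, 0, 0] \<in> listset [H1, H2, cconj ` H1, cconj ` H2]" using z that by (simp add: set_Cons_def del: split_paired_Ex)
        from direct_sumD(1)[OF H(1) this] show ?thesis by simp
      qed
      ultimately show "H1 \<subseteq> V \<times> V" "H2 \<subseteq> V \<times> V" by (intro subsetI; simp only:)+
    qed
    have mem: "a k \<in> V \<times> V" "b k \<in> V \<times> V" "cconj (a k) \<in> V \<times> V" "cconj (b k) \<in> V \<times> V" if "k \<in> {1..n}" for k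
      using ab[OF that] HV cconj_mem[OF subspace] by auto
    have c0: "cplx0.exp_chain n l (map_prod M M) a" "cplx0.exp_chain n (inverse l) (map_prod M M) b"
      using H(4,5,8) ab by (intro chain mem; simp)+
    have c1: "cplx0.exp_chain n (cnj l) (map_prod M M) (cconj \<circ> a)"
      "cplx0.exp_chain n (inverse (cnj l)) (map_prod M M) (cconj \<circ> b)"
      using H(6,7,8) ab mem by (intro chain; simp)+
    have i4: "i < n_rows t \<Longrightarrow> i = 0 \<or> i = 1 \<or> i = 2 \<or> i = 3" for i using Tr4 by auto
    have "preframe V M S t r"
      unfolding preframe_def
    proof (intro conjI allI impI ballI)
      fix i k assume "i < n_rows t" and k: "k \<in> {1..row_len t}"
      then have "i = 0 \<or> i = 1 \<or> i = 2 \<or> i = 3" using i4 by blast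
      then show "r i k \<in> V \<times> V" "cconj (r i k) = r (conj_row t i) k"
        using mem[of k] k Tr4 by (elim disjE; simp add: r_def)+
    next
      fix i assume "i < n_rows t"
      then have "i = 0 \<or> i = 1 \<or> i = 2 \<or> i = 3" using i4 by blast
      then show "cplx0.exp_chain (row_len t) (eigval t i) (map_prod M M) (r i)"
        using c0 c1 Tr4 by (elim disjE; simp add: r_def)
    next
      fix i j assume "i < n_rows t" "j < n_rows t"
      then have "i = 0 \<or> i = 1 \<or> i = 2 \<or> i = 3" "j = 0 \<or> j = 1 \<or> j = 2 \<or> j = 3" using i4 by blast+
      then show "gram_eq (row_len t) (cform S) (r i) (r j) (if j = dual_row t i then gram_const t i else 0)"
        using G unfolding Tr4 r_def by (elim disjE; simp)
    qed
    moreover have "V \<times> V \<subseteq> cplx.span (case_prod r ` idx t)"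
    proof
      fix z assume "z \<in> V \<times> V"
      then obtain xs where xs: "xs \<in> listset [H1, H2, cconj ` H1, cconj ` H2]" "z = sum_list xs"
        using direct_sumD(2)[OF H(1)] by metis
      obtain h1 h2 h3 h4 where h: "h1 \<in> H1" "h2 \<in> H2" "h3 \<in> cconj ` H1" "h4 \<in> cconj ` H2" "xs = [h1, h2, h3, h4]"
        using listset_4[OF xs(1)] by metis
      then have zz: "z = h1 + (h2 + (h3 + h4))" using xs(2) by (simp add: add.assoc)
      have row: "r i ` {1..n} \<subseteq> case_prod r ` idx t" if "i < 4" for i using that by (force simp: idx_def Tr4)
      have "a ` {1..n} \<subseteq> case_prod r ` idx t" "b ` {1..n} \<subseteq> case_prod r ` idx t"
        "cconj ` a ` {1..n} \<subseteq> case_prod r ` idx t" "cconj ` b ` {1..n} \<subseteq> case_prod r ` idx t"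
        using row[of 0] row[of 1] row[of 2] row[of 3] by (simp_all add: r_def image_comp)
      then have "h1 \<in> cplx.span (case_prod r ` idx t)" "h2 \<in> cplx.span (case_prod r ` idx t)"
        "h3 \<in> cplx.span (case_prod r ` idx t)" "h4 \<in> cplx.span (case_prod r ` idx t)"
        using h(1-4) unfolding sp cconj_span by (meson cplx.span_mono subsetD)+
      then show "z \<in> cplx.span (case_prod r ` idx t)" unfolding zz by (intro cplx.span_add)
    qed
    ultimately show ?thesis using framed_if_preframe[OF it t] by blast
  qed
qed

lemma listset_iff: "xs \<in> listset Hs \<longleftrightarrow> length xs = length Hs \<and> (\<forall>i<length Hs. xs ! i \<in> Hs ! i)"
proof (induction Hs arbitrary: xs)
  case (Cons H Hs)
  then show ?case
    by (cases xs) (auto simp: set_Cons_def nth_Cons split: nat.splits)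
qed auto

text \<open>
  A real linear relation is a complex one.
\<close>

lemma independent_of_complex:
  assumes "cplx.independent ((\<lambda>x. (x, 0)) ` B)" "finite B"
  shows "independent B"
proof (rule independent_if_scalars_zero[OF assms(2)])
  fix f x assume s: "(\<Sum>x\<in>B. f x *\<^sub>R x) = 0" and x: "x \<in> B"
  have inj: "inj_on (\<lambda>x. (x, 0::'a)) B" by (simp add: inj_on_def)
  have "(\<Sum>z\<in>(\<lambda>x. (x, 0)) ` B. cscale (of_real (f (fst z))) z) = (\<Sum>x\<in>B. (f x *\<^sub>R x, 0))"
    by (simp add: sum.reindex[OF inj] cscale_def)
  also have "\<dots> = 0" using s by (simp add: sum_prod zero_prod_def)
  finally have z: "(\<Sum>z\<in>(\<lambda>x. (x, 0)) ` B. cscale (of_real (f (fst z))) z) = 0" .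
  show "f x = 0"
  proof (rule ccontr)
    assume "f x \<noteq> 0"
    then have "\<exists>v\<in>(\<lambda>x. (x, 0::'a)) ` B. complex_of_real (f (fst v)) \<noteq> 0" using x by auto
    with z have "cplx.dependent ((\<lambda>x. (x, 0)) ` B)"
      unfolding cplx.dependent_finite[OF finite_imageI[OF assms(2)]]
      by (intro exI[of _ "\<lambda>z. complex_of_real (f (fst z))"] conjI)
    then show False using assms(1) by simp
  qed
qed

context framed
begin

abbreviation "H i \<equiv> cplx.span (r i ` {1..n})"

lemma row_subset: "i < s \<Longrightarrow> r i ` {1..n} \<subseteq> case_prod r ` idx t"
  by (force simp: idx_def)

lemma H_mem: "i < s \<Longrightarrow> z \<in> H i \<Longrightarrow> z \<in> V \<times> V"
  using cplx.span_mono[OF row_subset] span_r by blast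

lemma crow_basis_row: "i < s \<Longrightarrow> crow_basis n (r i) (H i)"
proof -
  assume i: "i < s"
  have "inj_on (r i) {1..n}"
  proof (rule inj_onI)
    fix j k assume "j \<in> {1..n}" "k \<in> {1..n}" "r i j = r i k"
    then show "j = k" using inj_onD[OF K.r_inj, of "(i, j)" "(i, k)"] i by (auto simp: idx_def)
  qed
  then show ?thesis
    using cplx.independent_mono[OF K.r_independent row_subset[OF i]] by (simp add: crow_basis_def)
qed

lemma H_coord: "i < s \<Longrightarrow> h \<in> H i \<Longrightarrow> p \<in> idx t \<Longrightarrow> fst p \<noteq> i \<Longrightarrow> \<phi> p h = 0"
proof -
  assume i: "i < s" and h: "h \<in> H i" and p: "p \<in> idx t" "fst p \<noteq> i"
  have "h \<in> V \<times> V \<and> \<phi> p h = 0" using h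
  proof (induction rule: cplx.span_induct_alt)
    case base
    then show ?case using K.\<phi>_0[OF p(1)] C.V_sub by (simp add: cplx.subspace_0)
  next
    case (step c x y)
    then obtain k where k: "k \<in> {1..n}" "x = r i k" by blast
    have x: "x \<in> V \<times> V" "cscale c x \<in> V \<times> V"
      using r_mem[OF i k(1)] k(2) cplx.subspace_scale[OF C.V_sub] by auto
    have "\<phi> p x = 0" using coord_r[OF p(1), of "(i, k)"] i k p(2) by (auto simp: idx_def)
    then show ?case
      using step x cplx.subspace_add[OF C.V_sub x(2)] by (simp add: coord_add[OF p(1)] coord_scale[OF p(1)])
  qed
  then show ?thesis ..
qed

text \<open>
  The projection to the span \<open>H i\<close> of row \<open>i\<close> along the other rows.
\<close>

definition proj :: "nat \<Rightarrow> 'a \<times> 'a \<Rightarrow> 'a \<times> 'a" where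
  "proj i z = (\<Sum>k\<in>{1..n}. cscale (\<phi> (i, k) z) (r i k))"

lemma proj_in: "proj i z \<in> H i"
  unfolding proj_def by (intro cplx.span_sum cplx.span_scale cplx.span_base) auto

lemma sum_proj: "z \<in> V \<times> V \<Longrightarrow> z = (\<Sum>i<s. proj i z)"
proof -
  assume "z \<in> V \<times> V"
  from K.expand[OF this] have "z = (\<Sum>(i, k)\<in>{..<s} \<times> {1..n}. cscale (\<phi> (i, k) z) (r i k))"
    by (simp only: idx_def split_def prod.collapse)
  also have "\<dots> = (\<Sum>i<s. proj i z)"
    unfolding proj_def by (rule sum.cartesian_product[symmetric])
  finally show ?thesis .
qed

lemma proj_H: "i < s \<Longrightarrow> j < s \<Longrightarrow> h \<in> H j \<Longrightarrow> proj i h = (if i = j then h else 0)"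
proof -
  assume ij: "i < s" "j < s" and h: "h \<in> H j"
  have z: "proj i h = 0" if "i < s" "i \<noteq> j" for i
    unfolding proj_def using H_coord[OF ij(2) h] that by (intro sum.neutral) (auto simp: idx_def)
  have "h = (\<Sum>i<s. proj i h)" by (rule sum_proj[OF H_mem[OF ij(2) h]])
  also have "\<dots> = (\<Sum>i<s. if i = j then proj j h else 0)" using z by (intro sum.cong) auto
  also have "\<dots> = proj j h" using ij by simp
  finally show ?thesis using z ij by auto
qed

lemma proj_add: "i < s \<Longrightarrow> z \<in> V \<times> V \<Longrightarrow> w \<in> V \<times> V \<Longrightarrow> proj i (z + w) = proj i z + proj i w"
  by (simp add: proj_def idx_def coord_add cplx.scale_left_distrib sum.distrib)

lemma proj_sum:
  "i < s \<Longrightarrow> (\<And>j. j \<in> J \<Longrightarrow> f j \<in> V \<times> V) \<Longrightarrow> proj i (\<Sum>j\<in>J. f j) = (\<Sum>j\<in>J. proj i (f j))"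
proof (induction J rule: infinite_finite_induct)
  case (insert j J)
  then have "(\<Sum>j\<in>J. f j) \<in> V \<times> V" by (intro cplx.subspace_sum[OF C.V_sub]) auto
  with insert show ?case by (simp add: proj_add del: mem_Sigma_iff)
qed (use K.\<phi>_0 in \<open>simp_all add: proj_def idx_def\<close>)

lemma direct_sum_H: "direct_sum (map H [0..<s]) (V \<times> V)"
  unfolding direct_sum_def
proof (rule bij_betw_byWitness[of _ "\<lambda>z. map (\<lambda>i. proj i z) [0..<s]"])
  have sl: "sum_list xs = (\<Sum>j<s. xs ! j)" if "length xs = s" for xs :: "('a \<times> 'a) list"
    using that by (simp add: sum_list_sum_nth atLeast0LessThan)
  have mem: "xs ! j \<in> V \<times> V" "xs ! j \<in> H j" "length xs = s" if "xs \<in> listset (map H [0..<s])" "j < s" for xs j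
    using that H_mem[of j "xs ! j"] by (auto simp: listset_iff)
  show "\<forall>xs\<in>listset (map H [0..<s]). map (\<lambda>i. proj i (sum_list xs)) [0..<s] = xs"
  proof
    fix xs assume xs: "xs \<in> listset (map H [0..<s])"
    note l = mem(3)[OF xs s_pos]
    show "map (\<lambda>i. proj i (sum_list xs)) [0..<s] = xs"
    proof (rule nth_equalityI)
      fix i assume "i < length (map (\<lambda>i. proj i (sum_list xs)) [0..<s])"
      then have i: "i < s" by simp
      have "proj i (sum_list xs) = (\<Sum>j<s. proj i (xs ! j))"
        unfolding sl[OF l] by (rule proj_sum[OF i mem(1)[OF xs]]) simp
      also have "\<dots> = (\<Sum>j<s. if j = i then xs ! i else 0)"
        using proj_H[OF i _ mem(2)[OF xs]] by (intro sum.cong) auto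
      also have "\<dots> = xs ! i" using i by simp
      finally show "map (\<lambda>i. proj i (sum_list xs)) [0..<s] ! i = xs ! i" using i by simp
    qed (simp add: l)
  qed
  show "\<forall>z\<in>V \<times> V. sum_list (map (\<lambda>i. proj i z) [0..<s]) = z"
    using sum_proj by (simp add: sl)
  show "sum_list ` listset (map H [0..<s]) \<subseteq> V \<times> V"
  proof (rule image_subsetI)
    fix xs assume xs: "xs \<in> listset (map H [0..<s])"
    show "sum_list xs \<in> V \<times> V"
      unfolding sl[OF mem(3)[OF xs s_pos]] by (intro cplx.subspace_sum[OF C.V_sub] mem(1)[OF xs]) simp
  qed
  show "(\<lambda>z. map (\<lambda>i. proj i z) [0..<s]) ` (V \<times> V) \<subseteq> listset (map H [0..<s])"
    using proj_in by (auto simp: listset_iff)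
qed

lemma cconj_H: "i < s \<Longrightarrow> cconj ` H i = H (conj_row t i)"
proof -
  assume i: "i < s"
  have "cconj ` r i ` {1..n} = r (conj_row t i) ` {1..n}"
    unfolding image_image using r_conj[OF i] by (intro image_cong refl) simp
  then show ?thesis by (simp add: cconj_span)
qed

text \<open>
  Take \<open>M\<^sub>s\<close> diagonal in the frame and \<open>M\<^sub>u = exp N\<close> for the shift \<open>N\<close>. Both are real because conjugate rows have
  conjugate eigenvalues, they commute since \<open>M\<^sub>s\<close> is scalar on each row, and \<open>log M\<^sub>u = N\<close>.
\<close>

lemma jordan_decomposition_exists:
  obtains Ms Mu where "jordan_decomposition V M Ms Mu"
    "\<And>i z. i < s \<Longrightarrow> z \<in> H i \<Longrightarrow> map_prod Ms Ms z = cscale (eigval t i) z"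
    "\<And>i. i < s \<Longrightarrow> jordan_row n (map_prod (unipotent_log Mu) (unipotent_log Mu)) (r i)"
proof -
  have cs: "cscale (c i) (r i k) \<in> V \<times> V" if "i < s" "k \<in> {1..n}" for c i k
    by (rule cplx.subspace_scale[OF C.V_sub r_mem[OF that]])
  have dg: "\<exists>f. linear_on V f \<and> (\<forall>x\<in>V. f x \<in> V) \<and> (\<forall>i<s. \<forall>k\<in>{1..n}. map_prod f f (r i k) = cscale (c i) (r i k))"
    if c: "\<And>i. i < s \<Longrightarrow> c (conj_row t i) = cnj (c i)" for c
  proof -
    define w where "w = (\<lambda>p. cscale (c (fst p)) (case_prod r p))"
    have w: "w p \<in> V \<times> V" "cconj (w p) = w (conj_idx p)" if "p \<in> idx t" for p
      using that cs r_conj c by (auto simp: w_def idx_def cconj_scale simp del: mem_Sigma_iff)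
    obtain f where f: "linear_on V f" "\<And>x. x \<in> V \<Longrightarrow> f x \<in> V" "\<And>p. p \<in> idx t \<Longrightarrow> map_prod f f (case_prod r p) = w p"
      by (rule K.extend_linear[where w = w, OF subspace w]) (assumption | rule that)+
    have "map_prod f f (r i k) = cscale (c i) (r i k)" if "i < s" "k \<in> {1..n}" for i k
      using f(3)[of "(i, k)"] that by (simp add: w_def idx_def)
    then show ?thesis using f(1,2) by blast
  qed
  obtain Ms where Ms: "linear_on V Ms" "\<And>x. x \<in> V \<Longrightarrow> Ms x \<in> V"
    "\<And>i k. i < s \<Longrightarrow> k \<in> {1..n} \<Longrightarrow> map_prod Ms Ms (r i k) = cscale (eigval t i) (r i k)"
    using dg[of "eigval t"] datum(6)[OF listed] by blast
  obtain Ms' where Ms': "linear_on V Ms'" "\<And>x. x \<in> V \<Longrightarrow> Ms' x \<in> V"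
    "\<And>i k. i < s \<Longrightarrow> k \<in> {1..n} \<Longrightarrow> map_prod Ms' Ms' (r i k) = cscale (inverse (eigval t i)) (r i k)"
    using dg[of "\<lambda>i. inverse (eigval t i)"] datum(6)[OF listed] by (metis complex_cnj_inverse)
  have id: "linear_on V (\<lambda>x. x)" by (simp add: linear_on_def)
  have inv: "Ms' (Ms x) = x" "Ms (Ms' x) = x" if x: "x \<in> V" for x
  proof -
    show "Ms' (Ms x) = x"
    proof (rule K.linear_eq_real[OF linear_on_comp[OF Ms(1,2) Ms'(1)] id _ x])
      fix p assume "p \<in> idx t"
      then obtain i k where p: "p = (i, k)" "i < s" "k \<in> {1..n}" by (auto simp: idx_def)
      show "map_prod (\<lambda>x. Ms' (Ms x)) (\<lambda>x. Ms' (Ms x)) (case_prod r p) = map_prod (\<lambda>x. x) (\<lambda>x. x) (case_prod r p)"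
        unfolding map_prod_id map_prod_comp[of Ms' Ms, symmetric]
        using p datum(8)[OF listed p(2)] by (simp add: Ms(3) Ms'(3) clin_scale[OF Ms'(1) subspace r_mem])
    qed
    show "Ms (Ms' x) = x"
    proof (rule K.linear_eq_real[OF linear_on_comp[OF Ms'(1,2) Ms(1)] id _ x])
      fix p assume "p \<in> idx t"
      then obtain i k where p: "p = (i, k)" "i < s" "k \<in> {1..n}" by (auto simp: idx_def)
      show "map_prod (\<lambda>x. Ms (Ms' x)) (\<lambda>x. Ms (Ms' x)) (case_prod r p) = map_prod (\<lambda>x. x) (\<lambda>x. x) (case_prod r p)"
        unfolding map_prod_id map_prod_comp[of Ms Ms', symmetric]
        using p datum(8)[OF listed p(2)] by (simp add: Ms(3) Ms'(3) clin_scale[OF Ms(1) subspace r_mem])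
    qed
  qed
  have Ms_bij: "bij_betw Ms V V"
    by (rule bij_betw_byWitness[of _ Ms']) (use inv Ms(2) Ms'(2) in auto)
  have Ms_H: "map_prod Ms Ms z = cscale (eigval t i) z" if i: "i < s" and z: "z \<in> H i" for i z
  proof -
    have "z = proj i z" using proj_H[OF i i z] by simp
    then have eq: "z = (\<Sum>k\<in>{1..n}. cscale (\<phi> (i, k) z) (r i k))" by (simp add: proj_def)
    have "map_prod Ms Ms (\<Sum>k\<in>{1..n}. cscale (\<phi> (i, k) z) (r i k))
        = (\<Sum>k\<in>{1..n}. cscale (\<phi> (i, k) z) (map_prod Ms Ms (r i k)))"
      by (rule csum_linear[OF Ms(1) subspace r_mem[OF i]])
    also have "\<dots> = (\<Sum>k\<in>{1..n}. cscale (eigval t i) (cscale (\<phi> (i, k) z) (r i k)))"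
      by (intro sum.cong refl) (simp add: Ms(3)[OF i] mult.commute)
    also have "\<dots> = cscale (eigval t i) (\<Sum>k\<in>{1..n}. cscale (\<phi> (i, k) z) (r i k))"
      by (simp add: cplx.scale_sum_right)
    finally show ?thesis by (simp only: eq[symmetric])
  qed
  obtain N where N: "linear_on V N" "\<And>x. x \<in> V \<Longrightarrow> N x \<in> V" "cplx0.nilp (V \<times> V) (map_prod N N) n"
    "\<And>i k. i < s \<Longrightarrow> k \<in> {1..n} \<Longrightarrow> map_prod N N (r i k) = (if k < n then r i (k + 1) else 0)"
    by (rule shift_exists[OF listed K.coords_axioms]) (assumption | rule that)+
  have pow: "(map_prod N N ^^ k) (x, y) = ((N ^^ k) x, (N ^^ k) y)" for k x y
    by (induction k) simp_all
  have Nn: "real0.nilp V N n"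
    unfolding real0.nilp_def
  proof (intro conjI ballI)
    show "real0.endo_on V N" using N(1,2) subspace by (auto simp: endo_on_linear_on)
    fix x assume "x \<in> V"
    then have "(x, x) \<in> V \<times> V" by simp
    then have "(map_prod N N ^^ n) (x, x) = 0" using N(3) by (simp add: cplx0.nilp_def)
    then show "(N ^^ n) x = 0" by (simp add: pow zero_prod_def)
  qed
  define Mu where "Mu = real0.op_exp N"
  have Mu_endo: "real0.endo_on V Mu" and Mu'_endo: "real0.endo_on V (real0.op_exp (\<lambda>x. - N x))"
    unfolding Mu_def real0.op_exp_def by (rule real0.fps_app_endo real0.nilp_uminus Nn)+
  have Mu: "linear_on V Mu" "\<And>x. x \<in> V \<Longrightarrow> Mu x \<in> V" using Mu_endo by (auto simp: endo_on_linear_on)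
  have Mu_bij: "bij_betw Mu V V"
    by (rule bij_betw_byWitness[of _ "real0.op_exp (\<lambda>x. - N x)"])
      (use real0.op_exp_uminus[OF Nn] real0.endo_onD(2)[OF Mu_endo] real0.endo_onD(2)[OF Mu'_endo] in \<open>auto simp: Mu_def\<close>)
  have Mu_nilp: "real0.nilp V (\<lambda>x. Mu x - x) n"
    unfolding Mu_def by (rule real0.nilp_op_exp_minus_id(1)[OF Nn])
  have log: "unipotent_log Mu x = N x" if "x \<in> V" for x
    using unipotent_log_eq[OF Mu_nilp that] real0.op_log_op_exp[OF Nn that] by (simp add: Mu_def)
  have logC: "map_prod (unipotent_log Mu) (unipotent_log Mu) z = map_prod N N z" if "z \<in> V \<times> V" for z
    using that log by auto
  have Mu_r: "map_prod Mu Mu (r i k) = (\<Sum>j=0..n-k. cscale (1 / fact j) (r i (k + j)))"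
    if ik: "i < s" "k \<in> {1..n}" for i k
  proof -
    have "map_prod Mu Mu (r i k) = cplx0.op_exp (map_prod N N) (r i k)"
      unfolding Mu_def real0.op_exp_def cplx0.op_exp_def
      by (rule fps_app_map_prod(2)[OF Nn fps_exp_of_real r_mem[OF ik], symmetric])
    also have "\<dots> = (\<Sum>j=0..n-k. cscale (1 / fact j) (r i (k + j)))"
      by (rule cplx0.op_exp_jordan[OF N(3) r_mem[OF ik(1)] _ _ ik(2)]) (use ik n1 in \<open>auto simp: N(4)\<close>)
    finally show ?thesis .
  qed
  have m: "r i (k + j) \<in> V \<times> V" if "j \<in> {0..n-k}" "i < s" "k \<in> {1..n}" for i j k
    using that by (intro r_mem) auto
  have MsMu: "map_prod Ms Ms (map_prod Mu Mu (r i k)) = map_prod M M (r i k)" if ik: "i < s" "k \<in> {1..n}" for i k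
  proof -
    have "map_prod Ms Ms (map_prod Mu Mu (r i k)) = (\<Sum>j=0..n-k. cscale (1 / fact j) (map_prod Ms Ms (r i (k + j))))"
      unfolding Mu_r[OF ik] by (rule csum_linear[OF Ms(1) subspace m[OF _ ik]])
    also have "\<dots> = (\<Sum>j=0..n-k. cscale (eigval t i) (cscale (1 / fact j) (r i (k + j))))"
    proof (intro sum.cong refl)
      fix j assume "j \<in> {0..n-k}"
      then have "k + j \<in> {1..n}" using ik by auto
      then show "cscale (1 / fact j) (map_prod Ms Ms (r i (k + j))) = cscale (eigval t i) (cscale (1 / fact j) (r i (k + j)))"
        using Ms(3)[OF ik(1)] by (simp add: mult.commute)
    qed
    finally show ?thesis by (simp add: r_chain[OF ik] cplx.scale_sum_right)
  qed
  have MuMs: "map_prod Mu Mu (map_prod Ms Ms (r i k)) = map_prod M M (r i k)" if ik: "i < s" "k \<in> {1..n}" for i k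
    unfolding Ms(3)[OF ik] clin_scale[OF Mu(1) subspace r_mem[OF ik]] Mu_r[OF ik] r_chain[OF ik] ..
  have M1: "M x = Ms (Mu x)" if "x \<in> V" for x
  proof (rule K.linear_eq_real[OF aut_linear linear_on_comp[OF Mu Ms(1)] _ that])
    fix p assume "p \<in> idx t"
    then obtain i k where "p = (i, k)" "i < s" "k \<in> {1..n}" by (auto simp: idx_def)
    then show "map_prod M M (case_prod r p) = map_prod (\<lambda>x. Ms (Mu x)) (\<lambda>x. Ms (Mu x)) (case_prod r p)"
      unfolding map_prod_comp[of Ms Mu, symmetric] by (simp add: MsMu)
  qed
  have M2: "M x = Mu (Ms x)" if "x \<in> V" for x
  proof (rule K.linear_eq_real[OF aut_linear linear_on_comp[OF Ms(1,2) Mu(1)] _ that])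
    fix p assume "p \<in> idx t"
    then obtain i k where "p = (i, k)" "i < s" "k \<in> {1..n}" by (auto simp: idx_def)
    then show "map_prod M M (case_prod r p) = map_prod (\<lambda>x. Mu (Ms x)) (\<lambda>x. Mu (Ms x)) (case_prod r p)"
      unfolding map_prod_comp[of Mu Ms, symmetric] by (simp add: MuMs)
  qed
  have ss: "semisimple_on V Ms"
    unfolding semisimple_on_def
  proof
    let ?E = "{z \<in> V \<times> V. \<exists>c. map_prod Ms Ms z = cscale c z}"
    have "case_prod r ` idx t \<subseteq> ?E"
    proof (rule image_subsetI)
      fix p assume p: "p \<in> idx t"
      have "map_prod Ms Ms (case_prod r p) = cscale (eigval t (fst p)) (case_prod r p)"
        using p Ms(3) by (auto simp: idx_def)
      then show "case_prod r p \<in> ?E" using r_mem'[OF p] by blast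
    qed
    from cplx.span_mono[OF this] show "V \<times> V \<subseteq> cplx.span ?E" unfolding span_r .
    show "cplx.span ?E \<subseteq> V \<times> V" by (intro cplx.span_minimal C.V_sub) blast
  qed
  have un: "unipotent_on V Mu"
    using Mu_nilp unfolding unipotent_on_def real0.nilp_def by blast
  have jd: "jordan_decomposition V M Ms Mu"
    unfolding jordan_decomposition_def using Ms(1) Ms_bij ss Mu(1) Mu_bij un M1 M2 by blast
  have jr: "jordan_row n (map_prod (unipotent_log Mu) (unipotent_log Mu)) (r i)" if "i < s" for i
    using n1 by (auto simp: jordan_row_def logC[OF r_mem[OF that]] N(4)[OF that])
  show thesis by (rule that[OF jd Ms_H jr])
qed

lemma dim_V: "dim V = s * n"
  using K.dim_eq_card by (simp add: idx_def)

lemma gram_rows: "i < s \<Longrightarrow> j < s \<Longrightarrow> gram_eq n (cform S) (r i) (r j) (if j = dual_row t i then gram_const t i else 0)"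
  using pre by (simp add: preframe_def)

lemma real_row:
  assumes i: "i < s" "conj_row t i = i"
  shows "k \<in> {1..n} \<Longrightarrow> r i k = (fst (r i k), 0)" "k \<in> {1..n} \<Longrightarrow> fst (r i k) \<in> V"
    and "row_basis n (\<lambda>k. fst (r i k)) (span ((\<lambda>k. fst (r i k)) ` {1..n}))"
    and "H i = span ((\<lambda>k. fst (r i k)) ` {1..n}) \<times> span ((\<lambda>k. fst (r i k)) ` {1..n})"
proof -
  show re: "r i k = (fst (r i k), 0)" if "k \<in> {1..n}" for k
  proof -
    have "- snd (r i k) = snd (r i k)" using r_conj[OF i(1) that] i(2) by (metis cconj_def snd_conv)
    then have "2 *\<^sub>R snd (r i k) = 0" unfolding scaleR_2 by (simp add: neg_eq_iff_add_eq_0)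
    then have "snd (r i k) = 0" by simp
    then show ?thesis by (simp add: prod_eq_iff)
  qed
  show "fst (r i k) \<in> V" if "k \<in> {1..n}" for k using r_mem[OF i(1) that] by auto
  let ?a = "\<lambda>k. fst (r i k)"
  have img: "r i ` {1..n} = (\<lambda>x. (x, 0)) ` ?a ` {1..n}"
    unfolding image_image using re by (intro image_cong refl) simp
  then show "H i = span (?a ` {1..n}) \<times> span (?a ` {1..n})" by (simp add: cplx_span_real)
  have c: "inj_on (r i) {1..n}" "cplx.independent (r i ` {1..n})"
    using crow_basis_row[OF i(1)] by (auto simp: crow_basis_def)
  have "inj_on ?a {1..n}"
  proof (rule inj_onI)
    fix j k assume "j \<in> {1..n}" "k \<in> {1..n}" "?a j = ?a k"
    then show "j = k" using re[of j] re[of k] c(1) by (metis inj_onD)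
  qed
  moreover have "independent (?a ` {1..n})"
    using c(2) unfolding img by (rule independent_of_complex) simp
  ultimately show "row_basis n ?a (span (?a ` {1..n}))" by (simp add: row_basis_def)
qed

lemma real_gram:
  assumes "i < s" "conj_row t i = i" "j < s" "conj_row t j = j" "(if j = dual_row t i then gram_const t i else 0) = of_real c"
  shows "gram_eq n S (\<lambda>k. fst (r i k)) (\<lambda>k. fst (r j k)) c"
  unfolding gram_eq_def
proof (intro ballI)
  fix k l assume kl: "k \<in> {1..n}" "l \<in> {1..n}"
  have "complex_of_real (S (fst (r i k)) (fst (r j l))) = cform S (r i k) (r j l)"
    using cS_real[OF real_row(2)[OF assms(1,2) kl(1)] real_row(2)[OF assms(3,4) kl(2)]]
      real_row(1)[OF assms(1,2) kl(1)] real_row(1)[OF assms(3,4) kl(2)] by simp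
  also have "\<dots> = of_real c * E_per n k l"
    using gram_rows[OF assms(1,3)] kl assms(5) by (simp add: gram_eq_def)
  also have "\<dots> = of_real (c * E_per n k l)" by (simp add: E_per_of_real)
  finally show "S (fst (r i k)) (fst (r j l)) = c * E_per n k l" unfolding of_real_eq_iff .
qed

lemma sign_par: "symmetric_form (parity t) V S"
proof -
  obtain m where m: "\<And>x y. x \<in> V \<Longrightarrow> y \<in> V \<Longrightarrow> S y x = (-1) ^ m * S x y" by (rule sign) blast
  have "(-1::real) ^ parity t = (-1) ^ m"
    using form_sign[OF m] by (auto simp: minus_one_power_iff split: if_splits)
  then show ?thesis unfolding symmetric_form_def using m by metis
qed

text \<open>
  What remains is to restate the frame, with the Jordan decomposition just found, in the wording of each
  family. Rows fixed by conjugation become real rows, and the Gram matrices between conjugate rows are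
  those between the corresponding rows of the frame.
\<close>

lemma of_type: "of_type V M S t"
proof -
  obtain Ms Mu where jd: "jordan_decomposition V M Ms Mu"
    and Ms: "\<And>i z. i < s \<Longrightarrow> z \<in> H i \<Longrightarrow> map_prod Ms Ms z = cscale (eigval t i) z"
    and jr: "\<And>i. i < s \<Longrightarrow> jordan_row n (map_prod (unipotent_log Mu) (unipotent_log Mu)) (r i)"
    by (rule jordan_decomposition_exists) (assumption | rule that)+
  let ?N = "unipotent_log Mu"
  have nn: "n \<ge> 1" using n1 by simp
  have jr': "jordan_row n (map_prod ?N ?N) (cconj \<circ> r i)" if "i < s" for i
    by (rule jordan_row_cong[OF jr[OF datum(1)[OF listed that]] nn]) (simp_all add: r_conj that)
  have gA: "gram_eq n (cform S) (r i) (cconj \<circ> r j) (if conj_row t j = dual_row t i then gram_const t i else 0)"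
    if "i < s" "j < s" for i j
    by (rule gram_eq_cong[OF gram_rows[OF that(1) datum(1)[OF listed that(2)]]]) (simp_all add: r_conj that)
  have gB: "gram_eq n (cform S) (cconj \<circ> r i) (r j) (if j = dual_row t (conj_row t i) then gram_const t (conj_row t i) else 0)"
    if "i < s" "j < s" for i j
    by (rule gram_eq_cong[OF gram_rows[OF datum(1)[OF listed that(1)] that(2)]]) (simp_all add: r_conj that)
  have gC: "gram_eq n (cform S) (cconj \<circ> r i) (cconj \<circ> r j) (if conj_row t j = dual_row t (conj_row t i) then gram_const t (conj_row t i) else 0)"
    if "i < s" "j < s" for i j
    by (rule gram_eq_cong[OF gram_rows[OF datum(1)[OF listed that(1)] datum(1)[OF listed that(2)]]])
      (simp_all add: r_conj that)
  have Ms_real: "Ms x = l *\<^sub>R x" if "i < s" "conj_row t i = i" "eigval t i = of_real l" "x \<in> span ((\<lambda>k. fst (r i k)) ` {1..n})" for i l x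
  proof -
    have "(x, 0) \<in> H i" using real_row(4)[OF that(1,2)] that(4) by (simp add: span_0)
    from Ms[OF that(1) this] show ?thesis using that(3) by (simp add: cscale_def)
  qed
  have jr_real: "jordan_row n ?N (\<lambda>k. fst (r i k))" if "i < s" "conj_row t i = i" for i
  proof -
    have "?N (fst (r i k)) = fst (r i (k + 1))" if k: "k \<in> {1..<n}" for k
      using jr[OF \<open>i < s\<close>] k unfolding jordan_row_def by (metis fst_map_prod)
    moreover have "?N (fst (r i n)) = 0"
      using jr[OF \<open>i < s\<close>] unfolding jordan_row_def by (metis fst_map_prod fst_zero)
    ultimately show ?thesis by (simp add: jordan_row_def)
  qed
  have "case t of
           Tr1 l k e \<Rightarrow> is_Tr1 V Ms ?N S l k e
         | Tr2e l k m e \<Rightarrow> is_Tr2e V Ms ?N S l k m e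
         | Tr2 l k m \<Rightarrow> is_Tr2 V Ms ?N S l k m
         | Tr4 l k m \<Rightarrow> is_Tr4 V Ms ?N S l k m"
  proof (cases t)
    case (Tr1 l n0 e)
    then have t: "s = 1" "n = n0" "conj_row t 0 = 0" "eigval t 0 = of_real l" "dual_row t 0 = 0" "gram_const t 0 = of_real e" by simp_all
    have s0: "0 < s" using t by simp
    let ?a = "\<lambda>k. fst (r 0 k)"
    have "H 0 = V \<times> V"
    proof
      show "H 0 \<subseteq> V \<times> V" by (rule subsetI) (rule H_mem[OF s0])
      show "V \<times> V \<subseteq> H 0"
      proof (rule subsetI)
        fix z assume z: "z \<in> V \<times> V"
        have "(\<Sum>i<s. proj i z) = proj 0 z" unfolding t(1) by simp
        with sum_proj[OF z] have "z = proj 0 z" by (rule trans)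
        then show "z \<in> H 0" using proj_in[of 0 z] by metis
      qed
    qed
    then have sp: "span (?a ` {1..n}) = V" using real_row(4)[OF s0 t(3)] by (auto simp: set_eq_iff)
    have "is_Tr1 V Ms ?N S l n e"
      unfolding is_Tr1_def
      using dim_V t real_row(3)[OF s0 t(3)] sp Ms_real[OF s0 t(3,4)] jr_real[OF s0 t(3)]
        real_gram[OF s0 t(3) s0 t(3), of e]
      by (intro conjI exI[of _ ?a]) simp_all
    then show ?thesis using Tr1 by simp
  next
    case (Tr2e l n0 m e)
    then have t: "s = 2" "n = n0" "conj_row t 0 = 1" "conj_row t 1 = 0" "eigval t 0 = l" "eigval t 1 = cnj l" "dual_row t 0 = 1" "dual_row t 1 = 0"
      "gram_const t 0 = \<i> ^ (n + m + 1) * of_real e" "gram_const t 1 = \<i> ^ (n + m + 1) * of_real e * (-1) ^ (n + m + 1)" "parity t = m" by simp_all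
    have s0: "0 < s" and s1: "1 < s" using t by simp_all
    have cH: "cconj ` H 0 = H 1" using cconj_H[OF s0] t by simp
    have ds: "direct_sum [H 0, cconj ` H 0] (V \<times> V)"
      using direct_sum_H unfolding cH t(1) by (simp add: upt_rec)
    have "is_Tr2e V Ms ?N S l n m e"
      unfolding is_Tr2e_def
    proof (intro conjI exI[of _ "H 0"] exI[of _ "r 0"])
      show "dim V = 2 * n" using dim_V t by simp
      show "symmetric_form m V S" using sign_par t by simp
      show "direct_sum [H 0, cconj ` H 0] (V \<times> V)" by (rule ds)
      show "crow_basis n (r 0) (H 0)" by (rule crow_basis_row[OF s0])
      show "\<forall>z\<in>H 0. map_prod Ms Ms z = cscale l z" using Ms[OF s0] t by simp
      show "\<forall>z\<in>cconj ` H 0. map_prod Ms Ms z = cscale (cnj l) z" unfolding cH using Ms[OF s1] t by simp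
      show "jordan_row n (map_prod ?N ?N) (r 0)" by (rule jr[OF s0])
      show "jordan_row n (map_prod ?N ?N) (cconj \<circ> r 0)" by (rule jr'[OF s0])
      show "gram_eq n (cform S) (r 0) (r 0) 0" using gram_rows[OF s0 s0] t by simp
      show "gram_eq n (cform S) (cconj \<circ> r 0) (cconj \<circ> r 0) 0" using gC[OF s0 s0] t by simp
      show "gram_eq n (cform S) (r 0) (cconj \<circ> r 0) (\<i> ^ (n + m + 1) * complex_of_real e)"
        using gA[OF s0 s0] unfolding t by simp
      show "gram_eq n (cform S) (cconj \<circ> r 0) (r 0) (\<i> ^ (n + m + 1) * complex_of_real e * (-1) ^ (n + m + 1))"
        using gB[OF s0 s0] unfolding t by simp
    qed
    then show ?thesis using Tr2e by simp
  next
    case (Tr2 l n0 m)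
    then have t: "s = 2" "n = n0" "conj_row t 0 = 0" "conj_row t 1 = 1" "eigval t 0 = of_real l" "eigval t 1 = of_real (inverse l)" "dual_row t 0 = 1" "dual_row t 1 = 0"
      "gram_const t 0 = of_real 1" "gram_const t 1 = of_real ((-1) ^ (n + m + 1))" by simp_all
    have s0: "0 < s" and s1: "1 < s" using t by simp_all
    let ?a = "\<lambda>k. fst (r 0 k)" and ?b = "\<lambda>k. fst (r 1 k)"
    let ?H1 = "span (?a ` {1..n})" and ?H2 = "span (?b ` {1..n})"
    note ra = real_row[OF s0 t(3)] and rb = real_row[OF s1 t(4)]
    have ds: "direct_sum [?H1, ?H2] V"
    proof (rule direct_sum_2)
      show "?H1 \<subseteq> V" "?H2 \<subseteq> V" using ra(2) rb(2) by (intro span_minimal subspace; blast)+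
      show "?H1 \<inter> ?H2 = {0}"
      proof -
        have "x = 0" if "x \<in> ?H1" "x \<in> ?H2" for x
        proof -
          have "(x, 0) \<in> H 0" "(x, 0) \<in> H 1" unfolding ra(4) rb(4) using that by (auto simp: span_0)
          then have "(x, 0) = (0 :: 'a \<times> 'a)" using proj_H[OF s0 s0, of "(x, 0)"] proj_H[OF s0 s1, of "(x, 0)"] by simp
          then show ?thesis by (simp add: zero_prod_def)
        qed
        then show ?thesis by (auto simp: span_0)
      qed
      show "\<exists>u\<in>?H1. x - u \<in> ?H2" if "x \<in> V" for x
      proof -
        have "(x, 0) \<in> V \<times> V" using that subspace_0[OF subspace] by simp
        from sum_proj[OF this] have "(x, 0) = proj 0 (x, 0) + proj 1 (x, 0)" unfolding t(1) by (simp add: numeral_2_eq_2)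
        then have "x = fst (proj 0 (x, 0)) + fst (proj 1 (x, 0))" by (metis fst_add fst_conv)
        moreover have "fst (proj 0 (x, 0)) \<in> ?H1" "fst (proj 1 (x, 0)) \<in> ?H2"
          using proj_in[of 0 "(x, 0)"] proj_in[of 1 "(x, 0)"] unfolding ra(4) rb(4) by auto
        ultimately show ?thesis by (intro bexI[of _ "fst (proj 0 (x, 0))"]) (metis add_diff_cancel_left')
      qed
    qed (rule subspace_span subspace)+
    have "is_Tr2 V Ms ?N S l n m"
      unfolding is_Tr2_def
    proof (rule exI[of _ ?H1], rule exI[of _ ?H2], rule exI[of _ ?a], rule exI[of _ ?b], intro conjI)
      show "direct_sum [?H1, ?H2] V" by (rule ds)
      show "row_basis n ?a ?H1" "row_basis n ?b ?H2" by (rule ra(3) rb(3))+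
      show "\<forall>x\<in>?H1. Ms x = l *\<^sub>R x" using Ms_real[OF s0 t(3,5)] by blast
      show "\<forall>x\<in>?H2. Ms x = inverse l *\<^sub>R x" using Ms_real[OF s1 t(4,6)] by blast
      show "jordan_row n ?N ?a" "jordan_row n ?N ?b" by (rule jr_real s0 s1 t)+
      show "gram_eq n S ?a ?a 0" by (rule real_gram[OF s0 t(3) s0 t(3)]) (simp add: t[simplified])
      show "gram_eq n S ?b ?b 0" by (rule real_gram[OF s1 t(4) s1 t(4)]) (simp add: t[simplified])
      show "gram_eq n S ?a ?b 1" by (rule real_gram[OF s0 t(3) s1 t(4)]) (simp add: t[simplified])
      show "gram_eq n S ?b ?a ((-1) ^ (n + m + 1))" by (rule real_gram[OF s1 t(4) s0 t(3)]) (simp add: t[simplified])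
    qed
    then show ?thesis using Tr2 by simp
  next
    case (Tr4 l n0 m)
    then have t: "s = 4" "n = n0" "conj_row t 0 = 2" "conj_row t 1 = 3" "conj_row t 2 = 0" "conj_row t 3 = 1"
      "eigval t 0 = l" "eigval t 1 = inverse l" "eigval t 2 = cnj l" "eigval t 3 = inverse (cnj l)"
      "dual_row t 0 = 1" "dual_row t 1 = 0" "dual_row t 2 = 3" "dual_row t 3 = 2"
      "gram_const t 0 = 1" "gram_const t 1 = (-1) ^ (n + m + 1)" "gram_const t 2 = 1" "gram_const t 3 = (-1) ^ (n + m + 1)" by simp_all
    have s: "0 < s" "1 < s" "2 < s" "3 < s" using t by simp_all
    have cH: "cconj ` H 0 = H 2" "cconj ` H 1 = H 3" using cconj_H s t by simp_all
    have "[0..<4] = [0, 1, 2, 3]" by (simp add: upt_rec)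
    then have ds: "direct_sum [H 0, H 1, cconj ` H 0, cconj ` H 1] (V \<times> V)"
      using direct_sum_H unfolding cH t(1) by simp
    have "is_Tr4 V Ms ?N S l n m"
      unfolding is_Tr4_def
    proof (rule conjI[OF _ exI[of _ "H 0", OF exI[of _ "H 1", OF exI[of _ "r 0", OF exI[of _ "r 1"]]]]], goal_cases)
      case 1
      show ?case using dim_V t by simp
    next
      case 2
      show ?case
      proof (intro conjI ds)
        show "crow_basis n (r 0) (H 0)" "crow_basis n (r 1) (H 1)" by (rule crow_basis_row s)+
        show "\<forall>z\<in>H 0. map_prod Ms Ms z = cscale l z" using Ms[OF s(1)] t by simp
        show "\<forall>z\<in>H 1. map_prod Ms Ms z = cscale (inverse l) z" using Ms[OF s(2)] t by simp
        show "\<forall>z\<in>cconj ` H 0. map_prod Ms Ms z = cscale (cnj l) z" unfolding cH using Ms[OF s(3)] t by simp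
        show "\<forall>z\<in>cconj ` H 1. map_prod Ms Ms z = cscale (inverse (cnj l)) z" unfolding cH using Ms[OF s(4)] t by simp
        show "\<forall>r\<in>{r 0, r 1, cconj \<circ> r 0, cconj \<circ> r 1}. jordan_row n (map_prod ?N ?N) r"
          using jr s jr' by auto
        show "gram_eq n (cform S) (r 0) (r 1) 1" "gram_eq n (cform S) (r 1) (r 0) ((-1) ^ (n + m + 1))"
          "gram_eq n (cform S) (r 0) (r 0) 0" "gram_eq n (cform S) (r 1) (r 1) 0"
          using gram_rows[OF s(1,2)] gram_rows[OF s(2,1)] gram_rows[OF s(1,1)] gram_rows[OF s(2,2)] unfolding t by simp_all
        show "gram_eq n (cform S) (cconj \<circ> r 0) (cconj \<circ> r 1) 1"
          "gram_eq n (cform S) (cconj \<circ> r 1) (cconj \<circ> r 0) ((-1) ^ (n + m + 1))"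
          "gram_eq n (cform S) (cconj \<circ> r 0) (cconj \<circ> r 0) 0" "gram_eq n (cform S) (cconj \<circ> r 1) (cconj \<circ> r 1) 0"
          using gC[OF s(1,2)] gC[OF s(2,1)] gC[OF s(1,1)] gC[OF s(2,2)] unfolding t by simp_all
        show "gram_eq n (cform S) (r 0) (cconj \<circ> r 0) 0" "gram_eq n (cform S) (r 0) (cconj \<circ> r 1) 0"
          "gram_eq n (cform S) (r 1) (cconj \<circ> r 0) 0" "gram_eq n (cform S) (r 1) (cconj \<circ> r 1) 0"
          using gA[OF s(1,1)] gA[OF s(1,2)] gA[OF s(2,1)] gA[OF s(2,2)] unfolding t by simp_all
        show "gram_eq n (cform S) (cconj \<circ> r 0) (r 0) 0" "gram_eq n (cform S) (cconj \<circ> r 0) (r 1) 0"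
          "gram_eq n (cform S) (cconj \<circ> r 1) (r 0) 0" "gram_eq n (cform S) (cconj \<circ> r 1) (r 1) 0"
          using gB[OF s(1,1)] gB[OF s(1,2)] gB[OF s(2,1)] gB[OF s(2,2)] unfolding t by simp_all
      qed
    qed
    then show ?thesis using Tr4 by simp
  qed
  then show ?thesis unfolding of_type_def using isometric_triple_axioms jd by blast
qed

end

section \<open>Irreducible triples have frames\<close>

lemma E_per_swap:
  "j \<in> {1..n} \<Longrightarrow> k \<in> {1..n} \<Longrightarrow> (E_per n k j :: 'c::comm_ring_1) = (-1) ^ (n + 1) * E_per n j k"
proof -
  assume jk: "j \<in> {1..n}" "k \<in> {1..n}"
  show ?thesis
  proof (cases "j + k = n + 1")
    case True
    then have "n + 1 + (j - 1) = k - 1 + 2 * j" using jk by auto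
    then have "(-1::'c) ^ (n + 1) * (-1) ^ (j - 1) = (-1) ^ (k - 1)"
      by (metis (no_types) mult.right_neutral power_add power_minus1_even)
    moreover have "k = n + 1 - j" "j = n + 1 - k" using True by auto
    ultimately show ?thesis unfolding E_per_def by (metis (full_types))
  next
    case False
    then have "k \<noteq> n + 1 - j" "j \<noteq> n + 1 - k" using jk by auto
    then show ?thesis by (simp add: E_per_def)
  qed
qed

text \<open>
  \<open>E_per\<close> is \<open>(-1)\<^sup>n\<^sup>+\<^sup>1\<close>-symmetric; this is where the sign \<open>(-1)\<^sup>n\<^sup>+\<^sup>m\<^sup>+\<^sup>1\<close> of the second Gram matrix comes from.
\<close>

lemma gram_swap:
  assumes "gram_eq n F a b c" "\<And>j k. j \<in> {1..n} \<Longrightarrow> k \<in> {1..n} \<Longrightarrow> F (b j) (a k) = (-1) ^ m * F (a k) (b j)"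
  shows "gram_eq n F b a ((-1) ^ (n + m + 1) * c)"
  unfolding gram_eq_def
proof (intro ballI)
  fix j k assume jk: "j \<in> {1..n}" "k \<in> {1..n}"
  have "F (b j) (a k) = (-1) ^ m * (c * E_per n k j)" using assms jk by (simp add: gram_eq_def)
  then show "F (b j) (a k) = (-1) ^ (n + m + 1) * c * E_per n j k"
    unfolding E_per_swap[OF jk] by (simp add: power_add mult_ac)
qed

lemma polarization:
  fixes h :: "'b::ab_group_add \<Rightarrow> 'b \<Rightarrow> 'c::comm_ring_1"
  assumes add: "\<And>x y z. x \<in> W \<Longrightarrow> y \<in> W \<Longrightarrow> z \<in> W \<Longrightarrow> h (x + y) z = h x z + h y z"
      "\<And>x y z. x \<in> W \<Longrightarrow> y \<in> W \<Longrightarrow> z \<in> W \<Longrightarrow> h z (x + y) = h z x + h z y"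
    and W: "\<And>x y. x \<in> W \<Longrightarrow> y \<in> W \<Longrightarrow> x + y \<in> W"
    and diag: "\<And>x. x \<in> W \<Longrightarrow> h x x = 0" and xy: "x \<in> W" "y \<in> W"
  shows "h y x = - h x y"
proof -
  have "h (x + y) (x + y) = h x y + h y x"
    using xy W[OF xy] diag[OF xy(1)] diag[OF xy(2)] by (simp add: add)
  then have "h x y + h y x = 0" using diag[OF W[OF xy]] by simp
  then show ?thesis by (simp add: eq_neg_iff_add_eq_0 add.commute)
qed

context isometric_triple
begin

interpretation R: iso_space scaleR V M S by (rule real_space)
interpretation C: iso_space cscale "V \<times> V" "map_prod M M" "cform S" by (rule cplx_space)

lemma sign_C:
  obtains m where "m \<in> {0, 1}" "\<And>x y. x \<in> V \<Longrightarrow> y \<in> V \<Longrightarrow> S y x = (-1) ^ m * S x y"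
    "\<And>z w. z \<in> V \<times> V \<Longrightarrow> w \<in> V \<times> V \<Longrightarrow> cform S w z = (-1) ^ m * cform S z w"
proof -
  obtain m where m: "m \<in> {0, 1::nat}" "\<And>x y. x \<in> V \<Longrightarrow> y \<in> V \<Longrightarrow> S y x = (-1) ^ m * S x y" by (rule sign) blast
  have "cform S w z = (-1) ^ m * cform S z w" if "z \<in> V \<times> V" "w \<in> V \<times> V" for z w
    by (rule cform_swap[OF m(2) that])
  with m show thesis using that by blast
qed

lemma chain_cconj:
  assumes "cplx0.exp_chain n l (map_prod M M) r" "\<And>k. k \<in> {1..n} \<Longrightarrow> r k \<in> V \<times> V"
  shows "cplx0.exp_chain n (cnj l) (map_prod M M) (\<lambda>k. cconj (r k))"
  unfolding cplx0.exp_chain_def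
proof
  fix k assume k: "k \<in> {1..n}"
  have "map_prod M M (cconj (r k)) = cconj (map_prod M M (r k))"
    by (rule cconj_map_prod[OF aut_linear assms(2)[OF k], symmetric])
  also have "\<dots> = cconj (cscale l (\<Sum>j=0..n-k. cscale (1 / fact j) (r (k + j))))"
    using assms(1) k by (simp add: cplx0.exp_chain_def)
  finally show "map_prod M M (cconj (r k)) = cscale (cnj l) (\<Sum>j=0..n-k. cscale (1 / fact j) (cconj (r (k + j))))"
    by (simp add: cconj_scale cconj_sum)
qed

lemma gram_cconj:
  assumes "gram_eq n (cform S) a b c" "\<And>k. k \<in> {1..n} \<Longrightarrow> a k \<in> V \<times> V" "\<And>k. k \<in> {1..n} \<Longrightarrow> b k \<in> V \<times> V"
  shows "gram_eq n (cform S) (\<lambda>k. cconj (a k)) (\<lambda>k. cconj (b k)) (cnj c)"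
  unfolding gram_eq_def
proof (intro ballI)
  fix j k assume jk: "j \<in> {1..n}" "k \<in> {1..n}"
  have "cform S (cconj (a j)) (cconj (b k)) = cnj (cform S (a j) (b k))"
    using cS_cconj[OF _ _ assms(2)[OF jk(1)] assms(3)[OF jk(2)]] .
  also have "\<dots> = cnj (c * E_per n j k)" using assms(1) jk by (simp add: gram_eq_def)
  also have "\<dots> = cnj c * E_per n j k" by (simp add: E_per_def)
  finally show "cform S (cconj (a j)) (cconj (b k)) = cnj c * E_per n j k" .
qed

lemma defect_cconj: "z \<in> V \<times> V \<Longrightarrow> cconj (C.defect l z) = C.defect (cnj l) (cconj z)"
  by (simp add: C.defect_def cconj_diff cconj_scale cconj_map_prod[OF aut_linear] del: mem_Sigma_iff)

lemma defect_pow_cconj: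
  assumes z: "z \<in> V \<times> V"
  shows "(C.defect (cnj l) ^^ k) (cconj z) = cconj ((C.defect l ^^ k) z)"
proof (induction k)
  case (Suc k)
  then show ?case
    using defect_cconj[OF cplx0.endo_onD(2)[OF cplx0.endo_on_funpow[OF C.defect_endo] z]] by simp
qed simp

lemma gen_cconj: "z \<in> C.gen l D \<Longrightarrow> cconj z \<in> C.gen (cnj l) D"
proof -
  assume z: "z \<in> C.gen l D"
  then have zV: "z \<in> V \<times> V" using C.gen_sub_V by blast
  show ?thesis using z defect_pow_cconj[OF zV, where l = l and k = D] cconj_mem[OF subspace, of z] unfolding C.gen_def mem_Collect_eq by simp
qed

text \<open>
  The coefficients of the logarithm series are real.
\<close>

lemma mlog_cconj:
  assumes z: "z \<in> C.gen l D"
  shows "cconj (C.mlog l z) = C.mlog (cnj l) (cconj z)"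
proof -
  have n: "cplx0.nilp (C.gen l D) (C.defect l) D" "cplx0.nilp (C.gen (cnj l) D) (C.defect (cnj l)) D"
    by (rule C.defect_nilp)+
  have zV: "z \<in> V \<times> V" using z C.gen_sub_V by blast
  note pow = defect_pow_cconj[OF zV, where l = l]
  have eq: "C.mlog l = cplx0.fps_app (fps_ln 1) (C.defect l)" for l
    by (simp add: C.mlog_def cplx0.op_log_def C.defect_def[abs_def])
  have "cconj (C.mlog l z) = (\<Sum>k<D. cscale (fps_ln 1 $ k) (cconj ((C.defect l ^^ k) z)))"
    unfolding eq cplx0.fps_app_eq[OF n(1) z order_refl] cconj_sum cconj_scale
    by (simp add: fps_ln_of_real)
  also have "\<dots> = C.mlog (cnj l) (cconj z)"
    unfolding eq cplx0.fps_app_eq[OF n(2) gen_cconj[OF z] order_refl] pow ..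
  finally show ?thesis .
qed

lemma gen_embed: "x \<in> R.gen l D \<Longrightarrow> (x, 0) \<in> C.gen (of_real l) D"
proof -
  assume x: "x \<in> R.gen l D"
  then have xV: "x \<in> V" using R.gen_sub_V by blast
  have "C.defect (of_real l) (y, 0) = (R.defect l y, 0)" for y
    using linear_on_0[OF aut_linear subspace]
    by (simp add: C.defect_def R.defect_def cscale_def minus_prod_def flip: of_real_inverse)
  then have "(C.defect (of_real l) ^^ k) (x, 0) = ((R.defect l ^^ k) x, 0)" for k
    by (induction k) simp_all
  then show ?thesis using x subspace_0[OF subspace] by (simp add: C.gen_def R.gen_def zero_prod_def)
qed

lemma cscale_inv_fact: "cscale (1 / fact j) (x, y) = ((1 / fact j) *\<^sub>R x, (1 / fact j) *\<^sub>R y)"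
proof -
  have *: "(1 / fact j :: complex) = complex_of_real (1 / fact j)" by simp
  show ?thesis unfolding * by (simp only: cscale_def Re_complex_of_real Im_complex_of_real) simp
qed

lemma chain_embed:
  assumes "real0.exp_chain n l M a"
  shows "cplx0.exp_chain n (of_real l) (map_prod M M) (\<lambda>k. (a k, 0))"
  unfolding cplx0.exp_chain_def
proof
  fix k assume k: "k \<in> {1..n}"
  have c: "cscale (1 / fact j) (x, 0) = ((1 / fact j) *\<^sub>R x, 0)" for j and x :: 'a
    by (simp add: cscale_inv_fact)
  show "map_prod M M (a k, 0) = cscale (of_real l) (\<Sum>j=0..n-k. cscale (1 / fact j) (a (k + j), 0))"
    unfolding c using assms k linear_on_0[OF aut_linear subspace]
    by (simp add: real0.exp_chain_def sum_prod cscale_def)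
qed

text \<open>
  For distinct eigenvalues the vanishing blocks of the Gram matrix come from \<open>gen_orthogonal\<close>: only the dual row
  has the reciprocal eigenvalue.
\<close>

lemma simple_preframe:
  assumes t: "listed_type t" "simple_type t"
    and gen: "\<And>i k. i < n_rows t \<Longrightarrow> k \<in> {1..row_len t} \<Longrightarrow> r i k \<in> C.gen (eigval t i) D"
    and conj: "\<And>i k. i < n_rows t \<Longrightarrow> k \<in> {1..row_len t} \<Longrightarrow> cconj (r i k) = r (conj_row t i) k"
    and chain: "\<And>i. i < n_rows t \<Longrightarrow> cplx0.exp_chain (row_len t) (eigval t i) (map_prod M M) (r i)"
    and gram: "\<And>i. i < n_rows t \<Longrightarrow> gram_eq (row_len t) (cform S) (r i) (r (dual_row t i)) (gram_const t i)"
  shows "preframe V M S t r"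
  unfolding preframe_def
proof (intro conjI allI impI ballI)
  fix i k assume "i < n_rows t" "k \<in> {1..row_len t}"
  then show "r i k \<in> V \<times> V" "cconj (r i k) = r (conj_row t i) k" using gen C.gen_sub_V conj by blast+
next
  fix i assume "i < n_rows t"
  then show "cplx0.exp_chain (row_len t) (eigval t i) (map_prod M M) (r i)" by (rule chain)
next
  fix i j assume ij: "i < n_rows t" "j < n_rows t"
  note d = datum[OF t(1) ij(1)]
  show "gram_eq (row_len t) (cform S) (r i) (r j) (if j = dual_row t i then gram_const t i else 0)"
  proof (cases "j = dual_row t i")
    case True
    then show ?thesis using gram[OF ij(1)] by simp
  next
    case False
    have "eigval t i * eigval t j \<noteq> 1"
    proof
      assume "eigval t i * eigval t j = 1"
      then have "eigval t j = eigval t (dual_row t i)" using d(7,8) by (simp add: inverse_unique)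
      then show False using simple_type_inj[OF t ij(2) d(2)] False by blast
    qed
    then show ?thesis
      using C.gen_orthogonal[OF gen[OF ij(1)] gen[OF ij(2)] d(8) datum(8)[OF t(1) ij(2)]] False
      by (simp add: gram_eq_def)
  qed
qed

text \<open>
  The real or the imaginary part of a complex eigenvector is a real eigenvector, as one of them is nonzero.
\<close>

lemma eigenvalue_real:
  assumes "eigenvalue (of_real l)"
  obtains x where "x \<in> V" "x \<noteq> 0" "M x = l *\<^sub>R x"
proof -
  obtain x y where xy: "x \<in> V" "y \<in> V" "(x, y) \<noteq> 0" "M x = l *\<^sub>R x" "M y = l *\<^sub>R y"
    using assms unfolding eigenvalue_def by (auto simp: cscale_def)
  show thesis
  proof (cases "x = 0")
    case True
    then show ?thesis using xy that by (auto simp: zero_prod_def)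
  qed (use xy that in blast)
qed

lemma preframe_Tr4:
  assumes l: "eigenvalue l" "cmod l > 1" "Im l > 0"
  shows "\<exists>t r. listed_type t \<and> preframe V M S t r"
proof -
  obtain m where m: "m \<in> {0, 1}" "\<And>z w. z \<in> V \<times> V \<Longrightarrow> w \<in> V \<times> V \<Longrightarrow> cform S w z = (-1) ^ m * cform S z w"
    by (rule sign_C) blast
  have l0: "l \<noteq> 0" using l by auto
  obtain z where z: "z \<in> V \<times> V" "z \<noteq> 0" "map_prod M M z = cscale l z" using l(1) by (rule eigenvalueE)
  obtain n D A B where AB: "n \<ge> 1" "\<And>k. A k \<in> C.gen l D" "\<And>k. B k \<in> C.gen (inverse l) D"
    "cplx0.exp_chain n l (map_prod M M) A" "cplx0.exp_chain n (inverse l) (map_prod M M) B" "gram_eq n (cform S) A B 1"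
    by (rule C.hyperbolic_strings[OF l0 z]) blast
  have V: "A k \<in> V \<times> V" "B k \<in> V \<times> V" for k using AB(2,3) C.gen_sub_V by blast+
  define t where "t = Tr4 l n m"
  have t: "listed_type t" unfolding t_def using AB(1) l m(1) by (intro listed_type.intros)
  define r where "r = (\<lambda>i::nat. [A, B, \<lambda>k. cconj (A k), \<lambda>k. cconj (B k)] ! i)"
  have i4: "i = 0 \<or> i = 1 \<or> i = 2 \<or> i = 3" if "i < n_rows t" for i using that by (auto simp: t_def)
  have g2: "gram_eq n (cform S) B A ((-1) ^ (n + m + 1))"
    using gram_swap[OF AB(6), of m] m(2)[OF V(1) V(2)] by simp
  have "preframe V M S t r"
  proof (rule simple_preframe[OF t])
    show "simple_type t" by (simp add: t_def)
    show "r i k \<in> C.gen (eigval t i) D" if "i < n_rows t" for i k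
      using i4[OF that] AB(2)[of k] AB(3)[of k] gen_cconj[OF AB(2), of k] gen_cconj[OF AB(3), of k]
      by (elim disjE) (simp_all add: r_def t_def)
    show "cconj (r i k) = r (conj_row t i) k" if "i < n_rows t" for i k
      using i4[OF that] by (elim disjE) (simp_all add: r_def t_def)
    show "cplx0.exp_chain (row_len t) (eigval t i) (map_prod M M) (r i)" if "i < n_rows t" for i
      using i4[OF that] AB(4,5) chain_cconj[OF AB(4) V(1)] chain_cconj[OF AB(5) V(2)]
      by (elim disjE) (simp_all add: r_def t_def)
    show "gram_eq (row_len t) (cform S) (r i) (r (dual_row t i)) (gram_const t i)" if "i < n_rows t" for i
      using i4[OF that] AB(6) g2 gram_cconj[OF AB(6) V] gram_cconj[OF g2 V(2) V(1)]
      by (elim disjE) (simp_all add: r_def t_def)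
  qed
  then show ?thesis using t by blast
qed

lemma preframe_Tr2:
  assumes l: "eigenvalue (of_real l)" "l > 1 \<or> l < -1"
  shows "\<exists>t r. listed_type t \<and> preframe V M S t r"
proof -
  obtain m where m: "m \<in> {0, 1}" "\<And>x y. x \<in> V \<Longrightarrow> y \<in> V \<Longrightarrow> S y x = (-1) ^ m * S x y"
    by (rule sign_C) blast
  have l0: "l \<noteq> 0" using l by auto
  obtain x where x: "x \<in> V" "x \<noteq> 0" "M x = l *\<^sub>R x" using l(1) by (rule eigenvalue_real)
  obtain n D A B where AB: "n \<ge> 1" "\<And>k. A k \<in> R.gen l D" "\<And>k. B k \<in> R.gen (inverse l) D"
    "real0.exp_chain n l M A" "real0.exp_chain n (inverse l) M B" "gram_eq n S A B 1"
    by (rule R.hyperbolic_strings[OF l0 x]) blast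
  have V: "A k \<in> V" "B k \<in> V" for k using AB(2,3) R.gen_sub_V by blast+
  define t where "t = Tr2 l n m"
  have t: "listed_type t" unfolding t_def using AB(1) l m(1) by (intro listed_type.intros)
  define r where "r = (\<lambda>i::nat. \<lambda>k. if i = 0 then (A k, 0::'a) else (B k, 0))"
  have i2: "i = 0 \<or> i = 1" if "i < n_rows t" for i using that by (auto simp: t_def)
  have g2: "gram_eq n S B A ((-1) ^ (n + m + 1))"
    using gram_swap[OF AB(6), of m] m(2)[OF V(1) V(2)] by simp
  have "preframe V M S t r"
  proof (rule simple_preframe[OF t])
    show "simple_type t" by (simp add: t_def)
    show "r i k \<in> C.gen (eigval t i) D" if "i < n_rows t" for i k
      using i2[OF that] gen_embed[OF AB(2), of k] gen_embed[OF AB(3), of k]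
      by (elim disjE) (simp_all add: r_def t_def)
    show "cconj (r i k) = r (conj_row t i) k" if "i < n_rows t" for i k
      using i2[OF that] by (elim disjE) (simp_all add: r_def t_def cconj_def)
    show "cplx0.exp_chain (row_len t) (eigval t i) (map_prod M M) (r i)" if "i < n_rows t" for i
      using i2[OF that] chain_embed[OF AB(4)] chain_embed[OF AB(5)]
      by (elim disjE) (simp_all add: r_def t_def)
    show "gram_eq (row_len t) (cform S) (r i) (r (dual_row t i)) (gram_const t i)" if "i < n_rows t" for i
      using i2[OF that] gram_embed[OF AB(6) V] gram_embed[OF g2 V(2) V(1)]
      by (elim disjE) (simp_all add: r_def t_def)
  qed
  then show ?thesis using t by blast
qed

text \<open>
  The top form \<open>h(x, y) = S(x, cconj (N\<^sup>n\<^sup>-\<^sup>1 y))\<close> is sesquilinear and nonzero. If its diagonal vanished, polarization for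
  \<open>a\<close>, \<open>b'\<close> and for \<open>a\<close>, \<open>\<i> b'\<close> would make it zero. So some \<open>h(x, x)\<close> is nonzero; up to the factor \<open>\<i>\<^sup>n\<^sup>+\<^sup>m\<^sup>+\<^sup>1\<close>
  it is real, and scaling \<open>x\<close> by a real number reduces it to its sign.
\<close>

lemma preframe_Tr2e:
  assumes l: "eigenvalue l" "cmod l = 1" "Im l > 0"
  shows "\<exists>t r. listed_type t \<and> preframe V M S t r"
proof -
  obtain m where m: "m \<in> {0, 1}" "\<And>z w. z \<in> V \<times> V \<Longrightarrow> w \<in> V \<times> V \<Longrightarrow> cform S w z = (-1) ^ m * cform S z w"
    by (rule sign_C) blast
  have l0: "l \<noteq> 0" using l by auto
  have "l * cnj l = 1" using l(2) by (simp add: complex_norm_square[symmetric])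
  then have inv: "inverse l = cnj l" by (rule inverse_unique)
  obtain z where z: "z \<in> V \<times> V" "z \<noteq> 0" "map_prod M M z = cscale l z" using l(1) by (rule eigenvalueE)
  obtain n D a b where ab: "n \<ge> 1" "a \<in> C.gen l D" "b \<in> C.gen (inverse l) D"
    "\<And>x. x \<in> C.gen l D \<Longrightarrow> (C.mlog l ^^ n) x = 0"
    "cform S a ((C.mlog (inverse l) ^^ (n - 1)) b) \<noteq> 0"
    by (rule C.top_pairing[OF l0 z]) blast
  let ?W = "C.gen l D" and ?N = "C.mlog l"
  have eN: "cplx0.endo_on ?W ?N" by (rule cplx0.nilpD(1)[OF C.mlog_nilp])
  note e = cplx0.endo_on_funpow[OF eN]
  have W: "cplx.subspace ?W" by (rule cplx0.endo_onD(1)[OF eN])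
  have WV: "x \<in> V \<times> V" if "x \<in> ?W" for x using that C.gen_sub_V by blast
  have pow: "(?N ^^ k) x \<in> ?W" if "x \<in> ?W" for x k by (rule cplx0.endo_onD(2)[OF e that])
  have cW: "cconj x \<in> C.gen (inverse l) D" if "x \<in> ?W" for x unfolding inv by (rule gen_cconj[OF that])
  have cV: "cconj x \<in> V \<times> V" if "x \<in> V \<times> V" for x using that cconj_mem[OF subspace] by blast
  have mc: "cconj (?N x) = C.mlog (inverse l) (cconj x)" if "x \<in> ?W" for x unfolding inv by (rule mlog_cconj[OF that])
  have mc_pow: "cconj ((?N ^^ k) x) = (C.mlog (inverse l) ^^ k) (cconj x)" if "x \<in> ?W" for x k
    by (induction k) (simp_all add: mc[OF pow[OF that]])
  have herm: "cnj (cform S x (cconj y)) = (-1) ^ m * cform S y (cconj x)" if "x \<in> V \<times> V" "y \<in> V \<times> V" for x y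
  proof -
    have "cnj (cform S x (cconj y)) = cform S (cconj x) y"
      using cS_cconj[OF _ _ that(1) cV[OF that(2)]] by simp
    then show ?thesis using m(2)[OF that(2) cV[OF that(1)]] by simp
  qed
  define h where "h = (\<lambda>x y. cform S x (cconj ((?N ^^ (n - 1)) y)))"
  have h_add: "h (x + y) z = h x z + h y z" "h z (x + y) = h z x + h z y" if "x \<in> ?W" "y \<in> ?W" "z \<in> ?W" for x y z
    using that WV pow cV by (simp_all add: h_def C.S_add_left C.S_add_right cplx0.endo_onD(3)[OF e] cconj_add del: mem_Sigma_iff)
  have h_scale: "h (cscale c x) z = c * h x z" "h z (cscale c x) = cnj c * h z x" if "x \<in> ?W" "z \<in> ?W" for c x z
    using that WV pow cV by (simp_all add: h_def C.S_scale_left C.S_scale_right cplx0.endo_onD(4)[OF e] cconj_scale del: mem_Sigma_iff)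
  have "\<exists>x\<in>?W. h x x \<noteq> 0"
  proof (rule ccontr)
    assume "\<not> (\<exists>x\<in>?W. h x x \<noteq> 0)"
    then have diag: "h x x = 0" if "x \<in> ?W" for x using that by blast
    have Wadd: "x + y \<in> ?W" if "x \<in> ?W" "y \<in> ?W" for x y using that cplx.subspace_add[OF W] by blast
    define b' where "b' = cconj b"
    have b': "b' \<in> ?W" using gen_cconj[OF ab(3)] by (simp add: b'_def inv)
    have ib: "cscale \<i> b' \<in> ?W" by (rule cplx.subspace_scale[OF W b'])
    have "h b' a = - h a b'" by (rule polarization[OF h_add Wadd diag ab(2) b'])
    moreover have "h (cscale \<i> b') a = - h a (cscale \<i> b')" by (rule polarization[OF h_add Wadd diag ab(2) ib])
    then have "\<i> * h b' a = \<i> * h a b'" using h_scale[OF b' ab(2)] by simp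
    ultimately have "h a b' = 0" by simp
    moreover have "h a b' = cform S a ((C.mlog (inverse l) ^^ (n - 1)) b)"
      by (simp add: h_def mc_pow[OF b']) (simp add: b'_def)
    ultimately show False using ab(5) by simp
  qed
  then obtain x where x: "x \<in> ?W" "h x x \<noteq> 0" by blast
  define \<omega> where "\<omega> = \<i> ^ (n + m + 1)"
  have \<omega>0: "\<omega> \<noteq> 0" by (simp add: \<omega>_def)
  have c\<omega>: "cnj \<omega> = (-1) ^ (n + m + 1) * \<omega>" unfolding \<omega>_def by (simp only: complex_cnj_power complex_cnj_i power_minus[of \<i>])
  have adj: "cform S ((?N ^^ k) x) (cconj y) = (-1) ^ k * cform S x (cconj ((?N ^^ k) y))" if "x \<in> ?W" "y \<in> ?W" for x y k
    using C.mlog_pow_adjoint[OF l0 that(1) cW[OF that(2)], of k] mc_pow[OF that(2)] by simp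
  have "cnj (h x x) = (-1) ^ m * ((-1) ^ (n - 1) * h x x)"
    using herm[OF WV[OF x(1)] WV[OF pow[OF x(1)]], of "n - 1"] adj[OF x(1) x(1), of "n - 1"] by (simp add: h_def)
  moreover have "(-1::complex) ^ (n + m + 1) = (-1) ^ m * (-1) ^ (n - 1)"
    using ab(1) by (cases n) (simp_all add: power_add)
  ultimately have "cnj (h x x / \<omega>) = h x x / \<omega>" using c\<omega> \<omega>0 by (simp add: mult.assoc)
  then have "h x x / \<omega> \<in> \<real>" by (simp add: Reals_cnj_iff)
  then obtain \<rho> where \<rho>: "h x x / \<omega> = of_real \<rho>" by (rule Reals_cases)
  have \<rho>0: "\<rho> \<noteq> 0" using \<rho> x(2) \<omega>0 by auto
  define e where "e = sgn \<rho>"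
  have e: "e \<in> {1, -1}" using \<rho>0 by (auto simp: e_def sgn_if)
  define q where "q = 1 / sqrt \<bar>\<rho>\<bar>"
  define x' where "x' = cscale (of_real q) x"
  have x': "x' \<in> ?W" unfolding x'_def by (rule cplx.subspace_scale[OF W x(1)])
  have "q * q * \<rho> = e" using \<rho>0 by (simp add: q_def e_def sgn_if)
  have "h x' x' = of_real (q * q) * h x x"
    unfolding x'_def using h_scale[OF x(1) x(1), of "of_real q"] h_scale[OF x(1) cplx.subspace_scale[OF W x(1)]] by simp
  also have "h x x = \<omega> * of_real \<rho>" using \<rho> \<omega>0 by (simp add: field_simps)
  also have "of_real (q * q) * (\<omega> * of_real \<rho>) = \<omega> * of_real e"
    using \<open>q * q * \<rho> = e\<close> by (metis (no_types) mult.left_commute of_real_mult)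
  finally have hx': "h x' x' = \<omega> * of_real e" .
  have nz: "\<omega> * of_real e \<noteq> 0" using \<omega>0 e by auto
  obtain A where A: "\<And>k. A k \<in> ?W" "cplx0.exp_chain n l (map_prod M M) A" "gram_eq n (cform S) A (\<lambda>k. cconj (A k)) (\<omega> * of_real e)"
  proof (rule C.self_dual_string[where \<theta> = cconj and \<kappa> = cnj and \<zeta> = "(-1) ^ m", OF l0 ab(1,4) cW cconj_add cconj_scale mc _ _ _ _ _ x' hx'[unfolded h_def] nz])
    show "cnj (cform S u (cconj v)) = (-1) ^ m * cform S v (cconj u)" if "u \<in> ?W" "v \<in> ?W" for u v
      by (rule herm[OF WV[OF that(1)] WV[OF that(2)]])
  qed (assumption | rule that | simp flip: power_mult_distrib)+
  have V: "A k \<in> V \<times> V" "cconj (A k) \<in> V \<times> V" for k using WV[OF A(1)] cV by blast+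
  define t where "t = Tr2e l n m e"
  have t: "listed_type t" unfolding t_def using ab(1) l(2,3) m(1) e by (intro listed_type.intros)
  define r where "r = (\<lambda>i::nat. \<lambda>k. if i = 0 then A k else cconj (A k))"
  have i2: "i = 0 \<or> i = 1" if "i < n_rows t" for i using that by (auto simp: t_def)
  have g2: "gram_eq n (cform S) (\<lambda>k. cconj (A k)) A (\<omega> * of_real e * (-1) ^ (n + m + 1))"
    using gram_cconj[OF A(3) V] c\<omega> by (simp add: mult_ac)
  have "preframe V M S t r"
  proof (rule simple_preframe[OF t])
    show "simple_type t" using l(3) by (simp add: t_def)
    show "r i k \<in> C.gen (eigval t i) D" if "i < n_rows t" for i k
      using i2[OF that] A(1)[of k] gen_cconj[OF A(1), of k] by (elim disjE) (simp_all add: r_def t_def)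
    show "cconj (r i k) = r (conj_row t i) k" if "i < n_rows t" for i k
      using i2[OF that] by (elim disjE) (simp_all add: r_def t_def)
    show "cplx0.exp_chain (row_len t) (eigval t i) (map_prod M M) (r i)" if "i < n_rows t" for i
      using i2[OF that] A(2) chain_cconj[OF A(2) V(1)] by (elim disjE) (simp_all add: r_def t_def)
    show "gram_eq (row_len t) (cform S) (r i) (r (dual_row t i)) (gram_const t i)" if "i < n_rows t" for i
      using i2[OF that] A(3) g2 unfolding r_def t_def \<omega>_def by (elim disjE) simp_all
  qed
  then show ?thesis using t by blast
qed

text \<open>
  For \<open>l = \<plusminus>1\<close> the top form \<open>h(x, y) = S(x, N\<^sup>n\<^sup>-\<^sup>1 y)\<close> is real and symmetric or alternating. A nonzero diagonal value
  gives one string. Otherwise \<open>h\<close> is alternating, so that \<open>m\<close> and \<open>n\<close> have the same parity, and there are two dual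
  isotropic strings \<open>A\<close>, \<open>B\<close>; the row of the type is \<open>A + \<i> B\<close>, with conjugate \<open>A - \<i> B\<close>.
\<close>

lemma preframe_real_unit:
  assumes l: "eigenvalue (of_real l)" "l = 1 \<or> l = -1"
  shows "\<exists>t r. listed_type t \<and> preframe V M S t r"
proof -
  obtain m where m: "m \<in> {0, 1}" "\<And>x y. x \<in> V \<Longrightarrow> y \<in> V \<Longrightarrow> S y x = (-1) ^ m * S x y"
    by (rule sign_C) blast
  have l0: "l \<noteq> 0" and inv: "inverse l = l" using l by auto
  obtain x where x: "x \<in> V" "x \<noteq> 0" "M x = l *\<^sub>R x" using l(1) by (rule eigenvalue_real)
  obtain n D a b where ab: "n \<ge> 1" "a \<in> R.gen l D" "b \<in> R.gen (inverse l) D"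
    "\<And>x. x \<in> R.gen l D \<Longrightarrow> (R.mlog l ^^ n) x = 0"
    "S a ((R.mlog (inverse l) ^^ (n - 1)) b) \<noteq> 0"
    by (rule R.top_pairing[OF l0 x]) blast
  let ?W = "R.gen l D" and ?N = "R.mlog l"
  have eN: "real0.endo_on ?W ?N" by (rule real0.nilpD(1)[OF R.mlog_nilp])
  note e = real0.endo_on_funpow[OF eN]
  have W: "subspace ?W" using eN by (simp add: endo_on_linear_on)
  have WV: "x \<in> V" if "x \<in> ?W" for x using that R.gen_sub_V by blast
  have pow: "(?N ^^ k) x \<in> ?W" if "x \<in> ?W" for x k by (rule real0.endo_onD(2)[OF e that])
  define h where "h = (\<lambda>x y. S x ((?N ^^ (n - 1)) y))"
  have h_add: "h (x + y) z = h x z + h y z" "h z (x + y) = h z x + h z y" if "x \<in> ?W" "y \<in> ?W" "z \<in> ?W" for x y z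
    using that WV pow by (simp_all add: h_def R.S_add_left R.S_add_right real0.endo_onD(3)[OF e])
  have h_sym: "h y x = (-1) ^ m * ((-1) ^ (n - 1) * h x y)" if "x \<in> ?W" "y \<in> ?W" for x y
    using m(2)[OF WV[OF pow[OF that(1)]] WV[OF that(2)], of "n - 1"]
      R.mlog_pow_adjoint[OF l0 that(1), of y "n - 1"] that(2) by (simp add: h_def inv)
  show ?thesis
  proof (cases "\<exists>x\<in>?W. h x x \<noteq> 0")
    case True
    then obtain x where x: "x \<in> ?W" "h x x \<noteq> 0" by blast
    define \<rho> where "\<rho> = h x x"
    have \<rho>0: "\<rho> \<noteq> 0" using x(2) by (simp add: \<rho>_def)
    define e' where "e' = sgn \<rho>"
    have e': "e' \<in> {1, -1}" using \<rho>0 by (auto simp: e'_def sgn_if)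
    define q where "q = 1 / sqrt \<bar>\<rho>\<bar>"
    define x' where "x' = q *\<^sub>R x"
    have x': "x' \<in> ?W" unfolding x'_def by (rule subspace_scale[OF W x(1)])
    have "h x' x' = q * q * \<rho>"
      using WV[OF x(1)] WV[OF pow[OF x(1)]] real0.endo_onD(4)[OF e x(1)] subspace_scale[OF subspace]
      by (simp add: h_def x'_def \<rho>_def R.S_scale_left R.S_scale_right)
    also have "\<dots> = e'" using \<rho>0 by (simp add: q_def e'_def sgn_if)
    finally have hx': "h x' x' = e'" .
    have nz: "e' \<noteq> 0" using e' by auto
    obtain A where A: "\<And>k. A k \<in> ?W" "real0.exp_chain n l M A" "gram_eq n S A (\<lambda>k. A k) e'"
    proof (rule R.self_dual_string[where \<theta> = "\<lambda>x. x" and \<kappa> = "\<lambda>c. c" and \<zeta> = "(-1) ^ m", OF l0 ab(1,4) _ _ _ _ _ _ _ _ _ x' hx'[unfolded h_def] nz])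
      show "S u v = (-1) ^ m * S v u" if "u \<in> ?W" "v \<in> ?W" for u v
        by (rule m(2)[OF WV[OF that(2)] WV[OF that(1)]])
    qed (assumption | rule that | simp add: inv flip: power_mult_distrib)+
    have V: "A k \<in> V" for k by (rule WV[OF A(1)])
    define t where "t = Tr1 l n e'"
    have t: "listed_type t" unfolding t_def using ab(1) l(2) e' by (intro listed_type.intros) auto
    define r where "r = (\<lambda>i::nat. \<lambda>k. (A k, 0::'a))"
    have "preframe V M S t r"
    proof (rule simple_preframe[OF t])
      show "r i k \<in> C.gen (eigval t i) D" for i k using gen_embed[OF A(1)] by (simp add: r_def t_def)
      show "cplx0.exp_chain (row_len t) (eigval t i) (map_prod M M) (r i)" for i
        using chain_embed[OF A(2)] by (simp add: r_def t_def)
      show "gram_eq (row_len t) (cform S) (r i) (r (dual_row t i)) (gram_const t i)" for i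
        using gram_embed[OF A(3) V V] by (simp add: r_def t_def)
    qed (simp_all add: t_def r_def cconj_def)
    then show ?thesis using t by blast
  next
    case False
    then have diag: "h x x = 0" if "x \<in> ?W" for x using that by blast
    have bW: "b \<in> ?W" using ab(3) by (simp add: inv)
    have hab: "h a b \<noteq> 0" using ab(5) by (simp add: h_def inv)
    have Wadd: "x + y \<in> ?W" if "x \<in> ?W" "y \<in> ?W" for x y using that subspace_add[OF W] by blast
    have "h b a = - h a b" by (rule polarization[OF h_add Wadd diag ab(2) bW])
    then have "(-1) ^ m * (-1) ^ (n - 1) * h a b = - 1 * h a b"
      by (simp only: h_sym[OF ab(2) bW] mult.assoc mult_minus1)
    then have "(-1::real) ^ m * (-1) ^ (n - 1) = -1" using hab mult_right_cancel by blast
    then have mn: "even (n + m)" using ab(1) by (cases n) (auto simp: minus_one_power_iff split: if_splits)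
    have "(-1::real) ^ m = (-1) ^ n" using mn by (auto simp: minus_one_power_iff)
    then have symn: "S y x = (-1) ^ n * S x y" if "x \<in> V" "y \<in> V" for x y using m(2)[OF that] by simp
    \<comment> \<open>\<open>A + \<i> B\<close> and \<open>A - \<i> B\<close> pair to \<open>-2 \<i> S(A, B)\<close>, while \<open>\<i>\<^sup>n\<^sup>+\<^sup>m\<^sup>+\<^sup>1\<close> is \<open>\<plusminus>\<i>\<close>; this fixes \<open>c = S(A, B)\<close>\<close>
    define c where "c = - Im (\<i> ^ (n + m + 1)) / 2"
    have odd: "odd (n + m + 1)" using mn by simp
    then obtain k0 where k0: "n + m + 1 = 2 * k0 + 1" by (elim oddE)
    have \<omega>: "\<i> ^ (n + m + 1) = of_real ((-1) ^ k0) * \<i>" unfolding k0 by (simp add: power_add power_mult)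
    have c0: "c \<noteq> 0" unfolding c_def \<omega> by simp
    have \<omega>c: "\<i> ^ (n + m + 1) = Complex 0 (- 2 * c)" unfolding c_def \<omega> by (simp add: complex_eq_iff)
    obtain A B where AB: "\<And>k. A k \<in> ?W" "\<And>k. B k \<in> ?W" "real0.exp_chain n l M A" "real0.exp_chain n l M B"
      "gram_eq n S A A 0" "gram_eq n S B B 0" "gram_eq n S A B c"
      by (rule R.symplectic_strings[OF inv l0 ab(1,4) symn ab(2) bW hab[unfolded h_def] c0]) (assumption | rule that)+
    have V: "A k \<in> V" "B k \<in> V" for k using WV AB(1,2) by blast+
    have gBA: "gram_eq n S B A (- c)"
      using gram_swap[OF AB(7), of n] symn[OF V(1) V(2)] by simp
    define t where "t = Tr2e (of_real l) n m 1"
    have "m mod 2 = n mod 2" using mn by presburger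
    then have t: "listed_type t" unfolding t_def using ab(1) l(2) m(1) by (intro listed_type.intros(2)) auto
    define r where "r = (\<lambda>i::nat. \<lambda>k. (A k, if i = 0 then B k else - B k))"
    have i2: "i = 0 \<or> i = 1" if "i < n_rows t" for i using that by (auto simp: t_def)
    have r1: "r 1 = (\<lambda>k. cconj (r 0 k))" by (simp add: r_def cconj_def)
    have rV: "r 0 k \<in> V \<times> V" for k using V by (simp add: r_def)
    have r1V: "r 1 k \<in> V \<times> V" for k using V subspace_neg[OF subspace] by (simp add: r_def)
    have ch: "cplx0.exp_chain n (of_real l) (map_prod M M) (r 0)"
      unfolding cplx0.exp_chain_def
    proof
      fix k assume k: "k \<in> {1..n}"
      show "map_prod M M (r 0 k) = cscale (of_real l) (\<Sum>j=0..n-k. cscale (1 / fact j) (r 0 (k + j)))"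
        unfolding r_def cscale_inv_fact using AB(3,4) k by (simp add: real0.exp_chain_def sum_prod cscale_def)
    qed
    have Sn: "S x (- y) = - S x y" "S (- x) y = - S x y" if "x \<in> V" "y \<in> V" for x y
      using that linear_on_uminus[OF form_linear_right, of x y] linear_on_uminus[OF form_linear_left, of y x] by simp_all
    have g00: "gram_eq n (cform S) (r 0) (r 0) 0"
      using AB(5,6,7) gBA by (simp add: gram_eq_def cform_def r_def complex_eq_iff)
    have E: "E_per n j k = complex_of_real (E_per n j k)" for j k by (simp add: E_per_of_real)
    have g01: "gram_eq n (cform S) (r 0) (r 1) (\<i> ^ (n + m + 1))"
      unfolding gram_eq_def \<omega>c E
      using AB(5,6,7) gBA V by (simp add: gram_eq_def cform_def r_def complex_eq_iff Sn)
    have "preframe V M S t r"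
      unfolding preframe_def
    proof (intro conjI allI impI ballI)
      fix i k assume "i < n_rows t"
      then show "r i k \<in> V \<times> V" "cconj (r i k) = r (conj_row t i) k"
        using i2[of i] V subspace_neg[OF subspace] by (auto simp: r_def t_def cconj_def)
    next
      fix i assume "i < n_rows t"
      show "cplx0.exp_chain (row_len t) (eigval t i) (map_prod M M) (r i)"
        using i2[OF \<open>i < n_rows t\<close>] ch chain_cconj[OF ch rV] by (elim disjE) (simp_all add: t_def r1[simplified])
    next
      fix i j assume "i < n_rows t" "j < n_rows t"
      then have ij: "i = 0 \<or> i = 1" "j = 0 \<or> j = 1" using i2 by blast+
      have g11: "gram_eq n (cform S) (r 1) (r 1) 0"
        using gram_cconj[OF g00 rV rV] unfolding r1 by simp
      have "gram_eq n (cform S) (\<lambda>k. cconj (r 0 k)) (\<lambda>k. cconj (r 1 k)) (cnj (\<i> ^ (n + m + 1)))"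
        by (rule gram_cconj[OF g01 rV r1V])
      moreover have "cnj (\<i> ^ (n + m + 1)) = \<i> ^ (n + m + 1) * (-1) ^ (n + m + 1)"
        by (simp only: complex_cnj_power complex_cnj_i power_minus[of \<i>] mult.commute)
      ultimately have g10: "gram_eq n (cform S) (r 1) (r 0) (\<i> ^ (n + m + 1) * (-1) ^ (n + m + 1))"
        unfolding r1 by (simp only: cconj_cconj)
      show "gram_eq (row_len t) (cform S) (r i) (r j) (if j = dual_row t i then gram_const t i else 0)"
        using ij g00 g01 g10 g11 by (elim disjE) (simp_all add: t_def)
    qed
    then show ?thesis using t by blast
  qed
qed

text \<open>
  Inversion and conjugation move any eigenvalue into the region \<open>\<bar>l\<bar> \<ge> 1\<close>, \<open>Im l \<ge> 0\<close>. Its position there (interior or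
  boundary) selects the family.
\<close>

lemma frame_exists_if_irreducible:
  assumes irr: "irreducible_triple V M S"
  shows "\<exists>t r. framed V M S t r"
proof -
  have "V \<noteq> {0}" using irr by (simp add: irreducible_triple_def)
  then obtain c where c: "eigenvalue c" using eigenvalue_exists by blast
  obtain c1 where c1: "eigenvalue c1" "cmod c1 \<ge> 1"
  proof (cases "cmod c \<ge> 1")
    case False
    then have "cmod (inverse c) \<ge> 1"
      using eigenvalue_nonzero[OF c] by (simp add: norm_inverse one_le_inverse_iff)
    then show ?thesis using eigenvalue_inverse[OF c] that by blast
  qed (use c that in blast)
  obtain l where l: "eigenvalue l" "cmod l \<ge> 1" "Im l \<ge> 0"
  proof (cases "Im c1 \<ge> 0")
    case False
    then show ?thesis using that[of "cnj c1"] eigenvalue_cnj[OF c1(1)] c1(2) by simp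
  qed (use c1 that in blast)
  have "\<exists>t r. listed_type t \<and> preframe V M S t r"
  proof (cases "Im l = 0")
    case True
    then have re: "l = of_real (Re l)" by (simp add: complex_eq_iff)
    then have eigval: "eigenvalue (of_real (Re l))" using l(1) by simp
    have "\<bar>Re l\<bar> \<ge> 1" using l(2) re by (metis norm_of_real)
    then consider "Re l > 1 \<or> Re l < -1" | "Re l = 1 \<or> Re l = -1" by linarith
    then show ?thesis using preframe_Tr2[OF eigval] preframe_real_unit[OF eigval] by cases
  next
    case False
    then have im: "Im l > 0" using l(3) by simp
    consider "cmod l > 1" | "cmod l = 1" using l(2) by linarith
    then show ?thesis using preframe_Tr4[OF l(1) _ im] preframe_Tr2e[OF l(1) _ im] by cases
  qed
  then obtain t r where tr: "listed_type t" "preframe V M S t r" by blast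
  interpret preframed V M S t r
    using tr by unfold_locales
  have "framed V M S t r" by unfold_locales (rule frame_if_irreducible[OF irr])
  then show ?thesis by blast
qed

end

section \<open>The classification\<close>

theorem theorem2p8:
  shows "(\<forall>(V :: 'a::real_vector set) M S.
            irreducible_triple V M S \<longleftrightarrow> (\<exists>t. listed_type t \<and> of_type V M S t)) \<and>
         (\<forall>t. listed_type t \<longrightarrow>
            (\<exists>(V :: (nat \<Rightarrow>\<^sub>0 real) set) M S. of_type V M S t)) \<and>
         (\<forall>t t' (V :: 'a set) M S (V' :: 'b::real_vector set) M' S'.
            listed_type t \<longrightarrow> listed_type t' \<longrightarrow> of_type V M S t \<longrightarrow> of_type V' M' S' t' \<longrightarrow>
            (isomorphic_triples V M S V' M' S' \<longleftrightarrow> t = t'))"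
proof (intro conjI allI impI)
  fix V :: "'a set" and M S
  show "irreducible_triple V M S \<longleftrightarrow> (\<exists>t. listed_type t \<and> of_type V M S t)"
  proof
    assume irr: "irreducible_triple V M S"
    then interpret isometric_triple V M S by (simp add: irreducible_triple_def)
    obtain t r where "framed V M S t r" using frame_exists_if_irreducible[OF irr] by blast
    then show "\<exists>t. listed_type t \<and> of_type V M S t"
      using framed.of_type preframed.listed framed.axioms(1) by blast
  next
    assume "\<exists>t. listed_type t \<and> of_type V M S t"
    then show "irreducible_triple V M S" using framed_if_of_type framed.irreducible by blast
  qed
next
  fix t assume "listed_type t"
  then show "\<exists>(V :: (nat \<Rightarrow>\<^sub>0 real) set) M S. of_type V M S t"
    using model_exists framed.of_type by blast
next
  fix t t' and V :: "'a set" and M S and V' :: "'b set" and M' S'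
  assume t: "listed_type t" "listed_type t'" "of_type V M S t" "of_type V' M' S' t'"
  obtain r where r: "framed V M S t r" using framed_if_of_type[OF t(1,3)] by blast
  obtain r' where r': "framed V' M' S' t' r'" using framed_if_of_type[OF t(2,4)] by blast
  have it: "isometric_triple V' M' S'" using t(4) by (simp add: of_type_def)
  show "isomorphic_triples V M S V' M' S' \<longleftrightarrow> t = t'"
  proof
    assume "isomorphic_triples V M S V' M' S'"
    then obtain r'' where "framed V' M' S' t r''" using framed_isomorphic[OF r it] by blast
    then show "t = t'" using type_unique r' by blast
  next
    assume "t = t'"
    then show "isomorphic_triples V M S V' M' S'" using isomorphic_if_framed[OF r] r' by blast
  qed
qed

end
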